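(* Let $K\ge 1$, $k=\frac{K-1}{K+1}$, and $0<p<\infty$. Suppose $f=h+\overline{g}$ is a $K$-quasiconformal harmonic mapping belonging to one of the classes $\mathcal{C}_H^0$, $\mathcal{S}_H^{*0}$, or $\mathcal{K}_H^0(\theta)$ (for some $0\le\theta<\pi$). Then for every $0<r<1$, $$M_p(r,h')\le M_p(r,\mathscr{H}_k)\quad\text{and}\quad M_p(r,g')\le M_p(r,\mathscr{G}_k),$$ where $$\mathscr{H}_k(z)=\frac{(1+z)^2}{(1-z)^3(1-kz)},\qquad \mathscr{G}_k(z)=\frac{kz(1+z)^2}{(1-z)^3(1-kz)}.$$
   Context: $\mathbb{D}=\{z\in\mathbb{C}:|z|<1\}$. Every complex-valued harmonic function $f$ in $\mathbb{D}$ has a unique representation $f=h+\overline{g}$ with $h,g$ analytic in $\mathbb{D}$ and $g(0)=0$. $\mathcal{S}_H$ denotes the class of sense-preserving univalent harmonic functions $f=h+\overline{g}$ in $\mathbb{D}$ with $h(0)=g(0)=0$, $h'(0)=1$; $\mathcal{S}_H^0=\{f\in\mathcal{S}_H: g'(0)=0\}$. $\mathcal{C}_H^0$, $\mathcal{S}_H^{*0}$, $\mathcal{K}_H^0(\theta)$ are the subclasses of $\mathcal{S}_H^0$ of functions mapping $\mathbb{D}$ onto a close-to-convex domain (complement is a union of non-crossing half-lines), a domain starlike with respect to the origin, and a domain convex in the direction $e^{i\theta}$ (every line parallel to $e^{i\theta}$ meets it in a connected set), respectively. For $K\ge1$, a sense-preserving harmonic $f=h+\overline g$ is $K$-quasiconformal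 if it is a homeomorphism of $\mathbb{D}$ and its analytic dilatation $\omega=g'/h'$ satisfies $|\omega(z)|\le k=\frac{K-1}{K+1}$ for all $z\in\mathbb{D}$. For $F$ analytic in $\mathbb{D}$ and $0<p<\infty$, $M_p(r,F)=\left(\frac{1}{2\pi}\int_0^{2\pi}|F(re^{i\theta})|^p\,d\theta\right)^{1/p}$. *)

theory Defs
  imports "HOL-Analysis.Analysis"
begin

abbreviation unit_disk :: "complex set" where "unit_disk \<equiv> ball 0 1"

definition harm :: "(complex \<Rightarrow> complex) \<Rightarrow> (complex \<Rightarrow> complex) \<Rightarrow> complex \<Rightarrow> complex" where
  "harm h g = (\<lambda>z. h z + cnj (g z))"

text \<open>Class S_H^0: sense-preserving (positive Jacobian |h'|^2 - |g'|^2),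
  univalent harmonic, normalized h(0)=g(0)=0, h'(0)=1, g'(0)=0.\<close>
definition in_SH0 :: "(complex \<Rightarrow> complex) \<Rightarrow> (complex \<Rightarrow> complex) \<Rightarrow> bool" where
  "in_SH0 h g \<longleftrightarrow> h holomorphic_on unit_disk \<and> g holomorphic_on unit_disk
     \<and> h 0 = 0 \<and> g 0 = 0 \<and> deriv h 0 = 1 \<and> deriv g 0 = 0
     \<and> inj_on (harm h g) unit_disk
     \<and> (\<forall>z\<in>unit_disk. cmod (deriv g z) < cmod (deriv h z))"

definition half_line :: "complex \<Rightarrow> complex \<Rightarrow> complex set" where
  "half_line a d = {a + complex_of_real t * d | t. t \<ge> 0}"

definition is_half_line :: "complex set \<Rightarrow> bool" where
  "is_half_line L \<longleftrightarrow> (\<exists>a d. d \<noteq> 0 \<and> L = half_line a d)"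

definition non_crossing :: "complex set \<Rightarrow> complex set \<Rightarrow> bool" where
  "non_crossing L1 L2 \<longleftrightarrow> L1 \<subseteq> L2 \<or> L2 \<subseteq> L1 \<or>
     (\<forall>w\<in>L1 \<inter> L2. (\<exists>d. L1 = half_line w d) \<or> (\<exists>d. L2 = half_line w d))"

definition close_to_convex_domain :: "complex set \<Rightarrow> bool" where
  "close_to_convex_domain \<Omega> \<longleftrightarrow>
     (\<exists>F. (\<forall>L\<in>F. is_half_line L) \<and> (\<forall>L1\<in>F. \<forall>L2\<in>F. non_crossing L1 L2)
          \<and> - \<Omega> = \<Union>F)"

definition starlike_origin :: "complex set \<Rightarrow> bool" where
  "starlike_origin \<Omega> \<longleftrightarrow> (\<forall>w\<in>\<Omega>. closed_segment 0 w \<subseteq> \<Omega>)"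

definition convex_in_direction :: "real \<Rightarrow> complex set \<Rightarrow> bool" where
  "convex_in_direction \<theta> \<Omega> \<longleftrightarrow>
     (\<forall>a. connected (\<Omega> \<inter> {a + complex_of_real t * cis \<theta> | t. True}))"

definition in_CH0 where
  "in_CH0 h g \<longleftrightarrow> in_SH0 h g \<and> close_to_convex_domain (harm h g ` unit_disk)"

definition in_SHstar0 where
  "in_SHstar0 h g \<longleftrightarrow> in_SH0 h g \<and> starlike_origin (harm h g ` unit_disk)"

definition in_KH0 where
  "in_KH0 \<theta> h g \<longleftrightarrow> in_SH0 h g \<and> convex_in_direction \<theta> (harm h g ` unit_disk)"

definition K_qc_harmonic :: "real \<Rightarrow> (complex \<Rightarrow> complex) \<Rightarrow> (complex \<Rightarrow> complex) \<Rightarrow> bool" where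
  "K_qc_harmonic K h g \<longleftrightarrow> h holomorphic_on unit_disk \<and> g holomorphic_on unit_disk
     \<and> (\<forall>z\<in>unit_disk. cmod (deriv g z) < cmod (deriv h z))
     \<and> (\<exists>f'. homeomorphism unit_disk (harm h g ` unit_disk) (harm h g) f')
     \<and> (\<forall>z\<in>unit_disk. cmod (deriv g z / deriv h z) \<le> (K - 1) / (K + 1))"

definition Mp :: "real \<Rightarrow> real \<Rightarrow> (complex \<Rightarrow> complex) \<Rightarrow> real" where
  "Mp p r F = ((1 / (2 * pi)) * integral {0..2*pi} (\<lambda>t. cmod (F (complex_of_real r * cis t)) powr p))
              powr (1 / p)"

definition Hk :: "real \<Rightarrow> complex \<Rightarrow> complex" where
  "Hk k z = (1 + z)^2 / ((1 - z)^3 * (1 - complex_of_real k * z))"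

definition Gk :: "real \<Rightarrow> complex \<Rightarrow> complex" where
  "Gk k z = complex_of_real k * z * (1 + z)^2 / ((1 - z)^3 * (1 - complex_of_real k * z))"

end

theory Submission
  imports Defs "HOL-Complex_Analysis.Complex_Analysis"
begin

text \<open>Through each point \<open>b\<close> of the complement of \<open>f(D)\<close> passes a ray in the complement, of direction
  \<open>d b\<close>, such that \<open>d\<close> is constant along it; this is all that is used of the three classes.

  Radial limits of \<open>f\<close> exist almost everywhere by a length-area argument. For unimodular \<open>e\<close>, the
  function \<open>F = cnj e * h + e * g\<close> is holomorphic with \<open>Re F = Re (cnj e * f)\<close>. After this rotation, an
  angle is of left or of right type according to the side to which the ray at its radial limit goes.
  Landing angles cannot alternate left, right, left, right: radii continued by rays would give
  disjoint connected sets in the plane whose preimages cross. So the left angles fill an arc, with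
  end points \<open>a\<close>, \<open>b\<close> say. The same topological argument, applied at a critical point, shows that
  \<open>Re F - m * w\<close> has no critical point for \<open>m > 0\<close>, where \<open>w\<close> is the harmonic measure of the arc; that is,
  \<open>F' (1 - cnj a * z) (1 - cnj b * z)\<close> omits a ray from 0. The freedom in \<open>e\<close> and in the position of vertical
  rays produces such a representation with an end point \<open>y\<close> in any given arc.

  A function which omits a ray and has value 1 at 0 is in absolute value \<open>|1 + x s|^2 / |1 - s|^2\<close> with \<open>s\<close> a
  Schwarz function and \<open>x\<close> unimodular. Hence \<open>ln (|h'| |1 - cnj y * z|)\<close> is a sum of logarithms to each of
  which Littlewood's subordination principle applies, and these majorizations add up since the
  majorants are symmetric and decreasing on \<open>[0, pi]\<close>. This bounds the p-th mean of
  \<open>h' (1 - cnj y * z)\<close> by that of \<open>Hk\<close>, for a dense set of \<open>y\<close>, hence for all \<open>y\<close>. Averaging over \<open>y\<close> removes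
  the factor, as the mean of \<open>|1 - cnj y * z|^p\<close> over \<open>y\<close> is at least 1.\<close>

subsection \<open>Crossing segments\<close>

text \<open>The factors of \<open>Hk\<close> have separate sources. With
  \<open>\<omega> = g' / h'\<close> one has \<open>h' + e * g' = h' * (1 + e * \<omega>)\<close>,
  where \<open>\<omega>\<close> is \<open>k\<close> times a Schwarz function; this yields
  \<open>1 - k * z\<close>. The omitted ray yields \<open>(1 + z)^2 / (1 - z)^2\<close>, and the
  weight \<open>1 - x * z\<close> one more power of \<open>1 - z\<close>. Majorizing the second
  weight \<open>1 - cnj y * z\<close> in the same way would give the fourth power; it is therefore
  kept on the left side and averaged out, and this is why end points \<open>y\<close> are needed in
  every arc. Two obstacles shape the topological part. \<open>f\<close> need not extend continuously
  to the circle: only radial limits outside a null set are available, and the arms from a critical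
  point have to be steered into such radii. And if all rays are parallel, as can happen for a domain
  convex in one direction, no rotation makes some of them point left and others right; they are then
  made vertical, and their abscissae, or the side from which the radii reach a common line, have to
  decide.\<close>

lemma connected_punctured_sector:
  fixes z0 :: complex
  shows "connected ((\<lambda>(t, a). z0 + of_real t * cis a) ` ({0<..<s} \<times> {a<..<b}))"
proof (rule connected_continuous_image)
  show "continuous_on ({0<..<s} \<times> {a<..<b}) (\<lambda>(t, a). z0 + complex_of_real t * cis a)"
    unfolding case_prod_unfold by (intro continuous_intros)
  show "connected ({0<..<s} \<times> {a<..<b::real})"
    by (intro connected_Times) auto
qed

lemma polar_angle_in_period:
  fixes w :: complex
  assumes "w \<noteq> 0"
  obtains a where "a0 \<le> a" "a < a0 + 2 * pi" "w = of_real (norm w) * cis a"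
proof -
  define n where "n = \<lceil>(a0 - Arg w) / (2 * pi)\<rceil>"
  define a where "a = Arg w + 2 * pi * of_int n"
  have "(a0 - Arg w) / (2 * pi) \<le> of_int n" "of_int n < (a0 - Arg w) / (2 * pi) + 1"
    unfolding n_def by linarith+
  then have "a0 \<le> a" "a < a0 + 2 * pi"
    unfolding a_def by (simp_all add: field_simps)
  moreover have "cis a = cis (Arg w)"
    by (simp add: a_def cis_mult [symmetric] cis_multiple_2pi)
  then have "w = of_real (norm w) * cis a"
    by (metis assms cis_Arg complex_norm_eq_1_exp mult.commute norm_eq_zero of_real_mult rcis_cmod_Arg rcis_def)
  ultimately show ?thesis by (rule that)
qed

lemma radial_eq_iff:
  assumes "t > 0" "t' > 0" "of_real t * cis a = of_real t' * cis b"
  shows "t = t'" "cis a = cis b"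
proof -
  have "norm (of_real t * cis a) = norm (of_real t' * cis b)" using assms(3) by (rule arg_cong)
  then show t: "t = t'" using assms(1,2) by (simp add: norm_mult)
  show "cis a = cis b" using assms t by simp
qed

lemma cis_eq_period:
  assumes "cis a = cis b" "\<bar>a - b\<bar> < 2 * pi" shows "a = b"
proof -
  have "cis (a - b) = 1" using assms by (simp add: cis_divide [symmetric])
  then have "cos (a - b) = 1" by (simp add: complex_eq_iff)
  then obtain n :: int where n: "a - b = of_int n * 2 * pi" by (auto simp: cos_one_2pi_int)
  have "\<bar>real_of_int n\<bar> * (2 * pi) < 2 * pi" using assms n by (simp add: abs_mult)
  then have "\<bar>real_of_int n\<bar> < 1" by simp
  then have "n = 0" by linarith
  then show ?thesis using n by simp
qed

text \<open>The ends of the first and third segment are joined inside \<open>X\<close>, and the loop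
  obtained through \<open>f z0\<close> is reduced to a Jordan curve \<open>J\<close> contained in
  \<open>X\<close> and the point \<open>f z0\<close>. Near \<open>z0\<close> its preimage consists
  of two radii, which cut a small disk into two sectors, and \<open>Y\<close> meets the images of
  both. Every point of a Jordan curve is on the frontier of both complementary domains, so each
  domain contains the image of a sector and hence meets \<open>Y\<close>. But \<open>Y\<close> is
  connected and disjoint from \<open>J\<close>.\<close>

lemma no_alternating_segments:
  fixes f :: "complex \<Rightarrow> complex"
  assumes "open D" and f: "continuous_on D f" "inj_on f D"
    and s: "s > 0" "cball z0 s \<subseteq> D"
    and a: "a1 < a2" "a2 < a3" "a3 < a4" "a4 < a1 + 2 * pi"
    and XY: "path_connected X" "path_connected Y" "X \<inter> Y = {}" "f z0 \<notin> X" "f z0 \<notin> Y"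
    and seg1: "\<And>t. \<lbrakk>0 < t; t \<le> s\<rbrakk> \<Longrightarrow> f (z0 + of_real t * cis a1) \<in> X"
    and seg2: "\<And>t. \<lbrakk>0 < t; t \<le> s\<rbrakk> \<Longrightarrow> f (z0 + of_real t * cis a2) \<in> Y"
    and seg3: "\<And>t. \<lbrakk>0 < t; t \<le> s\<rbrakk> \<Longrightarrow> f (z0 + of_real t * cis a3) \<in> X"
    and seg4: "\<And>t. \<lbrakk>0 < t; t \<le> s\<rbrakk> \<Longrightarrow> f (z0 + of_real t * cis a4) \<in> Y"
  shows False
proof -
  define P where "P = (\<lambda>t a. z0 + complex_of_real t * cis a)"
  have PD: "P t a \<in> cball z0 s" if "0 \<le> t" "t \<le> s" for t a
    using that by (simp add: P_def dist_norm norm_mult)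
  obtain g0 where g0: "path g0" "path_image g0 \<subseteq> X" "pathstart g0 = f (P s a1)" "pathfinish g0 = f (P s a3)"
    using XY(1) seg1[of s] seg3[of s] s unfolding path_connected_def P_def by blast
  have "compact (path_image g0)" "f z0 \<notin> path_image g0"
    using g0 XY by (auto intro: compact_path_image)
  then obtain e where e: "e > 0" "ball (f z0) e \<inter> path_image g0 = {}"
  proof -
    have "open (- path_image g0)"
      using \<open>compact (path_image g0)\<close> by (simp add: compact_imp_closed open_Compl)
    then show ?thesis using that \<open>f z0 \<notin> path_image g0\<close>
      by (meson ComplI ball_subset_cball disjoint_eq_subset_Compl open_contains_ball)
  qed
  have z0D: "z0 \<in> D" using s by (meson centre_in_cball less_imp_le subsetD)
  obtain s1 where s1: "s1 > 0" "\<And>z. \<lbrakk>z \<in> D; dist z z0 < s1\<rbrakk> \<Longrightarrow> dist (f z) (f z0) < e"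
    using f(1) e(1) z0D unfolding continuous_on_iff by blast
  \<comment> \<open>Up to distance \<open>s'\<close> from \<open>z0\<close> the image stays away
    from the joining path \<open>g0\<close>, so there the loop consists of the images of the two
    radii only.\<close>
  define s' where "s' = min (s / 2) (s1 / 2)"
  have s': "0 < s'" "s' < s" "s' < s1" using s s1 by (auto simp: s'_def min_def)
  have near: "f z \<notin> path_image g0" if "z \<in> cball z0 s'" for z
  proof -
    have "z \<in> D" using that s s' by auto
    then have "f z \<in> ball (f z0) e"
      using s1(2)[of z] that s' by (simp add: dist_commute)
    then show ?thesis using e by blast
  qed
  define p1 where "p1 = P s' a1"
  define p3 where "p3 = P s' a3"
  have cisne: "cis a1 \<noteq> cis a3" using a cis_eq_period[of a1 a3] by auto
  have p13: "p1 \<noteq> z0" "p3 \<noteq> z0" "p1 \<noteq> p3"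
    using s' cisne by (auto simp: p1_def p3_def P_def)
  have lin: "path_image (linepath (P s' b) (P s b)) \<subseteq> {P t b |t. s' \<le> t \<and> t \<le> s}" for b
  proof
    fix z assume "z \<in> path_image (linepath (P s' b) (P s b))"
    then obtain x where x: "0 \<le> x" "x \<le> 1" "z = (1 - x) *\<^sub>R P s' b + x *\<^sub>R P s b"
      by (auto simp: path_image_def linepath_def)
    have "z = P ((1 - x) * s' + x * s) b"
      by (simp add: x P_def algebra_simps scaleR_conv_of_real)
    moreover have "s' \<le> (1 - x) * s' + x * s"
      using x s' mult_left_mono[of s' s x] by (simp add: algebra_simps)
    moreover have "(1 - x) * s' + x * s \<le> s"
      using x s' mult_left_mono[of s' s "1 - x"] by (simp add: algebra_simps)
    ultimately show "z \<in> {P t b |t. s' \<le> t \<and> t \<le> s}" by blast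
  qed
  have lin0: "path_image (linepath z0 (P s' b)) = {P t b |t. 0 \<le> t \<and> t \<le> s'}" for b
  proof (intro equalityI subsetI)
    fix z assume "z \<in> path_image (linepath z0 (P s' b))"
    then obtain x where x: "0 \<le> x" "x \<le> 1" "z = (1 - x) *\<^sub>R z0 + x *\<^sub>R P s' b"
      by (auto simp: path_image_def linepath_def)
    have "z = P (x * s') b"
      by (simp add: x P_def algebra_simps scaleR_conv_of_real)
    moreover have "0 \<le> x * s'" "x * s' \<le> s'"
      using x s' mult_right_mono[of x 1 s'] by auto
    ultimately show "z \<in> {P t b |t. 0 \<le> t \<and> t \<le> s'}" by blast
  next
    fix z assume "z \<in> {P t b |t. 0 \<le> t \<and> t \<le> s'}"
    then obtain t where t: "0 \<le> t" "t \<le> s'" "z = P t b" by blast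
    have "z = linepath z0 (P s' b) (t / s')"
      using s' by (simp add: t P_def linepath_def algebra_simps scaleR_conv_of_real)
    then show "z \<in> path_image (linepath z0 (P s' b))"
      using t s' by (auto simp: path_image_def)
  qed
  \<comment> \<open>The parts of the radii between \<open>s'\<close> and \<open>s\<close> go to the
    outer path \<open>q\<close>, the parts below \<open>s'\<close> to the arc \<open>l\<close>.
    Since \<open>q\<close> may cross itself, an arc \<open>r\<close> is extracted from its
    image.\<close>
  define q1 where "q1 = f \<circ> linepath p1 (P s a1)"
  define q3 where "q3 = f \<circ> linepath (P s a3) p3"
  have im1: "path_image q1 \<subseteq> f ` {P t a1 |t. s' \<le> t \<and> t \<le> s}"
    unfolding q1_def p1_def path_image_compose by (intro image_mono lin)
  have im3: "path_image q3 \<subseteq> f ` {P t a3 |t. s' \<le> t \<and> t \<le> s}"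
    unfolding q3_def p3_def path_image_compose
    by (intro image_mono) (use lin[of a3] in \<open>simp add: closed_segment_commute\<close>)
  have subD: "{P t b |t. s' \<le> t \<and> t \<le> s} \<subseteq> D" for b
    using PD s s' by fastforce
  have lin_D: "path_image (linepath p1 (P s a1)) \<subseteq> D" "path_image (linepath (P s a3) p3) \<subseteq> D"
    using lin[of a1] lin[of a3] subD by (force simp: p1_def p3_def closed_segment_commute)+
  have pq: "path q1" "path q3"
    unfolding q1_def q3_def
    by (intro path_continuous_image path_linepath continuous_on_subset[OF f(1)] lin_D)+
  have ends: "pathfinish q1 = pathstart g0" "pathfinish g0 = pathstart q3"
    "pathstart q1 = f p1" "pathfinish q3 = f p3"
    using g0 by (simp_all add: q1_def q3_def pathstart_compose pathfinish_compose)
  define q where "q = q1 +++ g0 +++ q3"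
  have "path q" unfolding q_def using pq g0 ends by (simp add: path_join)
  moreover have "f p1 \<noteq> f p3"
    using p13 f(2) PD[of s' a1] PD[of s' a3] s s' unfolding p1_def p3_def inj_on_def
    by (metis less_imp_le subsetD)
  ultimately obtain r where r: "arc r" "path_image r \<subseteq> path_image q" "pathstart r = f p1" "pathfinish r = f p3"
    using path_contains_arc[of q "f p1" "f p3"] ends by (auto simp: q_def)
  have imq: "path_image q \<subseteq> f ` {P t a1 |t. s' \<le> t \<and> t \<le> s} \<union> path_image g0 \<union> f ` {P t a3 |t. s' \<le> t \<and> t \<le> s}"
    using im1 im3 ends unfolding q_def by (auto simp: path_image_join)
  define l where "l = linepath p3 z0 +++ linepath z0 p1"
  have iml: "path_image l = {P t a3 |t. 0 \<le> t \<and> t \<le> s'} \<union> {P t a1 |t. 0 \<le> t \<and> t \<le> s'}"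
    unfolding l_def using lin0[of a3] lin0[of a1]
    by (simp add: path_image_join p1_def p3_def closed_segment_commute)
  have Peq: "P t b = P t' b' \<Longrightarrow> t > 0 \<Longrightarrow> t' > 0 \<Longrightarrow> t = t' \<and> cis b = cis b'" for t b t' b'
    using radial_eq_iff[of t t' b b'] by (simp add: P_def)
  have P0: "P t b = z0 \<longleftrightarrow> t = 0" for t b by (simp add: P_def)
  have "arc l"
    unfolding l_def
  proof (rule arc_join)
    show "arc (linepath p3 z0)" "arc (linepath z0 p1)" using p13 by auto
    show "path_image (linepath p3 z0) \<inter> path_image (linepath z0 p1) \<subseteq> {pathstart (linepath z0 p1)}"
    proof
      fix z assume "z \<in> path_image (linepath p3 z0) \<inter> path_image (linepath z0 p1)"
      then obtain t t' where "0 \<le> t" "0 \<le> t'" "z = P t a3" "z = P t' a1"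
        using lin0[of a3] lin0[of a1] by (auto simp: p1_def p3_def closed_segment_commute)
      then have "z = z0" using Peq[of t a3 t' a1] cisne P0 by (metis antisym_conv1)
      then show "z \<in> {pathstart (linepath z0 p1)}" by simp
    qed
  qed simp
  have lD: "path_image l \<subseteq> cball z0 s'"
    using s' by (auto simp: iml P_def dist_norm norm_mult)
  have cbD: "cball z0 s' \<subseteq> D" using s s' by auto
  have arcfl: "arc (f \<circ> l)"
  proof -
    have "path (f \<circ> l)"
      using \<open>arc l\<close> lD cbD by (intro path_continuous_image arc_imp_path continuous_on_subset[OF f(1)]) auto
    moreover have "inj_on (f \<circ> l) {0..1}"
      using \<open>arc l\<close> lD cbD f(2) unfolding arc_def path_image_def
      by (meson comp_inj_on inj_on_subset subset_trans)
    ultimately show ?thesis by (simp add: arc_def)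
  qed
  define c where "c = r +++ (f \<circ> l)"
  have sc: "simple_path c"
    unfolding c_def
  proof (rule simple_path_join_loop)
    show "arc r" "arc (f \<circ> l)" by fact+
    show "pathfinish r = pathstart (f \<circ> l)" "pathfinish (f \<circ> l) = pathstart r"
      using r by (simp_all add: l_def pathstart_compose pathfinish_compose)
    show "path_image r \<inter> path_image (f \<circ> l) \<subseteq> {pathstart r, pathstart (f \<circ> l)}"
    proof
      fix w assume w: "w \<in> path_image r \<inter> path_image (f \<circ> l)"
      then obtain z where z: "z \<in> path_image l" "w = f z" by (auto simp: path_image_compose)
      have "w \<notin> path_image g0" using near z lD by blast
      then obtain t b where tb: "s' \<le> t" "t \<le> s" "w = f (P t b)" "b = a1 \<or> b = a3"
        using w r(2) imq by blast
      have "P t b \<in> D" "z \<in> D" using tb s' s PD[of t b] z lD cbD by auto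
      then have "z = P t b" using f(2) z tb by (metis inj_onD)
      then have "norm (z - z0) = t" using tb s' by (simp add: P_def norm_mult)
      moreover have "norm (z - z0) \<le> s'" using z lD by (auto simp: dist_norm norm_minus_commute)
      ultimately have "t = s'" using tb by simp
      then have "z = p1 \<or> z = p3" using tb \<open>z = P t b\<close> by (auto simp: p1_def p3_def)
      then show "w \<in> {pathstart r, pathstart (f \<circ> l)}"
        using r z by (auto simp: l_def pathstart_compose)
    qed
  qed
  have closed_c: "pathfinish c = pathstart c"
    using r by (simp add: c_def l_def pathfinish_compose)
  define J where "J = path_image c"
  have Jeq: "J = path_image r \<union> f ` path_image l"
    unfolding J_def c_def using r by (subst path_image_join) (auto simp: l_def pathstart_compose path_image_compose)
  note JJ = Jordan_inside_outside[OF sc closed_c, folded J_def]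
  have JX: "J \<subseteq> X \<union> {f z0}"
  proof
    fix w assume "w \<in> J"
    then consider "w \<in> path_image g0" | t b where "0 \<le> t" "t \<le> s" "w = f (P t b)" "b = a1 \<or> b = a3"
    proof -
      have "w \<in> path_image g0 \<or> (\<exists>t b. 0 \<le> t \<and> t \<le> s \<and> w = f (P t b) \<and> (b = a1 \<or> b = a3))"
        using \<open>w \<in> J\<close>[unfolded Jeq iml] subsetD[OF r(2), of w] subsetD[OF imq, of w] s'
        by (smt (verit, ccfv_threshold) UnE imageE mem_Collect_eq)
      then show ?thesis using that by blast
    qed
    then show "w \<in> X \<union> {f z0}"
    proof cases
      case 1 then show ?thesis using g0 by blast
    next
      case (2 t b)
      then show ?thesis using seg1[of t] seg3[of t] P0[of t b] by (cases "t = 0") (auto simp: P_def)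
    qed
  qed
  have YJ: "Y \<inter> J = {}" using JX XY by blast
  define B where "B = ball z0 s'"
  have BD: "B \<subseteq> D" unfolding B_def using cbD by auto
  have JB: "z = z0 \<or> (\<exists>t b. z = P t b \<and> 0 < t \<and> (b = a1 \<or> b = a3))" if zB: "z \<in> B" and zJ: "f z \<in> J" for z
  proof -
    have "f z \<notin> path_image g0" using near zB by (auto simp: B_def)
    then obtain t b where tb: "0 \<le> t" "t \<le> s" "f z = f (P t b)" "b = a1 \<or> b = a3"
      using zJ[unfolded Jeq iml] subsetD[OF r(2), of "f z"] subsetD[OF imq, of "f z"] s'
      by (smt (verit, ccfv_threshold) UnE imageE mem_Collect_eq)
    moreover have "P t b \<in> D" "z \<in> D" using tb s PD[of t b] zB BD by auto
    ultimately have "z = P t b" using f(2) by (metis inj_onD)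
    then show ?thesis using tb P0 by (metis antisym_conv1)
  qed
  define S1 where "S1 = (\<lambda>(t, a). P t a) ` ({0<..<s'} \<times> {a1<..<a3})"
  define S2 where "S2 = (\<lambda>(t, a). P t a) ` ({0<..<s'} \<times> {a3<..<a1 + 2 * pi})"
  have conS: "connected S1" "connected S2"
    unfolding S1_def S2_def P_def by (rule connected_punctured_sector)+
  have SB: "S1 \<subseteq> B" "S2 \<subseteq> B"
    unfolding S1_def S2_def B_def P_def by (auto simp: dist_norm norm_mult)
  have SJ: "f ` S1 \<inter> J = {}" "f ` S2 \<inter> J = {}"
  proof -
    have "f (P t b) \<notin> J" if tb: "0 < t" "t < s'" "(a1 < b \<and> b < a3) \<or> (a3 < b \<and> b < a1 + 2 * pi)" for t b
    proof
      assume "f (P t b) \<in> J"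
      moreover have "P t b \<in> B" using tb by (simp add: B_def P_def dist_norm norm_mult)
      ultimately obtain t' b' where *: "P t b = P t' b'" "0 < t'" "b' = a1 \<or> b' = a3"
        using JB[of "P t b"] P0[of t b] tb by blast
      then have "cis b = cis b'" using Peq tb by blast
      moreover have "\<bar>b - b'\<bar> < 2 * pi" using * tb a by auto
      ultimately have "b = b'" by (rule cis_eq_period)
      then show False using * tb a by auto
    qed
    then show "f ` S1 \<inter> J = {}" "f ` S2 \<inter> J = {}" unfolding S1_def S2_def by auto
  qed
  have inJ: "f (P t b) \<in> J" if "0 \<le> t" "t \<le> s'" "b = a1 \<or> b = a3" for t b
    unfolding Jeq iml using that by blast
  have fz0J: "f z0 \<in> J" using inJ[of 0 a1] s' P0[of 0 a1] by simp
  have cover: "f z \<in> J \<or> z \<in> S1 \<or> z \<in> S2" if "z \<in> B" for z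
  proof (cases "z = z0")
    case True
    then show ?thesis using fz0J by simp
  next
    case False
    then obtain b where b: "a1 \<le> b" "b < a1 + 2 * pi" "z - z0 = of_real (norm (z - z0)) * cis b"
      using polar_angle_in_period[of "z - z0" a1] by auto
    define t where "t = norm (z - z0)"
    have t: "0 < t" "t < s'" using False that by (auto simp: t_def B_def dist_norm norm_minus_commute)
    have z: "z = P t b" using b unfolding t_def P_def by (metis add.commute diff_add_cancel)
    consider "b = a1" | "a1 < b" "b < a3" | "b = a3" | "a3 < b" using b by linarith
    then show ?thesis
    proof cases
      case 1 then show ?thesis using z t inJ[of t b] by simp
    next
      case 2 then show ?thesis using z t unfolding S1_def by (auto intro!: image_eqI[of _ _ "(t, b)"])
    next
      case 3 then show ?thesis using z t inJ[of t b] by simp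
    next
      case 4 then show ?thesis using z t b unfolding S2_def by (auto intro!: image_eqI[of _ _ "(t, b)"])
    qed
  qed
  have opB: "open (f ` B)"
    by (rule invariance_of_domain) (use f BD in \<open>auto simp: B_def intro: continuous_on_subset inj_on_subset\<close>)
  have fz0B: "f z0 \<in> f ` B" using s' by (auto simp: B_def)
  have conf: "connected (f ` S1)" "connected (f ` S2)"
    using conS SB BD by (auto intro!: connected_continuous_image continuous_on_subset[OF f(1)])
  \<comment> \<open>Stated for a domain \<open>U\<close> with frontier \<open>J\<close>, to be used
    for the inside and the outside alike. Which of the two sectors falls into \<open>U\<close> is
    left open, as \<open>Y\<close> meets both.\<close>
  have side: "f ` S1 \<subseteq> U \<or> f ` S2 \<subseteq> U"
    if U: "open U" "frontier U = J" "open V" "U \<inter> V = {}" "U \<union> V = - J" for U V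
  proof -
    have "f z0 \<in> closure U" using fz0J U(2) unfolding frontier_def by blast
    then obtain w where w: "w \<in> U" "w \<in> f ` B"
      using opB fz0B by (meson closure_iff_nhds_not_empty disjoint_iff subset_refl)
    then obtain z where z: "z \<in> B" "w = f z" by blast
    have sub: "f ` T \<subseteq> U" if T: "connected (f ` T)" "f ` T \<inter> J = {}" "z \<in> T" for T
    proof -
      have 2: "f ` T \<subseteq> U \<union> V" using T(2) U(5) by (simp add: disjoint_eq_subset_Compl)
      have 1: "U \<inter> f ` T \<noteq> {}" using T(3) w(1) z(2) by (auto simp: disjoint_iff)
      have "U \<inter> V \<inter> f ` T = {}" using U(4) by simp
      then have "V \<inter> f ` T = {}" using connectedD[OF T(1) U(1) U(3)] 1 2 by argo
      then show ?thesis using 2 by blast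
    qed
    have "w \<notin> J" using w(1) U(5) by blast
    then have "z \<in> S1 \<or> z \<in> S2" using cover[OF z(1)] z(2) by simp
    then show ?thesis using sub[OF conf(1) SJ(1)] sub[OF conf(2) SJ(2)] by argo
  qed
  have Y1: "f (P (s'/2) a2) \<in> Y \<inter> f ` S1"
    using seg2[of "s'/2"] s' a unfolding S1_def P_def by (auto intro!: imageI image_eqI[of _ _ "(s'/2, a2)"])
  have Y2: "f (P (s'/2) a4) \<in> Y \<inter> f ` S2"
    using seg4[of "s'/2"] s' a unfolding S2_def P_def by (auto intro!: imageI image_eqI[of _ _ "(s'/2, a4)"])
  have conY: "connected Y" using XY by (simp add: path_connected_imp_connected)
  have YU: "Y \<subseteq> U" if U: "open U" "frontier U = J" "open V" "U \<inter> V = {}" "U \<union> V = - J" for U V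
  proof -
    have 1: "U \<inter> Y \<noteq> {}"
    proof -
      have "f (P (s'/2) a2) \<in> U \<or> f (P (s'/2) a4) \<in> U"
        using side[OF U] Y1 Y2 by (meson IntD2 subsetD)
      then show ?thesis using Y1 Y2 by (meson IntD1 disjoint_iff)
    qed
    have 2: "Y \<subseteq> U \<union> V" using YJ U(5) by (simp add: disjoint_eq_subset_Compl)
    have "U \<inter> V \<inter> Y = {}" using U(4) by simp
    then have "V \<inter> Y = {}" using connectedD[OF conY U(1) U(3)] 1 2 by argo
    then show ?thesis using 2 by blast
  qed
  have io: "open (inside J)" "open (outside J)" "frontier (inside J) = J" "frontier (outside J) = J"
    "inside J \<inter> outside J = {}" "inside J \<union> outside J = - J"
    using JJ by argo+
  have "Y \<subseteq> inside J"
    by (rule YU[OF io(1,3,2,5,6)])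
  moreover have "Y \<subseteq> outside J"
    by (rule YU[OF io(2,4,1)]) (use io(5,6) in \<open>simp_all only: Int_commute Un_commute\<close>)
  ultimately show False using io(5) Y1 by blast
qed

definition radial_tail :: "real \<Rightarrow> real \<Rightarrow> complex set" where
  "radial_tail \<rho> t = (\<lambda>r. of_real r * cis t) ` {\<rho>..<1}"

subsection \<open>Radial limits\<close>

text \<open>Change of variables is available in the library only for the types \<open>real^'n\<close>.\<close>
definition vec_of_complex :: "complex \<Rightarrow> real^2" where "vec_of_complex z = vector [Re z, Im z]"
definition complex_of_vec :: "real^2 \<Rightarrow> complex" where "complex_of_vec p = Complex (p $ 1) (p $ 2)"

lemma complex_vec_inverse [simp]:
  "complex_of_vec (vec_of_complex z) = z" "vec_of_complex (complex_of_vec p) = p"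
  by (simp_all add: vec_of_complex_def complex_of_vec_def vec_eq_iff forall_2)

lemma vec_of_complex_image: "vec_of_complex ` T = {q. complex_of_vec q \<in> T}"
  by (auto simp: image_iff) (metis complex_vec_inverse(2))

lemma linear_vec_of_complex: "bounded_linear vec_of_complex"
  by (rule linear_conv_bounded_linear[THEN iffD1])
     (auto intro!: linearI simp: vec_of_complex_def vec_eq_iff forall_2)

text \<open>\<open>A p\<close> and \<open>B p\<close> are the partial derivatives of
  \<open>G\<close>; in complex notation the Jacobian determinant is the imaginary part of
  \<open>cnj (A p) * B p\<close>.\<close>

lemma absolutely_integrable_change_of_variables_complex:
  fixes G :: "real^2 \<Rightarrow> complex" and w :: "complex \<Rightarrow> real"
  assumes S: "S \<in> sets lebesgue"
    and der: "\<And>p. p \<in> S \<Longrightarrow> (G has_derivative (\<lambda>v. v $ 1 *\<^sub>R A p + v $ 2 *\<^sub>R B p)) (at p within S)"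
    and inj: "inj_on G S"
  shows "(\<lambda>q. w (complex_of_vec q)) absolutely_integrable_on {q. complex_of_vec q \<in> G ` S} \<longleftrightarrow>
    (\<lambda>p. \<bar>Re (A p) * Im (B p) - Im (A p) * Re (B p)\<bar> * w (G p)) absolutely_integrable_on S"
proof -
  let ?g = "\<lambda>p. vec_of_complex (G p)"
  let ?g' = "\<lambda>p v. vec_of_complex (v $ 1 *\<^sub>R A p + v $ 2 *\<^sub>R B p)"
  have d: "(?g has_derivative ?g' p) (at p within S)" if "p \<in> S" for p
    by (rule bounded_linear.has_derivative[OF linear_vec_of_complex der[OF that]])
  have i: "inj_on ?g S"
    using inj unfolding inj_on_def by (metis complex_vec_inverse(1))
  have im: "?g ` S = {q. complex_of_vec q \<in> G ` S}"
    using vec_of_complex_image[of "G ` S"] by (simp add: image_image)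
  have det: "det (matrix (?g' p)) = Re (A p) * Im (B p) - Im (A p) * Re (B p)" for p
    by (simp add: det_2 matrix_def vec_of_complex_def axis_def)
  show ?thesis
    using absolutely_integrable_change_of_variables[OF S d i, of "\<lambda>q. (vec (w (complex_of_vec q)) :: real^1)"]
    unfolding im det by (simp add: absolutely_integrable_on_1_iff o_def)
qed

section \<open>Tonelli's theorem for the plane in coordinates\<close>

lemma Basis_vec2: "(Basis :: (real^2) set) = {axis 1 1, axis 2 1}"
  by (auto simp: Basis_vec_def UNIV_2)

lemma inner_axis2 [simp]: "p \<bullet> axis i 1 = (p :: real^2) $ i"
  by (simp add: inner_axis)

lemma lborel_vec2_prod: "distr (lborel :: (real^2) measure) borel (\<lambda>p. (p $ 1, p $ 2)) = (lborel :: (real \<times> real) measure)"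
proof (rule lborel_eqI[symmetric])
  have [measurable]: "(\<lambda>p::real^2. (p $ 1, p $ 2)) \<in> borel_measurable borel"
    by (intro borel_measurable_continuous_onI continuous_intros)
  fix l u :: "real \<times> real"
  assume le: "\<And>b. b \<in> Basis \<Longrightarrow> l \<bullet> b \<le> u \<bullet> b"
  have le12: "fst l \<le> fst u" "snd l \<le> snd u"
    using le[of "(1, 0)"] le[of "(0, 1)"] by (auto simp: Basis_prod_def inner_prod_def)
  let ?l = "vector [fst l, snd l] :: real^2" and ?u = "vector [fst u, snd u] :: real^2"
  have pre: "(\<lambda>p::real^2. (p $ 1, p $ 2)) -` box l u = box ?l ?u"
    by (auto simp: box_def Basis_prod_def inner_prod_def Basis_vec_def inner_axis forall_2)
  have "emeasure (distr lborel borel (\<lambda>p::real^2. (p $ 1, p $ 2))) (box l u) = emeasure lborel (box ?l ?u)"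
    by (subst emeasure_distr) (simp_all add: pre)
  also have "\<dots> = (\<Prod>b\<in>Basis. (?u - ?l) \<bullet> b)"
    by (rule emeasure_lborel_box) (use le12 in \<open>auto simp: Basis_vec2\<close>)
  also have "(\<Prod>b\<in>Basis. (?u - ?l) \<bullet> b) = (fst u - fst l) * (snd u - snd l)"
    by (simp add: Basis_vec2 axis_eq_axis)
  also have "\<dots> = (\<Prod>b\<in>Basis. (u - l) \<bullet> b)"
    by (simp add: Basis_prod_def inner_prod_def)
  finally show "emeasure (distr lborel borel (\<lambda>p::real^2. (p $ 1, p $ 2))) (box l u) = (\<Prod>b\<in>Basis. (u - l) \<bullet> b)" .
qed simp

lemma nn_integral_vec2:
  fixes \<psi> :: "real \<Rightarrow> real \<Rightarrow> ennreal"
  assumes [measurable]: "(\<lambda>(x, y). \<psi> x y) \<in> borel_measurable borel"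
  shows "(\<integral>\<^sup>+p. \<psi> (p $ 1) (p $ 2) \<partial>(lborel :: (real^2) measure)) = (\<integral>\<^sup>+y. \<integral>\<^sup>+x. \<psi> x y \<partial>lborel \<partial>lborel)"
proof -
  have [measurable]: "(\<lambda>p::real^2. (p $ 1, p $ 2)) \<in> borel_measurable borel"
    by (intro borel_measurable_continuous_onI continuous_intros)
  have "(\<integral>\<^sup>+p. \<psi> (p $ 1) (p $ 2) \<partial>(lborel :: (real^2) measure)) =
     (\<integral>\<^sup>+q. (\<lambda>(x, y). \<psi> x y) q \<partial>(distr (lborel :: (real^2) measure) borel (\<lambda>p. (p $ 1, p $ 2))))"
    by (subst nn_integral_distr) auto
  also have "\<dots> = (\<integral>\<^sup>+q. (\<lambda>(x, y). \<psi> x y) q \<partial>(lborel \<Otimes>\<^sub>M lborel))"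
    by (simp only: lborel_vec2_prod lborel_prod)
  also have "\<dots> = (\<integral>\<^sup>+y. \<integral>\<^sup>+x. \<psi> x y \<partial>lborel \<partial>lborel)"
    by (subst lborel_pair.nn_integral_snd[symmetric]) (simp_all add: lborel_prod)
  finally show ?thesis .
qed

lemma absolutely_integrable_vec2_iff:
  fixes \<psi> :: "real \<Rightarrow> real \<Rightarrow> real"
  assumes m: "(\<lambda>(x, y). \<psi> x y) \<in> borel_measurable borel" and nn: "\<And>x y. \<psi> x y \<ge> 0"
  shows "(\<lambda>p::real^2. \<psi> (p $ 1) (p $ 2)) absolutely_integrable_on UNIV \<longleftrightarrow>
     (\<integral>\<^sup>+y. \<integral>\<^sup>+x. ennreal (\<psi> x y) \<partial>lborel \<partial>lborel) < \<infinity>"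
proof -
  have c: "(\<lambda>p::real^2. (p $ 1, p $ 2)) \<in> borel_measurable borel"
    by (intro borel_measurable_continuous_onI continuous_intros)
  have m2: "(\<lambda>p::real^2. \<psi> (p $ 1) (p $ 2)) \<in> borel_measurable lborel"
    using measurable_compose[OF c m] by simp
  have "(\<lambda>p::real^2. \<psi> (p $ 1) (p $ 2)) absolutely_integrable_on UNIV \<longleftrightarrow>
      integrable lborel (\<lambda>p::real^2. \<psi> (p $ 1) (p $ 2))"
    by (simp add: set_integrable_def integrable_completion[OF m2])
  also have "\<dots> \<longleftrightarrow> (\<integral>\<^sup>+p. ennreal (\<psi> (p $ 1) (p $ 2)) \<partial>(lborel :: (real^2) measure)) < \<infinity>"
    using m2 nn by (simp add: integrable_iff_bounded)
  also have "(\<integral>\<^sup>+p. ennreal (\<psi> (p $ 1) (p $ 2)) \<partial>(lborel :: (real^2) measure)) =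
      (\<integral>\<^sup>+y. \<integral>\<^sup>+x. ennreal (\<psi> x y) \<partial>lborel \<partial>lborel)"
    by (rule nn_integral_vec2) (use m in \<open>simp add: case_prod_unfold\<close>)
  finally show ?thesis .
qed

text \<open>This density has finite integral, while paths to \<open>b\<close> or to infinity have infinite length for its
  square root. Length-area with it gives a finite limit different from \<open>b\<close> on almost every radius.\<close>
definition log_density :: "complex \<Rightarrow> complex \<Rightarrow> real" where
  "log_density b z = inverse ((cmod (z - b))\<^sup>2 * (1 + (ln (cmod (z - b)))\<^sup>2))"

lemma nn_integral_inverse_1_plus_sq: "(\<integral>\<^sup>+x. ennreal (inverse (1 + x\<^sup>2)) \<partial>lborel) < \<infinity>"
proof -
  have half: "(\<integral>\<^sup>+x. ennreal (inverse (1 + x\<^sup>2)) * indicator {0..} x \<partial>lborel) = ennreal (pi / 2)"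
    using nn_integral_FTC_atLeast[of "\<lambda>x::real. inverse (1 + x\<^sup>2)" 0 arctan "pi / 2"]
      DERIV_arctan tendsto_arctan_at_top by simp
  have "(\<integral>\<^sup>+x. ennreal (inverse (1 + x\<^sup>2)) * indicator {..0} x \<partial>lborel)
      = (\<integral>\<^sup>+x. ennreal (inverse (1 + x\<^sup>2)) * indicator {0..} x \<partial>lborel)"
    using nn_integral_real_affine[of "\<lambda>x. ennreal (inverse (1 + x\<^sup>2)) * indicator {..0} x" "-1" 0]
    by (simp add: indicator_def)
  then have "(\<integral>\<^sup>+x. ennreal (inverse (1 + x\<^sup>2)) * indicator {..0} x \<partial>lborel) = ennreal (pi / 2)"
    using half by simp
  moreover have "(\<integral>\<^sup>+x. ennreal (inverse (1 + x\<^sup>2)) \<partial>lborel) \<le>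
     (\<integral>\<^sup>+x. ennreal (inverse (1 + x\<^sup>2)) * indicator {..0} x + ennreal (inverse (1 + x\<^sup>2)) * indicator {0..} x \<partial>lborel)"
    by (intro nn_integral_mono) (auto simp: indicator_def)
  moreover have "\<dots> = (\<integral>\<^sup>+x. ennreal (inverse (1 + x\<^sup>2)) * indicator {..0} x \<partial>lborel)
     + (\<integral>\<^sup>+x. ennreal (inverse (1 + x\<^sup>2)) * indicator {0..} x \<partial>lborel)"
    by (intro nn_integral_add) auto
  ultimately show ?thesis using half
    by (metis ennreal_add_less_top ennreal_less_top infinity_ennreal_def order_le_less_trans)
qed

text \<open>In the coordinates \<open>b + exp (x + \<i> * y)\<close> the area element
  \<open>exp (2 * x)\<close> cancels the squared distance to \<open>b\<close>, and
  \<open>1 / (1 + x^2)\<close> remains on a strip of height \<open>2 * pi\<close>. The strip covers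
  the plane up to a horizontal ray from \<open>b\<close>.\<close>

lemma log_density_integrable:
  "(\<lambda>q. log_density b (complex_of_vec q)) absolutely_integrable_on UNIV"
proof -
  define S where "S = {p::real^2. 0 < p $ 2 \<and> p $ 2 < 2 * pi}"
  define G where "G = (\<lambda>p::real^2. b + exp (Complex (p $ 1) (p $ 2)))"
  define E where "E = (\<lambda>p::real^2. exp (Complex (p $ 1) (p $ 2)))"
  have "open S" unfolding S_def
    by (intro open_Collect_conj open_Collect_less continuous_intros)
  then have SL: "S \<in> sets lebesgue" by (simp add: borel_open)
  have Cd: "((\<lambda>p::real^2. Complex (p $ 1) (p $ 2)) has_derivative (\<lambda>v. Complex (v $ 1) (v $ 2))) (at p within S)" for p :: "real^2"
    by (rule bounded_linear_imp_has_derivative, rule linear_conv_bounded_linear[THEN iffD1], rule linearI)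
       (auto simp: complex_eq_iff)
  have der: "(G has_derivative (\<lambda>v. v $ 1 *\<^sub>R E p + v $ 2 *\<^sub>R (\<i> * E p))) (at p within S)" for p :: "real^2"
  proof -
    have "((\<lambda>p. exp (Complex (p $ 1) (p $ 2))) has_derivative (\<lambda>v. E p * Complex (v $ 1) (v $ 2))) (at p within S)"
      using has_derivative_compose[OF Cd[of p] DERIV_exp[unfolded has_field_derivative_def]]
      by (simp add: E_def)
    from has_derivative_add[OF has_derivative_const this, of b] show ?thesis unfolding G_def
      by (rule has_derivative_eq_rhs) (simp add: Complex_eq algebra_simps scaleR_conv_of_real)
  qed
  have inj: "inj_on G S"
  proof (rule inj_onI)
    fix p q :: "real^2" assume pq: "p \<in> S" "q \<in> S" "G p = G q"
    then have "exp (Complex (p $ 1) (p $ 2)) = exp (Complex (q $ 1) (q $ 2))" by (simp add: G_def)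
    moreover have "\<bar>Im (Complex (p $ 1) (p $ 2)) - Im (Complex (q $ 1) (q $ 2))\<bar> < 2 * pi"
      using pq by (auto simp: S_def)
    ultimately have "Complex (p $ 1) (p $ 2) = Complex (q $ 1) (q $ 2)"
      by (rule exp_complex_eqI[rotated])
    then show "p = q" by (simp add: vec_eq_iff forall_2)
  qed
  have val: "\<bar>Re (E p) * Im (\<i> * E p) - Im (E p) * Re (\<i> * E p)\<bar> * log_density b (G p) = inverse (1 + (p $ 1)\<^sup>2)" for p :: "real^2"
  proof -
    have "\<bar>Re (E p) * Im (\<i> * E p) - Im (E p) * Re (\<i> * E p)\<bar> = (cmod (E p))\<^sup>2"
      using cmod_power2[of "E p"] by (simp add: power2_eq_square)
    moreover have "cmod (E p) = exp (p $ 1)" by (simp add: E_def norm_exp_eq_Re)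
    moreover have "cmod (G p - b) = exp (p $ 1)" by (simp add: G_def norm_exp_eq_Re)
    ultimately show ?thesis by (simp add: log_density_def)
  qed
  have "(\<lambda>p::real^2. (\<lambda>x y. inverse (1 + x\<^sup>2) * indicator {0<..<2*pi} y) (p $ 1) (p $ 2)) absolutely_integrable_on UNIV"
  proof (subst absolutely_integrable_vec2_iff)
    have "(\<integral>\<^sup>+y. \<integral>\<^sup>+x. ennreal (inverse (1 + x\<^sup>2) * indicator {0<..<2*pi} y) \<partial>lborel \<partial>lborel)
      = (\<integral>\<^sup>+y. (\<integral>\<^sup>+x. ennreal (inverse (1 + x\<^sup>2)) \<partial>lborel) * indicator {0<..<2*pi} y \<partial>lborel)"
      by (intro nn_integral_cong) (auto simp: indicator_def)
    also have "\<dots> = (\<integral>\<^sup>+x. ennreal (inverse (1 + x\<^sup>2)) \<partial>lborel) * ennreal (2 * pi)"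
      by (subst nn_integral_cmult_indicator) (auto)
    also have "\<dots> < \<infinity>"
      using nn_integral_inverse_1_plus_sq by (simp add: ennreal_mult_less_top)
    finally show "(\<integral>\<^sup>+y. \<integral>\<^sup>+x. ennreal (inverse (1 + x\<^sup>2) * indicator {0<..<2*pi} y) \<partial>lborel \<partial>lborel) < \<infinity>" .
  next
    show "(\<lambda>(x::real, y). inverse (1 + x\<^sup>2) * indicator {0<..<2*pi} y) \<in> borel_measurable borel"
      by (subst borel_prod[symmetric]) measurable
  qed auto
  then have "(\<lambda>p::real^2. if p \<in> S then inverse (1 + (p $ 1)\<^sup>2) else 0) absolutely_integrable_on UNIV"
    by (rule absolutely_integrable_spike[where S="{}"]) (auto simp: S_def indicator_def)
  then have "(\<lambda>p. inverse (1 + (p $ 1)\<^sup>2)) absolutely_integrable_on S"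
    by (simp add: absolutely_integrable_restrict_UNIV)
  then have 1: "(\<lambda>q. log_density b (complex_of_vec q)) absolutely_integrable_on {q. complex_of_vec q \<in> G ` S}"
    using absolutely_integrable_change_of_variables_complex[OF SL der inj, of "log_density b"]
    by (simp only: val)
  have neg: "negligible {q::real^2. q $ 2 = Im b}"
    using negligible_standard_hyperplane[of "axis 2 1 :: real^2" "Im b"] by (simp add: Basis_vec2)
  show ?thesis
  proof (rule absolutely_integrable_spike_set[OF 1])
    have "q $ 2 = Im b" if "complex_of_vec q \<notin> G ` S" for q :: "real^2"
    proof (rule ccontr)
      assume q: "q $ 2 \<noteq> Im b"
      define z where "z = complex_of_vec q - b"
      have z: "Im z \<noteq> 0" using q by (simp add: z_def complex_of_vec_def)
      then have zn: "z \<noteq> 0" by auto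
      \<comment> \<open>The argument of \<open>z\<close> in the range from 0 to
        \<open>2 * pi\<close>, obtained from the principal one.\<close>
      define a where "a = (if Im z > 0 then Im (Ln z) else Im (Ln z) + 2 * pi)"
      have rng: "- pi < Im (Ln z)" "Im (Ln z) < pi \<or> Im (Ln z) = pi" using zn mpi_less_Im_Ln Im_Ln_le_pi[of z] by auto
      have pos: "Im z > 0 \<Longrightarrow> 0 < Im (Ln z) \<and> Im (Ln z) < pi" using Im_Ln_pos_lt[OF zn] by blast
      have neg': "\<not> Im z > 0 \<Longrightarrow> Im (Ln z) < 0"
        using Im_Ln_pos_le[OF zn] z rng by (metis Im_Ln_le_pi linorder_not_le order_le_less zn)
      have "0 < a" "a < 2 * pi" using pos neg' rng by (auto simp: a_def)
      moreover have "exp (Complex (Re (Ln z)) a) = z"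
      proof -
        have "exp (Complex (Re (Ln z)) a) = exp (Ln z)"
        proof (cases "Im z > 0")
          case True
          then show ?thesis by (simp only: a_def if_True complex_surj)
        next
          case False
          then have "Complex (Re (Ln z)) a = Ln z + 2 * of_real pi * \<i>"
            by (simp add: a_def complex_eq_iff)
          then show ?thesis by (simp only: exp_add exp_two_pi_i) simp
        qed
        then show ?thesis using zn by simp
      qed
      ultimately have "complex_of_vec q = G (vector [Re (Ln z), a]) \<and> vector [Re (Ln z), a] \<in> S"
        by (simp add: G_def S_def z_def)
      then show False using that by blast
    qed
    then show "negligible {q \<in> {q. complex_of_vec q \<in> G ` S} - UNIV. log_density b (complex_of_vec q) \<noteq> 0}"
      "negligible {q \<in> UNIV - {q. complex_of_vec q \<in> G ` S}. log_density b (complex_of_vec q) \<noteq> 0}"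
      by (auto intro!: negligible_subset[OF neg])
  qed
qed

section \<open>Length-area estimate on a single radius\<close>

lemma ln_norm_has_derivative:
  fixes T :: "real \<Rightarrow> complex"
  assumes "(T has_vector_derivative T') (at x)" "T x \<noteq> b"
  shows "((\<lambda>x. ln (cmod (T x - b))) has_real_derivative (Re T' * Re (T x - b) + Im T' * Im (T x - b)) / (cmod (T x - b))\<^sup>2) (at x)"
proof -
  have R: "((\<lambda>x. Re (T x)) has_real_derivative Re T') (at x)"
    and I: "((\<lambda>x. Im (T x)) has_real_derivative Im T') (at x)"
    using bounded_linear.has_vector_derivative[OF bounded_linear_Re assms(1)]
      bounded_linear.has_vector_derivative[OF bounded_linear_Im assms(1)]
    by (simp_all add: has_real_derivative_iff_has_vector_derivative)
  have pos: "(Re (T x) - Re b)\<^sup>2 + (Im (T x) - Im b)\<^sup>2 > 0"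
    using assms(2) by (metis complex_eq_iff diff_eq_diff_eq eq_iff_diff_eq_0 sum_power2_gt_zero_iff)
  define r where "r = (\<lambda>x. Re (T x))"
  define i where "i = (\<lambda>x. Im (T x))"
  have "((\<lambda>x. ln ((r x - Re b)\<^sup>2 + (i x - Im b)\<^sup>2) / 2) has_real_derivative
     (Re T' * (r x - Re b) + Im T' * (i x - Im b)) / ((r x - Re b)\<^sup>2 + (i x - Im b)\<^sup>2)) (at x)"
  proof -
    have R': "(r has_real_derivative Re T') (at x)" and I': "(i has_real_derivative Im T') (at x)"
      using R I by (simp_all add: r_def i_def)
    have p: "(r x - Re b)\<^sup>2 + (i x - Im b)\<^sup>2 > 0" using pos by (simp add: r_def i_def)
    have alg: "(1 / S * (real 2 * ((Re T' - 0) * A ^ (2 - Suc 0)) + real 2 * ((Im T' - 0) * B ^ (2 - Suc 0))) * 2 - l * 0) / (2 * 2)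
        = (Re T' * A + Im T' * B) / S" if "S > 0" for S A B l :: real
      using that by (simp add: field_simps)
    show ?thesis
      by (rule derivative_eq_intros R' I' refl p)+ (simp, rule alg[OF p])
  qed
  then have "((\<lambda>x. ln ((Re (T x) - Re b)\<^sup>2 + (Im (T x) - Im b)\<^sup>2) / 2) has_real_derivative
     (Re T' * Re (T x - b) + Im T' * Im (T x - b)) / ((Re (T x) - Re b)\<^sup>2 + (Im (T x) - Im b)\<^sup>2)) (at x)"
    by (simp add: r_def i_def)
  moreover have eq: "ln (cmod (T x - b)) = ln ((Re (T x) - Re b)\<^sup>2 + (Im (T x) - Im b)\<^sup>2) / 2" for x
    by (cases "T x = b") (auto simp: cmod_def ln_sqrt sum_power2_gt_zero_iff complex_eq_iff)
  ultimately show ?thesis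
    unfolding eq by (simp add: cmod_power2)
qed

text \<open>Let \<open>q\<close> be the line element of the metric given by
  \<open>log_density\<close>. As \<open>q \<le> 1 + q^2\<close>, finite energy implies finite
  length. The curve therefore stays in a closed annulus around \<open>b\<close>, bounded away from
  \<open>b\<close> and from infinity. There the density is bounded below, so the ordinary length is
  finite too, and the curve converges inside the annulus.\<close>

lemma finite_log_energy_imp_limit:
  fixes T T' :: "real \<Rightarrow> complex"
  assumes der: "\<And>x. x \<in> {0<..<1} \<Longrightarrow> (T has_vector_derivative T' x) (at x)"
    and cT': "continuous_on {0<..<1} T'"
    and ne: "\<And>x. x \<in> {0<..<1} \<Longrightarrow> T x \<noteq> b"
    and fin: "(\<integral>\<^sup>+x. ennreal (log_density b (T x) * (cmod (T' x))\<^sup>2) * indicator {0<..<1} x \<partial>lborel) < \<infinity>"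
  obtains w where "(T \<longlongrightarrow> w) (at_right 0)" "w \<noteq> b"
proof -
  define q where "q = (\<lambda>x. indicator {0<..<1} x *\<^sub>R (cmod (T' x) * sqrt (log_density b (T x))))"
  have cT: "continuous_on {0<..<1} T"
    using der by (meson continuous_at_imp_continuous_on has_vector_derivative_continuous)
  have cd: "continuous_on {0<..<1} (\<lambda>x. log_density b (T x))"
  proof -
    have "(cmod (T x - b))\<^sup>2 * (1 + (ln (cmod (T x - b)))\<^sup>2) \<noteq> 0" if "x \<in> {0<..<1}" for x
      using ne[OF that] by (metis add_pos_nonneg eq_iff_diff_eq_0 mult_eq_0_iff norm_eq_zero order_less_irrefl power_eq_0_iff zero_le_power2 zero_less_one)
    then show ?thesis unfolding log_density_def
      by (intro continuous_intros cT) (use ne in auto)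
  qed
  have qm: "q \<in> borel_measurable borel"
    unfolding q_def by (intro borel_measurable_continuous_on_indicator continuous_intros cT' cd) auto
  have dnn: "log_density b z \<ge> 0" for z by (simp add: log_density_def)
  have q0: "q x \<ge> 0" for x by (simp add: q_def dnn)
  have "integrable lborel q"
  proof (rule integrableI_bounded)
    show "q \<in> borel_measurable lborel" using qm by simp
    have "(\<integral>\<^sup>+x. ennreal (norm (q x)) \<partial>lborel) \<le>
      (\<integral>\<^sup>+x. indicator {0<..<1::real} x + ennreal (log_density b (T x) * (cmod (T' x))\<^sup>2) * indicator {0<..<1} x \<partial>lborel)"
    proof (rule nn_integral_mono)
      fix x :: real
      show "ennreal (norm (q x)) \<le> indicator {0<..<1} x + ennreal (log_density b (T x) * (cmod (T' x))\<^sup>2) * indicator {0<..<1} x"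
      proof (cases "x \<in> {0<..<1}")
        case True
        let ?a = "cmod (T' x) * sqrt (log_density b (T x))"
        have "?a\<^sup>2 = log_density b (T x) * (cmod (T' x))\<^sup>2" using dnn by (simp add: power_mult_distrib)
        moreover have "?a \<le> 1 + ?a\<^sup>2"
          using zero_le_power2[of "?a - 1/2"] by (simp add: power2_eq_square algebra_simps)
        ultimately have "norm (q x) \<le> 1 + log_density b (T x) * (cmod (T' x))\<^sup>2"
          using True q0[of x] by (simp add: q_def)
        then have "ennreal (norm (q x)) \<le> ennreal (1 + log_density b (T x) * (cmod (T' x))\<^sup>2)"
          by (rule ennreal_leI)
        then show ?thesis using True dnn by (simp add: ennreal_plus)
      qed (simp add: q_def)
    qed
    also have "\<dots> = (\<integral>\<^sup>+x. indicator {0<..<1::real} x \<partial>lborel) +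
        (\<integral>\<^sup>+x. ennreal (log_density b (T x) * (cmod (T' x))\<^sup>2) * indicator {0<..<1} x \<partial>lborel)"
    proof (rule nn_integral_add)
      have "(\<lambda>x. indicator {0<..<1} x *\<^sub>R (log_density b (T x) * (cmod (T' x))\<^sup>2)) \<in> borel_measurable borel"
        by (intro borel_measurable_continuous_on_indicator continuous_intros cT' cd) auto
      then have "(\<lambda>x. ennreal (indicator {0<..<1} x *\<^sub>R (log_density b (T x) * (cmod (T' x))\<^sup>2))) \<in> borel_measurable lborel"
        by simp
      moreover have "(\<lambda>x. ennreal (indicator {0<..<1} x *\<^sub>R (log_density b (T x) * (cmod (T' x))\<^sup>2))) =
         (\<lambda>x. ennreal (log_density b (T x) * (cmod (T' x))\<^sup>2) * indicator {0<..<1} x)"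
        by (auto simp: indicator_def)
      ultimately show "(\<lambda>x. ennreal (log_density b (T x) * (cmod (T' x))\<^sup>2) * indicator {0<..<1} x) \<in> borel_measurable lborel"
        by simp
    qed auto
    also have "\<dots> < \<infinity>" using fin by simp
    finally show "(\<integral>\<^sup>+x. ennreal (norm (q x)) \<partial>lborel) < \<infinity>" .
  qed
  then have qi: "q integrable_on {a..c}" for a c
    using integrable_on_lborel integrable_on_subinterval[of q UNIV a c] by blast
  define Q where "Q = (\<lambda>x. integral {0..x} q)"
  have QQ: "integral {x1..x2} q = Q x2 - Q x1" if "0 \<le> x1" "x1 \<le> x2" for x1 x2
    unfolding Q_def using Henstock_Kurzweil_Integration.integral_combine[OF that qi] by simp
  have Qc: "continuous_on {0..1} Q" unfolding Q_def by (rule indefinite_integral_continuous_1[OF qi])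
  have Qmono: "Q x1 \<le> Q x2" if "0 \<le> x1" "x1 \<le> x2" for x1 x2
    using QQ[OF that] Henstock_Kurzweil_Integration.integral_nonneg[OF qi, of x1 x2] q0 by simp
  have Q0: "Q 0 = 0" by (simp add: Q_def)
  \<comment> \<open>\<open>arsinh\<close> is the primitive of \<open>1 / sqrt (x^2 + 1)\<close>. So
    \<open>l\<close> varies by no more than the length measured by \<open>q\<close>, and a bound for
    \<open>l\<close> is a bound for \<open>ln (cmod (T x - b))\<close>.\<close>
  define l where "l = (\<lambda>x. arsinh (ln (cmod (T x - b))))"
  define l' where "l' = (\<lambda>x. (Re (T' x) * Re (T x - b) + Im (T' x) * Im (T x - b)) / (cmod (T x - b))\<^sup>2 / sqrt ((ln (cmod (T x - b)))\<^sup>2 + 1))"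
  have ld: "(l has_real_derivative l' x) (at x)" if "x \<in> {0<..<1}" for x
  proof -
    have "(arsinh has_real_derivative 1 / sqrt ((ln (cmod (T x - b)))\<^sup>2 + 1)) (at (ln (cmod (T x - b))))"
      by (rule arsinh_real_has_field_derivative)
    from DERIV_chain2[OF this ln_norm_has_derivative[OF der[OF that] ne[OF that]]]
    show ?thesis by (simp add: l_def l'_def mult.commute)
  qed
  have lb: "\<bar>l' x\<bar> \<le> q x" if x: "x \<in> {0<..<1}" for x
  proof -
    let ?n = "cmod (T x - b)" and ?s = "sqrt ((ln (cmod (T x - b)))\<^sup>2 + 1)"
    have n: "?n > 0" using ne[OF x] by simp
    have "\<bar>Re (T' x) * Re (T x - b) + Im (T' x) * Im (T x - b)\<bar> \<le> cmod (T' x) * ?n"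
      using Cauchy_Schwarz_ineq2[of "T' x" "T x - b"] by (simp add: inner_complex_def)
    then have "\<bar>Re (T' x) * Re (T x - b) + Im (T' x) * Im (T x - b)\<bar> / ?n\<^sup>2 \<le> cmod (T' x) / ?n"
      using n by (simp add: field_simps power2_eq_square)
    from divide_right_mono[OF this, of ?s]
    have "\<bar>l' x\<bar> \<le> cmod (T' x) / ?n / ?s"
      by (simp add: l'_def abs_divide)
    also have "\<dots> = q x"
      using x n by (simp add: q_def log_density_def real_sqrt_mult real_sqrt_inverse divide_simps real_sqrt_divide add.commute)
    finally show ?thesis .
  qed
  have ldiff: "\<bar>l x2 - l x1\<bar> \<le> Q x2 - Q x1" if x: "0 < x1" "x1 \<le> x2" "x2 < 1" for x1 x2
  proof -
    have "(l' has_integral (l x2 - l x1)) {x1..x2}"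
    proof (rule fundamental_theorem_of_calculus[OF x(2)])
      fix y assume "y \<in> {x1..x2}"
      then have "(l has_real_derivative l' y) (at y within {x1..x2})"
        using x by (intro has_field_derivative_at_within[OF ld]) auto
      then show "(l has_vector_derivative l' y) (at y within {x1..x2})"
        by (simp only: has_real_derivative_iff_has_vector_derivative)
    qed
    then have i: "l' integrable_on {x1..x2}" "integral {x1..x2} l' = l x2 - l x1"
      by (simp_all add: has_integral_iff)
    have "norm (integral {x1..x2} l') \<le> integral {x1..x2} q"
      by (rule integral_norm_bound_integral[OF i(1) qi]) (use lb x in auto)
    then show ?thesis using QQ[of x1 x2] x i by simp
  qed
  define L where "L = sinh (\<bar>l (1/2)\<bar> + Q 1)"
  have lbd: "\<bar>ln (cmod (T x - b))\<bar> \<le> L" if x: "x \<in> {0<..<1}" for x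
  proof -
    have "\<bar>l x - l (1/2)\<bar> \<le> Q 1"
    proof (cases "x \<le> 1/2")
      case True
      then have "\<bar>l (1/2) - l x\<bar> \<le> Q (1/2) - Q x" "Q 0 \<le> Q x" "Q (1/2) \<le> Q 1"
        using x by (auto intro!: ldiff Qmono)
      then show ?thesis using Q0 by linarith
    next
      case False
      then have "\<bar>l x - l (1/2)\<bar> \<le> Q x - Q (1/2)" "Q 0 \<le> Q (1/2)" "Q x \<le> Q 1"
        using x by (auto intro!: ldiff Qmono)
      then show ?thesis using Q0 by linarith
    qed
    then have "\<bar>l x\<bar> \<le> \<bar>l (1/2)\<bar> + Q 1" by linarith
    then have "sinh \<bar>l x\<bar> \<le> L" unfolding L_def by (simp only: sinh_real_le_iff)
    moreover have "sinh (l x) = ln (cmod (T x - b))" by (simp add: l_def sinh_arsinh_real)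
    moreover have "\<bar>sinh (l x)\<bar> = sinh \<bar>l x\<bar>" by (cases "l x \<ge> 0") (auto simp: sinh_real_nonneg_iff abs_if)
    ultimately show ?thesis by simp
  qed
  have L0: "L \<ge> 0" using lbd[of "1/2"] by simp
  have nb: "exp (- L) \<le> cmod (T x - b)" "cmod (T x - b) \<le> exp L" if x: "x \<in> {0<..<1}" for x
  proof -
    have n: "cmod (T x - b) > 0" using ne[OF x] by simp
    show "exp (- L) \<le> cmod (T x - b)" using lbd[OF x] n
      by (metis abs_le_iff exp_le_cancel_iff exp_ln minus_le_iff)
    show "cmod (T x - b) \<le> exp L" using lbd[OF x] n
      by (metis abs_le_iff exp_le_cancel_iff exp_ln)
  qed
  \<comment> \<open>On the annulus just found, \<open>1 / C\<close> is a lower bound for the square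
    root of \<open>log_density b\<close>.\<close>
  define C where "C = exp L * sqrt (1 + L\<^sup>2)"
  have C0: "C > 0" by (simp add: C_def add_pos_nonneg)
  have T'q: "cmod (T' x) \<le> C * q x" if x: "x \<in> {0<..<1}" for x
  proof -
    let ?n = "cmod (T x - b)"
    have n: "?n > 0" using ne[OF x] by simp
    have "(ln ?n)\<^sup>2 \<le> L\<^sup>2" using lbd[OF x] L0 by (simp add: abs_le_square_iff[symmetric])
    then have "?n * sqrt (1 + (ln ?n)\<^sup>2) \<le> C"
      unfolding C_def using nb(2)[OF x] n by (intro mult_mono) auto
    moreover have "q x = cmod (T' x) / (?n * sqrt (1 + (ln ?n)\<^sup>2))"
      using x n by (simp add: q_def log_density_def real_sqrt_mult real_sqrt_inverse inverse_eq_divide real_sqrt_divide)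
    moreover have "?n * sqrt (1 + (ln ?n)\<^sup>2) > 0" using n by (simp add: add_pos_nonneg)
    ultimately show ?thesis
      by (simp add: pos_le_divide_eq) (metis mult.commute mult_right_mono norm_ge_zero)
  qed
  have Tdiff: "cmod (T x2 - T x1) \<le> C * (Q x2 - Q x1)" if x: "0 < x1" "x1 \<le> x2" "x2 < 1" for x1 x2
  proof -
    have "(T' has_integral (T x2 - T x1)) {x1..x2}"
      by (rule fundamental_theorem_of_calculus[OF x(2)])
         (use x in \<open>intro has_vector_derivative_at_within[OF der], auto\<close>)
    then have i: "T' integrable_on {x1..x2}" "integral {x1..x2} T' = T x2 - T x1"
      by (simp_all add: has_integral_iff)
    have "norm (integral {x1..x2} T') \<le> integral {x1..x2} (\<lambda>x. C * q x)"
      by (rule integral_norm_bound_integral[OF i(1) integrable_on_mult_right[OF qi]]) (use T'q x in auto)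
    then show ?thesis using QQ[of x1 x2] x i by simp
  qed
  define s where "s = (\<lambda>n::nat. 1 / real (n + 2))"
  have s: "0 < s n" "s n < 1" for n by (auto simp: s_def)
  have s_lim: "s \<longlonglongrightarrow> 0" unfolding s_def by real_asymp
  have Qlim: "(\<lambda>n. Q (s n)) \<longlonglongrightarrow> 0"
  proof -
    have "(Q \<longlongrightarrow> Q 0) (at 0 within {0..1})" using Qc by (simp add: continuous_on_def)
    moreover have "filterlim s (at 0 within {0..1}) sequentially"
      using s_lim s by (auto simp: filterlim_at less_imp_le s(1)[THEN order_less_imp_not_eq2] intro!: always_eventually)
    ultimately show ?thesis using Q0 filterlim_compose by fastforce
  qed
  have TdiffQ: "cmod (T x - T y) \<le> C * max (Q x) (Q y)" if "x \<in> {0<..<1}" "y \<in> {0<..<1}" for x y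
  proof -
    have "C * (Q x - Q y) \<le> C * max (Q x) (Q y)" "C * (Q y - Q x) \<le> C * max (Q x) (Q y)"
      using Qmono[of 0 x] Qmono[of 0 y] Q0 that C0 by (auto simp: max_def intro!: mult_left_mono)
    then show ?thesis
      using Tdiff[of x y] Tdiff[of y x] that by (cases "x \<le> y") (auto simp: norm_minus_commute)
  qed
  have "Cauchy (\<lambda>n. T (s n))"
  proof (rule CauchyI)
    fix e :: real assume "e > 0"
    then have "eventually (\<lambda>n. Q (s n) < e / C) sequentially"
      using order_tendstoD(2)[OF Qlim, of "e / C"] C0 by simp
    then obtain M where M: "\<And>n. n \<ge> M \<Longrightarrow> Q (s n) < e / C" by (auto simp: eventually_sequentially)
    have "cmod (T (s m) - T (s n)) < e" if "m \<ge> M" "n \<ge> M" for m n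
    proof -
      have "C * max (Q (s m)) (Q (s n)) < C * (e / C)" using M that C0 by (intro mult_strict_left_mono) auto
      then show ?thesis using TdiffQ[of "s m" "s n"] s C0 by simp
    qed
    then show "\<exists>M. \<forall>m\<ge>M. \<forall>n\<ge>M. norm (T (s m) - T (s n)) < e" by blast
  qed
  then obtain w where w: "(\<lambda>n. T (s n)) \<longlonglongrightarrow> w" using Cauchy_convergent convergent_def by blast
  have wx: "cmod (T x - w) \<le> C * Q x" if x: "x \<in> {0<..<1}" for x
  proof (rule tendsto_upperbound)
    show "(\<lambda>n. cmod (T x - T (s n))) \<longlonglongrightarrow> cmod (T x - w)" by (intro tendsto_intros w)
    have "eventually (\<lambda>n. s n < x) sequentially" using order_tendstoD(2)[OF s_lim] x by auto
    then show "eventually (\<lambda>n. cmod (T x - T (s n)) \<le> C * Q x) sequentially"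
    proof eventually_elim
      case (elim n)
      then have "C * max (Q x) (Q (s n)) \<le> C * Q x"
        using Qmono[of "s n" x] s[of n] C0 by (intro mult_left_mono) auto
      then show ?case using TdiffQ[of x "s n"] x s[of n] by simp
    qed
  qed simp
  have QL: "(Q \<longlongrightarrow> 0) (at_right 0)"
  proof -
    have "(Q \<longlongrightarrow> Q 0) (at 0 within {0..1})" using Qc by (simp add: continuous_on_def)
    then show ?thesis using Q0 by (simp add: at_within_Icc_at_right)
  qed
  have "(T \<longlongrightarrow> w) (at_right 0)"
  proof (rule LIM_zero_cancel, rule metric_tendsto_imp_tendsto)
    have "eventually (\<lambda>x::real. x \<in> {0<..<1}) (at_right 0)"
      by (rule eventually_at_right_real) simp
    then show "eventually (\<lambda>x. dist (T x - w) 0 \<le> dist (C * Q x) 0) (at_right 0)"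
    proof eventually_elim
      case (elim x)
      then show ?case using wx[OF elim] by (simp add: dist_norm)
    qed
    show "((\<lambda>x. C * Q x) \<longlongrightarrow> 0) (at_right 0)" by (rule tendsto_mult_right_zero[OF QL])
  qed
  moreover have "w \<noteq> b"
  proof -
    have "exp (- L) \<le> cmod (w - b)"
    proof (rule tendsto_lowerbound)
      show "(\<lambda>n. cmod (T (s n) - b)) \<longlonglongrightarrow> cmod (w - b)" by (intro tendsto_intros w)
    qed (use nb s in auto)
    then show ?thesis by auto
  qed
  ultimately show ?thesis by (rule that)
qed

lemma negligible_of_AE:
  fixes P :: "real \<Rightarrow> bool"
  assumes "AE x in lborel. P x"
  shows "negligible {x. \<not> P x}"
proof -
  obtain N where N: "N \<in> null_sets lborel" "{x. \<not> P x} \<subseteq> N"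
    using assms by (auto simp: eventually_ae_filter)
  then have "negligible N"
    by (simp add: negligible_iff_null_sets null_sets_completionI)
  then show ?thesis using N(2) by (rule negligible_subset)
qed

text \<open>In the coordinates \<open>exp (- x + \<i> * y)\<close> a radius is a line of constant
  \<open>y\<close>, and the circle is reached as \<open>x\<close> decreases to 0. The Jacobian times
  \<open>log_density b\<close> at \<open>f\<close> has as its integral that of the density over the
  image, which is finite. Quasiconformality bounds the square of the \<open>x\<close>-derivative by
  a multiple of the Jacobian, so by Tonelli the energy is finite on almost every line, where
  \<open>finite_log_energy_imp_limit\<close> applies. An interval of length 1 keeps the coordinates
  injective.\<close>

lemma negligible_no_radial_limit_on_interval:
  fixes h g :: "complex \<Rightarrow> complex" and c Kq :: real
  defines "f \<equiv> \<lambda>z. h z + cnj (g z)"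
  assumes hol: "h holomorphic_on ball 0 1" "g holomorphic_on ball 0 1"
    and inj: "inj_on f (ball 0 1)"
    and Kq: "\<And>z. z \<in> ball 0 1 \<Longrightarrow> (cmod (deriv h z) + cmod (deriv g z))\<^sup>2 \<le> Kq * \<bar>(cmod (deriv h z))\<^sup>2 - (cmod (deriv g z))\<^sup>2\<bar>"
    and b: "\<And>z. \<lbrakk>exp (-1) < cmod z; cmod z < 1\<rbrakk> \<Longrightarrow> f z \<noteq> b"
  shows "negligible {y. c < y \<and> y < c + 1 \<and> \<not> (\<exists>w. w \<noteq> b \<and> ((\<lambda>r. f (of_real r * cis y)) \<longlongrightarrow> w) (at_left 1))}"
proof -
  define Z where "Z = (\<lambda>x y. exp (Complex (- x) y))"
  define H where "H = (\<lambda>x y. deriv h (Z x y) * Z x y)"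
  define \<Gamma> where "\<Gamma> = (\<lambda>x y. deriv g (Z x y) * Z x y)"
  define A where "A = (\<lambda>x y. - H x y - cnj (\<Gamma> x y))"
  define B where "B = (\<lambda>x y. \<i> * H x y - \<i> * cnj (\<Gamma> x y))"
  define S where "S = {p::real^2. 0 < p $ 1 \<and> p $ 1 < 1 \<and> c < p $ 2 \<and> p $ 2 < c + 1}"
  define S2 where "S2 = {0<..<1::real} \<times> {c<..<c+1}"
  have SS2: "p \<in> S \<longleftrightarrow> (p $ 1, p $ 2) \<in> S2" for p :: "real^2" by (auto simp: S_def S2_def)
  have cZ: "cmod (Z x y) = exp (- x)" for x y by (simp add: Z_def norm_exp_eq_Re)
  have ZD: "Z x y \<in> ball 0 1" "exp (-1) < cmod (Z x y)" "cmod (Z x y) < 1" if "0 < x" "x < 1" for x y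
    using that by (simp_all add: cZ)
  have dh: "(h has_field_derivative deriv h z) (at z)" "(g has_field_derivative deriv g z) (at z)" if "z \<in> ball 0 1" for z
    using hol that by (auto intro: holomorphic_derivI)
  have "open S" unfolding S_def
    by (intro open_Collect_conj open_Collect_less continuous_intros)
  then have SL: "S \<in> sets lebesgue" by (simp add: borel_open)
  have Zd: "((\<lambda>p::real^2. Z (p $ 1) (p $ 2)) has_derivative (\<lambda>v. Z (p $ 1) (p $ 2) * Complex (- (v $ 1)) (v $ 2))) (at p within S)" for p :: "real^2"
  proof -
    have "((\<lambda>p::real^2. Complex (- (p $ 1)) (p $ 2)) has_derivative (\<lambda>v. Complex (- (v $ 1)) (v $ 2))) (at p within S)"
      by (rule bounded_linear_imp_has_derivative, rule linear_conv_bounded_linear[THEN iffD1], rule linearI)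
         (auto simp: complex_eq_iff)
    from has_derivative_compose[OF this DERIV_exp[unfolded has_field_derivative_def]]
    show ?thesis by (simp add: Z_def)
  qed
  have der: "((\<lambda>p::real^2. f (Z (p $ 1) (p $ 2))) has_derivative
      (\<lambda>v. v $ 1 *\<^sub>R A (p $ 1) (p $ 2) + v $ 2 *\<^sub>R B (p $ 1) (p $ 2))) (at p within S)" if "p \<in> S" for p :: "real^2"
  proof -
    have z: "Z (p $ 1) (p $ 2) \<in> ball 0 1" using that ZD by (simp add: S_def)
    note d1 = has_derivative_compose[OF Zd[of p] dh(1)[OF z, unfolded has_field_derivative_def]]
    note d2 = bounded_linear.has_derivative[OF bounded_linear_cnj has_derivative_compose[OF Zd[of p] dh(2)[OF z, unfolded has_field_derivative_def]]]
    show ?thesis unfolding f_def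
      by (rule has_derivative_eq_rhs[OF has_derivative_add[OF d1 d2]])
         (auto simp: fun_eq_iff A_def B_def H_def \<Gamma>_def complex_eq_iff algebra_simps)
  qed
  have inj2: "inj_on (\<lambda>p::real^2. f (Z (p $ 1) (p $ 2))) S"
  proof (rule inj_onI)
    fix p q :: "real^2" assume pq: "p \<in> S" "q \<in> S" "f (Z (p $ 1) (p $ 2)) = f (Z (q $ 1) (q $ 2))"
    then have "Z (p $ 1) (p $ 2) = Z (q $ 1) (q $ 2)"
      using inj ZD by (auto simp: S_def inj_on_def)
    then have "exp (Complex (- (p $ 1)) (p $ 2)) = exp (Complex (- (q $ 1)) (q $ 2))" by (simp add: Z_def)
    moreover have "\<bar>Im (Complex (- (p $ 1)) (p $ 2)) - Im (Complex (- (q $ 1)) (q $ 2))\<bar> < 2 * pi"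
      using pq pi_ge_two by (auto simp: S_def)
    ultimately have "Complex (- (p $ 1)) (p $ 2) = Complex (- (q $ 1)) (q $ 2)"
      by (rule exp_complex_eqI[rotated])
    then show "p = q" by (simp add: vec_eq_iff forall_2)
  qed
  have det: "\<bar>Re (A x y) * Im (B x y) - Im (A x y) * Re (B x y)\<bar> = \<bar>(cmod (H x y))\<^sup>2 - (cmod (\<Gamma> x y))\<^sup>2\<bar>" for x y
    unfolding A_def B_def by (simp add: cmod_power2) (simp add: power2_eq_square algebra_simps abs_minus_commute)
  define \<psi> where "\<psi> = (\<lambda>x y. indicator S2 (x, y) *\<^sub>R (\<bar>(cmod (H x y))\<^sup>2 - (cmod (\<Gamma> x y))\<^sup>2\<bar> * log_density b (f (Z x y))))"
  have cont: "continuous_on S2 (\<lambda>(x, y). Z x y)"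
    unfolding Z_def case_prod_unfold Complex_eq by (intro continuous_intros)
  have imD: "(\<lambda>(x, y). Z x y) ` S2 \<subseteq> ball 0 1" using ZD by (auto simp: S2_def)
  have cd: "continuous_on (ball 0 1) (deriv h)" "continuous_on (ball 0 1) (deriv g)"
    using hol by (auto intro!: holomorphic_on_imp_continuous_on holomorphic_deriv)
  have cf: "continuous_on (ball 0 1) f"
    unfolding f_def using hol by (intro continuous_intros holomorphic_on_imp_continuous_on)
  have cont2: "continuous_on S2 (\<lambda>p. deriv h (Z (fst p) (snd p)))" "continuous_on S2 (\<lambda>p. deriv g (Z (fst p) (snd p)))"
     "continuous_on S2 (\<lambda>p. f (Z (fst p) (snd p)))" "continuous_on S2 (\<lambda>p. Z (fst p) (snd p))"
    using continuous_on_compose2[OF cd(1) cont imD] continuous_on_compose2[OF cd(2) cont imD]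
      continuous_on_compose2[OF cf cont imD] cont by (simp_all add: case_prod_unfold)
  have fb: "f (Z (fst p) (snd p)) \<noteq> b" if "p \<in> S2" for p
    using that by (intro b ZD(2,3)) (auto simp: S2_def)
  have dens_ne: "(cmod (z - b))\<^sup>2 * (1 + (ln (cmod (z - b)))\<^sup>2) \<noteq> 0" if "z \<noteq> b" for z
    using that by (metis add_pos_nonneg eq_iff_diff_eq_0 mult_eq_0_iff norm_eq_zero order_less_irrefl power_eq_0_iff zero_le_power2 zero_less_one)
  have psim: "(\<lambda>(x, y). \<psi> x y) \<in> borel_measurable borel"
  proof -
    have "continuous_on S2 (\<lambda>p. \<bar>(cmod (H (fst p) (snd p)))\<^sup>2 - (cmod (\<Gamma> (fst p) (snd p)))\<^sup>2\<bar> * log_density b (f (Z (fst p) (snd p))))"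
      unfolding H_def \<Gamma>_def log_density_def
      by (intro continuous_intros cont2) (use dens_ne fb in auto)
    moreover have "S2 \<in> sets borel" unfolding S2_def by (intro borel_open open_Times) auto
    ultimately have "(\<lambda>p. indicator S2 p *\<^sub>R (\<bar>(cmod (H (fst p) (snd p)))\<^sup>2 - (cmod (\<Gamma> (fst p) (snd p)))\<^sup>2\<bar> * log_density b (f (Z (fst p) (snd p))))) \<in> borel_measurable borel"
      by (intro borel_measurable_continuous_on_indicator)
    then show ?thesis by (simp add: \<psi>_def case_prod_unfold)
  qed
  have dnn: "log_density b z \<ge> 0" for z by (simp add: log_density_def)
  have psi0: "\<psi> x y \<ge> 0" for x y by (simp add: \<psi>_def dnn)
  have "(\<lambda>p::real^2. \<psi> (p $ 1) (p $ 2)) absolutely_integrable_on UNIV"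
  proof -
    let ?F = "(\<lambda>p::real^2. f (Z (p $ 1) (p $ 2))) ` S"
    have "{q. complex_of_vec q \<in> ?F} = (\<lambda>p::real^2. vec_of_complex (f (Z (p $ 1) (p $ 2)))) ` S"
      using vec_of_complex_image[of ?F] by (simp add: image_image)
    moreover have "open ((\<lambda>p::real^2. vec_of_complex (f (Z (p $ 1) (p $ 2)))) ` S)"
    proof (rule invariance_of_domain[OF _ \<open>open S\<close>])
      show "continuous_on S (\<lambda>p::real^2. vec_of_complex (f (Z (p $ 1) (p $ 2))))"
        using has_derivative_continuous[OF bounded_linear.has_derivative[OF linear_vec_of_complex der]]
        by (simp add: continuous_on_eq_continuous_within)
      show "inj_on (\<lambda>p::real^2. vec_of_complex (f (Z (p $ 1) (p $ 2)))) S"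
        using inj2 unfolding inj_on_def by (metis complex_vec_inverse(1))
    qed
    ultimately have "{q. complex_of_vec q \<in> ?F} \<in> sets lebesgue" by (simp add: borel_open)
    then have "(\<lambda>q. log_density b (complex_of_vec q)) absolutely_integrable_on {q. complex_of_vec q \<in> ?F}"
      using set_integrable_subset[OF log_density_integrable] by blast
    then have "(\<lambda>p::real^2. \<bar>(cmod (H (p $ 1) (p $ 2)))\<^sup>2 - (cmod (\<Gamma> (p $ 1) (p $ 2)))\<^sup>2\<bar> * log_density b (f (Z (p $ 1) (p $ 2)))) absolutely_integrable_on S"
      using absolutely_integrable_change_of_variables_complex[OF SL der inj2, of "log_density b"] by (simp only: det)
    then have "(\<lambda>p::real^2. if p \<in> S then \<bar>(cmod (H (p $ 1) (p $ 2)))\<^sup>2 - (cmod (\<Gamma> (p $ 1) (p $ 2)))\<^sup>2\<bar> * log_density b (f (Z (p $ 1) (p $ 2))) else 0) absolutely_integrable_on UNIV"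
      by (simp add: absolutely_integrable_restrict_UNIV)
    then show ?thesis
      by (rule absolutely_integrable_spike[where S="{}"]) (auto simp: SS2 \<psi>_def)
  qed
  then have fin: "(\<integral>\<^sup>+y. \<integral>\<^sup>+x. ennreal (\<psi> x y) \<partial>lborel \<partial>lborel) < \<infinity>"
    using absolutely_integrable_vec2_iff[OF psim psi0] by blast
  have "AE y in lborel. (\<integral>\<^sup>+x. ennreal (\<psi> x y) \<partial>lborel) \<noteq> \<infinity>"
  proof (rule nn_integral_PInf_AE)
    have "(\<lambda>q. ennreal ((\<lambda>(x, y). \<psi> x y) q)) \<in> borel_measurable (borel :: (real \<times> real) measure)"
      using psim by measurable
    then have "(\<lambda>(y, x). ennreal (\<psi> x y)) \<in> borel_measurable (lborel \<Otimes>\<^sub>M lborel)"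
      using measurable_compose[OF measurable_pair_swap'[of lborel lborel], of "\<lambda>q. ennreal ((\<lambda>(x, y). \<psi> x y) q)" borel]
      by (simp add: lborel_prod case_prod_unfold)
    then show "(\<lambda>y. \<integral>\<^sup>+x. ennreal (\<psi> x y) \<partial>lborel) \<in> borel_measurable lborel"
      by (rule lborel.borel_measurable_nn_integral)
  qed (use fin in auto)
  then have "negligible {y. \<not> (\<integral>\<^sup>+x. ennreal (\<psi> x y) \<partial>lborel) \<noteq> \<infinity>}"
    by (rule negligible_of_AE)
  moreover have "\<exists>w. w \<noteq> b \<and> ((\<lambda>r. f (of_real r * cis y)) \<longlongrightarrow> w) (at_left 1)"
    if y: "c < y" "y < c + 1" and fy: "(\<integral>\<^sup>+x. ennreal (\<psi> x y) \<partial>lborel) \<noteq> \<infinity>" for y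
  proof -
    have cy: "continuous_on {0<..<1} (\<lambda>x. (x, y))" "(\<lambda>x. (x, y)) ` {0<..<1} \<subseteq> S2"
      using y by (auto simp: S2_def intro!: continuous_intros)
    have cA: "continuous_on {0<..<1} (\<lambda>x. A x y)"
      unfolding A_def H_def \<Gamma>_def
      using continuous_on_compose2[OF cont2(1) cy] continuous_on_compose2[OF cont2(2) cy] continuous_on_compose2[OF cont2(4) cy]
      by (intro continuous_intros) simp_all
    have dT: "((\<lambda>x. f (Z x y)) has_vector_derivative A x y) (at x)" if "x \<in> {0<..<1}" for x
    proof -
      have z: "Z x y \<in> ball 0 1" using that ZD by simp
      have Zx: "((\<lambda>x. Z x y) has_vector_derivative - Z x y) (at x)"
      proof -
        have "((\<lambda>x. Complex (- x) y) has_vector_derivative (- 1)) (at x)"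
          unfolding has_vector_derivative_def Complex_eq
          by (auto intro!: derivative_eq_intros simp: scaleR_conv_of_real)
        from field_vector_diff_chain_at[OF this DERIV_exp]
        show ?thesis by (simp add: Z_def o_def)
      qed
      have "((\<lambda>x. h (Z x y)) has_vector_derivative - H x y) (at x)" "((\<lambda>x. g (Z x y)) has_vector_derivative - \<Gamma> x y) (at x)"
        using field_vector_diff_chain_at[OF Zx dh(1)[OF z]] field_vector_diff_chain_at[OF Zx dh(2)[OF z]]
        by (simp_all add: o_def H_def \<Gamma>_def mult.commute)
      from has_vector_derivative_add[OF this(1) bounded_linear.has_vector_derivative[OF bounded_linear_cnj this(2)]]
      show ?thesis by (simp add: f_def A_def)
    qed
    have Kpos: "\<bar>Kq\<bar> + 1 > 0" by simp
    \<comment> \<open>\<open>A x y\<close> is the derivative of \<open>f\<close> along the radius.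
      Its norm is at most \<open>cmod (H x y) + cmod (\<Gamma> x y)\<close>, and \<open>Kq\<close>
      turns the square of this sum into the Jacobian.\<close>
    have le: "ennreal (log_density b (f (Z x y)) * (cmod (A x y))\<^sup>2) * indicator {0<..<1} x \<le> ennreal (\<bar>Kq\<bar> + 1) * ennreal (\<psi> x y)" for x
    proof (cases "x \<in> {0<..<1}")
      case True
      then have z: "Z x y \<in> ball 0 1" using ZD by simp
      have "cmod (A x y) \<le> cmod (H x y) + cmod (\<Gamma> x y)"
        unfolding A_def using norm_triangle_ineq4[of "- H x y" "cnj (\<Gamma> x y)"] by simp
      also have "\<dots> = (cmod (deriv h (Z x y)) + cmod (deriv g (Z x y))) * cmod (Z x y)"
        by (simp add: H_def \<Gamma>_def norm_mult algebra_simps)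
      finally have "(cmod (A x y))\<^sup>2 \<le> ((cmod (deriv h (Z x y)) + cmod (deriv g (Z x y))) * cmod (Z x y))\<^sup>2"
        by (rule power_mono) simp
      also have "\<dots> \<le> Kq * \<bar>(cmod (deriv h (Z x y)))\<^sup>2 - (cmod (deriv g (Z x y)))\<^sup>2\<bar> * (cmod (Z x y))\<^sup>2"
        unfolding power_mult_distrib by (rule mult_right_mono[OF Kq[OF z]]) simp
      also have "\<dots> = Kq * \<bar>(cmod (H x y))\<^sup>2 - (cmod (\<Gamma> x y))\<^sup>2\<bar>"
        unfolding H_def \<Gamma>_def by (simp add: norm_mult power_mult_distrib left_diff_distrib[symmetric] abs_mult)
      also have "\<dots> \<le> (\<bar>Kq\<bar> + 1) * \<bar>(cmod (H x y))\<^sup>2 - (cmod (\<Gamma> x y))\<^sup>2\<bar>"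
        by (rule mult_right_mono) auto
      finally have "log_density b (f (Z x y)) * (cmod (A x y))\<^sup>2 \<le> (\<bar>Kq\<bar> + 1) * \<psi> x y"
        using True y dnn[of "f (Z x y)"] mult_left_mono by (fastforce simp: \<psi>_def S2_def algebra_simps)
      from ennreal_leI[OF this]
      have "ennreal (log_density b (f (Z x y)) * (cmod (A x y))\<^sup>2) \<le> ennreal (\<bar>Kq\<bar> + 1) * ennreal (\<psi> x y)"
        using psi0[of x y] by (subst (asm) ennreal_mult) auto
      then show ?thesis using True by (simp only: indicator_simps mult_1_right)
    qed simp
    have "(\<integral>\<^sup>+x. ennreal (log_density b (f (Z x y)) * (cmod (A x y))\<^sup>2) * indicator {0<..<1} x \<partial>lborel)
       \<le> (\<integral>\<^sup>+x. ennreal (\<bar>Kq\<bar> + 1) * ennreal (\<psi> x y) \<partial>lborel)"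
      by (rule nn_integral_mono) (rule le)
    also have "\<dots> = ennreal (\<bar>Kq\<bar> + 1) * (\<integral>\<^sup>+x. ennreal (\<psi> x y) \<partial>lborel)"
    proof (rule nn_integral_cmult)
      have "(\<lambda>x. (\<lambda>(x, y). \<psi> x y) (x, y)) \<in> borel_measurable borel"
        by (rule measurable_compose[OF _ psim]) (intro borel_measurable_continuous_onI continuous_intros)
      then show "(\<lambda>x. ennreal (\<psi> x y)) \<in> borel_measurable lborel" by simp
    qed
    also have "\<dots> < \<infinity>" using fy by (simp add: ennreal_mult_less_top less_top)
    finally obtain w where w: "((\<lambda>x. f (Z x y)) \<longlongrightarrow> w) (at_right 0)" "w \<noteq> b"
      using finite_log_energy_imp_limit[OF dT cA, of b] fb[of "(_, y)"] y by (auto simp: S2_def)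
    have "filterlim (\<lambda>r::real. - ln r) (at_right 0) (at_left 1)" by real_asymp
    from filterlim_compose[OF w(1) this]
    have "((\<lambda>r. f (Z (- ln r) y)) \<longlongrightarrow> w) (at_left 1)" .
    moreover have "eventually (\<lambda>r. r \<in> {0<..<1}) (at_left (1::real))"
      by (rule eventually_at_left_real) simp
    then have "eventually (\<lambda>r. f (Z (- ln r) y) = f (of_real r * cis y)) (at_left (1::real))"
    proof eventually_elim
      case (elim r)
      then have "Z (- ln r) y = of_real r * cis y"
        by (simp add: Z_def Complex_eq exp_add cis_conv_exp exp_of_real)
      then show ?case by simp
    qed
    ultimately have "((\<lambda>r. f (of_real r * cis y)) \<longlongrightarrow> w) (at_left 1)"
      by (rule Lim_transform_eventually)
    then show ?thesis using w by blast
  qed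
  ultimately show ?thesis
    by (elim negligible_subset) blast
qed

lemma negligible_no_radial_limit:
  fixes h g :: "complex \<Rightarrow> complex" and Kq :: real
  defines "f \<equiv> \<lambda>z. h z + cnj (g z)"
  assumes hol: "h holomorphic_on ball 0 1" "g holomorphic_on ball 0 1"
    and inj: "inj_on f (ball 0 1)"
    and Kq: "\<And>z. z \<in> ball 0 1 \<Longrightarrow> (cmod (deriv h z) + cmod (deriv g z))\<^sup>2 \<le> Kq * \<bar>(cmod (deriv h z))\<^sup>2 - (cmod (deriv g z))\<^sup>2\<bar>"
    and b: "\<And>z. \<lbrakk>exp (-1) < cmod z; cmod z < 1\<rbrakk> \<Longrightarrow> f z \<noteq> b"
  shows "negligible {y. \<not> (\<exists>w. w \<noteq> b \<and> ((\<lambda>r. f (of_real r * cis y)) \<longlongrightarrow> w) (at_left 1))}"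
proof (rule negligible_subset)
  let ?P = "\<lambda>y. \<exists>w. w \<noteq> b \<and> ((\<lambda>r. f (of_real r * cis y)) \<longlongrightarrow> w) (at_left 1)"
  let ?B = "\<lambda>c. {y. c < y \<and> y < c + 1 \<and> \<not> ?P y}"
  show "negligible (\<Union>n::int. ?B (real_of_int n) \<union> {real_of_int n})"
  proof (rule negligible_countable_Union, simp, clarify)
    fix n :: int
    show "negligible (?B (real_of_int n) \<union> {real_of_int n})"
      using negligible_no_radial_limit_on_interval[OF hol inj[unfolded f_def] Kq b[unfolded f_def], of "real_of_int n"]
      by (intro negligible_Un) (simp_all add: f_def)
  qed
  show "{y. \<not> ?P y} \<subseteq> (\<Union>n::int. ?B (real_of_int n) \<union> {real_of_int n})"
  proof
    fix y assume y: "y \<in> {y. \<not> ?P y}"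
    define n where "n = \<lfloor>y\<rfloor>"
    have "real_of_int n \<le> y" "y < real_of_int n + 1" by (simp_all add: n_def)
    then have "y \<in> ?B (real_of_int n) \<union> {real_of_int n}" using y by (cases "y = real_of_int n") auto
    then show "y \<in> (\<Union>n::int. ?B (real_of_int n) \<union> {real_of_int n})" by blast
  qed
qed

subsection \<open>Harmonic functions in the disk\<close>

text \<open>On the circle \<open>z * cnj z\<close> is the constant \<open>r^2\<close>. In
  \<open>Re a * Re b = Re (a * cnj b) / 2 + Re (a * b) / 2\<close> the mixed monomials in
  \<open>z\<close> and \<open>cnj z\<close> therefore reduce to multiples of powers of one of the
  two, whose real parts are again of the wanted form.\<close>

lemma Re_poly_mult_on_circle:
  fixes p q :: "complex poly" and r :: real
  shows "\<exists>s. \<forall>z\<in>sphere 0 r. Re (poly p z) * Re (poly q z) = Re (poly s z)"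
proof -
  define R where "R = (\<lambda>f. \<exists>s. \<forall>z\<in>sphere 0 r. f z = Re (poly s z))"
  have R_add: "R (\<lambda>z. f z + g z)" if "R f" "R g" for f g :: "complex \<Rightarrow> real"
    using that unfolding R_def by (metis (mono_tags, lifting) plus_complex.sel(1) poly_add)
  have R0: "R (\<lambda>z. 0)" unfolding R_def by (intro exI[of _ 0]) simp
  have R_sum: "R (\<lambda>z. \<Sum>i\<in>I. f i z)" if "finite I" "\<And>i. i \<in> I \<Longrightarrow> R (f i)" for I and f :: "nat \<Rightarrow> complex \<Rightarrow> real"
    using that by (induction I rule: finite_induct) (auto simp: R0 intro!: R_add)
  have mono1: "R (\<lambda>z. Re (a * z ^ i * cnj (b * z ^ j)) / 2)" if "j \<le> i" for a b i j
    unfolding R_def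
  proof (intro exI[of _ "monom (a * cnj b * of_real (r\<^sup>2) ^ j / 2) (i - j)"] ballI)
    fix z :: complex assume "z \<in> sphere 0 r"
    then have "z * cnj z = of_real (r\<^sup>2)" by (simp add: complex_norm_square[symmetric])
    moreover have "z ^ i = z ^ (i - j) * z ^ j" using that by (simp add: power_add[symmetric])
    ultimately have "z ^ i * cnj z ^ j = z ^ (i - j) * of_real (r\<^sup>2) ^ j"
      by (simp add: power_mult_distrib[symmetric] mult.assoc)
    then have "a * z ^ i * cnj (b * z ^ j) = a * cnj b * of_real (r\<^sup>2) ^ j * z ^ (i - j)"
      by (simp add: mult_ac)
    then have "Re (a * z ^ i * cnj (b * z ^ j)) / 2 = Re (a * cnj b * of_real (r\<^sup>2) ^ j * z ^ (i - j) / 2)"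
      by (simp only: Re_divide_numeral)
    then show "Re (a * z ^ i * cnj (b * z ^ j)) / 2 = Re (poly (monom (a * cnj b * of_real (r\<^sup>2) ^ j / 2) (i - j)) z)"
      by (simp only: poly_monom times_divide_eq_left)
  qed
  have mono2: "R (\<lambda>z. Re (a * z ^ i * cnj (b * z ^ j)) / 2)" for a b i j
  proof (cases "j \<le> i")
    case False
    have "Re (a * z ^ i * cnj (b * z ^ j)) = Re (b * z ^ j * cnj (a * z ^ i))" for z
      by (metis complex_cnj_cnj complex_cnj_mult complex_cnj cnj.sel(1) mult.commute)
    then show ?thesis using mono1[of i j b a] False by simp
  qed (rule mono1)
  have mono3: "R (\<lambda>z. Re (a * z ^ i * (b * z ^ j)) / 2)" for a b i j
    unfolding R_def by (intro exI[of _ "monom (a * b / 2) (i + j)"] ballI) (simp add: poly_monom power_add mult_ac)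
  have mono: "R (\<lambda>z. Re (a * z ^ i) * Re (b * z ^ j))" for a b i j
  proof -
    have eq: "Re (x * cnj y) / 2 + Re (x * y) / 2 = Re x * Re y" for x y by (simp add: field_simps)
    show ?thesis using R_add[OF mono2[of a i b j] mono3[of a i b j]] unfolding eq .
  qed
  have "R (\<lambda>z. \<Sum>i\<le>degree p. \<Sum>j\<le>degree q. Re (coeff p i * z ^ i) * Re (coeff q j * z ^ j))"
    by (intro R_sum mono) auto
  moreover have "(\<Sum>i\<le>degree p. \<Sum>j\<le>degree q. Re (coeff p i * z ^ i) * Re (coeff q j * z ^ j)) = Re (poly p z) * Re (poly q z)" for z
    by (simp add: poly_altdef sum_product Re_sum)
  ultimately show ?thesis unfolding R_def by simp
qed

text \<open>Takes the place of a solution of the Dirichlet problem: the real part of a polynomial is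
  harmonic in the whole plane and close to the given values on the circle. Real parts of polynomials
  form an algebra there by \<open>Re_poly_mult_on_circle\<close> and separate points, since
  \<open>Re\<close> and \<open>Im\<close> are among them; so Stone-Weierstrass applies.\<close>

lemma Re_poly_approx_on_circle:
  fixes v :: "complex \<Rightarrow> real"
  assumes "continuous_on (sphere 0 r) v" "e > 0"
  obtains p where "\<And>z. z \<in> sphere 0 r \<Longrightarrow> \<bar>v z - Re (poly p z)\<bar> < e"
proof -
  let ?P = "\<lambda>f. \<exists>p. \<forall>z\<in>sphere 0 r. f z = Re (poly p z)"
  have "\<exists>g. ?P g \<and> (\<forall>z\<in>sphere 0 r. \<bar>v z - g z\<bar> < e)"
  proof (rule Stone_Weierstrass_HOL[OF compact_sphere])
    show "?P (\<lambda>z. c)" for c by (intro exI[of _ "[:of_real c:]"]) simp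
    show "continuous_on (sphere 0 r) f" if f: "?P f" for f
    proof -
      obtain p where p: "\<forall>z\<in>sphere 0 r. f z = Re (poly p z)" using f by blast
      have "continuous_on (sphere 0 r) (\<lambda>z. Re (poly p z))" by (intro continuous_intros)
      then show ?thesis by (rule continuous_on_eq) (use p in simp)
    qed
    show "?P (\<lambda>x. f x + g x)" if fg: "?P f \<and> ?P g" for f g
    proof -
      obtain p q where "\<forall>z\<in>sphere 0 r. f z = Re (poly p z)" "\<forall>z\<in>sphere 0 r. g z = Re (poly q z)" using fg by blast
      then show ?thesis by (intro exI[of _ "p + q"]) simp
    qed
    show "?P (\<lambda>x. f x * g x)" if fg: "?P f \<and> ?P g" for f g
    proof -
      obtain p q where "\<forall>z\<in>sphere 0 r. f z = Re (poly p z)" "\<forall>z\<in>sphere 0 r. g z = Re (poly q z)" using fg by blast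
      then show ?thesis using Re_poly_mult_on_circle[of r p q] by simp
    qed
    show "\<exists>f. ?P f \<and> f x \<noteq> f y" if "x \<in> sphere 0 r \<and> y \<in> sphere 0 r \<and> x \<noteq> y" for x y
    proof (cases "Re x = Re y")
      case True
      then have "Im x \<noteq> Im y" using that complex_eqI by blast
      then show ?thesis by (intro exI[of _ Im] conjI exI[of _ "[:0, -\<i>:]"]) auto
    next
      case False
      then show ?thesis by (intro exI[of _ Re] conjI exI[of _ "[:0, 1:]"]) auto
    qed
  qed (use assms in auto)
  then show ?thesis using that by (metis (no_types, lifting))
qed

section \<open>Mean values and Harnack's inequality\<close>

lemma mean_value_circle:
  fixes f :: "complex \<Rightarrow> complex"
  assumes "f holomorphic_on ball 0 R" "0 < \<rho>" "\<rho> < R"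
  shows "((\<lambda>t. f (of_real \<rho> * cis t)) has_integral (2 * pi * f 0)) {0..2*pi}"
proof -
  have "((\<lambda>u. f u / (u - 0)) has_contour_integral (2 * of_real pi * \<i> * f 0)) (circlepath 0 \<rho>)"
    by (rule Cauchy_integral_circlepath_simple) (use assms in \<open>auto intro: holomorphic_on_subset\<close>)
  then have "((\<lambda>t. f (\<rho> * cis t) / (\<rho> * cis t) * \<rho> * \<i> * cis t) has_integral (2 * of_real pi * \<i> * f 0)) {0..2*pi}"
    unfolding circlepath_def by (subst (asm) has_contour_integral_part_circlepath_iff) auto
  then have "((\<lambda>t. f (\<rho> * cis t) * \<i>) has_integral (2 * of_real pi * \<i> * f 0)) {0..2*pi}"
    by (rule has_integral_eq[rotated]) (use assms in auto)
  from has_integral_mult_left[OF this, of "-\<i>"] show ?thesis by (simp add: mult_ac)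
qed

lemma mean_value_circle_Re:
  fixes f :: "complex \<Rightarrow> complex"
  assumes "f holomorphic_on ball 0 R" "0 < \<rho>" "\<rho> < R"
  shows "((\<lambda>t. Re (f (of_real \<rho> * cis t))) has_integral (2 * pi * Re (f 0))) {0..2*pi}"
  using has_integral_linear[OF mean_value_circle[OF assms] bounded_linear_Re] by (simp add: o_def)

text \<open>Schwarz lemma for \<open>(p - p 0) / (p + cnj (p 0))\<close>, the Cayley transform of
  the half-plane that takes \<open>p 0\<close> to 0, rescaled to the unit disk.\<close>

lemma Harnack_upper:
  assumes hol: "p holomorphic_on ball 0 R" and pos: "\<And>z. z \<in> ball 0 R \<Longrightarrow> Re (p z) > 0"
    and z: "z \<in> ball 0 R"
  shows "Re (p z) * (R - cmod z) \<le> Re (p 0) * (R + cmod z)"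
proof -
  have R: "R > 0" using z by (metis dist_0_norm mem_ball norm_ge_zero order_le_less_trans)
  define \<phi> where "\<phi> = (\<lambda>w. (p (of_real R * w) - p 0) / (p (of_real R * w) + cnj (p 0)))"
  have Rw: "of_real R * w \<in> ball 0 R" if "cmod w < 1" for w
    using that R by (simp add: norm_mult)
  have den: "p (of_real R * w) + cnj (p 0) \<noteq> 0" if "cmod w < 1" for w
    using pos[OF Rw[OF that]] pos[of 0] R by (auto simp: complex_eq_iff)
  have lt: "cmod (\<phi> w) < 1" if w: "cmod w < 1" for w
  proof -
    let ?x = "p (of_real R * w)"
    have x: "Re ?x > 0" "Re (p 0) > 0" using pos[OF Rw[OF w]] pos[of 0] R by auto
    then have "0 < Re ?x * Re (p 0)" by simp
    then have "(cmod (?x - p 0))\<^sup>2 < (cmod (?x + cnj (p 0)))\<^sup>2"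
      by (simp add: cmod_power2) (simp add: power2_eq_square algebra_simps)
    then have "cmod (?x - p 0) < cmod (?x + cnj (p 0))" by (rule power_less_imp_less_base) simp
    then show ?thesis using den[OF w] by (simp add: \<phi>_def norm_divide)
  qed
  have hphi: "\<phi> holomorphic_on ball 0 1"
    unfolding \<phi>_def
    by (intro holomorphic_intros holomorphic_on_compose_gen[OF _ hol, unfolded o_def]) (use Rw den in auto)
  define w where "w = z / of_real R"
  have w: "cmod w < 1" "of_real R * w = z" using z R by (auto simp: w_def norm_divide)
  have "cmod (\<phi> w) \<le> cmod w"
    using Schwarz_Lemma(1)[OF hphi _ lt w(1)] by (simp add: \<phi>_def)
  then have "cmod (p z - p 0) \<le> cmod w * cmod (p z + cnj (p 0))"
    using den[OF w(1)] unfolding \<phi>_def w(2) by (simp add: norm_divide field_simps)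
  then have "(cmod (p z - p 0))\<^sup>2 \<le> (cmod w)\<^sup>2 * (cmod (p z + cnj (p 0)))\<^sup>2"
    by (metis norm_ge_zero power_mono power_mult_distrib)
  then have "(Re (p z) - Re (p 0))\<^sup>2 + (Im (p z) - Im (p 0))\<^sup>2 \<le> (cmod w)\<^sup>2 * ((Re (p z) + Re (p 0))\<^sup>2 + (Im (p z) - Im (p 0))\<^sup>2)"
    by (simp add: cmod_power2)
  moreover have "(cmod w)\<^sup>2 * (Im (p z) - Im (p 0))\<^sup>2 \<le> (Im (p z) - Im (p 0))\<^sup>2"
    using w by (intro mult_left_le_one_le) (auto simp: power_le_one)
  ultimately have "(Re (p z) - Re (p 0))\<^sup>2 \<le> (cmod w * (Re (p z) + Re (p 0)))\<^sup>2"
    using distrib_left[of "(cmod w)\<^sup>2" "(Re (p z) + Re (p 0))\<^sup>2" "(Im (p z) - Im (p 0))\<^sup>2"]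
      power_mult_distrib[of "cmod w" "Re (p z) + Re (p 0)" 2] by linarith
  moreover have "0 \<le> cmod w * (Re (p z) + Re (p 0))" using pos[OF z] pos[of 0] R by simp
  ultimately have "Re (p z) - Re (p 0) \<le> cmod w * (Re (p z) + Re (p 0))"
    by (meson abs_le_square_iff abs_ge_self order_trans power2_le_imp_le)
  then have "R * (Re (p z) - Re (p 0)) \<le> R * (cmod w * (Re (p z) + Re (p 0)))"
    using R by simp
  also have "\<dots> = cmod z * (Re (p z) + Re (p 0))" using R by (simp add: w_def norm_divide)
  finally show ?thesis by (simp add: algebra_simps)
qed

section \<open>Components of sublevel sets and radial tails\<close>

lemma connected_component_sublevel_boundary:
  fixes G :: "complex \<Rightarrow> real"
  assumes "open D" "continuous_on D G" "z1 \<in> D" "G z1 < c"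
    and z: "z \<in> closure (connected_component_set {z\<in>D. G z < c} z1)" "z \<in> D"
      "z \<notin> connected_component_set {z\<in>D. G z < c} z1"
  shows "G z = c"
proof (rule ccontr)
  let ?U = "{z\<in>D. G z < c}"
  let ?C = "connected_component_set ?U z1"
  have opU: "open ?U"
    using continuous_open_preimage[OF assms(2,1), of "{..<c}"] by (simp add: vimage_def Int_def)
  have CU: "?C \<subseteq> ?U" by (rule connected_component_subset)
  assume ne: "G z \<noteq> c"
  show False
  proof (cases "G z < c")
    case True
    then have "z \<in> ?U" using z by simp
    with opU obtain e where e: "e > 0" "ball z e \<subseteq> ?U" by (rule openE)
    obtain y where y: "y \<in> ?C" "y \<in> ball z e"
      using z(1) e(1) unfolding closure_approachable by (auto simp: dist_commute)
    have "z \<in> ball z e" using e by simp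
    then have "z \<in> connected_component_set ?U y"
      using connected_component_maximal[OF y(2) connected_ball e(2)] by (rule rev_subsetD)
    then show False using y z(3) by (metis connected_component_eq)
  next
    case False
    then have "G z > c" using ne by simp
    moreover have "open {w\<in>D. G w > c}"
      using continuous_open_preimage[OF assms(2,1), of "{c<..}"] by (simp add: vimage_def Int_def)
    moreover have "z \<in> {w\<in>D. G w > c}" using z(2) \<open>G z > c\<close> by simp
    ultimately obtain e where e: "e > 0" "ball z e \<subseteq> {w\<in>D. G w > c}" by (elim openE)
    obtain y where "y \<in> ?C" "y \<in> ball z e"
      using z(1) e(1) unfolding closure_approachable by (auto simp: dist_commute)
    then show False using e CU by force
  qed
qed

text \<open>Otherwise the function \<open>V\<close>, equal to \<open>c - Re G\<close> on the
  component \<open>C\<close> and to 0 elsewhere, would have radial limit 0 almost everywhere. It is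
  continuous, bounded and subharmonic, so its value at \<open>z1\<close> is controlled by its means
  over circles, which tend to 0 by dominated convergence. But \<open>V z1 > 0\<close>.\<close>

lemma component_contains_radial_tail:
  fixes G :: "complex \<Rightarrow> complex"
  assumes hol: "G holomorphic_on ball 0 1" and z1: "z1 \<in> ball 0 1" "Re (G z1) < c"
    and C: "C = connected_component_set {z\<in>ball 0 1. Re (G z) < c} z1"
    and bd: "\<And>z. z \<in> C \<Longrightarrow> Re (G z) \<ge> - B"
    and N: "negligible N"
    and lim: "\<And>t. t \<notin> N \<Longrightarrow> \<exists>w. ((\<lambda>r. Re (G (of_real r * cis t))) \<longlongrightarrow> w) (at_left 1)"
  obtains t r0 where "t \<notin> N" "0 < r0" "r0 < 1" "\<And>r. \<lbrakk>r0 \<le> r; r < 1\<rbrakk> \<Longrightarrow> of_real r * cis t \<in> C"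
proof (rule ccontr)
  note ob = that
  assume nthesis: "\<not> thesis"
  have nt: "\<exists>r. r0 \<le> r \<and> r < 1 \<and> of_real r * cis t \<notin> C" if "t \<notin> N" "0 < r0" "r0 < 1" for t r0
    using ob nthesis that by blast
  let ?U = "{z\<in>ball 0 1. Re (G z) < c}"
  have cG: "continuous_on (ball 0 1) (\<lambda>z. Re (G z))"
    using hol by (intro continuous_intros holomorphic_on_imp_continuous_on)
  have opU: "open ?U"
    using continuous_open_preimage[OF cG open_ball, of "{..<c}"] by (simp add: vimage_def Int_def)
  have opC: "open C" unfolding C by (rule open_connected_component[OF opU])
  have CU: "C \<subseteq> ?U" unfolding C by (rule connected_component_subset)
  have z1C: "z1 \<in> C" unfolding C using z1 by simp
  have bdry: "Re (G z) = c" if "z \<in> closure C" "z \<in> ball 0 1" "z \<notin> C" for z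
    using connected_component_sublevel_boundary[OF open_ball cG z1] that unfolding C by blast
  define V where "V = (\<lambda>z. if z \<in> C then c - Re (G z) else 0)"
  have V0: "V z \<ge> 0" for z using CU by (auto simp: V_def)
  have Vcl: "V z = c - Re (G z)" if "z \<in> closure C" "z \<in> ball 0 1" for z
    using bdry that by (auto simp: V_def)
  have Bc: "c + B \<ge> 0" using bd[OF z1C] z1 by simp
  have VB: "V z \<le> c + B" for z using bd[of z] Bc by (auto simp: V_def)
  have cV: "continuous_on (ball 0 1) V"
  proof -
    have un: "ball 0 1 = (closure C \<inter> ball 0 1) \<union> (ball 0 1 - C)" using closure_subset CU by auto
    have "continuous_on ((closure C \<inter> ball 0 1) \<union> (ball 0 1 - C)) (\<lambda>z. if z \<in> C then c - Re (G z) else 0)"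
    proof (rule continuous_on_cases_local)
      show "closedin (top_of_set ((closure C \<inter> ball 0 1) \<union> (ball 0 1 - C))) (closure C \<inter> ball 0 1)"
        unfolding un[symmetric] using closedin_closed_Int[OF closed_closure, of "ball 0 1" C] by (simp add: Int_commute)
      show "closedin (top_of_set ((closure C \<inter> ball 0 1) \<union> (ball 0 1 - C))) (ball 0 1 - C)"
        unfolding un[symmetric] using opC
        by (metis Diff_eq closed_Compl closedin_closed_Int)
      show "continuous_on (closure C \<inter> ball 0 1) (\<lambda>z. c - Re (G z))"
        by (intro continuous_intros continuous_on_subset[OF cG]) auto
      show "c - Re (G x) = 0" if "x \<in> closure C \<inter> ball 0 1 \<and> x \<notin> C \<or> x \<in> ball 0 1 - C \<and> x \<in> C" for x
        using that bdry by auto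
    qed auto
    then show ?thesis unfolding V_def un[symmetric] .
  qed
  have Vint: "(\<lambda>t. V (of_real \<rho> * cis t)) integrable_on {0..2*pi}" if "0 < \<rho>" "\<rho> < 1" for \<rho>
    by (rule integrable_continuous_interval, rule continuous_on_compose2[OF cV])
       (use that in \<open>auto intro!: continuous_intros simp: norm_mult\<close>)
  \<comment> \<open>Poisson's inequality for the subharmonic function \<open>V\<close>, with the
    kernel estimated by Harnack. On the circle \<open>V\<close> is replaced by the real part of a
    polynomial, which the maximum principle compares with \<open>V\<close> on the part of
    \<open>C\<close> inside the circle.\<close>
  have sub: "V z1 * (\<rho> - cmod z1) * (2 * pi) \<le> (\<rho> + cmod z1) * integral {0..2*pi} (\<lambda>t. V (of_real \<rho> * cis t))"
    if \<rho>: "cmod z1 < \<rho>" "0 < \<rho>" "\<rho> < 1" for \<rho>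
  proof (rule field_le_epsilon)
    fix e' :: real assume e': "e' > 0"
    \<comment> \<open>On the circle the real part of \<open>q\<close> below exceeds \<open>V\<close>
      by at most \<open>3 * e\<close>; the integral runs over a length of \<open>2 * pi\<close>, and
      \<open>\<rho> + cmod z1 \<le> 2\<close>.\<close>
    define e where "e = e' / (2 * (3 * (2 * pi)))"
    have e: "e > 0" using e' by (simp add: e_def)
    have "sphere 0 \<rho> \<subseteq> ball (0::complex) 1" using \<rho> by auto
    then obtain p where p: "\<And>z. z \<in> sphere 0 \<rho> \<Longrightarrow> \<bar>V z - Re (poly p z)\<bar> < e"
      using Re_poly_approx_on_circle[OF continuous_on_subset[OF cV] e] by metis
    have ph: "poly p holomorphic_on A" for A by (intro holomorphic_intros)
    have Pin: "Re (poly p z) \<ge> - e" if "z \<in> cball 0 \<rho>" for z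
    proof -
      have "Re (- poly p z) \<le> e"
      proof (rule maximum_real_frontier[of "\<lambda>z. - poly p z" "cball 0 \<rho>" e z])
        fix w :: complex assume "w \<in> frontier (cball 0 \<rho>)"
        then show "Re (- poly p w) \<le> e"
          using p[of w] V0[of w] by (simp add: frontier_cball)
      qed (use that in \<open>auto intro!: holomorphic_intros continuous_intros\<close>)
      then show ?thesis by simp
    qed
    have 1: "Re (c - G z1 - poly p z1) \<le> e"
    proof (rule maximum_real_frontier[of "\<lambda>z. c - G z - poly p z" "C \<inter> ball 0 \<rho>" e z1])
      have cl: "closure (C \<inter> ball 0 \<rho>) \<subseteq> closure C \<inter> cball 0 \<rho>"
        using closure_mono[of "C \<inter> ball 0 \<rho>" C] closure_mono[of "C \<inter> ball 0 \<rho>" "ball 0 \<rho>"] \<rho> by auto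
      have cb: "cball (0::complex) \<rho> \<subseteq> ball 0 1" using \<rho> by auto
      have int: "interior (C \<inter> ball 0 \<rho>) \<subseteq> ball 0 1" using interior_subset CU by fastforce
      show "(\<lambda>z. c - G z - poly p z) holomorphic_on interior (C \<inter> ball 0 \<rho>)"
        by (intro holomorphic_intros holomorphic_on_subset[OF hol int])
      show "continuous_on (closure (C \<inter> ball 0 \<rho>)) (\<lambda>z. c - G z - poly p z)"
        by (intro continuous_intros continuous_on_subset[OF holomorphic_on_imp_continuous_on[OF hol]])
           (use cl cb in auto)
      show "bounded (C \<inter> ball 0 \<rho>)" by (meson bounded_Int bounded_ball)
      show "z1 \<in> C \<inter> ball 0 \<rho>" using z1C \<rho> by simp
      fix z assume z: "z \<in> frontier (C \<inter> ball 0 \<rho>)"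
      have op: "open (C \<inter> ball 0 \<rho>)" using opC by (simp add: open_Int)
      then have zc: "z \<in> closure C" "z \<in> cball 0 \<rho>" "z \<notin> C \<inter> ball 0 \<rho>"
        using z cl unfolding frontier_def interior_open[OF op] by auto
      have zV: "V z = c - Re (G z)" using Vcl zc cb by blast
      show "Re (c - G z - poly p z) \<le> e"
      proof (cases "cmod z = \<rho>")
        case True
        then show ?thesis using p[of z] zV by simp
      next
        case False
        then have "z \<notin> C" using zc by auto
        then have "c - Re (G z) = 0" using zV by (simp add: V_def)
        then show ?thesis using Pin[OF zc(2)] by simp
      qed
    qed
    \<comment> \<open>The shift by \<open>2 * e\<close> makes the real part positive in the disk, as
      Harnack's inequality requires, and \<open>Re (q z1)\<close> dominates
      \<open>V z1\<close>.\<close>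
    define q where "q = (\<lambda>z. poly p z + of_real (2 * e))"
    have qpos: "Re (q z) > 0" if "z \<in> ball 0 \<rho>" for z
      using Pin[of z] that e by (simp add: q_def)
    have "Re (q z1) * (\<rho> - cmod z1) \<le> Re (q 0) * (\<rho> + cmod z1)"
      by (rule Harnack_upper) (use qpos \<rho> in \<open>auto simp: q_def intro!: holomorphic_intros\<close>)
    moreover have "V z1 * (\<rho> - cmod z1) \<le> Re (q z1) * (\<rho> - cmod z1)"
      using 1 z1C e \<rho> by (intro mult_right_mono) (auto simp: q_def V_def)
    ultimately have "V z1 * (\<rho> - cmod z1) \<le> Re (q 0) * (\<rho> + cmod z1)" by linarith
    then have "V z1 * (\<rho> - cmod z1) * (2 * pi) \<le> Re (q 0) * (\<rho> + cmod z1) * (2 * pi)"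
      by (rule mult_right_mono) simp
    also have "\<dots> = (\<rho> + cmod z1) * (2 * pi * Re (q 0))" by (simp only: mult_ac)
    finally have 2: "V z1 * (\<rho> - cmod z1) * (2 * pi) \<le> (\<rho> + cmod z1) * (2 * pi * Re (q 0))" .
    have mv: "((\<lambda>t. Re (q (of_real \<rho> * cis t))) has_integral (2 * pi * Re (q 0))) {0..2*pi}"
      by (rule mean_value_circle_Re[of _ 1]) (use \<rho> in \<open>auto simp: q_def intro!: holomorphic_intros\<close>)
    have "2 * pi * Re (q 0) \<le> integral {0..2*pi} (\<lambda>t. V (of_real \<rho> * cis t) + 3 * e)"
    proof (rule has_integral_le[OF mv integrable_integral])
      show "(\<lambda>t. V (of_real \<rho> * cis t) + 3 * e) integrable_on {0..2*pi}"
        using Vint \<rho> by (intro integrable_add) auto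
      show "Re (q (of_real \<rho> * cis t)) \<le> V (of_real \<rho> * cis t) + 3 * e" for t
        using p[of "of_real \<rho> * cis t"] \<rho> by (simp add: q_def norm_mult)
    qed
    also have "\<dots> = integral {0..2*pi} (\<lambda>t. V (of_real \<rho> * cis t)) + 3 * e * (2 * pi)"
      using Vint[OF \<rho>(2,3)] by (subst integral_add) (auto simp: algebra_simps)
    finally have "(\<rho> + cmod z1) * (2 * pi * Re (q 0)) \<le> (\<rho> + cmod z1) * (integral {0..2*pi} (\<lambda>t. V (of_real \<rho> * cis t)) + 3 * e * (2 * pi))"
      using \<rho> by (intro mult_left_mono) auto
    moreover have "(\<rho> + cmod z1) * (3 * e * (2 * pi)) \<le> 2 * (3 * e * (2 * pi))"
      using \<rho> e by (intro mult_right_mono) auto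
    moreover have "2 * (3 * e * (2 * pi)) = e'" by (simp add: e_def)
    ultimately show "V z1 * (\<rho> - cmod z1) * (2 * pi) \<le> (\<rho> + cmod z1) * integral {0..2*pi} (\<lambda>t. V (of_real \<rho> * cis t)) + e'"
      using 2 unfolding distrib_left[of "\<rho> + cmod z1" "integral {0..2*pi} (\<lambda>t. V (of_real \<rho> * cis t))"] by linarith
  qed
  have Vlim: "((\<lambda>r. V (of_real r * cis t)) \<longlongrightarrow> 0) (at_left 1)" if t: "t \<notin> N" for t
  proof -
    obtain w where w: "((\<lambda>r. Re (G (of_real r * cis t))) \<longlongrightarrow> w) (at_left 1)" using lim t by blast
    have ev: "eventually (\<lambda>r. r \<in> {0<..<1}) (at_left (1::real))" by (rule eventually_at_left_real) simp
    show ?thesis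
    proof (cases "w < c")
      case True
      then have "eventually (\<lambda>r. Re (G (of_real r * cis t)) < c) (at_left 1)"
        using order_tendstoD(2)[OF w] by blast
      then have "eventually (\<lambda>r. r \<in> {0<..<1} \<and> Re (G (of_real r * cis t)) < c) (at_left 1)"
        using ev by (rule eventually_conj[rotated])
      then obtain r1 where r1: "r1 < 1" "\<And>r. \<lbrakk>r1 < r; r < 1\<rbrakk> \<Longrightarrow> r \<in> {0<..<1} \<and> Re (G (of_real r * cis t)) < c"
        unfolding eventually_at_left_field by blast
      define r0 where "r0 = (max r1 0 + 1) / 2"
      have r0: "0 < r0" "r0 < 1" "r1 < r0" using r1 by (auto simp: r0_def)
      define T where "T = (\<lambda>r. of_real r * cis t) ` {r0..<1}"
      have conT: "connected T" unfolding T_def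
        by (intro connected_continuous_image continuous_intros) auto
      have TU: "T \<subseteq> ?U" 
      proof
        fix y assume "y \<in> T"
        then obtain r where r: "y = of_real r * cis t" "r0 \<le> r" "r < 1" unfolding T_def by auto
        then have "0 < r" "Re (G y) < c" using r1(2)[of r] r0 by auto
        then show "y \<in> ?U" using r by (simp add: norm_mult)
      qed
      obtain r where r: "r0 \<le> r" "r < 1" "of_real r * cis t \<notin> C" using nt[OF t r0(1,2)] by blast
      \<comment> \<open>A tail inside the sublevel set lies in one component; if this were
        \<open>C\<close>, the tail would be of the kind assumed not to exist. Hence \<open>V\<close>
        vanishes on it.\<close>
      have "T \<inter> C = {}"
      proof (rule ccontr)
        assume "T \<inter> C \<noteq> {}"
        then obtain y where y: "y \<in> T" "y \<in> C" by blast
        then have "T \<subseteq> connected_component_set ?U y"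
          using connected_component_maximal[OF y(1) conT TU] by simp
        moreover have "connected_component_set ?U y = C" using y unfolding C by (metis connected_component_eq)
        ultimately show False using r unfolding T_def by force
      qed
      then have z: "V (of_real r * cis t) = 0" if "r0 \<le> r" "r < 1" for r
      proof -
        have "of_real r * cis t \<in> T" unfolding T_def using that by auto
        then show ?thesis using \<open>T \<inter> C = {}\<close> by (auto simp: V_def)
      qed
      have "eventually (\<lambda>r. r \<in> {r0<..<1}) (at_left (1::real))" by (rule eventually_at_left_real) (use r0 in simp)
      then have "eventually (\<lambda>r. V (of_real r * cis t) = 0) (at_left 1)"
        by eventually_elim (use z in auto)
      then show ?thesis by (rule tendsto_eventually)
    next
      case False
      have "((\<lambda>r. max 0 (c - Re (G (of_real r * cis t)))) \<longlongrightarrow> max 0 (c - w)) (at_left 1)"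
        by (intro tendsto_intros w)
      then have lim0: "((\<lambda>r. max 0 (c - Re (G (of_real r * cis t)))) \<longlongrightarrow> 0) (at_left 1)" using False by simp
      have le: "V z \<le> max 0 (c - Re (G z))" for z by (auto simp: V_def)
      show ?thesis
        by (rule tendsto_sandwich[OF _ _ tendsto_const lim0]) (use le in \<open>simp_all add: V0\<close>)
    qed
  qed
  define \<rho> where "\<rho> = (\<lambda>n::nat. 1 - 1 / real (n + 2))"
  have \<rho>: "0 < \<rho> n" "\<rho> n < 1" for n by (auto simp: \<rho>_def)
  have \<rho>1: "\<rho> \<longlonglongrightarrow> 1" unfolding \<rho>_def by real_asymp
  have \<rho>L: "filterlim \<rho> (at_left 1) sequentially"
    using \<rho>1 \<rho> by (auto simp: filterlim_at \<rho>(2)[THEN order_less_imp_not_eq] intro!: always_eventually)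
  define W where "W = (\<lambda>n t. if t \<in> N then 0 else V (of_real (\<rho> n) * cis t))"
  have Wint: "W n integrable_on {0..2*pi}" and Weq: "integral {0..2*pi} (W n) = integral {0..2*pi} (\<lambda>t. V (of_real (\<rho> n) * cis t))" for n
    using integrable_spike[OF Vint[OF \<rho>] N, of "W n" n] integral_spike[OF N, of "{0..2*pi}" "W n" "\<lambda>t. V (of_real (\<rho> n) * cis t)"]
    by (auto simp: W_def)
  have "(\<lambda>n. integral {0..2*pi} (W n)) \<longlonglongrightarrow> integral {0..2*pi} (\<lambda>t. 0)"
  proof (rule dominated_convergence(2)[OF Wint])
    show "(\<lambda>t. c + B) integrable_on {0..2*pi}" by auto
    show "norm (W n t) \<le> c + B" for n t using V0 VB Bc by (simp add: W_def)
    show "(\<lambda>n. W n t) \<longlonglongrightarrow> 0" for t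
    proof (cases "t \<in> N")
      case False
      show ?thesis using filterlim_compose[OF Vlim[OF False] \<rho>L] False by (simp add: W_def)
    qed (simp add: W_def)
  qed
  then have I0: "(\<lambda>n. integral {0..2*pi} (\<lambda>t. V (of_real (\<rho> n) * cis t))) \<longlonglongrightarrow> 0" by (simp add: Weq)
  have "V z1 * (1 - cmod z1) * (2 * pi) \<le> (1 + cmod z1) * 0"
  proof (rule tendsto_le[OF trivial_limit_sequentially])
    show "(\<lambda>n. V z1 * (\<rho> n - cmod z1) * (2 * pi)) \<longlonglongrightarrow> V z1 * (1 - cmod z1) * (2 * pi)"
      by (intro tendsto_intros \<rho>1)
    show "(\<lambda>n. (\<rho> n + cmod z1) * integral {0..2*pi} (\<lambda>t. V (of_real (\<rho> n) * cis t))) \<longlonglongrightarrow> (1 + cmod z1) * 0"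
      by (intro tendsto_intros \<rho>1 I0)
    have "eventually (\<lambda>n. cmod z1 < \<rho> n) sequentially"
      using order_tendstoD(1)[OF \<rho>1, of "cmod z1"] z1 by simp
    then show "eventually (\<lambda>n. V z1 * (\<rho> n - cmod z1) * (2 * pi) \<le> (\<rho> n + cmod z1) * integral {0..2*pi} (\<lambda>t. V (of_real (\<rho> n) * cis t))) sequentially"
      by eventually_elim (use sub \<rho> in auto)
  qed
  moreover have "V z1 > 0" using z1C z1 by (simp add: V_def)
  then have "0 < V z1 * (1 - cmod z1) * (2 * pi)" using z1 by simp
  ultimately show False by simp
qed

text \<open>The Moebius map of the disk onto the right half-plane with zero at
  \<open>cis \<beta>\<close> and pole at \<open>cis \<alpha>\<close>. The constant factor turns the
  image so that the arc from \<open>\<alpha>\<close> to \<open>\<beta>\<close> goes to the positive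
  imaginary axis and the rest of the circle to the negative one.\<close>

definition arc_ratio :: "real \<Rightarrow> real \<Rightarrow> complex \<Rightarrow> complex" where
  "arc_ratio \<alpha> \<beta> z = - \<i> * cis ((\<beta> - \<alpha>) / 2) * (1 - cis (- \<beta>) * z) / (1 - cis (- \<alpha>) * z)"

text \<open>The real part is the harmonic measure of the boundary arc from \<open>cis \<alpha>\<close> to \<open>cis \<beta>\<close>.\<close>
definition arc_measure :: "real \<Rightarrow> real \<Rightarrow> complex \<Rightarrow> complex" where
  "arc_measure \<alpha> \<beta> z = Ln (arc_ratio \<alpha> \<beta> z) / (of_real pi * \<i>) + 1 / 2"

lemma one_minus_cis_mult_nonzero: "cmod z < 1 \<Longrightarrow> 1 - cis a * z \<noteq> 0"
proof
  assume z: "cmod z < 1" and "1 - cis a * z = 0"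
  then have "cmod (cis a * z) = 1" by (metis eq_iff_diff_eq_0 norm_one)
  then show False using z by (simp add: norm_mult)
qed

lemma one_minus_cis: "1 - cis x = - 2 * \<i> * of_real (sin (x / 2)) * cis (x / 2)"
proof -
  have "cos x = 1 - 2 * (sin (x / 2))\<^sup>2" "sin x = 2 * sin (x / 2) * cos (x / 2)"
    using cos_double_sin[of "x / 2"] sin_double[of "x / 2"] by auto
  then show ?thesis by (simp add: complex_eq_iff power2_eq_square)
qed

text \<open>The real part is \<open>sin ((\<beta> - \<alpha>) / 2)\<close> times the Poisson kernel
  of the boundary point \<open>cis \<alpha>\<close>.\<close>

lemma Re_arc_ratio_pos:
  assumes ab: "\<alpha> < \<beta>" "\<beta> < \<alpha> + 2 * pi" and z: "cmod z < 1"
  shows "Re (arc_ratio \<alpha> \<beta> z) > 0"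
proof -
  define c where "c = cis ((\<beta> - \<alpha>) / 2)"
  define w where "w = 1 - cis (- \<alpha>) * z"
  have w: "w \<noteq> 0" using one_minus_cis_mult_nonzero[OF z] by (simp add: w_def)
  have b: "cis (- \<beta>) = cis (- \<alpha>) * cnj c * cnj c"
    unfolding c_def cis_cnj cis_mult by (rule arg_cong[of _ _ cis]) (simp add: field_simps)
  define v where "v = cis (- \<alpha>) * z"
  have cc: "c * cnj c = 1" by (simp add: c_def cis_cnj cis_mult)
  have "arc_ratio \<alpha> \<beta> z = - \<i> * c * (1 - cnj c * cnj c * v) / w"
    by (simp add: arc_ratio_def b c_def v_def w_def mult_ac)
  also have "\<dots> = - \<i> * (c - c * cnj c * cnj c * v) * cnj w / (w * cnj w)"
    using w by (simp add: field_simps)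
  also have "\<dots> = - \<i> * (c - cnj c * v) * (1 - cnj v) / of_real ((cmod w)\<^sup>2)"
    by (simp only: cc mult_1 complex_norm_square) (simp add: w_def v_def)
  finally have "arc_ratio \<alpha> \<beta> z = - \<i> * (c - cnj c * v) * (1 - cnj v) / of_real ((cmod w)\<^sup>2)" .
  then have "Re (arc_ratio \<alpha> \<beta> z) = Re (- \<i> * (c - cnj c * v) * (1 - cnj v)) / (cmod w)\<^sup>2"
    by (simp only: Re_divide_of_real)
  also have "Re (- \<i> * (c - cnj c * v) * (1 - cnj v)) = Im c * (1 - (cmod v)\<^sup>2)"
    unfolding cmod_power2 by (simp add: algebra_simps power2_eq_square)
  finally have e: "Re (arc_ratio \<alpha> \<beta> z) = Im c * (1 - (cmod v)\<^sup>2) / (cmod w)\<^sup>2" .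
  have "Im c > 0" using ab by (auto simp: c_def intro!: sin_gt_zero)
  moreover have "(cmod v)\<^sup>2 < 1" using z by (simp add: v_def norm_mult power_less_one_iff abs_square_less_1)
  ultimately show ?thesis unfolding e using w by simp
qed

lemma arc_ratio_has_derivative:
  assumes z: "cmod z < 1"
  shows "(arc_ratio \<alpha> \<beta> has_field_derivative
    - \<i> * cis ((\<beta> - \<alpha>) / 2) * (cis (- \<alpha>) - cis (- \<beta>)) / (1 - cis (- \<alpha>) * z)\<^sup>2) (at z)"
  unfolding arc_ratio_def using one_minus_cis_mult_nonzero[OF z, of "- \<alpha>"]
  by (auto intro!: derivative_eq_intros simp: power2_eq_square) (simp add: field_simps)

text \<open>Logarithmic differentiation leaves a constant over the product of the two linear factors
  that vanish at the end points of the arc. These factors are the weights by which the derivative is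
  multiplied in \<open>weighted_derivative_avoids_ray\<close>.\<close>

lemma arc_measure_has_derivative:
  assumes ab: "\<alpha> < \<beta>" "\<beta> < \<alpha> + 2 * pi" and z: "cmod z < 1"
  shows "(arc_measure \<alpha> \<beta> has_field_derivative
    (cis (- \<alpha>) - cis (- \<beta>)) / (of_real pi * \<i>) / ((1 - cis (- \<alpha>) * z) * (1 - cis (- \<beta>) * z))) (at z)"
proof -
  let ?x = "1 - cis (- \<alpha>) * z" and ?y = "1 - cis (- \<beta>) * z" and ?c = "cis ((\<beta> - \<alpha>) / 2)"
  have nz: "?x \<noteq> 0" "?y \<noteq> 0" "?c \<noteq> 0" using one_minus_cis_mult_nonzero[OF z] by auto
  have pos: "Re (arc_ratio \<alpha> \<beta> z) > 0" by (rule Re_arc_ratio_pos[OF ab z])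
  have "((\<lambda>z. Ln (arc_ratio \<alpha> \<beta> z)) has_field_derivative
    inverse (arc_ratio \<alpha> \<beta> z) * (- \<i> * ?c * (cis (- \<alpha>) - cis (- \<beta>)) / ?x\<^sup>2)) (at z)"
    by (rule DERIV_chain2[OF has_field_derivative_Ln arc_ratio_has_derivative[OF z]])
       (use pos in \<open>auto simp: complex_nonpos_Reals_iff\<close>)
  moreover have "inverse (arc_ratio \<alpha> \<beta> z) * (- \<i> * ?c * (cis (- \<alpha>) - cis (- \<beta>)) / ?x\<^sup>2) = (cis (- \<alpha>) - cis (- \<beta>)) / (?x * ?y)"
    using nz unfolding arc_ratio_def by (simp add: power2_eq_square)
  ultimately have "((\<lambda>z. Ln (arc_ratio \<alpha> \<beta> z)) has_field_derivative (cis (- \<alpha>) - cis (- \<beta>)) / (?x * ?y)) (at z)"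
    by (simp only:)
  from DERIV_add[OF DERIV_cdivide[OF this, of "of_real pi * \<i>"] DERIV_const[of "1 / 2"]]
  show ?thesis unfolding arc_measure_def[abs_def] by (simp add: mult_ac)
qed

lemma arc_measure_holomorphic:
  assumes "\<alpha> < \<beta>" "\<beta> < \<alpha> + 2 * pi"
  shows "arc_measure \<alpha> \<beta> holomorphic_on ball 0 1"
  unfolding holomorphic_on_def field_differentiable_def
  by (intro ballI exI, rule has_field_derivative_at_within[OF arc_measure_has_derivative[OF assms]]) simp

lemma Re_arc_measure: "Re (arc_measure \<alpha> \<beta> z) = Im (Ln (arc_ratio \<alpha> \<beta> z)) / pi + 1 / 2"
  by (simp add: arc_measure_def Re_divide power2_eq_square)

lemma Re_arc_measure_bounds:
  assumes "\<alpha> < \<beta>" "\<beta> < \<alpha> + 2 * pi" "cmod z < 1"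
  shows "0 < Re (arc_measure \<alpha> \<beta> z)" "Re (arc_measure \<alpha> \<beta> z) < 1"
proof -
  have pos: "Re (arc_ratio \<alpha> \<beta> z) > 0" by (rule Re_arc_ratio_pos[OF assms])
  then have "arc_ratio \<alpha> \<beta> z \<noteq> 0" by auto
  then have "\<bar>Im (Ln (arc_ratio \<alpha> \<beta> z))\<bar> < pi / 2" using Re_Ln_pos_lt pos by blast
  then have "\<bar>Im (Ln (arc_ratio \<alpha> \<beta> z)) / pi\<bar> < 1 / 2" by (simp add: field_simps)
  then show "0 < Re (arc_measure \<alpha> \<beta> z)" "Re (arc_measure \<alpha> \<beta> z) < 1" unfolding Re_arc_measure by linarith+
qed

lemma arc_ratio_on_circle:
  assumes "sin ((t - \<alpha>) / 2) \<noteq> 0"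
  shows "arc_ratio \<alpha> \<beta> (cis t) = - \<i> * of_real (sin ((t - \<beta>) / 2) / sin ((t - \<alpha>) / 2))"
proof -
  have m: "cis (- a) * cis t = cis (t - a)" for a by (simp add: cis_mult)
  have "cis ((\<beta> - \<alpha>) / 2) * cis ((t - \<beta>) / 2) = cis ((t - \<alpha>) / 2)" by (simp add: cis_mult add_divide_distrib[symmetric])
  moreover have "arc_ratio \<alpha> \<beta> (cis t) = - \<i> * (cis ((\<beta> - \<alpha>) / 2) * cis ((t - \<beta>) / 2)) * of_real (sin ((t - \<beta>) / 2)) / (of_real (sin ((t - \<alpha>) / 2)) * cis ((t - \<alpha>) / 2))"
    unfolding arc_ratio_def m one_minus_cis using assms by (simp add: field_simps)
  ultimately show ?thesis using assms by simp
qed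

lemma arc_measure_radial_limit:
  assumes x: "sin ((t - \<alpha>) / 2) \<noteq> 0" "sin ((t - \<beta>) / 2) / sin ((t - \<alpha>) / 2) = x" "x \<noteq> 0"
  shows "((\<lambda>r. Re (arc_measure \<alpha> \<beta> (of_real r * cis t))) \<longlongrightarrow> (if x < 0 then 1 else 0)) (at_left 1)"
proof -
  have v: "arc_ratio \<alpha> \<beta> (cis t) = - \<i> * of_real x" unfolding arc_ratio_on_circle[OF x(1)] x(2) ..
  have "1 - cis (t - \<alpha>) \<noteq> 0" unfolding one_minus_cis using x(1) by simp
  then have nz: "1 - cis (- \<alpha>) * cis t \<noteq> 0" unfolding cis_mult by simp
  have "((\<lambda>r. arc_ratio \<alpha> \<beta> (of_real r * cis t)) \<longlongrightarrow> arc_ratio \<alpha> \<beta> (of_real 1 * cis t)) (at_left 1)"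
    unfolding arc_ratio_def by (intro tendsto_intros) (use nz in auto)
  then have lim: "((\<lambda>r. arc_ratio \<alpha> \<beta> (of_real r * cis t)) \<longlongrightarrow> - \<i> * of_real x) (at_left 1)" using v by simp
  have "- \<i> * of_real x \<notin> \<real>\<^sub>\<le>\<^sub>0" using x(3) by (auto simp: complex_nonpos_Reals_iff)
  then have "((\<lambda>r. Im (Ln (arc_ratio \<alpha> \<beta> (of_real r * cis t))) / pi + 1 / 2) \<longlongrightarrow> Im (Ln (- \<i> * of_real x)) / pi + 1 / 2) (at_left 1)"
    by (intro tendsto_intros lim) auto
  moreover have "Im (Ln (- \<i> * of_real x)) = (if x < 0 then pi / 2 else - pi / 2)"
  proof (cases "x < 0")
    case True
    then have "Arg (of_real (- x) * \<i>) = pi / 2" by (subst Arg_times_of_real) auto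
    moreover have "of_real (- x) * \<i> = - \<i> * of_real x" by simp
    ultimately show ?thesis using True x(3) by (simp add: Arg_eq_Im_Ln[symmetric] mult.commute)
  next
    case False
    then have "Arg (of_real x * - \<i>) = - pi / 2" using x(3) by (subst Arg_times_of_real) auto
    moreover have "of_real x * - \<i> = - \<i> * of_real x" by simp
    ultimately show ?thesis using False x(3) by (simp add: Arg_eq_Im_Ln[symmetric] mult.commute)
  qed
  ultimately show ?thesis unfolding Re_arc_measure by (auto split: if_splits)
qed

lemma arc_measure_radial_limit_inside:
  assumes "\<alpha> < t" "t < \<beta>" "\<beta> < \<alpha> + 2 * pi"
  shows "((\<lambda>r. Re (arc_measure \<alpha> \<beta> (of_real r * cis t))) \<longlongrightarrow> 1) (at_left 1)"
proof -
  have a: "sin ((t - \<alpha>) / 2) > 0" using assms by (intro sin_gt_zero) auto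
  have "sin ((\<beta> - t) / 2) > 0" using assms by (intro sin_gt_zero) auto
  moreover have "sin ((t - \<beta>) / 2) = - sin ((\<beta> - t) / 2)" by (simp add: sin_minus[symmetric] minus_divide_left)
  ultimately have b: "sin ((t - \<beta>) / 2) < 0" by simp
  have "sin ((t - \<beta>) / 2) / sin ((t - \<alpha>) / 2) < 0" by (rule divide_neg_pos[OF b a])
  then show ?thesis using arc_measure_radial_limit[of t \<alpha> \<beta>, OF _ refl] a b by auto
qed

lemma arc_measure_radial_limit_outside:
  assumes "\<alpha> < \<beta>" "\<beta> < t" "t < \<alpha> + 2 * pi"
  shows "((\<lambda>r. Re (arc_measure \<alpha> \<beta> (of_real r * cis t))) \<longlongrightarrow> 0) (at_left 1)"
proof -
  have a: "sin ((t - \<alpha>) / 2) > 0" using assms by (intro sin_gt_zero) auto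
  have b: "sin ((t - \<beta>) / 2) > 0" using assms by (intro sin_gt_zero) auto
  have "\<not> sin ((t - \<beta>) / 2) / sin ((t - \<alpha>) / 2) < 0" using divide_pos_pos[OF b a] by simp
  then show ?thesis using arc_measure_radial_limit[of t \<alpha> \<beta>, OF _ refl] a b by auto
qed

text \<open>\<open>G - G z0\<close> has a zero of order \<open>n \<ge> 2\<close> at
  \<open>z0\<close>. Its leading term \<open>c * (z - z0) ^ n\<close> is real, with alternating
  signs, in directions spaced by \<open>pi / n\<close>, and close to \<open>z0\<close> the remainder
  is less than half of it.\<close>

lemma critical_point_sectors:
  assumes hol: "G holomorphic_on ball 0 1" and z0: "z0 \<in> ball 0 1" and cr: "deriv G z0 = 0"
    and nc: "\<not> G constant_on ball 0 1"
  obtains s a1 a2 a3 a4 where "s > 0" "cball z0 s \<subseteq> ball 0 1" "a1 < a2" "a2 < a3" "a3 < a4" "a4 < a1 + 2 * pi"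
    "\<And>t. \<lbrakk>0 < t; t \<le> s\<rbrakk> \<Longrightarrow> Re (G (z0 + of_real t * cis a1)) < Re (G z0)"
    "\<And>t. \<lbrakk>0 < t; t \<le> s\<rbrakk> \<Longrightarrow> Re (G (z0 + of_real t * cis a2)) > Re (G z0)"
    "\<And>t. \<lbrakk>0 < t; t \<le> s\<rbrakk> \<Longrightarrow> Re (G (z0 + of_real t * cis a3)) < Re (G z0)"
    "\<And>t. \<lbrakk>0 < t; t \<le> s\<rbrakk> \<Longrightarrow> Re (G (z0 + of_real t * cis a4)) > Re (G z0)"
proof -
  let ?f = "\<lambda>z. G z - G z0"
  have "?f holomorphic_on ball 0 1" using hol by (intro holomorphic_intros)
  moreover have "\<not> ?f constant_on ball 0 1"
  proof
    assume "?f constant_on ball 0 1"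
    then obtain c where "\<And>z. z \<in> ball 0 1 \<Longrightarrow> G z - G z0 = c" unfolding constant_on_def by blast
    then have "\<And>z. z \<in> ball 0 1 \<Longrightarrow> G z = c + G z0" by (metis diff_add_cancel)
    then show False using nc unfolding constant_on_def by blast
  qed
  ultimately obtain g r n where g: "0 < n" "0 < r" "ball z0 r \<subseteq> ball 0 1" "g holomorphic_on ball z0 r"
    "\<And>w. w \<in> ball z0 r \<Longrightarrow> G w - G z0 = (w - z0) ^ n * g w" "\<And>w. w \<in> ball z0 r \<Longrightarrow> g w \<noteq> 0"
    using holomorphic_factor_zero_nonconstant[of ?f "ball 0 1" z0] z0 by (metis (no_types, lifting) open_ball connected_ball diff_self)
  define c where "c = g z0"
  have c: "c \<noteq> 0" using g by (simp add: c_def)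
  have n2: "n \<ge> 2"
  proof (rule ccontr)
    assume "\<not> n \<ge> 2"
    then have n1: "n = 1" using g(1) by simp
    have "(g has_field_derivative deriv g z0) (at z0)"
      using g(2,4) holomorphic_derivI[of g "ball z0 r" z0] by simp
    then have "((\<lambda>w. G z0 + (w - z0) * g w) has_field_derivative c) (at z0)"
      by (auto intro!: derivative_eq_intros simp: c_def)
    moreover have "eventually (\<lambda>w. G z0 + (w - z0) * g w = G w) (nhds z0)"
    proof -
      have "eventually (\<lambda>w. w \<in> ball z0 r) (nhds z0)" using g(2) by (intro eventually_nhds_in_open) auto
      then show ?thesis by eventually_elim (use g(5) n1 in \<open>auto simp: algebra_simps\<close>)
    qed
    ultimately have "(G has_field_derivative c) (at z0)"
      using DERIV_cong_ev[OF refl _ refl, of "\<lambda>w. G z0 + (w - z0) * g w" G z0 c] by simp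
    then have "deriv G z0 = c" by (rule DERIV_imp_deriv)
    then show False using cr c by simp
  qed
  have "isCont g z0" using g(2,4) holomorphic_on_imp_continuous_on[of g "ball z0 r"] by (auto simp: continuous_on_eq_continuous_at)
  then obtain \<delta> where \<delta>: "\<delta> > 0" "\<And>w. dist w z0 < \<delta> \<Longrightarrow> dist (g w) c < cmod c / 2"
    unfolding continuous_at_eps_delta c_def[symmetric] using c by (metis half_gt_zero zero_less_norm_iff)
  define s where "s = min \<delta> r / 2"
  have s: "s > 0" "s < \<delta>" "s < r" using \<delta> g(2) by (auto simp: s_def)
  have "cball z0 s \<subseteq> ball z0 r" using s by auto
  then have sD: "cball z0 s \<subseteq> ball 0 1" using g(3) by blast
  \<comment> \<open>The solutions of \<open>Arg c + n * a k = pi * (k + 1)\<close>: the leading term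
    is negative for even \<open>k\<close> and positive for odd \<open>k\<close>.\<close>
  define a where "a = (\<lambda>k::nat. (pi * (real k + 1) - Arg c) / real n)"
  have ca: "c * cis (a k) ^ n = - of_real (cmod c * (-1) ^ k)" for k
  proof -
    have "cis (a k) ^ n = cis (pi * (real k + 1) - Arg c)" using g(1) unfolding Complex.DeMoivre a_def by simp
    also have "\<dots> = cis (real k * pi) * cis pi / cis (Arg c)"
      unfolding cis_divide cis_mult by (simp add: algebra_simps)
    also have "cis (real k * pi) = cis pi ^ k" unfolding Complex.DeMoivre by (rule refl)
    finally have 1: "cis (Arg c) * cis (a k) ^ n = - ((-1) ^ k)" by simp
    have 2: "c = of_real (cmod c) * cis (Arg c)" using c by (simp add: cis_Arg sgn_eq)
    have "c * cis (a k) ^ n = of_real (cmod c) * (cis (Arg c) * cis (a k) ^ n)" by (subst 2) (simp only: mult.assoc)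
    then show ?thesis unfolding 1 by simp
  qed
  have key: "(-1) ^ k * (Re (G (z0 + of_real t * cis (a k))) - Re (G z0)) < 0" if t: "0 < t" "t \<le> s" for t k
  proof -
    define w where "w = z0 + of_real t * cis (a k)"
    have dw: "dist w z0 = t" using t by (simp add: w_def dist_norm norm_mult)
    then have "w \<in> ball z0 r" using t s by (simp add: dist_commute)
    then have "G w - G z0 = of_real (t ^ n) * (cis (a k) ^ n * g w)" using g(5) by (simp add: w_def power_mult_distrib)
    then have inc: "Re (G w) - Re (G z0) = t ^ n * Re (cis (a k) ^ n * g w)"
      using arg_cong[of _ _ Re, OF \<open>G w - G z0 = _\<close>] 
      unfolding minus_complex.sel times_complex.sel[of "of_real (t ^ n)"] Re_complex_of_real Im_complex_of_real by simp
    have "cis (a k) ^ n * g w = - of_real (cmod c * (-1) ^ k) + cis (a k) ^ n * (g w - c)"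
      using ca[of k] by (simp add: algebra_simps)
    then have "Re (cis (a k) ^ n * g w) = - (cmod c * (-1) ^ k) + Re (cis (a k) ^ n * (g w - c))"
      by (simp only: plus_complex.sel uminus_complex.sel Re_complex_of_real)
    moreover have "\<bar>Re (cis (a k) ^ n * (g w - c))\<bar> \<le> cmod (cis (a k) ^ n * (g w - c))" by (rule abs_Re_le_cmod)
    moreover have "cmod (cis (a k) ^ n * (g w - c)) < cmod c / 2"
      using \<delta>(2)[of w] dw t s by (simp add: norm_mult norm_power dist_norm)
    moreover have "(-1) ^ k = (1::real) \<or> (-1) ^ k = (-1::real)" by (cases "even k") auto
    moreover have "cmod c > 0" using c by simp
    ultimately have neg: "(-1) ^ k * Re (cis (a k) ^ n * g w) < 0" by auto
    have "(-1) ^ k * (Re (G w) - Re (G z0)) = t ^ n * ((-1) ^ k * Re (cis (a k) ^ n * g w))"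
      unfolding inc by (simp only: mult.left_commute)
    also have "\<dots> < 0" by (rule mult_pos_neg) (use neg t in auto)
    finally show ?thesis unfolding w_def .

  qed
  have am: "a k < a (Suc k)" for k using g(1) by (auto simp: a_def divide_strict_right_mono)
  \<comment> \<open>Because of \<open>n \<ge> 2\<close>, four consecutive directions span at most
    \<open>3 * pi / 2\<close> and so fit into one turn.\<close>
  have "a 3 = a 0 + 3 * pi / real n" by (simp add: a_def field_simps add_divide_distrib diff_divide_distrib)
  moreover have "3 * pi / real n \<le> 3 * pi / 2" using n2 by (intro divide_left_mono) auto
  ultimately have "a 3 < a 0 + 2 * pi" using pi_gt_zero by linarith
  then show ?thesis
    using that[OF s(1) sD, of "a 0" "a 1" "a 2" "a 3"] am[of 0] am[of 1] am[of 2] key[of _ 0] key[of _ 1] key[of _ 2] key[of _ 3]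
    by (simp add: numeral_2_eq_2 numeral_3_eq_3)
qed

section \<open>Arms from a point towards the circle\<close>

lemma compact_subset_cball:
  fixes K :: "complex set"
  assumes "compact K" "K \<subseteq> ball 0 1"
  obtains \<rho> where "0 < \<rho>" "\<rho> < 1" "K \<subseteq> cball 0 \<rho>"
proof (cases "K = {}")
  case True
  then show ?thesis using that[of "1/2"] by simp
next
  case False
  obtain x where x: "x \<in> K" "\<And>y. y \<in> K \<Longrightarrow> cmod y \<le> cmod x"
    using continuous_attains_sup[OF assms(1) False, of cmod] by (auto intro: continuous_intros)
  then show ?thesis using that[of "max (cmod x) (1/2)"] assms by fastforce
qed

text \<open>\<open>Q\<close> stands for the points at which an arm may stop. If the component of
  \<open>z1\<close> in the sublevel set meets \<open>Q\<close>, a path inside the component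
  suffices. If it does not, \<open>Re G\<close> is bounded below on the component, and
  \<open>component_contains_radial_tail\<close> provides a radius to follow. The conclusion is
  stated for all \<open>\<rho>\<close> near 1 in order that several arms can be given the same
  \<open>\<rho>\<close>.\<close>

lemma sublevel_arm:
  fixes G :: "complex \<Rightarrow> complex"
  assumes hol: "G holomorphic_on ball 0 1" and z1: "z1 \<in> ball 0 1" "Re (G z1) < c"
    and bd: "\<And>z. \<lbrakk>z \<in> ball 0 1; z \<notin> Q\<rbrakk> \<Longrightarrow> Re (G z) \<ge> - B"
    and N: "negligible N"
    and lim: "\<And>t. t \<notin> N \<Longrightarrow> \<exists>w. ((\<lambda>r. Re (G (of_real r * cis t))) \<longlongrightarrow> w) (at_left 1)"
  obtains \<rho>0 where "0 < \<rho>0" "\<rho>0 < 1"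
    "\<And>\<rho>. \<lbrakk>\<rho>0 \<le> \<rho>; \<rho> < 1\<rbrakk> \<Longrightarrow> \<exists>P. path_connected P \<and> z1 \<in> P \<and> P \<subseteq> cball 0 \<rho> \<and> (\<forall>z\<in>P. Re (G z) < c) \<and>
       (P \<inter> Q \<noteq> {} \<or> (\<exists>t. t \<notin> N \<and> of_real \<rho> * cis t \<in> P \<and> (\<forall>z\<in>radial_tail \<rho> t. z \<notin> Q \<and> Re (G z) < c)))"
proof -
  define U where "U = {z\<in>ball 0 1. Re (G z) < c}"
  define C where "C = connected_component_set U z1"
  have "continuous_on (ball 0 1) (\<lambda>z. Re (G z))"
    using hol by (intro continuous_intros holomorphic_on_imp_continuous_on)
  then have opU: "open U"
    using continuous_open_preimage[of "ball 0 1" "\<lambda>z. Re (G z)" "{..<c}"] by (simp add: vimage_def Int_def U_def)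
  have CU: "C \<subseteq> U" unfolding C_def by (rule connected_component_subset)
  have z1C: "z1 \<in> C" unfolding C_def using z1 by (simp add: U_def)
  have "path_connected C"
    unfolding C_def using open_connected_component[OF opU] connected_connected_component connected_open_path_connected by blast
  then have pth: "\<exists>g. path g \<and> path_image g \<subseteq> C \<and> pathstart g = z1 \<and> pathfinish g = z" if "z \<in> C" for z
    using z1C that unfolding path_connected_def by blast
  have CD: "C \<subseteq> ball 0 1" and CG: "\<And>z. z \<in> C \<Longrightarrow> Re (G z) < c" using CU by (auto simp: U_def)
  have pK: "\<exists>K \<rho>0. path_connected K \<and> z1 \<in> K \<and> z \<in> K \<and> K \<subseteq> C \<and> 0 < \<rho>0 \<and> \<rho>0 < 1 \<and> K \<subseteq> cball 0 \<rho>0" if zC: "z \<in> C" for z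
  proof -
    obtain g where g: "path g" "path_image g \<subseteq> C" "pathstart g = z1" "pathfinish g = z" using pth[OF zC] by blast
    have "path_image g \<subseteq> ball 0 1" using g(2) CD by blast
    then obtain \<rho>0 where "0 < \<rho>0" "\<rho>0 < 1" "path_image g \<subseteq> cball 0 \<rho>0"
      using compact_subset_cball[OF compact_path_image[OF g(1)]] by blast
    moreover have "z1 \<in> path_image g" "z \<in> path_image g" using g(3,4) pathstart_in_path_image pathfinish_in_path_image by metis+
    ultimately show ?thesis using g(1,2) path_connected_path_image by blast
  qed
  show thesis
  proof (cases "C \<inter> Q = {}")
    case False
    then obtain z2 where z2: "z2 \<in> C" "z2 \<in> Q" by blast
    then obtain K \<rho>0 where K: "path_connected K" "z1 \<in> K" "z2 \<in> K" "K \<subseteq> C" "0 < \<rho>0" "\<rho>0 < 1" "K \<subseteq> cball 0 \<rho>0"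
      using pK by blast
    show thesis
    proof (rule that[OF K(5,6)], rule exI[of _ K], intro conjI K(1,2))
      fix \<rho> assume "\<rho>0 \<le> \<rho>" "\<rho> < 1"
      then show "K \<subseteq> cball 0 \<rho>" using K(7) by fastforce
    qed (use K z2 CG in auto)
  next
    case True
    have bdC: "Re (G z) \<ge> - B" if "z \<in> C" for z using bd[of z] that True CD by blast
    obtain t r0 where t: "t \<notin> N" "0 < r0" "r0 < 1" "\<And>r. \<lbrakk>r0 \<le> r; r < 1\<rbrakk> \<Longrightarrow> of_real r * cis t \<in> C"
    proof (rule component_contains_radial_tail[OF hol z1, of C B N])
      show "C = connected_component_set {z\<in>ball 0 1. Re (G z) < c} z1" by (simp only: C_def U_def)
    qed (use bdC N lim in \<open>simp_all\<close>)
    obtain K \<rho>0 where K: "path_connected K" "z1 \<in> K" "of_real r0 * cis t \<in> K" "K \<subseteq> C" "0 < \<rho>0" "\<rho>0 < 1" "K \<subseteq> cball 0 \<rho>0"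
      using pK[OF t(4)[OF order_refl t(3)]] by blast
    show thesis
    proof (rule that[of "max \<rho>0 r0"])
      fix \<rho> assume \<rho>: "max \<rho>0 r0 \<le> \<rho>" "\<rho> < 1"
      define S where "S = (\<lambda>r. of_real r * cis t) ` {r0..\<rho>}"
      have S: "path_connected S" unfolding S_def
        by (intro path_connected_continuous_image continuous_intros) (simp add: convex_imp_path_connected)
      have SC: "S \<subseteq> C" using t(4) \<rho> by (auto simp: S_def)
      have Sr: "of_real r0 * cis t \<in> S" "of_real \<rho> * cis t \<in> S" using \<rho> by (auto simp: S_def)
      have "path_connected (K \<union> S)" using K(1,3) S Sr(1) by (intro path_connected_Un) auto
      moreover have "K \<union> S \<subseteq> cball 0 \<rho>" using K(7) \<rho> t(2) by (fastforce simp: S_def norm_mult)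
      moreover have "radial_tail \<rho> t \<subseteq> C" using t(4) \<rho> by (auto simp: radial_tail_def)
      ultimately show "\<exists>P. path_connected P \<and> z1 \<in> P \<and> P \<subseteq> cball 0 \<rho> \<and> (\<forall>z\<in>P. Re (G z) < c) \<and>
       (P \<inter> Q \<noteq> {} \<or> (\<exists>t. t \<notin> N \<and> of_real \<rho> * cis t \<in> P \<and> (\<forall>z\<in>radial_tail \<rho> t. z \<notin> Q \<and> Re (G z) < c)))"
        using K(2,4) SC Sr(2) t(1) True CG
        by (intro exI[of _ "K \<union> S"] conjI disjI2 exI[of _ t]) blast+
    qed (use K t in auto)
  qed
qed

subsection \<open>Escaping along the complementary rays\<close>

definition horizontal :: "real \<Rightarrow> complex \<Rightarrow> complex set" where
  "horizontal \<sigma> w = (\<lambda>s. Complex (Re w + \<sigma> * s) (Im w)) ` {0..}"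

lemma path_connected_horizontal: "path_connected (horizontal \<sigma> w)"
  unfolding horizontal_def
  by (intro path_connected_continuous_image continuous_intros) (simp add: convex_imp_path_connected)

lemma start_in_horizontal: "w \<in> horizontal \<sigma> w"
  unfolding horizontal_def by (rule image_eqI[of _ _ 0]) auto

lemma horizontal_left: "w' \<in> horizontal (-1) w \<Longrightarrow> Im w' = Im w \<and> Re w' \<le> Re w"
  by (auto simp: horizontal_def)

lemma horizontal_right: "w' \<in> horizontal 1 w \<Longrightarrow> Im w' = Im w \<and> Re w' \<ge> Re w"
  by (auto simp: horizontal_def)

lemma horizontal_reaches:
  assumes "\<sigma> = 1 \<or> \<sigma> = -1"
  shows "\<exists>w'\<in>horizontal \<sigma> w. \<sigma> * Re w' > M"
proof -
  have "Complex (Re w + \<sigma> * (\<bar>M\<bar> + \<bar>Re w\<bar> + 1)) (Im w) \<in> horizontal \<sigma> w" unfolding horizontal_def by auto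
  then show ?thesis using assms by (intro bexI) auto
qed

locale ray_complement =
  fixes f d :: "complex \<Rightarrow> complex"
  assumes cont: "continuous_on (ball 0 1) f"
    and inj: "inj_on f (ball 0 1)"
    and norm_d: "b \<notin> f ` ball 0 1 \<Longrightarrow> cmod (d b) = 1"
    and ray: "\<lbrakk>b \<notin> f ` ball 0 1; 0 \<le> s\<rbrakk> \<Longrightarrow> b + of_real s * d b \<notin> f ` ball 0 1"
    and d_ray: "\<lbrakk>b \<notin> f ` ball 0 1; 0 \<le> s\<rbrakk> \<Longrightarrow> d (b + of_real s * d b) = d b"
begin

definition lands :: "real \<Rightarrow> complex \<Rightarrow> bool" where
  "lands t b \<longleftrightarrow> b \<notin> f ` ball 0 1 \<and> ((\<lambda>r. f (of_real r * cis t)) \<longlongrightarrow> b) (at_left 1)"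

text \<open>The ray at \<open>b\<close> goes up on the same vertical line as the ray at \<open>bs\<close>, from a higher point, and the
  radius lands on it from the left; its left connector may then leave it before \<open>b\<close> and run next to it.\<close>
definition lip :: "complex \<Rightarrow> real \<Rightarrow> complex \<Rightarrow> bool" where
  "lip bs t b \<longleftrightarrow> bs \<notin> f ` ball 0 1 \<and> d bs = \<i> \<and> Re b = Re bs \<and> Im b > Im bs \<and>
     eventually (\<lambda>r. Re (f (of_real r * cis t)) < Re bs) (at_left 1)"

text \<open>The parameter \<open>bs\<close> only serves to decide the type of the upward rays.\<close>
definition onL :: "complex \<Rightarrow> real \<Rightarrow> complex \<Rightarrow> bool" where
  "onL bs t b \<longleftrightarrow> Re (d b) < 0 \<or> d b = -\<i> \<or> d b = \<i> \<and> (Re b < Re bs \<or> lip bs t b)"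

definition half_ray :: "complex \<Rightarrow> complex set" where
  "half_ray b = (\<lambda>s. b + of_real s * d b) ` {0..}"

text \<open>Vertical rays are followed up to height \<open>V\<close>, above the compact sets in question, and then left
  horizontally on the side \<open>\<sigma>\<close>.\<close>
definition escape :: "real \<Rightarrow> real \<Rightarrow> complex \<Rightarrow> complex set" where
  "escape \<sigma> V b = (if Re (d b) = 0
     then (\<lambda>s. b + of_real s * d b) ` {0..V - Im b * Im (d b)} \<union> horizontal \<sigma> (Complex (Re b) (V * Im (d b)))
     else half_ray b)"

lemma half_ray_disjoint: "b \<notin> f ` ball 0 1 \<Longrightarrow> half_ray b \<inter> f ` ball 0 1 = {}"
  using ray unfolding half_ray_def by auto

lemma rays_meet:
  assumes "b \<notin> f ` ball 0 1" "b' \<notin> f ` ball 0 1" "w \<in> half_ray b" "w \<in> half_ray b'"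
  shows "d b = d b'"
proof -
  have "d w = d b" if b: "b \<notin> f ` ball 0 1" "w \<in> half_ray b" for b
  proof -
    obtain s where "w = b + of_real s * d b" "0 \<le> s" using b(2) by (auto simp: half_ray_def)
    then show ?thesis using d_ray[OF b(1)] by simp
  qed
  then show ?thesis using assms by metis
qed

lemma vertical_direction:
  assumes "b \<notin> f ` ball 0 1" "Re (d b) = 0"
  shows "d b = \<i> \<or> d b = -\<i>"
proof -
  have "\<bar>Im (d b)\<bar> = 1" using norm_d[OF assms(1)] assms(2) by (simp add: cmod_def)
  then have "Im (d b) = 1 \<or> Im (d b) = -1" by linarith
  then show ?thesis using assms(2) by (auto simp: complex_eq_iff)
qed

lemma closed_half_ray:
  assumes "b \<notin> f ` ball 0 1"
  shows "closed (half_ray b)"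
proof -
  have d0: "d b \<noteq> 0" using norm_d[OF assms] by auto
  have "half_ray b = (\<lambda>w. (w - b) / d b) -` \<real>\<^sub>\<ge>\<^sub>0"
  proof (intro set_eqI iffI)
    fix w assume "w \<in> half_ray b"
    then show "w \<in> (\<lambda>w. (w - b) / d b) -` \<real>\<^sub>\<ge>\<^sub>0" using d0 by (auto simp: half_ray_def)
  next
    fix w assume "w \<in> (\<lambda>w. (w - b) / d b) -` \<real>\<^sub>\<ge>\<^sub>0"
    then obtain s where "(w - b) / d b = of_real s" "s \<ge> 0" by (auto simp: nonneg_Reals_def)
    then have "w = b + of_real s * d b" using d0 by (simp add: field_simps)
    then show "w \<in> half_ray b" using \<open>s \<ge> 0\<close> by (auto simp: half_ray_def)
  qed
  then show ?thesis
    using continuous_closed_vimage[OF closed_nonneg_Reals_complex] d0 by (auto intro!: continuous_intros)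
qed

text \<open>If the ray at \<open>b'\<close> reached the height \<open>\<epsilon> * V\<close> before
  the vertical line through \<open>b\<close>, it would go on to cross this line at or beyond that
  height, that is, on the ray at \<open>b\<close>. Rays that meet have equal directions, which is
  impossible here.\<close>

lemma ray_side_of_vertical:
  assumes b: "b \<notin> f ` ball 0 1" "d b = of_real \<epsilon> * \<i>" "\<epsilon> = 1 \<or> \<epsilon> = -1"
    and b': "b' \<notin> f ` ball 0 1" "Re (d b') \<noteq> 0"
    and V: "\<bar>Im b\<bar> < V" "\<bar>Im b'\<bar> < V"
    and w: "w \<in> half_ray b'" "Im w = \<epsilon> * V"
  shows "(Re w - Re b) * Re (d b') > 0"
proof (rule ccontr)
  assume neg: "\<not> ?thesis"
  obtain s where s: "w = b' + of_real s * d b'" "0 \<le> s" using w by (auto simp: half_ray_def)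
  define x where "x = (Re b - Re w) / Re (d b')"
  have "x = - ((Re w - Re b) * Re (d b')) / (Re (d b'))\<^sup>2"
    using b' by (simp add: x_def field_simps power2_eq_square)
  then have x: "x \<ge> 0" using neg by (simp add: divide_le_0_iff not_less)
  have "\<epsilon> * Im b' < V" using V b(3) by auto
  moreover have "\<epsilon> * Im w = V" using w b(3) by auto
  ultimately have "s * (\<epsilon> * Im (d b')) > 0" using s by (simp add: algebra_simps)
  then have im: "\<epsilon> * Im (d b') > 0" using s by (simp add: zero_less_mult_iff)
  define w' where "w' = w + of_real x * d b'"
  have w'1: "w' \<in> half_ray b'"
    unfolding half_ray_def w'_def s(1) by (rule image_eqI[of _ _ "s + x"]) (use s x in \<open>auto simp: algebra_simps\<close>)
  have re: "Re w' = Re b" using b' by (simp add: w'_def x_def)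
  have "\<epsilon> * Im w' = V + x * (\<epsilon> * Im (d b'))" using \<open>\<epsilon> * Im w = V\<close> by (simp add: w'_def algebra_simps)
  then have "\<epsilon> * Im w' \<ge> V" using x im by simp
  then have "\<epsilon> * (Im w' - Im b) \<ge> 0" using V b(3) by (auto simp: algebra_simps)
  moreover have "w' = b + of_real (\<epsilon> * (Im w' - Im b)) * d b" using b re by (auto simp: complex_eq_iff)
  ultimately have "w' \<in> half_ray b" unfolding half_ray_def by blast
  then have "d b = d b'" using rays_meet w'1 b b' by blast
  moreover have "Re (d b) = 0" using b(2) by simp
  ultimately show False using b' by simp
qed

lemma escape_subset:
  assumes "b \<notin> f ` ball 0 1" "\<bar>Im b\<bar> < V"
  shows "escape \<sigma> V b \<subseteq> half_ray b \<union> {w. \<bar>Im w\<bar> = V}"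
proof (cases "Re (d b) = 0")
  case True
  then have "\<bar>V * Im (d b)\<bar> = V" using vertical_direction[OF assms(1) True] assms by auto
  then show ?thesis using True by (auto simp: escape_def half_ray_def horizontal_def)
qed (simp add: escape_def)

lemma escape_disjoint_image:
  assumes "b \<notin> f ` ball 0 1" "\<bar>Im b\<bar> < V" "S \<subseteq> ball 0 1" "\<And>z. z \<in> S \<Longrightarrow> \<bar>Im (f z)\<bar> < V"
  shows "escape \<sigma> V b \<inter> f ` S = {}"
  using escape_subset[OF assms(1,2), of \<sigma>] half_ray_disjoint[OF assms(1)] assms(3,4) by fastforce

lemma escape_Re:
  assumes "b \<notin> f ` ball 0 1" "\<sigma> * Re (d b) \<ge> 0" "w \<in> escape \<sigma> V b" "\<sigma> = 1 \<or> \<sigma> = -1"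
  shows "\<sigma> * Re w \<ge> \<sigma> * Re b"
proof (cases "Re (d b) = 0")
  case False
  then obtain s where "w = b + of_real s * d b" "s \<ge> 0" using assms by (auto simp: escape_def half_ray_def)
  then have "\<sigma> * Re w = \<sigma> * Re b + s * (\<sigma> * Re (d b))" by (simp add: algebra_simps)
  then show ?thesis using assms \<open>s \<ge> 0\<close> by simp
qed (use assms in \<open>auto simp: escape_def horizontal_def\<close>)

lemma path_connected_escape:
  assumes "b \<notin> f ` ball 0 1" "\<bar>Im b\<bar> < V"
  shows "path_connected (escape \<sigma> V b)" and "b \<in> escape \<sigma> V b"
proof -
  have im: "path_connected ((\<lambda>s. b + of_real s * d b) ` I)" if "convex I" for I
    using that by (intro path_connected_continuous_image continuous_intros convex_imp_path_connected)
  have *: "path_connected (escape \<sigma> V b) \<and> b \<in> escape \<sigma> V b"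
  proof (cases "Re (d b) = 0")
    case True
    let ?h = "V - Im b * Im (d b)"
    have h: "?h \<ge> 0" using vertical_direction[OF assms(1) True] assms by auto
    have endpt: "b + of_real ?h * d b = Complex (Re b) (V * Im (d b))"
      using vertical_direction[OF assms(1) True] by (auto simp: complex_eq_iff)
    have "path_connected ((\<lambda>s. b + of_real s * d b) ` {0..?h} \<union> horizontal \<sigma> (Complex (Re b) (V * Im (d b))))"
    proof (rule path_connected_Un[OF im path_connected_horizontal])
      have "b + of_real ?h * d b \<in> (\<lambda>s. b + of_real s * d b) ` {0..?h}" by (rule imageI) (use h in simp)
      then show "(\<lambda>s. b + of_real s * d b) ` {0..?h} \<inter> horizontal \<sigma> (Complex (Re b) (V * Im (d b))) \<noteq> {}"
        unfolding endpt using start_in_horizontal by blast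
    qed simp
    moreover have "b \<in> (\<lambda>s. b + of_real s * d b) ` {0..?h}" by (rule image_eqI[of _ _ 0]) (use h in auto)
    ultimately show ?thesis using True by (simp add: escape_def)
  next
    case False
    have "b \<in> half_ray b" unfolding half_ray_def by (rule image_eqI[of _ _ 0]) auto
    then show ?thesis using False im[of "{0..}"] by (simp add: escape_def half_ray_def)
  qed
  show "path_connected (escape \<sigma> V b)" "b \<in> escape \<sigma> V b" using * by auto
qed

lemma escape_reaches:
  assumes "b \<notin> f ` ball 0 1" "\<sigma> * Re (d b) \<ge> 0" "\<sigma> = 1 \<or> \<sigma> = -1"
  shows "\<exists>w\<in>escape \<sigma> V b. \<sigma> * Re w > M"
proof (cases "Re (d b) = 0")
  case True
  then show ?thesis using horizontal_reaches[OF assms(3), of "Complex (Re b) (V * Im (d b))" M] by (auto simp: escape_def)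
next
  case False
  then have pos: "\<sigma> * Re (d b) > 0" using assms by auto
  define s where "s = (\<bar>M\<bar> + \<bar>Re b\<bar> + 1) / (\<sigma> * Re (d b))"
  have "s \<ge> 0" using pos by (simp add: s_def)
  then have "b + of_real s * d b \<in> escape \<sigma> V b" using False by (auto simp: escape_def half_ray_def)
  moreover have "\<sigma> * Re (b + of_real s * d b) = \<sigma> * Re b + s * (\<sigma> * Re (d b))" by (simp add: algebra_simps)
  moreover have "s * (\<sigma> * Re (d b)) = \<bar>M\<bar> + \<bar>Re b\<bar> + 1" unfolding s_def using pos by (intro nonzero_divide_eq_eq[THEN iffD1, OF _ refl, symmetric]) auto
  ultimately show ?thesis using assms(3) by (intro bexI) auto
qed

text \<open>Rays of different directions are disjoint, so a common point would have to be on a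
  horizontal part, at height \<open>V\<close> or \<open>- V\<close>. A slanted ray that crosses this
  height is beyond the vertical line by \<open>ray_side_of_vertical\<close>, on the side away from
  the horizontal part. A downward and an upward ray turn off at opposite heights. Two upward rays
  are separated by the abscissa of \<open>bs\<close>.\<close>

lemma escapes_disjoint:
  assumes b: "b \<notin> f ` ball 0 1" "onL bs t b" "\<not> lip bs t b" "\<bar>Im b\<bar> < V"
    and b': "b' \<notin> f ` ball 0 1" "\<not> onL bs t' b'" "\<bar>Im b'\<bar> < V"
  shows "escape (-1) V b \<inter> escape 1 V b' = {}"
proof -
  have V: "V > 0" using b by simp
  have ty: "Re (d b) < 0 \<or> d b = -\<i> \<or> d b = \<i> \<and> Re b < Re bs" using b by (auto simp: onL_def)
  have ty': "Re (d b') > 0 \<or> d b' = \<i> \<and> Re b' \<ge> Re bs"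
    using b' vertical_direction[OF b'(1)] by (auto simp: onL_def)
  have sep: "half_ray b \<inter> half_ray b' = {}" if "d b \<noteq> d b'"
    using rays_meet[OF b(1) b'(1)] that by blast
  show ?thesis
  proof (rule ccontr)
    assume "\<not> ?thesis"
    then obtain w where w: "w \<in> escape (-1) V b" "w \<in> escape 1 V b'" by blast
    have w1: "w \<in> half_ray b \<or> Re (d b) = 0 \<and> w \<in> horizontal (-1) (Complex (Re b) (V * Im (d b)))"
      using w by (auto simp: escape_def half_ray_def split: if_splits)
    have w2: "w \<in> half_ray b' \<or> Re (d b') = 0 \<and> w \<in> horizontal 1 (Complex (Re b') (V * Im (d b')))"
      using w by (auto simp: escape_def half_ray_def split: if_splits)
    consider "Re (d b) < 0" "Re (d b') > 0" | "Re (d b) < 0" "d b' = \<i>"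
      | "d b = \<i> \<or> d b = -\<i>" "Re (d b') > 0" | "d b = -\<i>" "d b' = \<i>" | "d b = \<i>" "d b' = \<i>" "Re b < Re b'"
      using ty ty' by fastforce
    then show False
    proof cases
      case 1
      then have "d b \<noteq> d b'" by auto
      then show False using 1 w1 w2 sep by auto
    next
      case 2
      then have "d b \<noteq> d b'" by auto
      then have "w \<in> half_ray b" "w \<in> horizontal 1 (Complex (Re b') V)" using 2 w1 w2 sep by auto
      then have "(Re w - Re b') * Re (d b) > 0" "Re w \<ge> Re b'"
        using ray_side_of_vertical[OF b'(1), of 1 b V w] 2 b b' horizontal_right[of w "Complex (Re b') V"] by auto
      then show False using 2 by (simp add: zero_less_mult_iff)
    next
      case 3
      then have ne: "d b \<noteq> d b'" by (metis imaginary_unit.sel(1) less_irrefl uminus_complex.sel(1) minus_zero)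
      obtain \<epsilon> where e: "\<epsilon> = 1 \<or> \<epsilon> = -1" "d b = of_real \<epsilon> * \<i>" using 3
        by (metis minus_mult_left mult_1 of_real_1 of_real_minus)
      have "w \<in> half_ray b'" "w \<in> horizontal (-1) (Complex (Re b) (V * Im (d b)))" using ne 3 w1 w2 sep by auto
      then have "(Re w - Re b) * Re (d b') > 0" "Re w \<le> Re b"
        using ray_side_of_vertical[OF b(1) e(2,1) b'(1), of V w] 3 b b' e horizontal_left[of w "Complex (Re b) (V * Im (d b))"] by auto
      then show False using 3 by (simp add: zero_less_mult_iff)
    next
      case 4
      then have ne: "d b \<noteq> d b'" by auto
      have i: "Im w \<le> Im b \<or> Im w = V" if "w \<in> half_ray b" using that 4 by (auto simp: half_ray_def)
      have "Im w \<ge> Im b'" if "w \<in> half_ray b'" using that 4 by (auto simp: half_ray_def)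
      then show False
        using 4 w1 w2 sep[OF ne] V b b' horizontal_left[of w "Complex (Re b) (V * Im (d b))"]
          horizontal_right[of w "Complex (Re b') (V * Im (d b'))"] by (auto simp: half_ray_def)
    next
      case 5
      have "Re w \<le> Re b" using w1 5 horizontal_left[of w "Complex (Re b) (V * Im (d b))"] by (auto simp: half_ray_def)
      moreover have "Re w \<ge> Re b'" using w2 5 horizontal_right[of w "Complex (Re b') (V * Im (d b'))"] by (auto simp: half_ray_def)
      ultimately show False using 5 by simp
    qed
  qed
qed

section \<open>Radii continued through their landing points\<close>

lemma radial_tail_subset: "0 < \<rho> \<Longrightarrow> radial_tail \<rho> t \<subseteq> ball 0 1"
  by (auto simp: radial_tail_def norm_mult)

lemma compact_landing_tail:
  assumes "lands t b" "0 < \<rho>" "\<rho> < 1"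
  shows "compact (insert b (f ` radial_tail \<rho> t))" "path_connected (insert b (f ` radial_tail \<rho> t))"
proof -
  define g where "g = (\<lambda>r. if r = 1 then b else f (of_real r * cis t))"
  have lim: "((\<lambda>r. f (of_real r * cis t)) \<longlongrightarrow> b) (at_left 1)" using assms by (simp add: lands_def)
  have cg: "continuous_on {\<rho>..1} g"
    unfolding continuous_on_eq_continuous_within
  proof
    fix r assume r: "r \<in> {\<rho>..1}"
    show "continuous (at r within {\<rho>..1}) g"
    proof (cases "r = 1")
      case True
      have "eventually (\<lambda>r. f (of_real r * cis t) = g r) (at_left 1)"
        unfolding eventually_at_left_field g_def by (intro exI[of _ 0]) auto
      then have "(g \<longlongrightarrow> b) (at_left 1)" by (rule Lim_transform_eventually[OF lim])
      then have "(g \<longlongrightarrow> b) (at 1 within {\<rho>..1})" using assms(3) by (simp add: at_within_Icc_at_left)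
      then show ?thesis using True by (simp add: continuous_within g_def)
    next
      case False
      have "isCont f (of_real r * cis t)"
        using cont r False assms continuous_on_eq_continuous_at[of "ball 0 1" f] by (auto simp: norm_mult)
      then have "continuous (at r within {\<rho>..1}) (\<lambda>r. f (of_real r * cis t))"
        by (rule continuous_within_compose3) (intro continuous_intros)
      moreover have "eventually (\<lambda>x. f (of_real x * cis t) = g x) (at r within {\<rho>..1})"
        unfolding eventually_at g_def by (intro exI[of _ "1 - r"]) (use False r in \<open>auto simp: dist_real_def\<close>)
      moreover have "f (of_real r * cis t) = g r" using False by (simp add: g_def)
      ultimately show ?thesis
        unfolding continuous_within using Lim_transform_eventually[of "\<lambda>r. f (of_real r * cis t)" "g r"] by simp
    qed
  qed
  have "insert b (f ` radial_tail \<rho> t) = g ` {\<rho>..1}"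
  proof -
    have "{\<rho>..1} = insert 1 {\<rho>..<1}" using assms by auto
    then show ?thesis by (auto simp: g_def radial_tail_def image_image)
  qed
  then show "compact (insert b (f ` radial_tail \<rho> t))" "path_connected (insert b (f ` radial_tail \<rho> t))"
    using compact_continuous_image[OF cg] path_connected_continuous_image[OF cg]
    by (auto simp: convex_imp_path_connected)
qed

lemma landing_le:
  fixes L :: "complex \<Rightarrow> real"
  assumes "lands t b" "0 < \<rho>" "\<rho> < 1" "continuous_on UNIV L" "\<And>z. z \<in> radial_tail \<rho> t \<Longrightarrow> L (f z) \<le> c"
  shows "L b \<le> c"
proof -
  have "isCont L b" using assms(4) by (simp add: continuous_on_eq_continuous_at)
  then have "((\<lambda>r. L (f (of_real r * cis t))) \<longlongrightarrow> L b) (at_left 1)"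
    using assms(1) unfolding lands_def by (auto intro: isCont_tendsto_compose)
  moreover have "eventually (\<lambda>r. L (f (of_real r * cis t)) \<le> c) (at_left 1)"
    unfolding eventually_at_left_field
    by (intro exI[of _ \<rho>]) (use assms in \<open>auto intro!: assms(5) simp: radial_tail_def\<close>)
  ultimately show ?thesis by (intro tendsto_upperbound[of _ "L b" "at_left 1"]) auto
qed

text \<open>The connector of a lip. It starts at a point \<open>p\<close> of the disk image shortly
  before the landing point, and so runs strictly to the left of the vertical line through
  \<open>bs\<close>, which may be occupied by a connector of the right type.\<close>

definition lip_set :: "real \<Rightarrow> complex \<Rightarrow> complex set" where
  "lip_set V p = (\<lambda>y. Complex (Re p) y) ` {Im p..V} \<union> horizontal (-1) (Complex (Re p) V)"

lemma path_connected_lip_set: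
  assumes "Im p \<le> V"
  shows "path_connected (lip_set V p)" "p \<in> lip_set V p"
proof -
  show "path_connected (lip_set V p)" unfolding lip_set_def
  proof (rule path_connected_Un[OF _ path_connected_horizontal])
    show "path_connected (Complex (Re p) ` {Im p..V})"
      by (intro path_connected_continuous_image continuous_intros) (simp add: convex_imp_path_connected)
    have "Complex (Re p) V \<in> Complex (Re p) ` {Im p..V}" using assms by simp
    then show "Complex (Re p) ` {Im p..V} \<inter> horizontal (-1) (Complex (Re p) V) \<noteq> {}"
      using start_in_horizontal by blast
  qed
  show "p \<in> lip_set V p" unfolding lip_set_def
    by (rule UnI1, rule image_eqI[of _ _ "Im p"]) (use assms in auto)
qed

lemma lip_direction:
  assumes "lip bs t b"
  shows "d b = \<i>" "b \<in> half_ray bs"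
proof -
  have bs: "bs \<notin> f ` ball 0 1" "d bs = \<i>" "Re b = Re bs" "Im b > Im bs" using assms by (auto simp: lip_def)
  have e: "b = bs + of_real (Im b - Im bs) * d bs" using bs by (auto simp: complex_eq_iff)
  show "d b = \<i>" using d_ray[OF bs(1), of "Im b - Im bs"] bs e by simp
  show "b \<in> half_ray bs" unfolding half_ray_def using e bs by (metis atLeast_iff diff_ge_0_iff_ge imageI less_imp_le)
qed

text \<open>The vertical segment from \<open>b\<close> up to height \<open>V\<close> is compact and
  hence has a positive distance from \<open>Q\<close>. Each point of the segment over
  \<open>f (r * cis t)\<close> is at most as far from it as \<open>f (r * cis t)\<close> is from
  \<open>b\<close>.\<close>

lemma lip_vertical_clear:
  assumes l: "lands t b" and cl: "closed Q" and Q: "Q \<inter> (\<lambda>y. Complex (Re b) y) ` {Im b..V} = {}"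
  shows "eventually (\<lambda>r. Q \<inter> (\<lambda>y. Complex (Re (f (of_real r * cis t))) y) ` {Im (f (of_real r * cis t))..V} = {}) (at_left 1)"
proof -
  let ?K = "(\<lambda>y. Complex (Re b) y) ` {Im b..V}"
  have "compact ?K" by (intro compact_continuous_image continuous_intros) auto
  then obtain \<delta> where \<delta>: "\<delta> > 0" "\<And>x y. \<lbrakk>x \<in> ?K; y \<in> Q\<rbrakk> \<Longrightarrow> \<delta> \<le> dist x y"
    using separate_compact_closed[of ?K Q] cl Q by (metis inf_commute)
  have lim: "((\<lambda>r. f (of_real r * cis t)) \<longlongrightarrow> b) (at_left 1)" using l by (simp add: lands_def)
  then have ev: "eventually (\<lambda>r. dist (f (of_real r * cis t)) b < \<delta>) (at_left 1)" using \<delta>(1) by (rule tendstoD)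
  show ?thesis
  proof (cases "Im b \<le> V")
    case True
    show ?thesis using ev
  proof eventually_elim
    case (elim r)
    define p where "p = f (of_real r * cis t)"
    have False if w: "w \<in> Q" "w \<in> (\<lambda>y. Complex (Re p) y) ` {Im p..V}" for w
    proof -
      have w': "Re w = Re p" "Im p \<le> Im w" "Im w \<le> V" using w by auto
      \<comment> \<open>The point of the segment over \<open>b\<close> nearest in height to
        \<open>w\<close>; the maximum matters when \<open>w\<close> is below
        \<open>b\<close>.\<close>
      define q where "q = Complex (Re b) (max (Im b) (Im w))"
      have "q \<in> ?K" unfolding q_def using w' True by auto
      then have "\<delta> \<le> dist q w" using \<delta> w by blast
      also have "dist q w \<le> dist p b"
      proof -
        have "\<bar>Im (q - w)\<bar> \<le> \<bar>Im (p - b)\<bar>" "\<bar>Re (q - w)\<bar> = \<bar>Re (p - b)\<bar>" using w' by (auto simp: q_def)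
        then have "(Im (q - w))\<^sup>2 \<le> (Im (p - b))\<^sup>2" "(Re (q - w))\<^sup>2 = (Re (p - b))\<^sup>2"
          by (simp_all only: abs_le_square_iff[symmetric] power2_eq_iff) (auto simp: abs_if split: if_splits)
        then show ?thesis unfolding dist_norm cmod_def by simp
      qed
      finally show False using elim by (simp add: p_def)
    qed
    then show ?case unfolding p_def by blast
  qed
  next
    case False
    then have "eventually (\<lambda>r. Im (f (of_real r * cis t)) > V) (at_left 1)"
      using order_tendstoD(1)[OF tendsto_Im[OF lim]] by simp
    then show ?thesis by eventually_elim auto
  qed
qed

text \<open>Near \<open>b\<close> the vertical line through \<open>b\<close> is free of the image,
  so by the intermediate value theorem the image of the radius ends up on one side of it. This is
  what makes the condition on the side in \<open>lip\<close> decidable for landing points above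
  another one.\<close>

lemma eventually_Re_less_of_avoids:
  assumes l: "lands t b" and \<epsilon>: "\<epsilon> > 0" "\<And>w. \<lbrakk>dist w b < \<epsilon>; Re w = Re b\<rbrakk> \<Longrightarrow> w \<notin> f ` ball 0 1"
  shows "eventually (\<lambda>r. Re (f (of_real r * cis t)) < Re b) (at_left 1) \<or>
    eventually (\<lambda>r. Re (f (of_real r * cis t)) > Re b) (at_left 1)"
proof -
  have lim: "((\<lambda>r. f (of_real r * cis t)) \<longlongrightarrow> b) (at_left 1)" using l by (simp add: lands_def)
  have "eventually (\<lambda>r. dist (f (of_real r * cis t)) b < \<epsilon>) (at_left 1)" using lim \<epsilon>(1) by (rule tendstoD)
  moreover have "eventually (\<lambda>r. r \<in> {0<..<1}) (at_left (1::real))" by (rule eventually_at_left_real) simp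
  ultimately have "eventually (\<lambda>r. r \<in> {0<..<1} \<and> dist (f (of_real r * cis t)) b < \<epsilon>) (at_left 1)"
    by eventually_elim auto
  then obtain r1 where r1: "r1 < 1" "\<And>r. \<lbrakk>r1 < r; r < 1\<rbrakk> \<Longrightarrow> r \<in> {0<..<1} \<and> dist (f (of_real r * cis t)) b < \<epsilon>"
    unfolding eventually_at_left_field by blast
  define g where "g = (\<lambda>r. Re (f (of_real r * cis t)))"
  have ne: "g r \<noteq> Re b" if "r1 < r" "r < 1" for r
  proof -
    have "of_real r * cis t \<in> ball 0 1" using r1(2)[OF that] by (auto simp: norm_mult)
    then show ?thesis using \<epsilon>(2)[of "f (of_real r * cis t)"] r1(2)[OF that] by (auto simp: g_def)
  qed
  have cg: "continuous_on {r1<..<1} g"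
    unfolding g_def
    by (intro continuous_on_Re continuous_on_compose2[OF cont] continuous_intros) (use r1(2) in \<open>force simp: norm_mult\<close>)
  have sides: "(\<forall>r\<in>{r1<..<1}. g r < Re b) \<or> (\<forall>r\<in>{r1<..<1}. g r > Re b)"
  proof (rule ccontr)
    assume "\<not> ?thesis"
    then obtain x y where xy: "x \<in> {r1<..<1}" "y \<in> {r1<..<1}" "g x \<ge> Re b" "g y \<le> Re b" by (meson not_less)
    have "connected (g ` {r1<..<1})" using connected_continuous_image[OF cg] by simp
    then have "Re b \<in> g ` {r1<..<1}" using xy unfolding connected_iff_interval by blast
    then obtain x where "x \<in> {r1<..<1}" "g x = Re b" by force
    then show False using ne[of x] by simp
  qed
  have near: "eventually (\<lambda>r. r \<in> {r1<..<1}) (at_left 1)" by (rule eventually_at_left_real) fact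
  from sides show ?thesis
  proof
    assume "\<forall>r\<in>{r1<..<1}. g r < Re b"
    with near show ?thesis unfolding g_def by (auto elim: eventually_mono)
  next
    assume "\<forall>r\<in>{r1<..<1}. g r > Re b"
    with near show ?thesis unfolding g_def by (intro disjI2) (auto elim: eventually_mono)
  qed
qed

lemma lip_set_avoids_compact:
  assumes l: "lip bs t b" "lands t b" "\<bar>Im b\<bar> < V"
    and K: "compact K" "K \<subseteq> ball 0 1" "\<And>z. z \<in> K \<Longrightarrow> \<bar>Im (f z)\<bar> < V"
  shows "eventually (\<lambda>r. lip_set V (f (of_real r * cis t)) \<inter> f ` K = {}) (at_left 1)"
proof -
  have b: "b \<notin> f ` ball 0 1" using l by (simp add: lands_def)
  have sub: "(\<lambda>y. Complex (Re b) y) ` {Im b..V} \<subseteq> half_ray b"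
  proof clarify
    fix y assume "y \<in> {Im b..V}"
    then show "Complex (Re b) y \<in> half_ray b" unfolding half_ray_def lip_direction(1)[OF l(1)]
      by (intro image_eqI[of _ _ "y - Im b"]) (auto simp: complex_eq_iff)
  qed
  have "compact (f ` K)" using K continuous_on_subset[OF cont] by (intro compact_continuous_image) auto
  then have "eventually (\<lambda>r. f ` K \<inter> (\<lambda>y. Complex (Re (f (of_real r * cis t))) y) ` {Im (f (of_real r * cis t))..V} = {}) (at_left 1)"
  proof (rule lip_vertical_clear[OF l(2) compact_imp_closed])
    show "f ` K \<inter> (\<lambda>y. Complex (Re b) y) ` {Im b..V} = {}"
      using half_ray_disjoint[OF b] sub image_mono[OF K(2), of f] by blast
  qed
  then show ?thesis
  proof eventually_elim
    case (elim r)
    have "horizontal (-1) (Complex (Re (f (of_real r * cis t))) V) \<inter> f ` K = {}"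
      using horizontal_left[of _ "Complex (Re (f (of_real r * cis t))) V"] K(3) by fastforce
    then show ?case using elim unfolding lip_set_def by blast
  qed
qed

text \<open>If \<open>b'\<close> is not on the vertical segment over \<open>b\<close>, the tail at
  \<open>t'\<close> with its landing point keeps a positive distance from that segment. If it is,
  the radius at \<open>t'\<close> must come from the right, because otherwise \<open>b'\<close>
  would itself be a lip; only a compact part of its tail can then be to the left of the line through
  \<open>bs\<close>, where the lip set runs. An upward escape route stays on or to the right of this
  line, and a slanted one is kept away by \<open>rays_meet\<close> and
  \<open>ray_side_of_vertical\<close>.\<close>

lemma lip_set_avoids_landing:
  assumes l: "lip bs t b" "lands t b" "\<bar>Im b\<bar> < V"
    and l': "lands t' b'" "\<not> onL bs t' b'" "\<bar>Im b'\<bar> < V"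
    and \<rho>: "0 < \<rho>" "\<rho> < 1" and V: "\<And>z. z \<in> radial_tail \<rho> t' \<Longrightarrow> \<bar>Im (f z)\<bar> < V"
  shows "eventually (\<lambda>r. lip_set V (f (of_real r * cis t)) \<inter> (f ` radial_tail \<rho> t' \<union> escape 1 V b') = {}) (at_left 1)"
proof -
  let ?p = "\<lambda>r. f (of_real r * cis t)"
  let ?vert = "\<lambda>p. (\<lambda>y. Complex (Re p) y) ` {Im p..V}"
  have b: "b \<notin> f ` ball 0 1" "b' \<notin> f ` ball 0 1" using l l' by (auto simp: lands_def)
  have bs: "bs \<notin> f ` ball 0 1" "d bs = \<i>" "Re b = Re bs" "Im b > Im bs"
    and left: "eventually (\<lambda>r. Re (?p r) < Re bs) (at_left 1)" using l by (auto simp: lip_def)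
  have db: "d b = \<i>" using lip_direction[OF l(1)] by simp
  have ty': "Re (d b') > 0 \<or> d b' = \<i> \<and> Re b' \<ge> Re bs" "d b' = \<i> \<Longrightarrow> \<not> lip bs t' b'"
    using l'(2) vertical_direction[OF b(2)] by (auto simp: onL_def)
  have sub: "?vert b \<subseteq> half_ray b"
  proof clarify
    fix y assume "y \<in> {Im b..V}"
    then show "Complex (Re b) y \<in> half_ray b" unfolding half_ray_def db
      by (intro image_eqI[of _ _ "y - Im b"]) (auto simp: complex_eq_iff)
  qed
  have hor: "w \<in> horizontal (-1) (Complex (Re p) V) \<Longrightarrow> Im w = V \<and> Re w \<le> Re p" for w p
    using horizontal_left[of w "Complex (Re p) V"] by simp
  have tail: "eventually (\<lambda>r. f ` radial_tail \<rho> t' \<inter> ?vert (?p r) = {}) (at_left 1)"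
  proof (cases "b' \<in> ?vert b")
    case False
    have "eventually (\<lambda>r. insert b' (f ` radial_tail \<rho> t') \<inter> ?vert (?p r) = {}) (at_left 1)"
    proof (rule lip_vertical_clear[OF l(2)])
      show "closed (insert b' (f ` radial_tail \<rho> t'))"
        using compact_landing_tail[OF l'(1) \<rho>] by (simp add: compact_imp_closed)
      show "insert b' (f ` radial_tail \<rho> t') \<inter> ?vert b = {}"
        using False sub half_ray_disjoint[OF b(1)] radial_tail_subset[OF \<rho>(1), of t'] by blast
    qed
    then show ?thesis by eventually_elim auto
  next
    case True
    then have b'': "Re b' = Re bs" "Im b' > Im bs" using bs by auto
    have "b' \<in> half_ray b" using True sub by blast
    then have db': "d b' = \<i>" using rays_meet[OF b, of b'] db path_connected_escape(2)[OF b(2) l'(3)]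
      d_ray[OF b(1)] by (auto simp: half_ray_def)
    \<comment> \<open>Near \<open>b'\<close> the vertical line belongs to the ray at
      \<open>bs\<close>, which the disk image avoids.\<close>
    have "eventually (\<lambda>r. Re (f (of_real r * cis t')) < Re b') (at_left 1) \<or>
      eventually (\<lambda>r. Re (f (of_real r * cis t')) > Re b') (at_left 1)"
    proof (rule eventually_Re_less_of_avoids[OF l'(1), of "Im b' - Im bs"])
      fix w assume w: "dist w b' < Im b' - Im bs" "Re w = Re b'"
      have "\<bar>Im (w - b')\<bar> \<le> dist w b'" unfolding dist_norm by (rule abs_Im_le_cmod)
      then have "Im w > Im bs" using w by simp
      then have "w = bs + of_real (Im w - Im bs) * d bs" using w b'' bs by (auto simp: complex_eq_iff)
      then show "w \<notin> f ` ball 0 1" using ray[OF bs(1), of "Im w - Im bs"] \<open>Im w > Im bs\<close> by simp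
    qed (use b'' in simp)
    then have "eventually (\<lambda>r. Re (f (of_real r * cis t')) > Re bs) (at_left 1)"
      using ty'(2)[OF db'] bs b'' unfolding lip_def by auto
    then obtain r2 where r2: "r2 < 1" "\<And>r. \<lbrakk>r2 < r; r < 1\<rbrakk> \<Longrightarrow> Re (f (of_real r * cis t')) > Re bs"
      unfolding eventually_at_left_field by blast
    define K where "K = (\<lambda>r. of_real r * cis t') ` {\<rho>..max \<rho> r2}"
    have K: "compact K" unfolding K_def by (intro compact_continuous_image continuous_intros) auto
    have Ks: "K \<subseteq> ball 0 1" "K \<subseteq> radial_tail \<rho> t'" using \<rho> r2 by (auto simp: K_def norm_mult radial_tail_def)
    have "eventually (\<lambda>r. lip_set V (?p r) \<inter> f ` K = {}) (at_left 1)"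
      using lip_set_avoids_compact[OF l K Ks(1)] V Ks by blast
    then show ?thesis using left
    proof eventually_elim
      case (elim r)
      have "z \<in> K" if z: "z \<in> radial_tail \<rho> t'" "Re (f z) \<le> Re bs" for z
      proof -
        obtain x where x: "z = of_real x * cis t'" "\<rho> \<le> x" "x < 1" using z(1) by (auto simp: radial_tail_def)
        then have "x \<le> r2" using r2(2)[of x] z(2) by (auto simp: not_less[symmetric])
        then show ?thesis using x by (auto simp: K_def)
      qed
      then show ?case using elim unfolding lip_set_def by fastforce
    qed
  qed
  have esc: "eventually (\<lambda>r. escape 1 V b' \<inter> lip_set V (?p r) = {}) (at_left 1)"
  proof (cases "d b' = \<i>")
    case True
    show ?thesis using left
    proof eventually_elim
      case (elim r)
      have "Re w \<ge> Re bs" if "w \<in> escape 1 V b'" for w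
        using escape_Re[OF b(2), of 1 w V] that ty' True by simp
      moreover have "Re w \<le> Re (?p r)" if "w \<in> lip_set V (?p r)" for w
        using that hor[of w "?p r"] by (auto simp: lip_set_def)
      ultimately show ?case using elim by fastforce
    qed
  next
    case False
    then have pos: "Re (d b') > 0" using ty' by simp
    then have esc: "escape 1 V b' = half_ray b'" by (simp add: escape_def)
    have "half_ray b' \<inter> ?vert b = {}"
      using rays_meet[OF b] sub db False by fastforce
    then have "eventually (\<lambda>r. half_ray b' \<inter> ?vert (?p r) = {}) (at_left 1)"
      by (rule lip_vertical_clear[OF l(2) closed_half_ray[OF b(2)]])
    then show ?thesis using left
    proof eventually_elim
      case (elim r)
      have False if "w \<in> half_ray b'" "w \<in> horizontal (-1) (Complex (Re (?p r)) V)" for w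
      proof -
        have "(Re w - Re b) * Re (d b') > 0"
          using ray_side_of_vertical[OF b(1), of 1 b' V w] db b l l' pos that hor[of w "?p r"] by simp
        moreover have "Re w < Re b" using hor[OF that(2)] elim bs by simp
        ultimately show False using pos by (simp add: zero_less_mult_iff)
      qed
      then show ?case using elim unfolding lip_set_def esc by blast
    qed
  qed
  have "eventually (\<lambda>r. horizontal (-1) (Complex (Re (?p r)) V) \<inter> f ` radial_tail \<rho> t' = {}) (at_left 1)"
    using hor V by (intro always_eventually) fastforce
  then show ?thesis using tail esc
    by eventually_elim (auto simp: lip_set_def)
qed

text \<open>The two ways in which an arm can be continued to infinity on the right. Either it
  contains a point with \<open>Re f > hi\<close>, and can leave horizontally from there, even
  through the disk image, since the left arms stay in \<open>Re f \<le> hi\<close>. Or it arrives at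
  a radius whose landing point is of the right type; \<open>T\<close> is then the rest of that
  radius.\<close>

definition R_end :: "real \<Rightarrow> complex \<Rightarrow> real \<Rightarrow> complex set \<Rightarrow> complex set \<Rightarrow> bool" where
  "R_end \<rho> bs hi Q T \<longleftrightarrow> (T = {} \<and> (\<exists>z\<in>Q. hi < Re (f z))) \<or>
     (\<exists>t b. lands t b \<and> \<not> onL bs t b \<and> of_real \<rho> * cis t \<in> Q \<and> T = radial_tail \<rho> t)"

definition L_end :: "real \<Rightarrow> complex \<Rightarrow> real \<Rightarrow> complex set \<Rightarrow> complex set \<Rightarrow> bool" where
  "L_end \<rho> bs lo P T \<longleftrightarrow> (T = {} \<and> (\<exists>z\<in>P. Re (f z) < lo)) \<or>
     (\<exists>t b. lands t b \<and> onL bs t b \<and> of_real \<rho> * cis t \<in> P \<and> T = radial_tail \<rho> t)"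

definition R_connector :: "real \<Rightarrow> complex \<Rightarrow> real \<Rightarrow> real \<Rightarrow> complex set \<Rightarrow> complex set \<Rightarrow> complex set \<Rightarrow> bool" where
  "R_connector \<rho> bs hi V Q T C \<longleftrightarrow> (T = {} \<and> (\<exists>z\<in>Q. hi < Re (f z) \<and> C = horizontal 1 (f z))) \<or>
     (\<exists>t b. lands t b \<and> \<not> onL bs t b \<and> \<bar>Im b\<bar> < V \<and> of_real \<rho> * cis t \<in> Q \<and> T = radial_tail \<rho> t \<and> C = escape 1 V b)"

lemma landing_abs_Im_le:
  assumes "lands t b" "0 < \<rho>" "\<rho> < 1" "\<And>z. z \<in> radial_tail \<rho> t \<Longrightarrow> \<bar>Im (f z)\<bar> \<le> V"
  shows "\<bar>Im b\<bar> \<le> V"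
  by (rule landing_le[OF assms(1-3), of "\<lambda>w. \<bar>Im w\<bar>"]) (use assms(4) in \<open>auto intro!: continuous_intros\<close>)

lemma R_connector_exists:
  assumes R: "R_end \<rho> bs hi Q T" and \<rho>: "0 < \<rho>" "\<rho> < 1"
    and V: "V' < V" "\<And>z. z \<in> T \<Longrightarrow> \<bar>Im (f z)\<bar> \<le> V'"
  obtains C where "R_connector \<rho> bs hi V Q T C"
  using R unfolding R_end_def
proof (elim disjE conjE exE bexE)
  fix z assume "T = {}" "z \<in> Q" "hi < Re (f z)"
  then show thesis using that[of "horizontal 1 (f z)"] unfolding R_connector_def by blast
next
  fix t b assume t: "lands t b" "\<not> onL bs t b" "of_real \<rho> * cis t \<in> Q" "T = radial_tail \<rho> t"
  then have "\<bar>Im b\<bar> \<le> V'" using landing_abs_Im_le[OF t(1) \<rho>] V by blast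
  then have "\<bar>Im b\<bar> < V" using V by simp
  then show thesis using that[of "escape 1 V b"] t unfolding R_connector_def by blast
qed

lemma not_onL_Re: "\<lbrakk>lands t b; \<not> onL bs t b\<rbrakk> \<Longrightarrow> Re (d b) \<ge> 0"
  by (auto simp: onL_def)

lemma onL_Re: "\<lbrakk>onL bs t b\<rbrakk> \<Longrightarrow> Re (d b) \<le> 0"
  by (auto simp: onL_def)

lemma path_connected_arm:
  assumes l: "lands t b" and \<rho>: "0 < \<rho>" "\<rho> < 1" and V: "\<bar>Im b\<bar> < V"
    and P: "path_connected P" "P \<subseteq> ball 0 1" "of_real \<rho> * cis t \<in> P"
  shows "path_connected (f ` (P \<union> radial_tail \<rho> t) \<union> escape \<sigma> V b)"
proof -
  have b: "b \<notin> f ` ball 0 1" using l by (simp add: lands_def)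
  have 1: "path_connected (f ` P)"
    using P continuous_on_subset[OF cont] by (intro path_connected_continuous_image) auto
  have "of_real \<rho> * cis t \<in> radial_tail \<rho> t" unfolding radial_tail_def using \<rho> by auto
  then have 2: "path_connected (f ` P \<union> insert b (f ` radial_tail \<rho> t))"
    using P(3) by (intro path_connected_Un[OF 1 compact_landing_tail(2)[OF l \<rho>]]) blast
  have "path_connected ((f ` P \<union> insert b (f ` radial_tail \<rho> t)) \<union> escape \<sigma> V b)"
    using path_connected_escape[OF b V] by (intro path_connected_Un[OF 2]) auto
  moreover have "(f ` P \<union> insert b (f ` radial_tail \<rho> t)) \<union> escape \<sigma> V b = f ` (P \<union> radial_tail \<rho> t) \<union> escape \<sigma> V b"
    using path_connected_escape(2)[OF b V] by blast
  ultimately show ?thesis by simp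
qed

lemma R_connector_props:
  assumes C: "R_connector \<rho> bs hi V Q T C" and \<rho>: "0 < \<rho>" "\<rho> < 1"
    and Q: "path_connected Q" "Q \<subseteq> ball 0 1"
    and lo: "\<And>z. z \<in> Q \<union> T \<Longrightarrow> lo \<le> Re (f z)" "lo \<le> hi"
  shows "path_connected (f ` (Q \<union> T) \<union> C)" "\<exists>w\<in>C. Re w > M" "\<And>w. w \<in> C \<Longrightarrow> lo \<le> Re w"
    "\<And>S. \<lbrakk>S \<subseteq> ball 0 1; \<And>z. z \<in> S \<Longrightarrow> Re (f z) \<le> hi \<and> \<bar>Im (f z)\<bar> < V\<rbrakk> \<Longrightarrow> C \<inter> f ` S = {}"
proof -
  have *: "path_connected (f ` (Q \<union> T) \<union> C) \<and> (\<exists>w\<in>C. Re w > M) \<and> (\<forall>w\<in>C. lo \<le> Re w) \<and>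
    (\<forall>S \<subseteq> ball 0 1. (\<forall>z\<in>S. Re (f z) \<le> hi \<and> \<bar>Im (f z)\<bar> < V) \<longrightarrow> C \<inter> f ` S = {})"
    using C unfolding R_connector_def
  proof (elim disjE conjE exE bexE)
    fix z assume z: "T = {}" "z \<in> Q" "hi < Re (f z)" "C = horizontal 1 (f z)"
    have "path_connected (f ` Q)"
      using Q continuous_on_subset[OF cont] by (intro path_connected_continuous_image) auto
    then have "path_connected (f ` (Q \<union> T) \<union> C)"
      unfolding z using start_in_horizontal[of "f z" 1] z(2)
      by (auto intro!: path_connected_Un path_connected_horizontal)
    moreover have "\<exists>w\<in>C. Re w > M" using horizontal_reaches[of 1 "f z" M] z by simp
    moreover have "Re w > hi" if "w \<in> C" for w using horizontal_right that z by fastforce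
    then have "\<forall>w\<in>C. lo \<le> Re w" "\<forall>S. (\<forall>z\<in>S. Re (f z) \<le> hi \<and> \<bar>Im (f z)\<bar> < V) \<longrightarrow> C \<inter> f ` S = {}"
      using lo(2) by fastforce+
    ultimately show ?thesis by simp
  next
    fix t b assume t: "lands t b" "\<not> onL bs t b" "\<bar>Im b\<bar> < V" "of_real \<rho> * cis t \<in> Q" "T = radial_tail \<rho> t" "C = escape 1 V b"
    have b: "b \<notin> f ` ball 0 1" using t by (simp add: lands_def)
    have d: "1 * Re (d b) \<ge> 0" using not_onL_Re t by simp
    have "lo \<le> Re b"
      using landing_le[OF t(1) \<rho> continuous_on_minus[OF continuous_on_Re[OF continuous_on_id]], of "- lo"] lo(1) t(5) by simp
    then have "lo \<le> Re w" if "w \<in> C" for w using escape_Re[OF b d, of w V] that t by simp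
    moreover have "path_connected (f ` (Q \<union> T) \<union> C)"
      unfolding t by (rule path_connected_arm[OF t(1) \<rho> t(3) Q t(4)])
    moreover have "\<exists>w\<in>C. Re w > M" using escape_reaches[OF b d, of V M] t by simp
    moreover have "C \<inter> f ` S = {}" if "S \<subseteq> ball 0 1" "\<forall>z\<in>S. Re (f z) \<le> hi \<and> \<bar>Im (f z)\<bar> < V" for S
      unfolding t by (rule escape_disjoint_image[OF b t(3) that(1)]) (use that(2) in auto)
    ultimately show ?thesis by simp
  qed
  show "path_connected (f ` (Q \<union> T) \<union> C)" "\<exists>w\<in>C. Re w > M" "\<And>w. w \<in> C \<Longrightarrow> lo \<le> Re w"
    "\<And>S. \<lbrakk>S \<subseteq> ball 0 1; \<And>z. z \<in> S \<Longrightarrow> Re (f z) \<le> hi \<and> \<bar>Im (f z)\<bar> < V\<rbrakk> \<Longrightarrow> C \<inter> f ` S = {}"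
    using * by simp_all
qed

text \<open>The left connector of a lip leaves the disk image just before the landing point, so it
  depends on a parameter \<^term>\<open>r\<close> and avoids a given right connector only for \<^term>\<open>r\<close> close to 1.\<close>
lemma L_connector_exists:
  assumes L: "L_end \<rho> bs lo P T" and \<rho>: "0 < \<rho>" "\<rho> < 1"
    and P: "path_connected P" "P \<subseteq> cball 0 \<rho>"
    and V: "V' < V" "\<And>z. z \<in> P \<union> T \<Longrightarrow> \<bar>Im (f z)\<bar> \<le> V'"
    and hi: "\<And>z. z \<in> P \<union> T \<Longrightarrow> Re (f z) \<le> hi" "lo \<le> hi"
    and z0: "z0 \<in> cball 0 \<rho>" "lo \<le> Re (f z0)" and V\<rho>: "\<And>z. z \<in> cball 0 \<rho> \<Longrightarrow> \<bar>Im (f z)\<bar> < V"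
  obtains B C where
    "\<And>r. \<lbrakk>\<rho> \<le> r; r < 1\<rbrakk> \<Longrightarrow> P \<subseteq> B r \<and> B r \<subseteq> P \<union> T \<and> path_connected (f ` B r \<union> C r) \<and> (\<exists>w\<in>C r. Re w < - M) \<and> (\<forall>w\<in>C r. Re w \<le> hi)"
    "eventually (\<lambda>r. f z0 \<notin> C r) (at_left 1)"
    "\<And>Q T' E. \<lbrakk>R_connector \<rho> bs hi V Q T' E; Q \<subseteq> cball 0 \<rho>; path_connected Q; \<And>z. z \<in> Q \<union> T' \<Longrightarrow> lo \<le> Re (f z) \<and> \<bar>Im (f z)\<bar> < V\<rbrakk>
       \<Longrightarrow> eventually (\<lambda>r. C r \<inter> (f ` (Q \<union> T') \<union> E) = {}) (at_left 1)"
proof -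
  note ob = that
  have \<rho>b: "cball (0::complex) \<rho> \<subseteq> ball 0 1" using \<rho> by auto
  have fP: "path_connected (f ` P)"
    using P \<rho>b continuous_on_subset[OF cont] by (intro path_connected_continuous_image) (auto intro: order_trans)
  have QT: "Q \<union> T' \<subseteq> ball 0 1" if "R_connector \<rho> bs hi V Q T' E" "Q \<subseteq> cball 0 \<rho>" for Q T' E
    using that \<rho>b radial_tail_subset[OF \<rho>(1)] unfolding R_connector_def by blast
  from L show thesis unfolding L_end_def
  proof (elim disjE conjE exE bexE)
    fix z assume z: "T = {}" "z \<in> P" "Re (f z) < lo"
    let ?C = "horizontal (-1) (f z)"
    have C: "Re w < lo" if "w \<in> ?C" for w using horizontal_left[OF that] z by simp
    show thesis
    proof (rule ob[of "\<lambda>r. P" "\<lambda>r. ?C"])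
      fix r
      have "path_connected (f ` P \<union> ?C)"
        using start_in_horizontal[of "f z" "-1"] z(2) by (intro path_connected_Un fP path_connected_horizontal) blast
      moreover have "\<exists>w\<in>?C. Re w < - M" using horizontal_reaches[of "-1" "f z" M] by (simp add: less_minus_iff)
      ultimately show "P \<subseteq> P \<and> P \<subseteq> P \<union> T \<and> path_connected (f ` P \<union> ?C) \<and> (\<exists>w\<in>?C. Re w < - M) \<and> (\<forall>w\<in>?C. Re w \<le> hi)"
        using C hi(2) by fastforce
    next
      show "eventually (\<lambda>r. f z0 \<notin> ?C) (at_left 1)" using C[of "f z0"] z0 by (intro always_eventually allI notI) fastforce
    next
      fix Q T' E assume R: "R_connector \<rho> bs hi V Q T' E" "Q \<subseteq> cball 0 \<rho>" "path_connected Q" "\<And>z. z \<in> Q \<union> T' \<Longrightarrow> lo \<le> Re (f z) \<and> \<bar>Im (f z)\<bar> < V"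
      have "Q \<subseteq> ball 0 1" using R(2) \<rho>b by (rule order_trans)
      then have E: "lo \<le> Re w" if "w \<in> E" for w
        using R_connector_props(3)[OF R(1) \<rho> R(3) _ _ hi(2) that] R(4) by blast
      have "lo \<le> Re w" if "w \<in> f ` (Q \<union> T') \<union> E" for w
        using that
      proof
        assume "w \<in> f ` (Q \<union> T')"
        then obtain z where "z \<in> Q \<union> T'" "w = f z" by (rule imageE)
        then show ?thesis using R(4)[of z] by simp
      qed (rule E)
      then show "eventually (\<lambda>r. ?C \<inter> (f ` (Q \<union> T') \<union> E) = {}) (at_left 1)"
        using C by (intro always_eventually) fastforce
    qed
  next
    fix t b assume t: "lands t b" "onL bs t b" "of_real \<rho> * cis t \<in> P" "T = radial_tail \<rho> t"
    have b: "b \<notin> f ` ball 0 1" using t by (simp add: lands_def)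
    have "\<bar>Im b\<bar> \<le> V'" using landing_abs_Im_le[OF t(1) \<rho>] V t by blast
    then have Vb: "\<bar>Im b\<bar> < V" using V by simp
    have hib: "Re b \<le> hi"
      using landing_le[OF t(1) \<rho> continuous_on_Re[OF continuous_on_id], of hi] hi(1) t(4) by simp
    show thesis
    proof (cases "lip bs t b")
      case False
      let ?C = "escape (-1) V b"
      have db: "-1 * Re (d b) \<ge> 0" using onL_Re[OF t(2)] by simp
      have C: "Re w \<le> Re b" if "w \<in> ?C" for w using escape_Re[OF b db that] by simp
      show thesis
      proof (rule ob[of "\<lambda>r. P \<union> T" "\<lambda>r. ?C"])
        fix r
        have "path_connected (f ` (P \<union> T) \<union> ?C)"
          unfolding t by (rule path_connected_arm[OF t(1) \<rho> Vb P(1) _ t(3)]) (use P \<rho>b in auto)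
        moreover have "\<exists>w\<in>?C. Re w < - M" using escape_reaches[OF b db, of V M] by (simp add: less_minus_iff)
        ultimately show "P \<subseteq> P \<union> T \<and> P \<union> T \<subseteq> P \<union> T \<and> path_connected (f ` (P \<union> T) \<union> ?C) \<and> (\<exists>w\<in>?C. Re w < - M) \<and> (\<forall>w\<in>?C. Re w \<le> hi)"
          using C hib by fastforce
      next
        have "?C \<inter> f ` {z0} = {}" by (rule escape_disjoint_image[OF b Vb]) (use z0 \<rho>b V\<rho> in auto)
        then show "eventually (\<lambda>r. f z0 \<notin> ?C) (at_left 1)" by auto
      next
        fix Q T' E assume R: "R_connector \<rho> bs hi V Q T' E" "Q \<subseteq> cball 0 \<rho>" "path_connected Q" "\<And>z. z \<in> Q \<union> T' \<Longrightarrow> lo \<le> Re (f z) \<and> \<bar>Im (f z)\<bar> < V"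
        have "?C \<inter> f ` (Q \<union> T') = {}"
          by (rule escape_disjoint_image[OF b Vb QT[OF R(1,2)]]) (use R in blast)
        moreover have "?C \<inter> E = {}"
          using R(1) unfolding R_connector_def
        proof (elim disjE conjE exE bexE)
          fix z assume "hi < Re (f z)" "E = horizontal 1 (f z)"
          then show ?thesis using C hib horizontal_right[of _ "f z"] by fastforce
        next
          fix t' b' assume "lands t' b'" "\<not> onL bs t' b'" "\<bar>Im b'\<bar> < V" "E = escape 1 V b'"
          then show ?thesis using escapes_disjoint[OF b t(2) False Vb] by (auto simp: lands_def)
        qed
        ultimately show "eventually (\<lambda>r. ?C \<inter> (f ` (Q \<union> T') \<union> E) = {}) (at_left 1)"
          by (intro always_eventually) blast
      qed
    next
      case True
      let ?p = "\<lambda>r. f (of_real r * cis t)"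
      let ?C = "\<lambda>r. lip_set V (?p r)"
      \<comment> \<open>The arm is continued along its radius only up to \<open>r\<close>, and the
        lip set takes over at the end of this piece.\<close>
      let ?S = "\<lambda>r. (\<lambda>x. of_real x * cis t) ` {\<rho>..r}"
      have lipset: "Re w \<le> Re p" if "w \<in> lip_set V p" for w p
        using that horizontal_left[of w "Complex (Re p) V"] by (auto simp: lip_set_def)
      show thesis
      proof (rule ob[of "\<lambda>r. P \<union> ?S r" ?C])
        fix r assume r: "\<rho> \<le> r" "r < 1"
        have ST: "?S r \<subseteq> T" unfolding t radial_tail_def using r by auto
        have "of_real r * cis t \<in> ?S r" "of_real \<rho> * cis t \<in> ?S r" using r by auto
        note rS = this
        then have "of_real r * cis t \<in> P \<union> T" using ST by blast
        then have p: "Re (?p r) \<le> hi" "Im (?p r) \<le> V" using hi(1) V(1) V(2)[of "of_real r * cis t"] by auto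
        have "path_connected (f ` ?S r)"
        proof (rule path_connected_continuous_image)
          show "continuous_on (?S r) f" using cont ST radial_tail_subset[OF \<rho>(1), of t] t(4)
            by (auto intro: continuous_on_subset)
          show "path_connected (?S r)"
            by (intro path_connected_continuous_image continuous_intros) (simp add: convex_imp_path_connected)
        qed
        then have "path_connected (f ` P \<union> f ` ?S r)"
          using rS t(3) by (intro path_connected_Un[OF fP]) blast+
        then have "path_connected ((f ` P \<union> f ` ?S r) \<union> ?C r)"
        proof (rule path_connected_Un)
          show "path_connected (?C r)" by (rule path_connected_lip_set[OF p(2)])
          show "(f ` P \<union> f ` ?S r) \<inter> ?C r \<noteq> {}" using rS path_connected_lip_set(2)[OF p(2)] by blast
        qed
        then have "path_connected (f ` (P \<union> ?S r) \<union> ?C r)" by (simp add: image_Un)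
        moreover have "\<exists>w\<in>?C r. Re w < - M"
          using horizontal_reaches[of "-1" "Complex (Re (?p r)) V" M] unfolding lip_set_def bex_Un by (simp add: less_minus_iff)
        ultimately show "P \<subseteq> P \<union> ?S r \<and> P \<union> ?S r \<subseteq> P \<union> T \<and> path_connected (f ` (P \<union> ?S r) \<union> ?C r) \<and> (\<exists>w\<in>?C r. Re w < - M) \<and> (\<forall>w\<in>?C r. Re w \<le> hi)"
          using ST lipset p(1) by fastforce
      next
        have "eventually (\<lambda>r. ?C r \<inter> f ` {z0} = {}) (at_left 1)"
          by (rule lip_set_avoids_compact[OF True t(1) Vb]) (use z0 \<rho>b V\<rho> in auto)
        then show "eventually (\<lambda>r. f z0 \<notin> ?C r) (at_left 1)" by simp
      next
        fix Q T' E assume R: "R_connector \<rho> bs hi V Q T' E" "Q \<subseteq> cball 0 \<rho>" "path_connected Q" "\<And>z. z \<in> Q \<union> T' \<Longrightarrow> lo \<le> Re (f z) \<and> \<bar>Im (f z)\<bar> < V"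
        have Kev: "eventually (\<lambda>r. ?C r \<inter> f ` cball 0 \<rho> = {}) (at_left 1)"
          by (rule lip_set_avoids_compact[OF True t(1) Vb]) (use \<rho>b V\<rho> in auto)
        show "eventually (\<lambda>r. ?C r \<inter> (f ` (Q \<union> T') \<union> E) = {}) (at_left 1)"
          using R(1) unfolding R_connector_def
        proof (elim disjE conjE exE bexE)
          fix z assume z: "T' = {}" "hi < Re (f z)" "E = horizontal 1 (f z)"
          show ?thesis using Kev eventually_at_left_real[OF \<rho>(2)]
          proof eventually_elim
            case (elim r)
            have "of_real r * cis t \<in> T" unfolding t radial_tail_def using elim by auto
            then have "Re (?p r) \<le> hi" using hi(1) by blast
            then have "Re w \<le> hi" if "w \<in> ?C r" for w using lipset[OF that] by simp
            moreover have "hi < Re w" if "w \<in> E" for w using horizontal_right that z by fastforce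
            ultimately have "?C r \<inter> E = {}" by fastforce
            moreover have "?C r \<inter> f ` Q = {}" using elim(1) image_mono[OF R(2), of f] by blast
            ultimately show ?case unfolding z(1) Un_empty_right Int_Un_distrib by simp
          qed
        next
          fix t' b' assume t': "lands t' b'" "\<not> onL bs t' b'" "\<bar>Im b'\<bar> < V" "T' = radial_tail \<rho> t'" "E = escape 1 V b'"
          have "eventually (\<lambda>r. ?C r \<inter> (f ` radial_tail \<rho> t' \<union> escape 1 V b') = {}) (at_left 1)"
            using R(4) t' by (intro lip_set_avoids_landing[OF True t(1) Vb t'(1-3) \<rho>]) blast
          then show ?thesis using Kev
          proof eventually_elim
            case (elim r)
            have "?C r \<inter> f ` Q = {}" using elim(2) image_mono[OF R(2), of f] by blast
            then show ?case using elim(1) unfolding t'(4,5) image_Un Int_Un_distrib by simp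
          qed
        qed
      qed
    qed
  qed
qed

text \<open>\<open>X\<close> consists of the images of the left arms, their connectors and a left
  half-plane far away; \<open>Y\<close> is built in the same way on the right. The levels
  \<open>lo\<close> and \<open>hi\<close> separate the connectors that start inside the disk image
  from the opposite arms, and the properties of the other connectors do the rest. The four segments
  at \<open>z0\<close> then contradict \<open>no_alternating_segments\<close>.\<close>

theorem no_alternating_arms:
  assumes \<rho>: "0 < \<rho>" "\<rho> < 1" and s: "s > 0" "cball z0 s \<subseteq> ball 0 1"
    and a: "a1 < a2" "a2 < a3" "a3 < a4" "a4 < a1 + 2 * pi"
    and P: "path_connected P1" "path_connected P2" "path_connected P3" "path_connected P4"
      "P1 \<subseteq> cball 0 \<rho>" "P2 \<subseteq> cball 0 \<rho>" "P3 \<subseteq> cball 0 \<rho>" "P4 \<subseteq> cball 0 \<rho>" "z0 \<in> cball 0 \<rho>"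
    and seg: "\<And>t. \<lbrakk>0 < t; t \<le> s\<rbrakk> \<Longrightarrow> z0 + of_real t * cis a1 \<in> P1"
      "\<And>t. \<lbrakk>0 < t; t \<le> s\<rbrakk> \<Longrightarrow> z0 + of_real t * cis a2 \<in> P2"
      "\<And>t. \<lbrakk>0 < t; t \<le> s\<rbrakk> \<Longrightarrow> z0 + of_real t * cis a3 \<in> P3"
      "\<And>t. \<lbrakk>0 < t; t \<le> s\<rbrakk> \<Longrightarrow> z0 + of_real t * cis a4 \<in> P4"
    and ends: "L_end \<rho> bs lo P1 T1" "R_end \<rho> bs hi P2 T2" "L_end \<rho> bs lo P3 T3" "R_end \<rho> bs hi P4 T4"
    and disj: "(P1 \<union> T1 \<union> P3 \<union> T3) \<inter> (P2 \<union> T2 \<union> P4 \<union> T4) = {}"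
      "z0 \<notin> P1 \<union> T1 \<union> P3 \<union> T3" "z0 \<notin> P2 \<union> T2 \<union> P4 \<union> T4"
    and lev: "\<And>z. z \<in> P1 \<union> T1 \<union> P3 \<union> T3 \<Longrightarrow> Re (f z) \<le> hi"
      "\<And>z. z \<in> P2 \<union> T2 \<union> P4 \<union> T4 \<Longrightarrow> lo \<le> Re (f z)" "lo \<le> Re (f z0)" "Re (f z0) \<le> hi"
  shows False
proof -
  have \<rho>b: "cball (0::complex) \<rho> \<subseteq> ball 0 1" using \<rho> by auto
  have lohi: "lo \<le> hi" using lev(3,4) by simp
  have Tb: "bounded (f ` T) \<and> T \<subseteq> ball 0 1" if "L_end \<rho> bs lo P T \<or> R_end \<rho> bs hi P T" for P T
  proof -
    have "T = {} \<or> (\<exists>t b. lands t b \<and> T = radial_tail \<rho> t)" using that unfolding L_end_def R_end_def by blast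
    then show ?thesis
    proof (elim disjE exE conjE)
      fix t b assume "lands t b" "T = radial_tail \<rho> t"
      then show ?thesis using compact_landing_tail(1)[of t b \<rho>] \<rho> radial_tail_subset[OF \<rho>(1), of t]
        by (auto dest: compact_imp_bounded)
    qed simp
  qed
  note T1 = Tb[OF disjI1[OF ends(1)]] and T2 = Tb[OF disjI2[OF ends(2)]]
    and T3 = Tb[OF disjI1[OF ends(3)]] and T4 = Tb[OF disjI2[OF ends(4)]]
  have "compact (f ` cball 0 \<rho>)"
    by (intro compact_continuous_image continuous_on_subset[OF cont] \<rho>b) auto
  then have "bounded (f ` cball 0 \<rho> \<union> (f ` T1 \<union> f ` T2 \<union> f ` T3 \<union> f ` T4))"
    using T1 T2 T3 T4 by (simp add: compact_imp_bounded)
  then obtain V' where V'0: "\<forall>w \<in> f ` cball 0 \<rho> \<union> (f ` T1 \<union> f ` T2 \<union> f ` T3 \<union> f ` T4). cmod w \<le> V'"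
    unfolding bounded_iff ..
  define S where "S = cball 0 \<rho> \<union> (T1 \<union> T2 \<union> T3 \<union> T4)"
  have fS: "cmod (f z) \<le> V'" if "z \<in> S" for z
  proof -
    have "f z \<in> f ` cball 0 \<rho> \<union> (f ` T1 \<union> f ` T2 \<union> f ` T3 \<union> f ` T4)" using that unfolding S_def by blast
    then show ?thesis by (rule bspec[OF V'0])
  qed
  have sub: "P1 \<union> T1 \<subseteq> S" "P2 \<union> T2 \<subseteq> S" "P3 \<union> T3 \<subseteq> S" "P4 \<union> T4 \<subseteq> S" using P unfolding S_def by auto
  have Sb: "S \<subseteq> ball 0 1" using T1 T2 T3 T4 \<rho>b unfolding S_def by simp
  define V where "V = V' + 1"
  \<comment> \<open>Larger than all values of \<open>\<bar>Re f\<bar>\<close> on arms and tails and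
    than both levels, so that the half-planes beyond \<open>M\<close> and \<open>- M\<close> touch
    nothing of the opposite side.\<close>
  define M where "M = \<bar>V'\<bar> + \<bar>hi\<bar> + \<bar>lo\<bar> + 1"
  have VV: "V' < V" by (simp add: V_def)
  have Im: "\<bar>Im (f z)\<bar> \<le> V'" if "z \<in> S" for z using fS[OF that] abs_Im_le_cmod[of "f z"] by linarith
  have Im': "\<bar>Im (f z)\<bar> < V" if "z \<in> S" for z using Im[OF that] VV by simp
  have Re: "\<bar>Re (f z)\<bar> \<le> V'" if "z \<in> S" for z using fS[OF that] abs_Re_le_cmod[of "f z"] by linarith
  obtain E2 where E2: "R_connector \<rho> bs hi V P2 T2 E2"
    using R_connector_exists[OF ends(2) \<rho> VV] Im sub(2) by blast
  obtain E4 where E4: "R_connector \<rho> bs hi V P4 T4 E4"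
    using R_connector_exists[OF ends(4) \<rho> VV] Im sub(4) by blast
  have Pb: "P1 \<subseteq> ball 0 1" "P2 \<subseteq> ball 0 1" "P3 \<subseteq> ball 0 1" "P4 \<subseteq> ball 0 1" using sub Sb by auto
  have lo2: "lo \<le> Re (f z)" if "z \<in> P2 \<union> T2" for z using lev(2) that by blast
  have lo4: "lo \<le> Re (f z)" if "z \<in> P4 \<union> T4" for z using lev(2) that by blast
  note R2 = R_connector_props[OF E2 \<rho> P(2) Pb(2) lo2 lohi] and R4 = R_connector_props[OF E4 \<rho> P(4) Pb(4) lo4 lohi]
  have hi1: "Re (f z) \<le> hi" if "z \<in> P1 \<union> T1" for z using lev(1) that by blast
  have hi3: "Re (f z) \<le> hi" if "z \<in> P3 \<union> T3" for z using lev(1) that by blast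
  have Im\<rho>: "\<bar>Im (f z)\<bar> < V" if "z \<in> cball 0 \<rho>" for z using Im' that unfolding S_def by blast
  have Im1: "\<forall>z\<in>P1 \<union> T1. \<bar>Im (f z)\<bar> \<le> V'" "\<forall>z\<in>P1 \<union> T1. Re (f z) \<le> hi" using Im sub(1) hi1 by blast+
  have Im3: "\<forall>z\<in>P3 \<union> T3. \<bar>Im (f z)\<bar> \<le> V'" "\<forall>z\<in>P3 \<union> T3. Re (f z) \<le> hi" using Im sub(3) hi3 by blast+
  have lv2: "lo \<le> Re (f z) \<and> \<bar>Im (f z)\<bar> < V" if "z \<in> P2 \<union> T2" for z using lo2[OF that] Im' sub(2) that by blast
  have lv4: "lo \<le> Re (f z) \<and> \<bar>Im (f z)\<bar> < V" if "z \<in> P4 \<union> T4" for z using lo4[OF that] Im' sub(4) that by blast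
  have X: "\<exists>B C. P \<subseteq> B \<and> B \<subseteq> P \<union> T \<and> path_connected (f ` B \<union> C) \<and> (\<exists>w\<in>C. Re w < - M) \<and> (\<forall>w\<in>C. Re w \<le> hi) \<and> f z0 \<notin> C
      \<and> C \<inter> (f ` (P2 \<union> T2) \<union> E2) = {} \<and> C \<inter> (f ` (P4 \<union> T4) \<union> E4) = {}"
    if L: "L_end \<rho> bs lo P T" "path_connected P" "P \<subseteq> cball 0 \<rho>" "\<forall>z\<in>P \<union> T. \<bar>Im (f z)\<bar> \<le> V'"
      "\<forall>z\<in>P \<union> T. Re (f z) \<le> hi" for P T
  proof -
    obtain B C where BC: "\<And>r. \<lbrakk>\<rho> \<le> r; r < 1\<rbrakk> \<Longrightarrow> P \<subseteq> B r \<and> B r \<subseteq> P \<union> T \<and> path_connected (f ` B r \<union> C r) \<and> (\<exists>w\<in>C r. Re w < - M) \<and> (\<forall>w\<in>C r. Re w \<le> hi)"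
      and ev0: "eventually (\<lambda>r. f z0 \<notin> C r) (at_left 1)"
      and ev: "\<And>Q T' E. \<lbrakk>R_connector \<rho> bs hi V Q T' E; Q \<subseteq> cball 0 \<rho>; path_connected Q; \<And>z. z \<in> Q \<union> T' \<Longrightarrow> lo \<le> Re (f z) \<and> \<bar>Im (f z)\<bar> < V\<rbrakk>
         \<Longrightarrow> eventually (\<lambda>r. C r \<inter> (f ` (Q \<union> T') \<union> E) = {}) (at_left 1)"
    proof (rule L_connector_exists[where M = M, OF L(1) \<rho> L(2,3) VV L(4)[rule_format] L(5)[rule_format] lohi P(9) lev(3) Im\<rho>], goal_cases)
      case (4 B C)
      show ?case by (rule 4(1)[of B C], fact 4(2), fact 4(3), rule 4(4))
    qed
    \<comment> \<open>A single \<open>r\<close> has to serve against both right connectors and the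
      point \<open>f z0\<close>; each condition holds for all \<open>r\<close> close enough to
      1.\<close>
    have "eventually (\<lambda>r. r \<in> {\<rho><..<1} \<and> f z0 \<notin> C r \<and> C r \<inter> (f ` (P2 \<union> T2) \<union> E2) = {} \<and> C r \<inter> (f ` (P4 \<union> T4) \<union> E4) = {}) (at_left 1)"
      by (intro eventually_conj ev0 ev[OF E2 P(6) P(2) lv2] ev[OF E4 P(8) P(4) lv4] eventually_at_left_real \<rho>(2))
    then have "\<exists>r. r \<in> {\<rho><..<1} \<and> f z0 \<notin> C r \<and> C r \<inter> (f ` (P2 \<union> T2) \<union> E2) = {} \<and> C r \<inter> (f ` (P4 \<union> T4) \<union> E4) = {}"
      by (rule eventually_happens'[rotated]) simp
    then obtain r where r: "r \<in> {\<rho><..<1}" "f z0 \<notin> C r" "C r \<inter> (f ` (P2 \<union> T2) \<union> E2) = {}" "C r \<inter> (f ` (P4 \<union> T4) \<union> E4) = {}"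
      by (elim exE conjE) (rule that)
    show ?thesis by (rule exI[of _ "B r"], rule exI[of _ "C r"]) (use BC[of r] r in auto)
  qed
  obtain B1 C1 where 1: "P1 \<subseteq> B1" "B1 \<subseteq> P1 \<union> T1" "path_connected (f ` B1 \<union> C1)" "\<exists>w\<in>C1. Re w < - M" "\<forall>w\<in>C1. Re w \<le> hi"
    "f z0 \<notin> C1" "C1 \<inter> (f ` (P2 \<union> T2) \<union> E2) = {}" "C1 \<inter> (f ` (P4 \<union> T4) \<union> E4) = {}"
    using X[OF ends(1) P(1,5) Im1] by (elim exE conjE) (rule that)
  obtain B3 C3 where 3: "P3 \<subseteq> B3" "B3 \<subseteq> P3 \<union> T3" "path_connected (f ` B3 \<union> C3)" "\<exists>w\<in>C3. Re w < - M" "\<forall>w\<in>C3. Re w \<le> hi"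
    "f z0 \<notin> C3" "C3 \<inter> (f ` (P2 \<union> T2) \<union> E2) = {}" "C3 \<inter> (f ` (P4 \<union> T4) \<union> E4) = {}"
    using X[OF ends(3) P(3,7) Im3] by (elim exE conjE) (rule that)
  define X where "X = (f ` B1 \<union> C1) \<union> {w. Re w < - M} \<union> (f ` B3 \<union> C3)"
  define Y where "Y = (f ` (P2 \<union> T2) \<union> E2) \<union> {w. Re w > M} \<union> (f ` (P4 \<union> T4) \<union> E4)"
  have pX: "path_connected X" unfolding X_def
    by (intro path_connected_Un 1(3) 3(3) convex_imp_path_connected convex_halfspace_Re_lt) (use 1(4) 3(4) in blast)+
  have pY: "path_connected Y" unfolding Y_def
    by (intro path_connected_Un R2(1) R4(1) convex_imp_path_connected convex_halfspace_Re_gt)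
       (use R2(2)[of M] R4(2)[of M] in blast)+
  have M: "- M < w" "w < M" if "\<bar>w\<bar> \<le> V' \<or> w = lo \<or> w = hi" for w using that by (auto simp: M_def)
  have ReB: "w \<in> f ` B1 \<union> C1 \<union> (f ` B3 \<union> C3) \<Longrightarrow> Re w \<le> hi" for w
    using 1(2,5) 3(2,5) hi1 hi3 by blast
  have ReY: "w \<in> f ` (P2 \<union> T2) \<union> E2 \<union> (f ` (P4 \<union> T4) \<union> E4) \<Longrightarrow> lo \<le> Re w" for w
    using lo2 lo4 R2(3) R4(3) by blast
  have imdis: "f ` A \<inter> f ` A' = {}" if "A \<subseteq> S" "A' \<subseteq> S" "A \<inter> A' = {}" for A A'
    using inj_on_image_Int[OF inj, of A A'] that Sb by (metis image_empty order_trans)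
  have Bd: "(B1 \<union> B3) \<inter> (P2 \<union> T2) = {}" "(B1 \<union> B3) \<inter> (P4 \<union> T4) = {}" "B1 \<union> B3 \<subseteq> S" using 1(2) 3(2) disj(1) sub by blast+
  have EB: "E2 \<inter> f ` (B1 \<union> B3) = {}" "E4 \<inter> f ` (B1 \<union> B3) = {}"
  proof -
    have *: "Re (f z) \<le> hi \<and> \<bar>Im (f z)\<bar> < V" if "z \<in> B1 \<union> B3" for z
      using that 1(2) 3(2) hi1 hi3 Im' Bd(3) by blast
    have BB: "B1 \<union> B3 \<subseteq> ball 0 1" using Bd(3) Sb by (rule order_trans)
    show "E2 \<inter> f ` (B1 \<union> B3) = {}" by (rule R2(4)) (use * BB in blast)+
    show "E4 \<inter> f ` (B1 \<union> B3) = {}" by (rule R4(4)) (use * BB in blast)+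
  qed
  have "X \<inter> Y = {}"
  proof -
    let ?XB = "f ` B1 \<union> C1 \<union> (f ` B3 \<union> C3)" and ?YB = "f ` (P2 \<union> T2) \<union> E2 \<union> (f ` (P4 \<union> T4) \<union> E4)"
    have im: "f ` (B1 \<union> B3) \<inter> f ` (P2 \<union> T2) = {}" "f ` (B1 \<union> B3) \<inter> f ` (P4 \<union> T4) = {}"
      by (rule imdis[OF Bd(3) sub(2) Bd(1)], rule imdis[OF Bd(3) sub(4) Bd(2)])
    have "?XB \<inter> ?YB = {}"
    proof -
      have "w \<notin> ?YB" if w: "w \<in> ?XB" for w
      proof -
        consider "w \<in> f ` (B1 \<union> B3)" | "w \<in> C1" | "w \<in> C3" using w unfolding image_Un by blast
        then show ?thesis
        proof cases
          case 1 then show ?thesis using im EB by blast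
        next
          case 2 then show ?thesis using \<open>C1 \<inter> (f ` (P2 \<union> T2) \<union> E2) = {}\<close> \<open>C1 \<inter> (f ` (P4 \<union> T4) \<union> E4) = {}\<close> by blast
        next
          case 3 then show ?thesis using \<open>C3 \<inter> (f ` (P2 \<union> T2) \<union> E2) = {}\<close> \<open>C3 \<inter> (f ` (P4 \<union> T4) \<union> E4) = {}\<close> by blast
        qed
      qed
      then show ?thesis by blast
    qed
    moreover have "?XB \<inter> {w. Re w > M} = {}"
    proof (rule equals0I, erule IntE)
      fix w assume "w \<in> ?XB" "w \<in> {w. Re w > M}"
      then show False using ReB[of w] M(2)[of hi] by simp
    qed
    moreover have "{w. Re w < - M} \<inter> ?YB = {}"
    proof (rule equals0I, erule IntE)
      fix w assume "w \<in> {w. Re w < - M}" "w \<in> ?YB"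
      then show False using ReY[of w] M(1)[of lo] by simp
    qed
    moreover have "{w. Re w < - M} \<inter> {w. Re w > M} = {}" using M[of lo] by auto
    ultimately have "(?XB \<union> {w. Re w < - M}) \<inter> (?YB \<union> {w. Re w > M}) = {}"
      unfolding Int_Un_distrib Int_Un_distrib2 by simp
    moreover have "X = ?XB \<union> {w. Re w < - M}" "Y = ?YB \<union> {w. Re w > M}" unfolding X_def Y_def by (simp_all only: Un_ac)
    ultimately show ?thesis by simp
  qed
  have z0S: "z0 \<in> S" "z0 \<in> ball 0 1" using P(9) \<rho>b unfolding S_def by auto
  have z0B: "f z0 \<notin> f ` A" if "A \<subseteq> S" "z0 \<notin> A" for A
    using imdis[of "{z0}" A] that z0S by blast
  have f0: "Re (f z0) \<le> hi \<and> \<bar>Im (f z0)\<bar> < V" using z0S lev(4) Im' by blast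
  have E20: "E2 \<inter> f ` {z0} = {}" by (rule R2(4)) (use f0 z0S in blast)+
  have E40: "E4 \<inter> f ` {z0} = {}" by (rule R4(4)) (use f0 z0S in blast)+
  have B0: "B1 \<subseteq> S" "B3 \<subseteq> S" "z0 \<notin> B1" "z0 \<notin> B3" using 1(2) 3(2) disj(2) sub by blast+
  have P0: "z0 \<notin> P2 \<union> T2" "z0 \<notin> P4 \<union> T4" using disj(3) by blast+
  have M0: "- M < Re (f z0)" "Re (f z0) < M" using M[of "Re (f z0)"] Re[OF z0S(1)] by blast+
  have z0X: "f z0 \<notin> X"
    using z0B[OF B0(1,3)] z0B[OF B0(2,4)] 1(6) 3(6) M0 unfolding X_def by simp
  have z0Y: "f z0 \<notin> Y"
    using z0B[OF sub(2) P0(1)] z0B[OF sub(4) P0(2)] E20 E40 M0 unfolding Y_def by simp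
  show False
  proof (rule no_alternating_segments[OF open_ball cont inj s a pX pY \<open>X \<inter> Y = {}\<close> z0X z0Y])
    fix t :: real assume "0 < t" "t \<le> s"
    note sg = seg[OF this]
    show "f (z0 + of_real t * cis a1) \<in> X" "f (z0 + of_real t * cis a3) \<in> X"
      using sg(1,3) 1(1) 3(1) unfolding X_def by blast+
    show "f (z0 + of_real t * cis a2) \<in> Y" "f (z0 + of_real t * cis a4) \<in> Y"
      using sg(2,4) unfolding Y_def by blast+
  qed
qed

text \<open>The case \<open>z0 = 0\<close> of \<open>no_alternating_arms\<close>, with the radii
  themselves as arms. A radius that lands has a bounded image, so \<open>- M\<close> and
  \<open>M\<close> can be taken as levels that enclose everything.\<close>

lemma no_alternating_landings:
  assumes t: "t1 < t2" "t2 < t3" "t3 < t4" "t4 < t1 + 2 * pi"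
    and l: "lands t1 b1" "lands t2 b2" "lands t3 b3" "lands t4 b4"
    and ty: "onL bs t1 b1" "\<not> onL bs t2 b2" "onL bs t3 b3" "\<not> onL bs t4 b4"
  shows False
proof -
  define P where "P = (\<lambda>t. (\<lambda>r. of_real r * cis t) ` {0<..1/2})"
  have tail: "P t \<union> radial_tail (1/2) t = (\<lambda>r. of_real r * cis t) ` {0<..<1}" for t
  proof -
    have "{0<..<1::real} = {0<..1/2} \<union> {1/2..<1}" by auto
    then show ?thesis by (simp add: P_def radial_tail_def image_Un)
  qed
  have pc: "path_connected (P t)" for t unfolding P_def
    by (intro path_connected_continuous_image continuous_intros) (simp add: convex_imp_path_connected)
  have Ps: "P t \<subseteq> cball 0 (1/2)" for t by (auto simp: P_def norm_mult)
  have ends: "L_end (1/2) bs lo (P t) (radial_tail (1/2) t)" if "lands t b" "onL bs t b" for t b lo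
    unfolding L_end_def by (rule disjI2, rule exI[of _ t], rule exI[of _ b]) (use that in \<open>auto simp: P_def intro!: image_eqI[of _ _ "1/2"]\<close>)
  have ends': "R_end (1/2) bs lo (P t) (radial_tail (1/2) t)" if "lands t b" "\<not> onL bs t b" for t b lo
    unfolding R_end_def by (rule disjI2, rule exI[of _ t], rule exI[of _ b]) (use that in \<open>auto simp: P_def intro!: image_eqI[of _ _ "1/2"]\<close>)
  have "bounded (f ` (P t \<union> radial_tail (1/2) t))" if "lands t b" for t b
  proof -
    have "compact (f ` cball 0 (1/2))" by (intro compact_continuous_image continuous_on_subset[OF cont]) auto
    then have "bounded (f ` P t)" using Ps by (meson bounded_subset compact_imp_bounded image_mono)
    moreover have "bounded (f ` radial_tail (1/2) t)"
      using compact_landing_tail(1)[OF that, of "1/2"] by (auto dest: compact_imp_bounded)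
    ultimately show ?thesis by (simp add: image_Un)
  qed
  note bd = this
  let ?A = "\<lambda>t. P t \<union> radial_tail (1/2) t"
  have "bounded (f ` ?A t1 \<union> f ` ?A t2 \<union> f ` ?A t3 \<union> f ` ?A t4 \<union> {f 0})"
    using bd[OF l(1)] bd[OF l(2)] bd[OF l(3)] bd[OF l(4)] by (simp only: bounded_Un) simp
  then obtain M where M: "\<forall>w \<in> f ` ?A t1 \<union> f ` ?A t2 \<union> f ` ?A t3 \<union> f ` ?A t4 \<union> {f 0}. cmod w \<le> M"
    unfolding bounded_iff ..
  have M': "- M \<le> Re (f z)" "Re (f z) \<le> M" if "z \<in> ?A t1 \<union> ?A t2 \<union> ?A t3 \<union> ?A t4 \<union> {0}" for z
  proof -
    have "f z \<in> f ` ?A t1 \<union> f ` ?A t2 \<union> f ` ?A t3 \<union> f ` ?A t4 \<union> {f 0}" using that by blast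
    then have "cmod (f z) \<le> M" by (rule bspec[OF M])
    then show "- M \<le> Re (f z)" "Re (f z) \<le> M" using abs_Re_le_cmod[of "f z"] by linarith+
  qed
  have dis: "?A t \<inter> ?A t' = {}" if "t < t'" "t' < t + 2 * pi" for t t'
  proof -
    have False if "0 < r" "0 < r'" "of_real r * cis t = of_real r' * cis t'" for r r'
      using radial_eq_iff(2)[OF that] cis_eq_period[of t t'] \<open>t < t'\<close> \<open>t' < t + 2 * pi\<close> by simp
    then show ?thesis unfolding tail by force
  qed
  have z0: "0 \<notin> ?A t" for t unfolding tail by auto
  show False
  proof (rule no_alternating_arms[of "1/2" "1/2" 0 t1 t2 t3 t4 "P t1" "P t2" "P t3" "P t4" bs "- M" "radial_tail (1/2) t1" M
        "radial_tail (1/2) t2" "radial_tail (1/2) t3" "radial_tail (1/2) t4"])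
    show "(P t1 \<union> radial_tail (1/2) t1 \<union> P t3 \<union> radial_tail (1/2) t3) \<inter> (P t2 \<union> radial_tail (1/2) t2 \<union> P t4 \<union> radial_tail (1/2) t4) = {}"
    proof -
      have "?A t1 \<inter> ?A t2 = {}" "?A t1 \<inter> ?A t4 = {}" "?A t2 \<inter> ?A t3 = {}" "?A t3 \<inter> ?A t4 = {}"
        using t by (auto intro!: dis simp del: Un_iff)
      then show ?thesis by blast
    qed
    show "0 \<notin> P t1 \<union> radial_tail (1/2) t1 \<union> P t3 \<union> radial_tail (1/2) t3" "0 \<notin> P t2 \<union> radial_tail (1/2) t2 \<union> P t4 \<union> radial_tail (1/2) t4"
      using z0 by blast+
    show "Re (f z) \<le> M" if "z \<in> P t1 \<union> radial_tail (1/2) t1 \<union> P t3 \<union> radial_tail (1/2) t3" for z using M' that by blast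
    show "- M \<le> Re (f z)" if "z \<in> P t2 \<union> radial_tail (1/2) t2 \<union> P t4 \<union> radial_tail (1/2) t4" for z using M' that by blast
  qed (use t pc Ps ends[OF l(1) ty(1)] ends'[OF l(2) ty(2)] ends[OF l(3) ty(3)] ends'[OF l(4) ty(4)] M'[of 0] in \<open>auto simp: P_def\<close>)
qed

end

subsection \<open>Critical points\<close>

lemma countable_imp_negligible:
  fixes S :: "real set"
  assumes "countable S" shows "negligible S"
  using negligible_countable_Union[of "(\<lambda>x. {x}) ` S"] assms by auto

locale harmonic_ray_complement = ray_complement +
  fixes F :: "complex \<Rightarrow> complex"
  assumes F_holo: "F holomorphic_on ball 0 1"
    and Re_F: "z \<in> ball 0 1 \<Longrightarrow> Re (F z) = Re (f z)"
    and ae_lands: "negligible {t. \<not> (\<exists>b. lands t b)}"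
begin

lemma lands_period: "lands (t + 2 * pi * of_int n) b \<longleftrightarrow> lands t b"
proof -
  have "cis (t + 2 * pi * of_int n) = cis t" by (simp add: cis_mult[symmetric] cis_multiple_2pi)
  then show ?thesis by (simp add: lands_def)
qed

lemma onL_period: "onL bs (t + 2 * pi * of_int n) b \<longleftrightarrow> onL bs t b"
proof -
  have "cis (t + 2 * pi * of_int n) = cis t" by (simp add: cis_mult[symmetric] cis_multiple_2pi)
  then show ?thesis by (simp add: onL_def lip_def)
qed

lemma reduce_angle:
  obtains n :: int where "\<alpha> \<le> t + 2 * pi * of_int n" "t + 2 * pi * of_int n < \<alpha> + 2 * pi"
proof -
  define n where "n = - \<lfloor>(t - \<alpha>) / (2 * pi)\<rfloor>"
  have "of_int (- n) \<le> (t - \<alpha>) / (2 * pi)" "(t - \<alpha>) / (2 * pi) < of_int (- n) + 1"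
    unfolding n_def by (simp_all add: floor_correct)
  then have "2 * pi * of_int (- n) \<le> t - \<alpha>" "t - \<alpha> < 2 * pi * (of_int (- n) + 1)"
    using pi_gt_zero by (simp_all add: field_simps)
  then show ?thesis by (intro that[of n]) (simp_all add: algebra_simps)
qed

lemma Re_F_limit:
  assumes "lands t b"
  shows "((\<lambda>r. Re (F (of_real r * cis t))) \<longlongrightarrow> Re b) (at_left 1)"
proof -
  have lim: "((\<lambda>r. Re (f (of_real r * cis t))) \<longlongrightarrow> Re b) (at_left 1)"
    using assms unfolding lands_def by (intro tendsto_Re) simp
  have "eventually (\<lambda>r. r \<in> {0<..<1}) (at_left (1::real))" by (rule eventually_at_left_real) simp
  then have "eventually (\<lambda>r. Re (f (of_real r * cis t)) = Re (F (of_real r * cis t))) (at_left 1)"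
    by eventually_elim (simp add: Re_F norm_mult)
  then show ?thesis using Lim_transform_eventually[OF lim] by simp
qed

text \<open>A critical point of \<open>Re f - \<mu> \<omega>\<close>, where \<open>\<omega>\<close> is the harmonic measure of the arc, would give four
  arms from it which alternate between the left and the right.\<close>
theorem no_critical_point:
  assumes ab: "\<alpha> < \<beta>" "\<beta> < \<alpha> + 2 * pi"
    and inside: "\<And>t b. \<lbrakk>\<alpha> < t; t < \<beta>; lands t b\<rbrakk> \<Longrightarrow> onL bs t b"
    and outside: "\<And>t b. \<lbrakk>\<beta> < t; t < \<alpha> + 2 * pi; lands t b\<rbrakk> \<Longrightarrow> \<not> onL bs t b"
    and \<mu>: "\<mu> > 0" and z0: "z0 \<in> ball 0 1"
    and nc: "\<not> (\<lambda>z. F z - of_real \<mu> * arc_measure \<alpha> \<beta> z) constant_on ball 0 1"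
  shows "deriv F z0 \<noteq> of_real \<mu> * deriv (arc_measure \<alpha> \<beta>) z0"
proof
  assume eq: "deriv F z0 = of_real \<mu> * deriv (arc_measure \<alpha> \<beta>) z0"
  let ?q = "arc_measure \<alpha> \<beta>"
  define G where "G = (\<lambda>z. F z - of_real \<mu> * ?q z)"
  have hq: "?q holomorphic_on ball 0 1" by (rule arc_measure_holomorphic[OF ab])
  have hG: "G holomorphic_on ball 0 1" unfolding G_def by (intro holomorphic_intros F_holo hq)
  have "(F has_field_derivative deriv F z0) (at z0)" "(?q has_field_derivative deriv ?q z0) (at z0)"
    using z0 F_holo hq by (auto intro: holomorphic_derivI[OF _ open_ball])
  then have "(G has_field_derivative deriv F z0 - of_real \<mu> * deriv ?q z0) (at z0)"
    unfolding G_def by (auto intro!: derivative_eq_intros)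
  then have cr: "deriv G z0 = 0" using eq by (simp add: DERIV_imp_deriv)
  have ReG: "Re (G z) = Re (f z) - \<mu> * Re (?q z)" if "z \<in> ball 0 1" for z
    using Re_F[OF that] by (simp add: G_def)
  have q01: "0 < Re (?q z)" "Re (?q z) < 1" if "z \<in> ball 0 1" for z
    using Re_arc_measure_bounds[OF ab, of z] that by auto
  \<comment> \<open>The harmonic measure lies strictly between 0 and 1. This makes \<open>c\<close>
    and \<open>c + \<mu>\<close> the levels for the left and right arms from a point where
    \<open>Re G\<close> is \<open>c\<close>.\<close>
  have ub: "Re (G z) < Re (f z)" "Re (f z) < Re (G z) + \<mu>" if "z \<in> ball 0 1" for z
    using ReG[OF that] q01[OF that] \<mu> mult_strict_left_mono[OF q01(2)[OF that] \<mu>] by auto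
  \<comment> \<open>Besides the angles without landing, the end points of the arc and their
    translates by full turns are set aside, where the statements on radial limits of
    \<open>arc_measure\<close> do not apply.\<close>
  define N where "N = {t. \<not> (\<exists>b. lands t b)} \<union> (\<lambda>n::int. \<alpha> + 2 * pi * of_int n) ` UNIV \<union> (\<lambda>n::int. \<beta> + 2 * pi * of_int n) ` UNIV"
  have N: "negligible N" unfolding N_def
    by (intro negligible_Un ae_lands countable_imp_negligible countable_image) auto
  have lim: "\<exists>b. lands t b \<and> (onL bs t b \<and> ((\<lambda>r. Re (G (of_real r * cis t))) \<longlongrightarrow> Re b - \<mu>) (at_left 1) \<or>
      \<not> onL bs t b \<and> ((\<lambda>r. Re (G (of_real r * cis t))) \<longlongrightarrow> Re b) (at_left 1))" if t: "t \<notin> N" for t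
  proof -
    obtain b where b: "lands t b" using t by (auto simp: N_def)
    obtain n :: int where n: "\<alpha> \<le> t + 2 * pi * of_int n" "t + 2 * pi * of_int n < \<alpha> + 2 * pi" by (rule reduce_angle)
    define t' where "t' = t + 2 * pi * of_int n"
    have c: "cis t' = cis t" unfolding t'_def by (simp add: cis_mult[symmetric] cis_multiple_2pi)
    have "t = \<alpha> + 2 * pi * of_int (- n)" if "t' = \<alpha>" using that by (simp add: t'_def)
    then have "t' \<noteq> \<alpha>" using t unfolding N_def by blast
    have "t = \<beta> + 2 * pi * of_int (- n)" if "t' = \<beta>" using that by (simp add: t'_def)
    then have "t' \<noteq> \<beta>" using t unfolding N_def by blast
    have b': "lands t' b" "onL bs t' b \<longleftrightarrow> onL bs t b" using b lands_period onL_period by (auto simp: t'_def)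
    have "((\<lambda>r. Re (F (of_real r * cis t)) - \<mu> * Re (?q (of_real r * cis t))) \<longlongrightarrow> Re b - \<mu> * w) (at_left 1)"
      if "((\<lambda>r. Re (?q (of_real r * cis t'))) \<longlongrightarrow> w) (at_left 1)" for w
      using that unfolding c by (intro tendsto_intros Re_F_limit[OF b])
    then have lm: "((\<lambda>r. Re (G (of_real r * cis t))) \<longlongrightarrow> Re b - \<mu> * w) (at_left 1)"
      if "((\<lambda>r. Re (?q (of_real r * cis t'))) \<longlongrightarrow> w) (at_left 1)" for w
      using that by (simp add: G_def)
    show ?thesis
    proof (cases "t' < \<beta>")
      case True
      then have "((\<lambda>r. Re (?q (of_real r * cis t'))) \<longlongrightarrow> 1) (at_left 1)"
        using arc_measure_radial_limit_inside[of \<alpha> t' \<beta>] n(1) \<open>t' \<noteq> \<alpha>\<close> ab by (simp add: t'_def)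
      moreover have "onL bs t' b" using inside[OF _ True b'(1)] n(1) \<open>t' \<noteq> \<alpha>\<close> by (simp add: t'_def)
      ultimately show ?thesis using b b' lm by fastforce
    next
      case False
      then have "((\<lambda>r. Re (?q (of_real r * cis t'))) \<longlongrightarrow> 0) (at_left 1)"
        using arc_measure_radial_limit_outside[of \<alpha> \<beta> t'] n(2) \<open>t' \<noteq> \<beta>\<close> ab by (simp add: t'_def)
      moreover have "\<not> onL bs t' b" using outside[OF _ _ b'(1)] n(2) False \<open>t' \<noteq> \<beta>\<close> by (simp add: t'_def)
      ultimately show ?thesis using b b' lm by fastforce
    qed
  qed
  define c where "c = Re (G z0)"
  have L_arm: "\<exists>\<rho>0. 0 < \<rho>0 \<and> \<rho>0 < 1 \<and> (\<forall>\<rho>. \<rho>0 \<le> \<rho> \<and> \<rho> < 1 \<longrightarrow> (\<exists>P T. path_connected P \<and> z1 \<in> P \<and> P \<subseteq> cball 0 \<rho> \<and> L_end \<rho> bs c P T \<and> (\<forall>z\<in>P \<union> T. Re (G z) < c)))"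
    if z1: "z1 \<in> ball 0 1" "Re (G z1) < c" for z1
  proof -
    \<comment> \<open>A level strictly between, so that a limit of \<open>Re G\<close> along a tail
      is still strictly below \<open>c\<close>.\<close>
    define c' where "c' = (c + Re (G z1)) / 2"
    have c': "Re (G z1) < c'" "c' < c" using z1 by (auto simp: c'_def)
    obtain \<rho>0 where \<rho>0: "0 < \<rho>0" "\<rho>0 < 1"
      "\<And>\<rho>. \<lbrakk>\<rho>0 \<le> \<rho>; \<rho> < 1\<rbrakk> \<Longrightarrow> \<exists>P. path_connected P \<and> z1 \<in> P \<and> P \<subseteq> cball 0 \<rho> \<and> (\<forall>z\<in>P. Re (G z) < c') \<and>
       (P \<inter> {z \<in> ball 0 1. Re (f z) < c} \<noteq> {} \<or> (\<exists>t. t \<notin> N \<and> of_real \<rho> * cis t \<in> P \<and> (\<forall>z\<in>radial_tail \<rho> t. z \<notin> {z \<in> ball 0 1. Re (f z) < c} \<and> Re (G z) < c')))"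
    proof (rule sublevel_arm[OF hG z1(1) c'(1), of "{z \<in> ball 0 1. Re (f z) < c}" "\<mu> - c" N])
      show "- (\<mu> - c) \<le> Re (G z)" if "z \<in> ball 0 1" "z \<notin> {z \<in> ball 0 1. Re (f z) < c}" for z
        using ub(2)[of z] that by simp
      show "\<exists>w. ((\<lambda>r. Re (G (of_real r * cis t))) \<longlongrightarrow> w) (at_left 1)" if "t \<notin> N" for t
        using lim[OF that] by blast
    qed (use N in simp_all)
    show ?thesis
    proof (intro exI[of _ \<rho>0] conjI \<rho>0 allI impI, elim conjE)
      fix \<rho> assume \<rho>: "\<rho>0 \<le> \<rho>" "\<rho> < 1"
      obtain P where P: "path_connected P" "z1 \<in> P" "P \<subseteq> cball 0 \<rho>" "\<forall>z\<in>P. Re (G z) < c'"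
       "P \<inter> {z \<in> ball 0 1. Re (f z) < c} \<noteq> {} \<or> (\<exists>t. t \<notin> N \<and> of_real \<rho> * cis t \<in> P \<and> (\<forall>z\<in>radial_tail \<rho> t. z \<notin> {z \<in> ball 0 1. Re (f z) < c} \<and> Re (G z) < c'))"
        using \<rho>0(3)[OF \<rho>] by (elim exE conjE) (rule that)
      from P(5) show "\<exists>P T. path_connected P \<and> z1 \<in> P \<and> P \<subseteq> cball 0 \<rho> \<and> L_end \<rho> bs c P T \<and> (\<forall>z\<in>P \<union> T. Re (G z) < c)"
      proof (elim disjE exE conjE)
        assume "P \<inter> {z \<in> ball 0 1. Re (f z) < c} \<noteq> {}"
        then have "L_end \<rho> bs c P {}" by (auto simp: L_end_def)
        then show ?thesis using P(1-4) c'(2) by (intro exI[of _ P] exI[of _ "{}"]) auto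
      next
        fix t assume t: "t \<notin> N" "of_real \<rho> * cis t \<in> P" "\<forall>z\<in>radial_tail \<rho> t. z \<notin> {z \<in> ball 0 1. Re (f z) < c} \<and> Re (G z) < c'"
        have tb: "radial_tail \<rho> t \<subseteq> ball 0 1" using radial_tail_subset \<rho>0(1) \<rho> by simp
        obtain b where b: "lands t b" "onL bs t b \<or> \<not> onL bs t b \<and> ((\<lambda>r. Re (G (of_real r * cis t))) \<longlongrightarrow> Re b) (at_left 1)"
          using lim[OF t(1)] by blast
        \<comment> \<open>A tail outside the region \<open>Re f < c\<close> lands at a point with
          \<open>Re b \<ge> c\<close>. At a landing of the right type \<open>Re G\<close> would tend
          to \<open>Re b\<close>, although it stays below \<open>c'\<close>; so the landing is of
          the left type.\<close>
        have "Re b \<ge> c"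
          using landing_le[OF b(1) _ \<rho>(2) continuous_on_minus[OF continuous_on_Re[OF continuous_on_id]], of "- c"] \<rho> \<rho>0(1) t(3) tb by fastforce
        moreover have "Re b \<le> c'" if l: "((\<lambda>r. Re (G (of_real r * cis t))) \<longlongrightarrow> Re b) (at_left 1)"
        proof (rule tendsto_upperbound[OF l])
          have "eventually (\<lambda>r. r \<in> {\<rho><..<1}) (at_left (1::real))" by (rule eventually_at_left_real) (use \<rho> in simp)
          then show "eventually (\<lambda>r. Re (G (of_real r * cis t)) \<le> c') (at_left 1)"
          proof eventually_elim
            case (elim r)
            then have "of_real r * cis t \<in> radial_tail \<rho> t" by (auto simp: radial_tail_def)
            then show ?case using t(3) by fastforce
          qed
        qed simp
        ultimately have "onL bs t b" using b(2) c'(2) by fastforce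
        then have "L_end \<rho> bs c P (radial_tail \<rho> t)" using b(1) t(2) by (auto simp: L_end_def)
        moreover have "\<forall>z\<in>P \<union> radial_tail \<rho> t. Re (G z) < c"
        proof
          fix z assume "z \<in> P \<union> radial_tail \<rho> t"
          then show "Re (G z) < c" using P(4) t(3) c'(2) by fastforce
        qed
        ultimately show ?thesis using P(1-3) by (intro exI conjI)
      qed
    qed
  qed
  \<comment> \<open>The mirror image, with \<open>- G\<close> for \<open>G\<close>. A landing of the
    left type is now excluded by \<open>Re f \<le> c + \<mu>\<close> on the tail: there
    \<open>Re G\<close> would tend to \<open>Re b - \<mu> \<le> c\<close>, although it stays above
    \<open>c'\<close>.\<close>
  have R_arm: "\<exists>\<rho>0. 0 < \<rho>0 \<and> \<rho>0 < 1 \<and> (\<forall>\<rho>. \<rho>0 \<le> \<rho> \<and> \<rho> < 1 \<longrightarrow> (\<exists>P T. path_connected P \<and> z1 \<in> P \<and> P \<subseteq> cball 0 \<rho> \<and> R_end \<rho> bs (c + \<mu>) P T \<and> (\<forall>z\<in>P \<union> T. Re (G z) > c)))"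
    if z1: "z1 \<in> ball 0 1" "Re (G z1) > c" for z1
  proof -
    define c' where "c' = (c + Re (G z1)) / 2"
    have c': "Re (- G z1) < - c'" "c' > c" using z1 by (auto simp: c'_def)
    have hG': "(\<lambda>z. - G z) holomorphic_on ball 0 1" by (intro holomorphic_intros hG)
    obtain \<rho>0 where \<rho>0: "0 < \<rho>0" "\<rho>0 < 1"
      "\<And>\<rho>. \<lbrakk>\<rho>0 \<le> \<rho>; \<rho> < 1\<rbrakk> \<Longrightarrow> \<exists>P. path_connected P \<and> z1 \<in> P \<and> P \<subseteq> cball 0 \<rho> \<and> (\<forall>z\<in>P. Re (- G z) < - c') \<and>
       (P \<inter> {z \<in> ball 0 1. Re (f z) > c + \<mu>} \<noteq> {} \<or> (\<exists>t. t \<notin> N \<and> of_real \<rho> * cis t \<in> P \<and> (\<forall>z\<in>radial_tail \<rho> t. z \<notin> {z \<in> ball 0 1. Re (f z) > c + \<mu>} \<and> Re (- G z) < - c')))"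
    proof (rule sublevel_arm[OF hG' z1(1) c'(1), of "{z \<in> ball 0 1. Re (f z) > c + \<mu>}" "c + \<mu>" N])
      show "- (c + \<mu>) \<le> Re (- G z)" if "z \<in> ball 0 1" "z \<notin> {z \<in> ball 0 1. Re (f z) > c + \<mu>}" for z
        using ub(1)[of z] that by simp
      show "\<exists>w. ((\<lambda>r. Re (- G (of_real r * cis t))) \<longlongrightarrow> w) (at_left 1)" if "t \<notin> N" for t
      proof -
        obtain w where "((\<lambda>r. Re (G (of_real r * cis t))) \<longlongrightarrow> w) (at_left 1)" using lim[OF \<open>t \<notin> N\<close>] by blast
        from tendsto_minus[OF this] show ?thesis unfolding uminus_complex.sel by (rule exI)
      qed
    qed (use N in simp_all)
    show ?thesis
    proof (intro exI[of _ \<rho>0] conjI \<rho>0 allI impI, elim conjE)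
      fix \<rho> assume \<rho>: "\<rho>0 \<le> \<rho>" "\<rho> < 1"
      obtain P where P: "path_connected P" "z1 \<in> P" "P \<subseteq> cball 0 \<rho>" "\<forall>z\<in>P. Re (- G z) < - c'"
       "P \<inter> {z \<in> ball 0 1. Re (f z) > c + \<mu>} \<noteq> {} \<or> (\<exists>t. t \<notin> N \<and> of_real \<rho> * cis t \<in> P \<and> (\<forall>z\<in>radial_tail \<rho> t. z \<notin> {z \<in> ball 0 1. Re (f z) > c + \<mu>} \<and> Re (- G z) < - c'))"
        using \<rho>0(3)[OF \<rho>] by (elim exE conjE) (rule that)
      from P(5) show "\<exists>P T. path_connected P \<and> z1 \<in> P \<and> P \<subseteq> cball 0 \<rho> \<and> R_end \<rho> bs (c + \<mu>) P T \<and> (\<forall>z\<in>P \<union> T. Re (G z) > c)"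
      proof (elim disjE exE conjE)
        assume "P \<inter> {z \<in> ball 0 1. Re (f z) > c + \<mu>} \<noteq> {}"
        then have "R_end \<rho> bs (c + \<mu>) P {}" by (auto simp: R_end_def)
        then show ?thesis using P(1-4) c'(2) by (intro exI[of _ P] exI[of _ "{}"]) auto
      next
        fix t assume t: "t \<notin> N" "of_real \<rho> * cis t \<in> P" "\<forall>z\<in>radial_tail \<rho> t. z \<notin> {z \<in> ball 0 1. Re (f z) > c + \<mu>} \<and> Re (- G z) < - c'"
        have tb: "radial_tail \<rho> t \<subseteq> ball 0 1" using radial_tail_subset \<rho>0(1) \<rho> by simp
        obtain b where b: "lands t b" "\<not> onL bs t b \<or> onL bs t b \<and> ((\<lambda>r. Re (G (of_real r * cis t))) \<longlongrightarrow> Re b - \<mu>) (at_left 1)"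
          using lim[OF t(1)] by blast
        have "Re b \<le> c + \<mu>"
          using landing_le[OF b(1) _ \<rho>(2) continuous_on_Re[OF continuous_on_id], of "c + \<mu>"] \<rho> \<rho>0(1) t(3) tb by fastforce
        moreover have "c' \<le> Re b - \<mu>" if l: "((\<lambda>r. Re (G (of_real r * cis t))) \<longlongrightarrow> Re b - \<mu>) (at_left 1)"
        proof (rule tendsto_lowerbound[OF l])
          have "eventually (\<lambda>r. r \<in> {\<rho><..<1}) (at_left (1::real))" by (rule eventually_at_left_real) (use \<rho> in simp)
          then show "eventually (\<lambda>r. c' \<le> Re (G (of_real r * cis t))) (at_left 1)"
          proof eventually_elim
            case (elim r)
            then have "of_real r * cis t \<in> radial_tail \<rho> t" by (auto simp: radial_tail_def)
            then show ?case using t(3) by fastforce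
          qed
        qed simp
        ultimately have "\<not> onL bs t b" using b(2) c'(2) by fastforce
        then have "R_end \<rho> bs (c + \<mu>) P (radial_tail \<rho> t)" using b(1) t(2) by (auto simp: R_end_def)
        moreover have "\<forall>z\<in>P \<union> radial_tail \<rho> t. Re (G z) > c"
        proof
          fix z assume "z \<in> P \<union> radial_tail \<rho> t"
          then show "Re (G z) > c" using P(4) t(3) c'(2) by fastforce
        qed
        ultimately show ?thesis using P(1-3) by (intro exI conjI)
      qed
    qed
  qed
  have nc': "\<not> G constant_on ball 0 1" using nc by (simp add: G_def)
  obtain s a1 a2 a3 a4 where s: "s > 0" "cball z0 s \<subseteq> ball 0 1" and a: "a1 < a2" "a2 < a3" "a3 < a4" "a4 < a1 + 2 * pi"
    and s1: "\<And>t. \<lbrakk>0 < t; t \<le> s\<rbrakk> \<Longrightarrow> Re (G (z0 + of_real t * cis a1)) < c"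
    and s2: "\<And>t. \<lbrakk>0 < t; t \<le> s\<rbrakk> \<Longrightarrow> Re (G (z0 + of_real t * cis a2)) > c"
    and s3: "\<And>t. \<lbrakk>0 < t; t \<le> s\<rbrakk> \<Longrightarrow> Re (G (z0 + of_real t * cis a3)) < c"
    and s4: "\<And>t. \<lbrakk>0 < t; t \<le> s\<rbrakk> \<Longrightarrow> Re (G (z0 + of_real t * cis a4)) > c"
    unfolding c_def by (rule critical_point_sectors[OF hG z0 cr nc']) blast
  define seg where "seg = (\<lambda>a. (\<lambda>t. z0 + of_real t * cis a) ` {0<..s})"
  have segcb: "seg a \<subseteq> cball z0 s" for a by (auto simp: seg_def dist_norm norm_mult)
  have pseg: "path_connected (seg a)" for a unfolding seg_def
    by (intro path_connected_continuous_image continuous_intros) (simp add: convex_imp_path_connected)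
  have eseg: "z0 + of_real s * cis a \<in> seg a" for a using s by (auto simp: seg_def)
  have eD: "z0 + of_real s * cis a \<in> ball 0 1" for a using eseg segcb s by blast
  obtain \<rho>c where \<rho>c: "0 < \<rho>c" "\<rho>c < 1" "cball z0 s \<subseteq> cball 0 \<rho>c"
    using compact_subset_cball[OF compact_cball s(2)] by metis
  obtain \<rho>1 where r1: "0 < \<rho>1" "\<rho>1 < 1" "\<forall>\<rho>. \<rho>1 \<le> \<rho> \<and> \<rho> < 1 \<longrightarrow> (\<exists>P T. path_connected P \<and> z0 + of_real s * cis a1 \<in> P \<and> P \<subseteq> cball 0 \<rho> \<and> L_end \<rho> bs c P T \<and> (\<forall>z\<in>P \<union> T. Re (G z) < c))"
    using L_arm[OF eD s1[OF s(1) order_refl]] by blast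
  obtain \<rho>2 where r2: "0 < \<rho>2" "\<rho>2 < 1" "\<forall>\<rho>. \<rho>2 \<le> \<rho> \<and> \<rho> < 1 \<longrightarrow> (\<exists>P T. path_connected P \<and> z0 + of_real s * cis a2 \<in> P \<and> P \<subseteq> cball 0 \<rho> \<and> R_end \<rho> bs (c + \<mu>) P T \<and> (\<forall>z\<in>P \<union> T. Re (G z) > c))"
    using R_arm[OF eD s2[OF s(1) order_refl]] by blast
  obtain \<rho>3 where r3: "0 < \<rho>3" "\<rho>3 < 1" "\<forall>\<rho>. \<rho>3 \<le> \<rho> \<and> \<rho> < 1 \<longrightarrow> (\<exists>P T. path_connected P \<and> z0 + of_real s * cis a3 \<in> P \<and> P \<subseteq> cball 0 \<rho> \<and> L_end \<rho> bs c P T \<and> (\<forall>z\<in>P \<union> T. Re (G z) < c))"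
    using L_arm[OF eD s3[OF s(1) order_refl]] by blast
  obtain \<rho>4 where r4: "0 < \<rho>4" "\<rho>4 < 1" "\<forall>\<rho>. \<rho>4 \<le> \<rho> \<and> \<rho> < 1 \<longrightarrow> (\<exists>P T. path_connected P \<and> z0 + of_real s * cis a4 \<in> P \<and> P \<subseteq> cball 0 \<rho> \<and> R_end \<rho> bs (c + \<mu>) P T \<and> (\<forall>z\<in>P \<union> T. Re (G z) > c))"
    using R_arm[OF eD s4[OF s(1) order_refl]] by blast
  define \<rho> where "\<rho> = max \<rho>c (max (max \<rho>1 \<rho>2) (max \<rho>3 \<rho>4))"
  have \<rho>: "0 < \<rho>" "\<rho> < 1" "\<rho>1 \<le> \<rho> \<and> \<rho> < 1" "\<rho>2 \<le> \<rho> \<and> \<rho> < 1" "\<rho>3 \<le> \<rho> \<and> \<rho> < 1" "\<rho>4 \<le> \<rho> \<and> \<rho> < 1" "\<rho>c \<le> \<rho>"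
    unfolding \<rho>_def using \<rho>c(1,2) r1(1,2) r2(1,2) r3(1,2) r4(1,2) by auto
  obtain P1 T1 where 1: "path_connected P1" "z0 + of_real s * cis a1 \<in> P1" "P1 \<subseteq> cball 0 \<rho>" "L_end \<rho> bs c P1 T1" "\<forall>z\<in>P1 \<union> T1. Re (G z) < c"
    using r1(3)[rule_format, OF \<rho>(3)] by blast
  obtain P2 T2 where 2: "path_connected P2" "z0 + of_real s * cis a2 \<in> P2" "P2 \<subseteq> cball 0 \<rho>" "R_end \<rho> bs (c + \<mu>) P2 T2" "\<forall>z\<in>P2 \<union> T2. Re (G z) > c"
    using r2(3)[rule_format, OF \<rho>(4)] by blast
  obtain P3 T3 where 3: "path_connected P3" "z0 + of_real s * cis a3 \<in> P3" "P3 \<subseteq> cball 0 \<rho>" "L_end \<rho> bs c P3 T3" "\<forall>z\<in>P3 \<union> T3. Re (G z) < c"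
    using r3(3)[rule_format, OF \<rho>(5)] by blast
  obtain P4 T4 where 4: "path_connected P4" "z0 + of_real s * cis a4 \<in> P4" "P4 \<subseteq> cball 0 \<rho>" "R_end \<rho> bs (c + \<mu>) P4 T4" "\<forall>z\<in>P4 \<union> T4. Re (G z) > c"
    using r4(3)[rule_format, OF \<rho>(6)] by blast
  have L_mono: "L_end \<rho> bs c (S \<union> P) T" if "L_end \<rho> bs c P T" for S P T
    using that unfolding L_end_def by blast
  have R_mono: "R_end \<rho> bs (c + \<mu>) (S \<union> P) T" if "R_end \<rho> bs (c + \<mu>) P T" for S P T
    using that unfolding R_end_def by blast
  have Tb: "T \<subseteq> ball 0 1" if "L_end \<rho> bs c P T \<or> R_end \<rho> bs (c + \<mu>) P T" for P T
    using that radial_tail_subset[OF \<rho>(1)] unfolding L_end_def R_end_def by blast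
  have pc: "path_connected (seg a \<union> P)" if "path_connected P" "z0 + of_real s * cis a \<in> P" for a P
    using eseg[of a] that by (intro path_connected_Un pseg) auto
  have sc: "cball z0 s \<subseteq> cball 0 \<rho>" using \<rho>c(3) \<rho>(7) by fastforce
  have scb: "seg a \<union> P \<subseteq> cball 0 \<rho>" if "P \<subseteq> cball 0 \<rho>" for a P using sc segcb[of a] that by blast
  have cb: "cball (0::complex) \<rho> \<subseteq> ball 0 1" using \<rho>(2) by auto
  have lt: "Re (G z) < c" if "z \<in> seg a1 \<union> P1 \<union> T1 \<union> (seg a3 \<union> P3) \<union> T3" for z
    using that 1(5) 3(5) s1 s3 by (auto simp: seg_def)
  have gt: "Re (G z) > c" if "z \<in> seg a2 \<union> P2 \<union> T2 \<union> (seg a4 \<union> P4) \<union> T4" for z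
    using that 2(5) 4(5) s2 s4 by (auto simp: seg_def)
  have lD: "seg a1 \<union> P1 \<union> T1 \<union> (seg a3 \<union> P3) \<union> T3 \<subseteq> ball 0 1"
    using scb[OF 1(3), of a1] scb[OF 3(3), of a3] cb Tb[OF disjI1[OF 1(4)]] Tb[OF disjI1[OF 3(4)]] by blast
  have gD: "seg a2 \<union> P2 \<union> T2 \<union> (seg a4 \<union> P4) \<union> T4 \<subseteq> ball 0 1"
    using scb[OF 2(3), of a2] scb[OF 4(3), of a4] cb Tb[OF disjI2[OF 2(4)]] Tb[OF disjI2[OF 4(4)]] by blast
  show False
  proof (rule no_alternating_arms[OF \<rho>(1,2) s a pc[OF 1(1,2)] pc[OF 2(1,2)] pc[OF 3(1,2)] pc[OF 4(1,2)]
        scb[OF 1(3)] scb[OF 2(3)] scb[OF 3(3)] scb[OF 4(3)] _ _ _ _ _ L_mono[OF 1(4)] R_mono[OF 2(4)] L_mono[OF 3(4)] R_mono[OF 4(4)]])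
    show "z0 \<in> cball 0 \<rho>" by (rule subsetD[OF sc]) (use s(1) in simp)
    show "(seg a1 \<union> P1 \<union> T1 \<union> (seg a3 \<union> P3) \<union> T3) \<inter> (seg a2 \<union> P2 \<union> T2 \<union> (seg a4 \<union> P4) \<union> T4) = {}"
    proof (rule equals0I, erule IntE)
      fix z assume "z \<in> seg a1 \<union> P1 \<union> T1 \<union> (seg a3 \<union> P3) \<union> T3" "z \<in> seg a2 \<union> P2 \<union> T2 \<union> (seg a4 \<union> P4) \<union> T4"
      then show False using lt[of z] gt[of z] by linarith
    qed
    show "z0 \<notin> seg a1 \<union> P1 \<union> T1 \<union> (seg a3 \<union> P3) \<union> T3" using lt[of z0] unfolding c_def by blast
    show "z0 \<notin> seg a2 \<union> P2 \<union> T2 \<union> (seg a4 \<union> P4) \<union> T4" using gt[of z0] unfolding c_def by blast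
    show "Re (f z) \<le> c + \<mu>" if "z \<in> seg a1 \<union> P1 \<union> T1 \<union> (seg a3 \<union> P3) \<union> T3" for z
      using ub(2)[OF subsetD[OF lD that]] lt[OF that] by simp
    show "c \<le> Re (f z)" if "z \<in> seg a2 \<union> P2 \<union> T2 \<union> (seg a4 \<union> P4) \<union> T4" for z
      using ub(1)[OF subsetD[OF gD that]] gt[OF that] by simp
    show "c \<le> Re (f z0)" "Re (f z0) \<le> c + \<mu>" using ub[OF z0] by (auto simp: c_def)
  qed (auto simp: seg_def)
qed

text \<open>The derivative of the harmonic measure is a constant \<open>k\<close> over the product
  of the two weights, so a critical point of \<open>F - \<mu> * arc_measure \<alpha> \<beta>\<close>
  is a point where the weighted derivative equals \<open>\<mu> * k\<close>. Excluding these for all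
  \<open>\<mu> > 0\<close> excludes an open ray; its tip 0 is excluded by \<open>F'\<close>.\<close>

theorem weighted_derivative_avoids_ray:
  assumes ab: "\<alpha> < \<beta>" "\<beta> < \<alpha> + 2 * pi"
    and inside: "\<And>t b. \<lbrakk>\<alpha> < t; t < \<beta>; lands t b\<rbrakk> \<Longrightarrow> onL bs t b"
    and outside: "\<And>t b. \<lbrakk>\<beta> < t; t < \<alpha> + 2 * pi; lands t b\<rbrakk> \<Longrightarrow> \<not> onL bs t b"
    and F': "\<And>z. z \<in> ball 0 1 \<Longrightarrow> deriv F z \<noteq> 0"
  obtains \<kappa> where "cmod \<kappa> = 1"
    "\<And>z s. \<lbrakk>z \<in> ball 0 1; 0 \<le> s\<rbrakk> \<Longrightarrow> deriv F z * (1 - cis (- \<alpha>) * z) * (1 - cis (- \<beta>) * z) \<noteq> of_real s * \<kappa>"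
proof -
  define k where "k = (cis (- \<alpha>) - cis (- \<beta>)) / (of_real pi * \<i>)"
  define \<Phi> where "\<Phi> = (\<lambda>z. deriv F z * (1 - cis (- \<alpha>) * z) * (1 - cis (- \<beta>) * z))"
  have nz: "1 - cis a * z \<noteq> 0" if "z \<in> ball 0 1" for a z using that one_minus_cis_mult_nonzero by simp
  have "cis (- \<alpha>) \<noteq> cis (- \<beta>)" using cis_eq_period[of "- \<alpha>" "- \<beta>"] ab by auto
  then have k0: "k \<noteq> 0" by (simp add: k_def)
  have dq: "deriv (arc_measure \<alpha> \<beta>) z = k / ((1 - cis (- \<alpha>) * z) * (1 - cis (- \<beta>) * z))" if "z \<in> ball 0 1" for z
    using DERIV_imp_deriv[OF arc_measure_has_derivative[OF ab]] that by (simp add: k_def)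
  have \<Phi>0: "\<Phi> z \<noteq> 0" if "z \<in> ball 0 1" for z using that F' nz by (simp add: \<Phi>_def)
  have alg: "D * x * y = m * c \<longleftrightarrow> D = m * (c / (x * y))" if "x \<noteq> 0" "y \<noteq> 0" for D x y m c :: complex
    using that by (auto simp: field_simps)
  have eqv: "\<Phi> z = of_real \<mu> * k \<longleftrightarrow> deriv F z = of_real \<mu> * deriv (arc_measure \<alpha> \<beta>) z" if "z \<in> ball 0 1" for z \<mu>
    unfolding \<Phi>_def dq[OF that] by (rule alg[OF nz[OF that] nz[OF that]])
  have sg: "of_real s * sgn c = of_real (s / cmod c) * c" for s and c :: complex
    by (simp add: sgn_eq)
  show thesis
  proof (cases "\<exists>\<mu>>0. (\<lambda>z. F z - of_real \<mu> * arc_measure \<alpha> \<beta> z) constant_on ball 0 1")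
    case True
    \<comment> \<open>Here \<open>F\<close> is, up to a constant, a multiple of the harmonic
      measure, and all points are critical. But then the weighted derivative is the constant
      \<open>\<mu> * k\<close>, and it omits the opposite ray.\<close>
    then obtain \<mu> c where \<mu>: "\<mu> > 0" "\<And>z. z \<in> ball 0 1 \<Longrightarrow> F z - of_real \<mu> * arc_measure \<alpha> \<beta> z = c"
      unfolding constant_on_def by blast
    have "\<Phi> z = of_real \<mu> * k" if z: "z \<in> ball 0 1" for z
    proof -
      have "(F has_field_derivative deriv F z) (at z)" "(arc_measure \<alpha> \<beta> has_field_derivative deriv (arc_measure \<alpha> \<beta>) z) (at z)"
        using z F_holo arc_measure_holomorphic[OF ab] by (auto intro: holomorphic_derivI[OF _ open_ball])
      then have "((\<lambda>z. F z - of_real \<mu> * arc_measure \<alpha> \<beta> z) has_field_derivative deriv F z - of_real \<mu> * deriv (arc_measure \<alpha> \<beta>) z) (at z)"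
        by (auto intro!: derivative_eq_intros)
      moreover have "((\<lambda>z. F z - of_real \<mu> * arc_measure \<alpha> \<beta> z) has_field_derivative 0) (at z)"
        by (rule has_field_derivative_transform_within_open[OF DERIV_const[of c] open_ball z]) (use \<mu> in auto)
      ultimately have "deriv F z - of_real \<mu> * deriv (arc_measure \<alpha> \<beta>) z = 0" by (rule DERIV_unique)
      then show ?thesis using eqv[OF z] by simp
    qed
    note \<Phi> = this
    show thesis
    proof (rule that[of "- sgn k"])
      show "cmod (- sgn k) = 1" using k0 by (simp add: norm_sgn)
      fix z :: complex and s :: real assume z: "z \<in> ball 0 1" and s: "0 \<le> s"
      have "of_real \<mu> * k \<noteq> of_real (- (s / cmod k)) * k"
      proof
        assume "of_real \<mu> * k = of_real (- (s / cmod k)) * k"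
        then have "\<mu> = - (s / cmod k)" using k0 by (simp only: mult_cancel_right of_real_eq_iff) simp
        then show False using \<mu>(1) s by (simp add: field_simps) (smt (verit) divide_nonneg_nonneg norm_ge_zero)
      qed
      then show "deriv F z * (1 - cis (- \<alpha>) * z) * (1 - cis (- \<beta>) * z) \<noteq> of_real s * - sgn k"
        using \<Phi>[OF z] sg[of s k] unfolding \<Phi>_def by simp
    qed
  next
    case noconst: False
    show thesis
    proof (rule that[of "sgn k"])
      show "cmod (sgn k) = 1" using k0 by (simp add: norm_sgn)
      fix z :: complex and s :: real assume z: "z \<in> ball 0 1" and s: "0 \<le> s"
      have "\<Phi> z \<noteq> of_real (s / cmod k) * k"
      proof (cases "s = 0")
        case True then show ?thesis using \<Phi>0[OF z] by simp
      next
        case False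
        then have sp: "s / cmod k > 0" using s k0 by simp
        then have nc: "\<not> (\<lambda>z. F z - of_real (s / cmod k) * arc_measure \<alpha> \<beta> z) constant_on ball 0 1"
          using noconst by blast
        have "deriv F z \<noteq> of_real (s / cmod k) * deriv (arc_measure \<alpha> \<beta>) z"
          by (rule no_critical_point[OF ab _ _ sp z nc]) (use inside outside in blast)+
        then show ?thesis using eqv[OF z] by blast
      qed
      then show "deriv F z * (1 - cis (- \<alpha>) * z) * (1 - cis (- \<beta>) * z) \<noteq> of_real s * sgn k"
        unfolding \<Phi>_def sg .
    qed
  qed
qed

end

text \<open>By \<open>noalt\<close> the type changes only twice in a turn. \<open>\<alpha>\<close>
  is the supremum of the angles of type \<open>B\<close> between \<open>p\<close> and
  \<open>q\<close>, and \<open>\<beta>\<close> that of the angles of the other type between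
  \<open>q\<close> and \<open>p + 2 * pi\<close>. The second witnesses \<open>q'\<close> and
  \<open>p'\<close> ensure that neither arc degenerates to a point.\<close>

lemma two_arcs:
  fixes T :: "real set" and B :: "real \<Rightarrow> bool"
  assumes T: "\<And>t. t \<in> T \<Longrightarrow> t + 2 * pi \<in> T" and B: "\<And>t. B (t + 2 * pi) = B t"
    and noalt: "\<And>t1 t2 t3 t4. \<lbrakk>t1 \<in> T; t2 \<in> T; t3 \<in> T; t4 \<in> T; t1 < t2; t2 < t3; t3 < t4; t4 < t1 + 2 * pi;
      B t1; \<not> B t2; B t3; \<not> B t4\<rbrakk> \<Longrightarrow> False"
    and pq: "p \<in> T" "q \<in> T" "p < q" "q < p + 2 * pi" "B p" "\<not> B q"
    and p': "p' \<in> T" "p < p'" "p' < p + 2 * pi" "B p'"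
    and q': "q' \<in> T" "p < q'" "q' < p + 2 * pi" "\<not> B q'" "q' \<noteq> q"
  obtains \<alpha> \<beta> where "p \<le> \<alpha>" "\<alpha> \<le> q" "\<alpha> < \<beta>" "\<beta> < \<alpha> + 2 * pi"
    "\<And>t. \<lbrakk>t \<in> T; \<alpha> < t; t < \<beta>\<rbrakk> \<Longrightarrow> \<not> B t" "\<And>t. \<lbrakk>t \<in> T; \<beta> < t; t < \<alpha> + 2 * pi\<rbrakk> \<Longrightarrow> B t"
proof -
  have noalt': False if "t1 \<in> T" "t2 \<in> T" "t3 \<in> T" "t4 \<in> T" "t1 < t2" "t2 < t3" "t3 < t4" "t4 < t1 + 2 * pi"
      "\<not> B t1" "B t2" "\<not> B t3" "B t4" for t1 t2 t3 t4
    using noalt[of t2 t3 t4 "t1 + 2 * pi"] that T[of t1] B[of t1] by auto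
  have p2: "p + 2 * pi \<in> T" "B (p + 2 * pi)" using T B pq by auto
  define S where "S = {t \<in> T. p \<le> t \<and> t \<le> q \<and> B t}"
  define R where "R = {t \<in> T. q \<le> t \<and> t \<le> p + 2 * pi \<and> \<not> B t}"
  define \<alpha> where "\<alpha> = Sup S"
  define \<beta> where "\<beta> = Sup R"
  have S: "p \<in> S" "bdd_above S" using pq by (auto simp: S_def intro!: bdd_aboveI[of _ q])
  have R: "q \<in> R" "bdd_above R" using pq by (auto simp: R_def intro!: bdd_aboveI[of _ "p + 2 * pi"])
  have \<alpha>: "p \<le> \<alpha>" "\<alpha> \<le> q"
    unfolding \<alpha>_def using S cSup_upper[OF S] by (auto intro!: cSup_least simp: S_def)
  have \<beta>: "q \<le> \<beta>" "\<beta> \<le> p + 2 * pi"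
    unfolding \<beta>_def using R cSup_upper[OF R] by (auto intro!: cSup_least simp: R_def)
  have lt\<alpha>: "B t" if t: "t \<in> T" "p \<le> t" "t < \<alpha>" for t
  proof (rule ccontr)
    assume nB: "\<not> B t"
    obtain t2 where t2: "t2 \<in> S" "t < t2" using t(3) S less_cSup_iff[of S t] unfolding \<alpha>_def by auto
    then have "t2 < q" using pq by (cases "t2 = q") (auto simp: S_def)
    moreover have "p < t" using t pq nB by (cases "t = p") auto
    ultimately show False using noalt'[of t t2 q "p + 2 * pi"] t t2 pq p2 nB by (auto simp: S_def)
  qed
  have gt\<alpha>: "\<not> B t" if "t \<in> T" "\<alpha> < t" "t \<le> q" for t
    using cSup_upper[of t S] S(2) that \<alpha> unfolding \<alpha>_def S_def by force
  have lt\<beta>: "\<not> B t" if t: "t \<in> T" "q \<le> t" "t < \<beta>" for t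
  proof
    assume Bt: "B t"
    obtain t2 where t2: "t2 \<in> R" "t < t2" using t(3) R less_cSup_iff[of R t] unfolding \<beta>_def by auto
    then have "t2 < p + 2 * pi" using p2 by (cases "t2 = p + 2 * pi") (auto simp: R_def)
    moreover have "q < t" using t pq Bt by (cases "t = q") auto
    ultimately show False using noalt'[of q t t2 "p + 2 * pi"] t t2 pq p2 Bt by (auto simp: R_def)
  qed
  have gt\<beta>: "B t" if "t \<in> T" "\<beta> < t" "t \<le> p + 2 * pi" for t
    using cSup_upper[of t R] R(2) that \<beta> unfolding \<beta>_def R_def by force
  have ab: "\<alpha> < \<beta>"
  proof (cases "q' < q")
    case True
    then have "\<alpha> \<le> q'" using lt\<alpha>[of q'] q' by force
    then show ?thesis using True \<beta> by simp
  next
    case False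
    then have "q' \<le> \<beta>" using gt\<beta>[of q'] q' by force
    then show ?thesis using False \<alpha> q'(5) by simp
  qed
  have ba: "\<beta> < \<alpha> + 2 * pi"
  proof (cases "p' < q")
    case True
    then have "p' \<le> \<alpha>" using gt\<alpha>[of p'] p' by force
    then show ?thesis using p'(2) \<beta> by simp
  next
    case False
    then have "\<beta> \<le> p'" using lt\<beta>[of p'] p' by force
    then show ?thesis using p'(3) \<alpha> by simp
  qed
  show thesis
  proof (rule that[OF \<alpha> ab ba])
    show "\<not> B t" if "t \<in> T" "\<alpha> < t" "t < \<beta>" for t
      using gt\<alpha>[of t] lt\<beta>[of t] that by fastforce
    show "B t" if t: "t \<in> T" "\<beta> < t" "t < \<alpha> + 2 * pi" for t
    proof (cases "t \<le> p + 2 * pi")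
      case True then show ?thesis using gt\<beta> t by blast
    next
      case False
      show ?thesis
      proof (rule ccontr)
        assume nB: "\<not> B t"
        have "t - 2 * pi < \<alpha>" using t by simp
        then obtain t2 where t2: "t2 \<in> S" "t - 2 * pi < t2" using S less_cSup_iff[of S "t - 2 * pi"] unfolding \<alpha>_def by auto
        then have "t2 < q" using pq by (cases "t2 = q") (auto simp: S_def)
        then show False using noalt'[of q "p + 2 * pi" t "t2 + 2 * pi"] t t2 pq p2 nB False T[of t2] B[of t2] \<alpha>
          by (auto simp: S_def)
      qed
    qed
  qed
qed

section \<open>Locating an end point of the left arc\<close>

context harmonic_ray_complement
begin

lemma lands_unique: "\<lbrakk>lands t b; lands t b'\<rbrakk> \<Longrightarrow> b = b'"
  unfolding lands_def by (auto intro: tendsto_unique[of "at_left (1::real)"])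

text \<open>Started at the smallest of the four given angles, \<open>two_arcs\<close> puts the first
  change of type between two of them, hence between \<open>u\<close> and \<open>v\<close>. Whichever
  type comes first, this change is an end point of the arc of left angles. Two angles of each type
  are required to keep that arc and its complement nondegenerate.\<close>

theorem ray_avoidance_near_landings:
  assumes F': "\<And>z. z \<in> ball 0 1 \<Longrightarrow> deriv F z \<noteq> 0"
    and len: "v \<le> u + 2 * pi"
    and L: "t1 \<in> {u<..<v}" "t2 \<in> {u<..<v}" "t1 \<noteq> t2" "lands t1 b1" "lands t2 b2" "onL bs t1 b1" "onL bs t2 b2"
    and R: "t3 \<in> {u<..<v}" "t4 \<in> {u<..<v}" "t3 \<noteq> t4" "lands t3 b3" "lands t4 b4" "\<not> onL bs t3 b3" "\<not> onL bs t4 b4"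
  obtains y x \<kappa> where "u < y" "y < v" "cmod x = 1" "cmod \<kappa> = 1"
    "\<And>z s. \<lbrakk>z \<in> ball 0 1; 0 \<le> s\<rbrakk> \<Longrightarrow> deriv F z * (1 - cis (- y) * z) * (1 - x * z) \<noteq> of_real s * \<kappa>"
proof -
  note ob = that
  define T where "T = {t. \<exists>b. lands t b}"
  define A where "A = (\<lambda>t. \<exists>b. lands t b \<and> onL bs t b)"
  have A: "A t \<longleftrightarrow> onL bs t b" if "lands t b" for t b using that lands_unique unfolding A_def by blast
  have per: "lands (t + 2 * pi) b \<longleftrightarrow> lands t b" "onL bs (t + 2 * pi) b \<longleftrightarrow> onL bs t b" for t b
    using lands_period[of t 1 b] onL_period[of bs t 1 b] by simp_all
  have T2: "t + 2 * pi \<in> T \<longleftrightarrow> t \<in> T" for t unfolding T_def mem_Collect_eq per ..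
  have A2: "A (t + 2 * pi) = A t" for t unfolding A_def per ..
  have noalt: False if sT: "s1 \<in> T" "s2 \<in> T" "s3 \<in> T" "s4 \<in> T" and s: "s1 < s2" "s2 < s3" "s3 < s4" "s4 < s1 + 2 * pi"
      and ty: "A s1" "\<not> A s2" "A s3" "\<not> A s4" for s1 s2 s3 s4
  proof -
    obtain c1 c2 c3 c4 where "lands s1 c1" "lands s2 c2" "lands s3 c3" "lands s4 c4" using sT unfolding T_def by blast
    then show False using no_alternating_landings[OF s, of c1 c2 c3 c4 bs] ty A by blast
  qed
  have noalt': False if "s1 \<in> T" "s2 \<in> T" "s3 \<in> T" "s4 \<in> T" "s1 < s2" "s2 < s3" "s3 < s4" "s4 < s1 + 2 * pi"
      "\<not> A s1" "A s2" "\<not> A s3" "A s4" for s1 s2 s3 s4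
    using noalt[of s2 s3 s4 "s1 + 2 * pi"] that T2[of s1] A2[of s1] by auto
  have TT: "t1 \<in> T" "t2 \<in> T" "t3 \<in> T" "t4 \<in> T" using L R by (auto simp: T_def)
  have TA: "A t1" "A t2" "\<not> A t3" "\<not> A t4" using L R A by blast+
  have inside: "\<exists>\<alpha> \<beta>. u < \<alpha> \<and> \<alpha> < v \<and> \<alpha> < \<beta> \<and> \<beta> < \<alpha> + 2 * pi \<and>
    (\<forall>t\<in>T. \<alpha> < t \<and> t < \<beta> \<longrightarrow> \<not> C t) \<and> (\<forall>t\<in>T. \<beta> < t \<and> t < \<alpha> + 2 * pi \<longrightarrow> C t)"
    if C: "\<And>t. C (t + 2 * pi) = C t"
      "\<And>t1 t2 t3 t4. \<lbrakk>t1 \<in> T; t2 \<in> T; t3 \<in> T; t4 \<in> T; t1 < t2; t2 < t3; t3 < t4; t4 < t1 + 2 * pi;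
        C t1; \<not> C t2; C t3; \<not> C t4\<rbrakk> \<Longrightarrow> False"
      and p: "p \<in> T" "p' \<in> T" "q \<in> T" "q' \<in> T" "C p" "C p'" "\<not> C q" "\<not> C q'" "p < p'" "p < q" "p < q'" "q \<noteq> q'"
        "p \<in> {u<..<v}" "p' \<in> {u<..<v}" "q \<in> {u<..<v}" "q' \<in> {u<..<v}" for C p p' q q'
  proof -
    have lt: "x < p + 2 * pi" if "x \<in> {u<..<v}" for x using that p(13) len by simp
    obtain \<alpha> \<beta> where "p \<le> \<alpha>" "\<alpha> \<le> q" "\<alpha> < \<beta>" "\<beta> < \<alpha> + 2 * pi"
      "\<And>t. \<lbrakk>t \<in> T; \<alpha> < t; t < \<beta>\<rbrakk> \<Longrightarrow> \<not> C t" "\<And>t. \<lbrakk>t \<in> T; \<beta> < t; t < \<alpha> + 2 * pi\<rbrakk> \<Longrightarrow> C t"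
    proof (rule two_arcs[of T C p q p' q'])
      show False if "t1 \<in> T" "t2 \<in> T" "t3 \<in> T" "t4 \<in> T" "t1 < t2" "t2 < t3" "t3 < t4" "t4 < t1 + 2 * pi"
        "C t1" "\<not> C t2" "C t3" "\<not> C t4" for t1 t2 t3 t4 using C(2) that by blast
    qed (use p lt C(1) T2 in auto)
    then show ?thesis using p(13,15) by (intro exI[of _ \<alpha>] exI[of _ \<beta>]) auto
  qed
  have fin: thesis if y: "u < y" "y < v" and ab: "\<alpha> < \<beta>" "\<beta> < \<alpha> + 2 * pi" "cis (- y) = cis (- \<alpha>) \<or> cis (- y) = cis (- \<beta>)"
    and i: "\<forall>t\<in>T. \<alpha> < t \<and> t < \<beta> \<longrightarrow> A t" and o: "\<forall>t\<in>T. \<beta> < t \<and> t < \<alpha> + 2 * pi \<longrightarrow> \<not> A t" for y \<alpha> \<beta>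
  proof -
    obtain \<kappa> where \<kappa>: "cmod \<kappa> = 1"
      "\<And>z s. \<lbrakk>z \<in> ball 0 1; 0 \<le> s\<rbrakk> \<Longrightarrow> deriv F z * (1 - cis (- \<alpha>) * z) * (1 - cis (- \<beta>) * z) \<noteq> of_real s * \<kappa>"
    proof (rule weighted_derivative_avoids_ray[OF ab(1,2), of bs])
      show "onL bs t b" if "\<alpha> < t" "t < \<beta>" "lands t b" for t b using i that A T_def by blast
      show "\<not> onL bs t b" if "\<beta> < t" "t < \<alpha> + 2 * pi" "lands t b" for t b using o that A T_def by blast
    qed (use F' in auto)
    from ab(3) show thesis
    proof
      assume "cis (- y) = cis (- \<alpha>)"
      then show thesis using ob[OF y, of "cis (- \<beta>)" \<kappa>] \<kappa> by simp
    next
      assume "cis (- y) = cis (- \<beta>)"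
      then show thesis using ob[OF y, of "cis (- \<alpha>)" \<kappa>] \<kappa> by (simp add: mult_ac)
    qed
  qed
  have L_first: thesis if p: "p \<in> T" "p' \<in> T" "q \<in> T" "q' \<in> T" "A p" "A p'" "\<not> A q" "\<not> A q'" "p < p'" "p < q" "p < q'" "q \<noteq> q'"
        "p \<in> {u<..<v}" "p' \<in> {u<..<v}" "q \<in> {u<..<v}" "q' \<in> {u<..<v}" for p p' q q'
  proof -
    have "\<exists>\<alpha> \<beta>. u < \<alpha> \<and> \<alpha> < v \<and> \<alpha> < \<beta> \<and> \<beta> < \<alpha> + 2 * pi \<and>
      (\<forall>t\<in>T. \<alpha> < t \<and> t < \<beta> \<longrightarrow> \<not> A t) \<and> (\<forall>t\<in>T. \<beta> < t \<and> t < \<alpha> + 2 * pi \<longrightarrow> A t)"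
      by (rule inside[OF A2 _ p]) (rule noalt)
    then obtain \<alpha> \<beta> where ab: "u < \<alpha>" "\<alpha> < v" "\<alpha> < \<beta>" "\<beta> < \<alpha> + 2 * pi"
      "\<forall>t\<in>T. \<alpha> < t \<and> t < \<beta> \<longrightarrow> \<not> A t" "\<forall>t\<in>T. \<beta> < t \<and> t < \<alpha> + 2 * pi \<longrightarrow> A t"
      by (elim exE conjE) (rule that)
    have "cis (- \<alpha>) = cis (- (\<alpha> + 2 * pi))" unfolding cis_cnj[symmetric] by (simp add: complex_eq_iff)
    moreover have "\<not> A t" if "t \<in> T" "\<alpha> + 2 * pi < t" "t < \<beta> + 2 * pi" for t
    proof -
      have "t - 2 * pi \<in> T" "A (t - 2 * pi) = A t" using T2[of "t - 2 * pi"] A2[of "t - 2 * pi"] that by auto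
      then show ?thesis using ab(5) that by auto
    qed
    ultimately show thesis using fin[OF ab(1,2), of \<beta> "\<alpha> + 2 * pi"] ab by auto
  qed
  have R_first: thesis if p: "p \<in> T" "p' \<in> T" "q \<in> T" "q' \<in> T" "\<not> A p" "\<not> A p'" "A q" "A q'" "p < p'" "p < q" "p < q'" "q \<noteq> q'"
        "p \<in> {u<..<v}" "p' \<in> {u<..<v}" "q \<in> {u<..<v}" "q' \<in> {u<..<v}" for p p' q q'
  proof -
    have "\<exists>\<alpha> \<beta>. u < \<alpha> \<and> \<alpha> < v \<and> \<alpha> < \<beta> \<and> \<beta> < \<alpha> + 2 * pi \<and>
      (\<forall>t\<in>T. \<alpha> < t \<and> t < \<beta> \<longrightarrow> \<not> \<not> A t) \<and> (\<forall>t\<in>T. \<beta> < t \<and> t < \<alpha> + 2 * pi \<longrightarrow> \<not> A t)"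
      by (rule inside[OF _ _ p(1-6) _ _ p(9-16)]) (use p(7,8) A2 in simp_all, use noalt' in blast)
    then obtain \<alpha> \<beta> where ab: "u < \<alpha>" "\<alpha> < v" "\<alpha> < \<beta>" "\<beta> < \<alpha> + 2 * pi"
      "\<forall>t\<in>T. \<alpha> < t \<and> t < \<beta> \<longrightarrow> \<not> \<not> A t" "\<forall>t\<in>T. \<beta> < t \<and> t < \<alpha> + 2 * pi \<longrightarrow> \<not> A t"
      by (elim exE conjE) (rule that)
    then show thesis using fin[OF ab(1,2), of \<alpha> \<beta>] by auto
  qed
  have ne: "t1 \<noteq> t3" "t1 \<noteq> t4" "t2 \<noteq> t3" "t2 \<noteq> t4" using TA by auto
  consider "t1 < t2 \<and> t1 < t3 \<and> t1 < t4" | "t2 < t1 \<and> t2 < t3 \<and> t2 < t4"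
    | "t3 < t4 \<and> t3 < t1 \<and> t3 < t2" | "t4 < t3 \<and> t4 < t1 \<and> t4 < t2"
    using ne L(3) R(3) by linarith
  then show thesis
  proof cases
    case 1 then show thesis using L_first[of t1 t2 t3 t4] TT TA L R by blast
  next
    case 2 then show thesis using L_first[of t2 t1 t3 t4] TT TA L R by blast
  next
    case 3 then show thesis using R_first[of t3 t4 t1 t2] TT TA L R by blast
  next
    case 4 then show thesis using R_first[of t4 t3 t1 t2] TT TA L R by blast
  qed
qed

end

subsection \<open>Density\<close>

lemma four_increasing:
  fixes S :: "'a set" and \<phi> :: "'a \<Rightarrow> real"
  assumes "infinite (\<phi> ` S)"
  obtains a1 a2 a3 a4 where "a1 \<in> S" "a2 \<in> S" "a3 \<in> S" "a4 \<in> S" "\<phi> a1 < \<phi> a2" "\<phi> a2 < \<phi> a3" "\<phi> a3 < \<phi> a4"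
proof -
  obtain T where T: "finite T" "card T = 4" "T \<subseteq> \<phi> ` S"
    using infinite_arbitrarily_large[OF assms, of 4] by blast
  define xs where "xs = sorted_list_of_set T"
  have xs: "length xs = 4" "set xs = T" "sorted_wrt (<) xs" using T by (auto simp: xs_def)
  have "xs ! i \<in> \<phi> ` S" if "i < 4" for i using xs T that nth_mem[of i xs] by auto
  then have "\<forall>i. \<exists>a. i < 4 \<longrightarrow> a \<in> S \<and> xs ! i = \<phi> a" by auto
  from choice[OF this] obtain a where a: "\<forall>i. i < 4 \<longrightarrow> a i \<in> S \<and> xs ! i = \<phi> (a i)" by (rule exE)
  have "xs ! i < xs ! Suc i" if "Suc i < 4" for i using xs(1,3) that sorted_wrt_nth_less[OF xs(3), of i "Suc i"] by simp
  from this[of 0] this[of 1] this[of 2] show ?thesis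
    by (intro that[of "a 0" "a 1" "a 2" "a 3"]) (use a in \<open>simp_all add: numeral_2_eq_2 numeral_3_eq_3\<close>)
qed

lemma infinite_image_of_negligible_fibers:
  fixes T :: "real set"
  assumes "\<not> negligible T" "\<And>b. negligible {t \<in> T. \<phi> t = b}"
  shows "infinite (\<phi> ` T)"
proof
  assume "finite (\<phi> ` T)"
  then have "negligible (\<Union>b\<in>\<phi> ` T. {t \<in> T. \<phi> t = b})" using assms(2) by (intro negligible_Union) auto
  moreover have "(\<Union>b\<in>\<phi> ` T. {t \<in> T. \<phi> t = b}) = T" by auto
  ultimately show False using assms(1) by simp
qed

lemma nonnegligible_fiber:
  fixes T :: "real set"
  assumes "\<not> negligible T" "finite (\<phi> ` T)"
  obtains b where "\<not> negligible {t \<in> T. \<phi> t = b}"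
  using infinite_image_of_negligible_fibers[OF assms(1), of \<phi>] assms(2) by blast

context harmonic_ray_complement
begin

text \<open>\<open>cis y\<close> and \<open>cnj x\<close> are the end points of the left arc. Only
  \<open>y\<close> is localized; nothing is said about the position of the other one.\<close>

definition avoids_near :: "real \<Rightarrow> real \<Rightarrow> bool" where
  "avoids_near u v \<longleftrightarrow> (\<exists>y x \<kappa>. u < y \<and> y < v \<and> cmod x = 1 \<and> cmod \<kappa> = 1 \<and>
    (\<forall>z\<in>ball 0 1. \<forall>s\<ge>0. deriv F z * (1 - cis (- y) * z) * (1 - x * z) \<noteq> of_real s * \<kappa>))"

lemma avoids_nearI:
  assumes F': "\<And>z. z \<in> ball 0 1 \<Longrightarrow> deriv F z \<noteq> 0"
    and len: "v \<le> u + 2 * pi"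
    and t: "t1 \<in> {u<..<v}" "t2 \<in> {u<..<v}" "t3 \<in> {u<..<v}" "t4 \<in> {u<..<v}"
    and l: "lands t1 b1" "lands t2 b2" "lands t3 b3" "lands t4 b4"
    and ne: "b1 \<noteq> b2" "b3 \<noteq> b4"
    and ty: "onL bs t1 b1" "onL bs t2 b2" "\<not> onL bs t3 b3" "\<not> onL bs t4 b4"
  shows "avoids_near u v"
proof -
  have ne': "t1 \<noteq> t2" "t3 \<noteq> t4" using ne l lands_unique by blast+
  show ?thesis
    unfolding avoids_near_def
    by (rule ray_avoidance_near_landings[OF F' len t(1,2) ne'(1) l(1,2) ty(1,2) t(3,4) ne'(2) l(3,4) ty(3,4)], assumption)
       (intro exI conjI ballI allI impI)
qed

text \<open>Of four upward rays with different abscissae, the two leftmost become left and the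
  others right when the abscissa of \<open>bs\<close> is put between the second and the third. Only
  the real part of \<open>bs\<close> matters for this.\<close>

lemma avoids_near_different_abscissae:
  assumes F': "\<And>z. z \<in> ball 0 1 \<Longrightarrow> deriv F z \<noteq> 0" and len: "v \<le> u + 2 * pi"
    and T: "T \<subseteq> {u<..<v}" "\<And>t. t \<in> T \<Longrightarrow> lands t (b t) \<and> d (b t) = \<i>"
    and inf: "infinite ((\<lambda>t. Re (b t)) ` T)"
  shows "avoids_near u v"
proof -
  obtain t1 t2 t3 t4 where t: "t1 \<in> T" "t2 \<in> T" "t3 \<in> T" "t4 \<in> T"
    and lt: "Re (b t1) < Re (b t2)" "Re (b t2) < Re (b t3)" "Re (b t3) < Re (b t4)"
    using four_increasing[OF inf] by blast
  define bs where "bs = Complex ((Re (b t2) + Re (b t3)) / 2) 0"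
  have bs: "Re (b t2) < Re bs" "Re bs < Re (b t3)" using lt by (auto simp: bs_def)
  show ?thesis
    by (rule avoids_nearI[OF F' len, of t1 t2 t3 t4 "b t1" "b t2" "b t3" "b t4" bs])
       (use t T lt bs in \<open>auto simp: onL_def lip_def\<close>)
qed

text \<open>All landing points are on one vertical line and reached from the left. With the second
  lowest of four as \<open>bs\<close>, the two above it are lips and so of the left type, while it
  and the lowest one are of the right type because \<open>lip\<close> asks for a strictly greater
  height.\<close>

lemma avoids_near_left_lips:
  assumes F': "\<And>z. z \<in> ball 0 1 \<Longrightarrow> deriv F z \<noteq> 0" and len: "v \<le> u + 2 * pi"
    and T: "T \<subseteq> {u<..<v}" "\<And>t. t \<in> T \<Longrightarrow> lands t (b t) \<and> d (b t) = \<i> \<and> Re (b t) = \<tau>"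
      "\<And>t. t \<in> T \<Longrightarrow> eventually (\<lambda>r. Re (f (of_real r * cis t)) < \<tau>) (at_left 1)"
    and inf: "infinite ((\<lambda>t. Im (b t)) ` T)"
  shows "avoids_near u v"
proof -
  obtain t1 t2 t3 t4 where t: "t1 \<in> T" "t2 \<in> T" "t3 \<in> T" "t4 \<in> T"
    and lt: "Im (b t1) < Im (b t2)" "Im (b t2) < Im (b t3)" "Im (b t3) < Im (b t4)"
    using four_increasing[OF inf] by blast
  have "b t2 \<notin> f ` ball 0 1" using T(2)[OF t(2)] by (simp add: lands_def)
  show ?thesis
    by (rule avoids_nearI[OF F' len, of t3 t4 t1 t2 "b t3" "b t4" "b t1" "b t2" "b t2"])
       (use t T lt \<open>b t2 \<notin> f ` ball 0 1\<close> in \<open>auto simp: onL_def lip_def\<close>)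
qed

end

text \<open>No direction of projection is fixed here: the rotation is chosen later, and every
  rotated mapping \<open>cnj e * f\<close> inherits the assumptions. The continuous inverse serves
  to keep radial limits out of the image.\<close>

locale harmonic_ray_domain =
  fixes h g d :: "complex \<Rightarrow> complex" and Kq :: real
  assumes h: "h holomorphic_on ball 0 1" and g: "g holomorphic_on ball 0 1"
    and inj_harm: "inj_on (\<lambda>z. h z + cnj (g z)) (ball 0 1)"
    and inverse_cont: "\<exists>k. continuous_on ((\<lambda>z. h z + cnj (g z)) ` ball 0 1) k \<and> (\<forall>z\<in>ball 0 1. k (h z + cnj (g z)) = z)"
    and sense: "z \<in> ball 0 1 \<Longrightarrow> cmod (deriv g z) < cmod (deriv h z)"
    and quasi: "z \<in> ball 0 1 \<Longrightarrow> (cmod (deriv h z) + cmod (deriv g z))\<^sup>2 \<le> Kq * \<bar>(cmod (deriv h z))\<^sup>2 - (cmod (deriv g z))\<^sup>2\<bar>"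
    and dir_norm: "b \<notin> (\<lambda>z. h z + cnj (g z)) ` ball 0 1 \<Longrightarrow> cmod (d b) = 1"
    and dir_ray: "\<lbrakk>b \<notin> (\<lambda>z. h z + cnj (g z)) ` ball 0 1; 0 \<le> s\<rbrakk> \<Longrightarrow> b + of_real s * d b \<notin> (\<lambda>z. h z + cnj (g z)) ` ball 0 1"
    and dir_const: "\<lbrakk>b \<notin> (\<lambda>z. h z + cnj (g z)) ` ball 0 1; 0 \<le> s\<rbrakk> \<Longrightarrow> d (b + of_real s * d b) = d b"
begin

definition f :: "complex \<Rightarrow> complex" where "f z = h z + cnj (g z)"

definition hits :: "real \<Rightarrow> complex \<Rightarrow> bool" where
  "hits t b \<longleftrightarrow> b \<notin> f ` ball 0 1 \<and> ((\<lambda>r. f (of_real r * cis t)) \<longlongrightarrow> b) (at_left 1)"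

lemma f_eq: "f = (\<lambda>z. h z + cnj (g z))" by (simp add: f_def fun_eq_iff)

lemmas dir = dir_norm[folded f_eq] dir_ray[folded f_eq] dir_const[folded f_eq]

lemma f_cont: "continuous_on (ball 0 1) f"
  unfolding f_eq using h g by (intro continuous_intros holomorphic_on_imp_continuous_on)

text \<open>Radial limits exist by \<open>negligible_no_radial_limit\<close>. If such a limit were a
  value of \<open>f\<close>, the continuous inverse would carry it to a limit of
  \<open>r * cis t\<close> inside the disk, whereas this tends to the circle.\<close>

lemma ae_hits: "negligible {t. \<not> (\<exists>b. hits t b)}"
proof -
  \<comment> \<open>The pole of the density may be any point not attained in the outer annulus; by
    injectivity \<open>f 0\<close> is one.\<close>
  have ne: "f z \<noteq> f 0" if "exp (-1) < cmod z" "cmod z < 1" for z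
  proof -
    have "z \<noteq> 0" using that by auto
    then show ?thesis using inj_harm that unfolding f_eq inj_on_def by auto
  qed
  have "negligible {y. \<not> (\<exists>w. w \<noteq> f 0 \<and> ((\<lambda>r. f (of_real r * cis y)) \<longlongrightarrow> w) (at_left 1))}"
    unfolding f_eq
    by (rule negligible_no_radial_limit[OF h g inj_harm quasi]) (use ne in \<open>auto simp: f_eq\<close>)
  moreover have "hits t w" if w: "((\<lambda>r. f (of_real r * cis t)) \<longlongrightarrow> w) (at_left 1)" for t w
  proof -
    have "w \<notin> f ` ball 0 1"
    proof
      assume wf: "w \<in> f ` ball 0 1"
      then obtain z where z: "z \<in> ball 0 1" "w = f z" by blast
      obtain k where k: "continuous_on (f ` ball 0 1) k" "\<And>z. z \<in> ball 0 1 \<Longrightarrow> k (f z) = z"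
        using inverse_cont unfolding f_eq by blast
      have ev: "eventually (\<lambda>r. r \<in> {0<..<1}) (at_left (1::real))" by (rule eventually_at_left_real) simp
      then have ev': "eventually (\<lambda>r. of_real r * cis t \<in> ball 0 1) (at_left 1)"
        by eventually_elim (simp add: norm_mult)
      have "((\<lambda>r. k (f (of_real r * cis t))) \<longlongrightarrow> k w) (at_left 1)"
        by (rule continuous_on_tendsto_compose[OF k(1) w wf]) (use ev' in \<open>eventually_elim, auto\<close>)
      moreover have "eventually (\<lambda>r. k (f (of_real r * cis t)) = of_real r * cis t) (at_left 1)"
        using ev' by eventually_elim (rule k(2))
      ultimately have "((\<lambda>r. of_real r * cis t) \<longlongrightarrow> k w) (at_left 1)"
        by (rule Lim_transform_eventually)
      moreover have "((\<lambda>r. of_real r * cis t) \<longlongrightarrow> of_real 1 * cis t) (at_left 1)" by (intro tendsto_intros)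
      ultimately have "k w = of_real 1 * cis t" by (rule tendsto_unique[OF trivial_limit_at_left_real])
      then show False using z k(2)[OF z(1)] by simp
    qed
    then show ?thesis using w by (simp add: hits_def)
  qed
  then have "{t. \<not> (\<exists>b. hits t b)} \<subseteq> {y. \<not> (\<exists>w. w \<noteq> f 0 \<and> ((\<lambda>r. f (of_real r * cis y)) \<longlongrightarrow> w) (at_left 1))}" by blast
  ultimately show ?thesis by (rule negligible_subset)
qed

text \<open>The length-area argument with the density centred at \<open>b\<close> gives limits
  different from \<open>b\<close> on almost all radii.\<close>

lemma negligible_hits: "negligible {t. hits t b}"
proof (cases "b \<in> f ` ball 0 1")
  case True
  then show ?thesis by (simp add: hits_def)
next
  case False
  have "negligible {y. \<not> (\<exists>w. w \<noteq> b \<and> ((\<lambda>r. f (of_real r * cis y)) \<longlongrightarrow> w) (at_left 1))}"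
    unfolding f_eq
    by (rule negligible_no_radial_limit[OF h g inj_harm quasi]) (use False in \<open>auto simp: f_eq image_iff\<close>)
  then show ?thesis
  proof (rule negligible_subset, clarify)
    fix t w assume "hits t b" "w \<noteq> b" "((\<lambda>r. f (of_real r * cis t)) \<longlongrightarrow> w) (at_left 1)"
    then show False unfolding hits_def using tendsto_unique[OF trivial_limit_at_left_real] by blast
  qed
qed

lemma rotated_image: "cmod e = 1 \<Longrightarrow> b \<in> (\<lambda>z. cnj e * f z) ` ball 0 1 \<longleftrightarrow> e * b \<in> f ` ball 0 1"
proof -
  assume "cmod e = 1"
  then have e: "e * cnj e = 1" by (simp add: complex_norm_square[symmetric])
  have "b = cnj e * w \<longleftrightarrow> e * b = w" for w
    using e by (metis mult.assoc mult.commute mult_1)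
  then show ?thesis by auto
qed

lemma rotation:
  assumes e: "cmod e = 1"
  shows "harmonic_ray_complement (\<lambda>z. cnj e * f z) (\<lambda>b. cnj e * d (e * b)) (\<lambda>z. cnj e * h z + e * g z)"
    and "ray_complement.lands (\<lambda>z. cnj e * f z) t b \<longleftrightarrow> hits t (e * b)"
proof -
  have ee: "e * cnj e = 1" "e \<noteq> 0" using e by (auto simp: complex_norm_square[symmetric])
  have ee': "e * (cnj e * x) = x" for x using ee by (simp add: mult.assoc[symmetric])
  interpret ray_complement "\<lambda>z. cnj e * f z" "\<lambda>b. cnj e * d (e * b)"
  proof
    show "continuous_on (ball 0 1) (\<lambda>z. cnj e * f z)" by (intro continuous_intros f_cont)
    show "inj_on (\<lambda>z. cnj e * f z) (ball 0 1)"
      using inj_harm[folded f_eq] ee unfolding inj_on_def by auto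
  next
    fix b assume b: "b \<notin> (\<lambda>z. cnj e * f z) ` ball 0 1"
    then have b': "e * b \<notin> f ` ball 0 1" using rotated_image[OF e] by blast
    show "cmod (cnj e * d (e * b)) = 1" using dir(1)[OF b'] e by (simp add: norm_mult)
    fix s :: real assume s: "0 \<le> s"
    have eq: "e * (b + of_real s * (cnj e * d (e * b))) = e * b + of_real s * d (e * b)"
      by (simp add: distrib_left mult.left_commute[of e "of_real s"] ee')
    show "b + of_real s * (cnj e * d (e * b)) \<notin> (\<lambda>z. cnj e * f z) ` ball 0 1"
      unfolding rotated_image[OF e] eq by (rule dir(2)[OF b' s])
    show "cnj e * d (e * (b + of_real s * (cnj e * d (e * b)))) = cnj e * d (e * b)"
      unfolding eq dir(3)[OF b' s] ..
  qed
  have lim: "((\<lambda>r. cnj e * f (of_real r * cis t)) \<longlongrightarrow> b) (at_left 1) \<longleftrightarrow> ((\<lambda>r. f (of_real r * cis t)) \<longlongrightarrow> e * b) (at_left 1)" for t b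
    using tendsto_mult_left[of "\<lambda>r. cnj e * f (of_real r * cis t)" b "at_left 1" e]
      tendsto_mult_left[of "\<lambda>r. f (of_real r * cis t)" "e * b" "at_left 1" "cnj e"] ee
    by (auto simp: ee' mult.assoc[symmetric] mult.commute[of "cnj e" e])
  show l: "lands t b \<longleftrightarrow> hits t (e * b)" for t b
    unfolding lands_def hits_def rotated_image[OF e] lim ..
  show "harmonic_ray_complement (\<lambda>z. cnj e * f z) (\<lambda>b. cnj e * d (e * b)) (\<lambda>z. cnj e * h z + e * g z)"
  proof
    show "(\<lambda>z. cnj e * h z + e * g z) holomorphic_on ball 0 1" by (intro holomorphic_intros h g)
    show "Re (cnj e * h z + e * g z) = Re (cnj e * f z)" for z by (simp add: f_def algebra_simps)
    have "(\<exists>b. lands t b) \<longleftrightarrow> (\<exists>b. hits t b)" for t unfolding l using ee'[of _] by metis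
    then show "negligible {t. \<not> (\<exists>b. lands t b)}" using ae_hits by simp
  qed
qed

end

section \<open>Landing points whose rays are all vertical\<close>

context harmonic_ray_complement
begin

text \<open>Reflection in the imaginary axis keeps upward rays upward but interchanges the sides
  from which radii approach; \<open>Re f\<close> and with it \<open>F\<close> change sign.\<close>

lemma reflection:
  shows "harmonic_ray_complement (\<lambda>z. - cnj (f z)) (\<lambda>b. - cnj (d (- cnj b))) (\<lambda>z. - F z)"
    and "ray_complement.lands (\<lambda>z. - cnj (f z)) t b \<longleftrightarrow> lands t (- cnj b)"
proof -
  have img: "b \<in> (\<lambda>z. - cnj (f z)) ` ball 0 1 \<longleftrightarrow> - cnj b \<in> f ` ball 0 1" for b
  proof -
    have "b = - cnj w \<longleftrightarrow> - cnj b = w" for w by auto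
    then show ?thesis by auto
  qed
  interpret R: ray_complement "\<lambda>z. - cnj (f z)" "\<lambda>b. - cnj (d (- cnj b))"
  proof
    show "continuous_on (ball 0 1) (\<lambda>z. - cnj (f z))" by (intro continuous_intros cont)
    show "inj_on (\<lambda>z. - cnj (f z)) (ball 0 1)" using inj unfolding inj_on_def by auto
  next
    fix b assume "b \<notin> (\<lambda>z. - cnj (f z)) ` ball 0 1"
    then have b': "- cnj b \<notin> f ` ball 0 1" using img by blast
    show "cmod (- cnj (d (- cnj b))) = 1" using norm_d[OF b'] by simp
    fix s :: real assume s: "0 \<le> s"
    have eq: "- cnj (b + of_real s * - cnj (d (- cnj b))) = - cnj b + of_real s * d (- cnj b)" by simp
    show "b + of_real s * - cnj (d (- cnj b)) \<notin> (\<lambda>z. - cnj (f z)) ` ball 0 1"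
      unfolding img eq by (rule ray[OF b' s])
    show "- cnj (d (- cnj (b + of_real s * - cnj (d (- cnj b))))) = - cnj (d (- cnj b))"
      unfolding eq d_ray[OF b' s] ..
  qed
  have lim: "((\<lambda>r. - cnj (f (of_real r * cis t))) \<longlongrightarrow> b) (at_left 1) \<longleftrightarrow> ((\<lambda>r. f (of_real r * cis t)) \<longlongrightarrow> - cnj b) (at_left 1)" for t b
    using tendsto_minus[OF tendsto_cnj, of "\<lambda>r. - cnj (f (of_real r * cis t))" b "at_left 1"]
      tendsto_minus[OF tendsto_cnj, of "\<lambda>r. f (of_real r * cis t)" "- cnj b" "at_left 1"] by auto
  show l: "R.lands t b \<longleftrightarrow> lands t (- cnj b)" for t b
    unfolding R.lands_def lands_def img lim ..
  show "harmonic_ray_complement (\<lambda>z. - cnj (f z)) (\<lambda>b. - cnj (d (- cnj b))) (\<lambda>z. - F z)"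
  proof
    show "(\<lambda>z. - F z) holomorphic_on ball 0 1" by (intro holomorphic_intros F_holo)
    show "Re (- F z) = Re (- cnj (f z))" if "z \<in> ball 0 1" for z using Re_F[OF that] by simp
    have "(\<exists>b. R.lands t b) \<longleftrightarrow> (\<exists>b. lands t b)" for t
      unfolding l by (metis complex_cnj_cnj complex_cnj_minus minus_minus)
    then show "negligible {t. \<not> (\<exists>b. R.lands t b)}" using ae_lands by simp
  qed
qed

lemma avoids_near_minus:
  assumes "harmonic_ray_complement.avoids_near (\<lambda>z. - F z) u v"
  shows "avoids_near u v"
proof -
  obtain y x \<kappa> where a: "u < y" "y < v" "cmod x = 1" "cmod \<kappa> = 1"
    "\<forall>z\<in>ball 0 1. \<forall>s\<ge>0. deriv (\<lambda>z. - F z) z * (1 - cis (- y) * z) * (1 - x * z) \<noteq> of_real s * \<kappa>"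
    using assms unfolding harmonic_ray_complement.avoids_near_def[OF reflection(1)] by (elim exE conjE) (rule that)
  have "deriv F z * (1 - cis (- y) * z) * (1 - x * z) \<noteq> of_real s * - \<kappa>" if z: "z \<in> ball 0 1" "s \<ge> 0" for z s
  proof -
    have "F field_differentiable at z" using F_holo z(1) by (simp add: holomorphic_on_imp_differentiable_at)
    then have "deriv (\<lambda>z. - F z) z = - deriv F z" by (rule deriv_minus)
    then have "- (deriv F z * (1 - cis (- y) * z) * (1 - x * z)) \<noteq> of_real s * \<kappa>"
      using bspec[OF a(5) z(1), rule_format, OF z(2)] by simp
    then show ?thesis by (metis minus_minus mult_minus_right)
  qed
  then show ?thesis unfolding avoids_near_def using a(1-4) by (intro exI[of _ y] exI[of _ x] exI[of _ "- \<kappa>"]) auto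
qed

text \<open>When all rays point upward, their direction does not distinguish left from right. If
  infinitely many abscissae occur, these do. If not, one vertical line carries the landing points of
  a set of angles that is not negligible; infinitely many heights occur on it, as each single point
  is hit from a negligible set only.\<close>

lemma avoids_near_vertical:
  assumes F': "\<And>z. z \<in> ball 0 1 \<Longrightarrow> deriv F z \<noteq> 0" and len: "v \<le> u + 2 * pi"
    and T: "T \<subseteq> {u<..<v}" "\<And>t. t \<in> T \<Longrightarrow> lands t (b t) \<and> d (b t) = \<i>"
    and big: "\<not> negligible T" and fib: "\<And>b. negligible {t. lands t b}"
  shows "avoids_near u v"
proof (cases "finite ((\<lambda>t. Re (b t)) ` T)")
  case False
  show ?thesis by (rule avoids_near_different_abscissae[OF F' len T False])
next
  case True
  obtain \<tau> where \<tau>: "\<not> negligible {t \<in> T. Re (b t) = \<tau>}" by (rule nonnegligible_fiber[OF big True])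
  define T2 where "T2 = {t \<in> T. Re (b t) = \<tau>}"
  have T2: "t \<in> T2 \<Longrightarrow> lands t (b t) \<and> d (b t) = \<i> \<and> Re (b t) = \<tau>" for t using T by (auto simp: T2_def)
  have fib2: "negligible {t \<in> S. Im (b t) = y}" if "S \<subseteq> T2" for S y
  proof (rule negligible_subset[OF fib[of "Complex \<tau> y"]], clarify)
    fix t assume "t \<in> S" "y = Im (b t)"
    moreover from this have "Complex \<tau> (Im (b t)) = b t" using T2[of t] that by (auto simp: complex_eq_iff)
    ultimately show "lands t (Complex \<tau> (Im (b t)))" using T2[of t] that by auto
  qed
  \<comment> \<open>A landing point above another one lies on the ray of the latter, so that
    \<open>eventually_Re_less_of_avoids\<close> applies to it. The points left out all have the
    least height, and their angles form a negligible set.\<close>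
  define T3 where "T3 = {t \<in> T2. \<exists>t'\<in>T2. Im (b t') < Im (b t)}"
  have T3: "\<not> negligible T3"
  proof
    assume n3: "negligible T3"
    have "negligible (T2 - T3)"
    proof (cases "T2 - T3 = {}")
      case False
      then obtain t0 where t0: "t0 \<in> T2 - T3" by blast
      have "Im (b t) = Im (b t0)" if "t \<in> T2 - T3" for t
      proof -
        have "\<not> Im (b t) < Im (b t0)" "\<not> Im (b t0) < Im (b t)" using that t0 unfolding T3_def by blast+
        then show ?thesis by simp
      qed
      then have "T2 - T3 \<subseteq> {t \<in> T2. Im (b t) = Im (b t0)}" by blast
      then show ?thesis by (rule negligible_subset[OF fib2[OF order_refl]])
    qed simp
    then have "negligible (T3 \<union> (T2 - T3))" using n3 by (rule negligible_Un[rotated])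
    then have "negligible T2" by (rule negligible_subset) blast
    then show False using \<tau> by (simp add: T2_def)
  qed
  \<comment> \<open>At least one of the two sides is taken by a set that is not negligible; the
    right side is reduced to the left one by \<open>reflection\<close>.\<close>
  define TL where "TL = {t \<in> T3. eventually (\<lambda>r. Re (f (of_real r * cis t)) < \<tau>) (at_left 1)}"
  define TR where "TR = {t \<in> T3. eventually (\<lambda>r. Re (f (of_real r * cis t)) > \<tau>) (at_left 1)}"
  have "t \<in> TL \<union> TR" if t: "t \<in> T3" for t
  proof -
    obtain t' where t': "t' \<in> T2" "Im (b t') < Im (b t)" and t2: "t \<in> T2" using t by (auto simp: T3_def)
    have "eventually (\<lambda>r. Re (f (of_real r * cis t)) < Re (b t)) (at_left 1) \<or>
      eventually (\<lambda>r. Re (f (of_real r * cis t)) > Re (b t)) (at_left 1)"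
    proof (rule eventually_Re_less_of_avoids[of t "b t" "Im (b t) - Im (b t')"])
      fix w assume w: "dist w (b t) < Im (b t) - Im (b t')" "Re w = Re (b t)"
      have "\<bar>Im (w - b t)\<bar> \<le> dist w (b t)" unfolding dist_norm by (rule abs_Im_le_cmod)
      then have im: "Im w > Im (b t')" using w by simp
      then have "w = b t' + of_real (Im w - Im (b t')) * d (b t')" using w T2[OF t'(1)] T2[OF t2] by (simp add: complex_eq_iff)
      moreover have "b t' \<notin> f ` ball 0 1" using T2[OF t'(1)] by (simp add: lands_def)
      ultimately show "w \<notin> f ` ball 0 1" using ray[of "b t'" "Im w - Im (b t')"] im by simp
    qed (use T2[OF t2] t'(2) in auto)
    then show ?thesis using T2[OF t2] t by (auto simp: TL_def TR_def)
  qed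
  then have "T3 \<subseteq> TL \<union> TR" by blast
  then have "\<not> negligible TL \<or> \<not> negligible TR" using T3 negligible_Un negligible_subset by blast
  moreover have sub: "TL \<subseteq> T2" "TR \<subseteq> T2" "T2 \<subseteq> {u<..<v}" using T(1) by (auto simp: TL_def TR_def T3_def T2_def)
  ultimately show ?thesis
  proof (elim disjE)
    assume "\<not> negligible TL"
    then have "infinite ((\<lambda>t. Im (b t)) ` TL)" by (rule infinite_image_of_negligible_fibers) (rule fib2[OF sub(1)])
    then show ?thesis
      using sub T2 by (intro avoids_near_left_lips[OF F' len, of TL b \<tau>]) (auto simp: TL_def)
  next
    assume "\<not> negligible TR"
    then have inf: "infinite ((\<lambda>t. Im (b t)) ` TR)" by (rule infinite_image_of_negligible_fibers) (rule fib2[OF sub(2)])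
    interpret R: harmonic_ray_complement "\<lambda>z. - cnj (f z)" "\<lambda>b. - cnj (d (- cnj b))" "\<lambda>z. - F z"
      by (rule reflection(1))
    have dF: "deriv (\<lambda>z. - F z) z = - deriv F z" if "z \<in> ball 0 1" for z
      using F_holo that by (intro deriv_minus) (simp add: holomorphic_on_imp_differentiable_at)
    have "R.avoids_near u v"
    proof (rule R.avoids_near_left_lips[of v u TR "\<lambda>t. - cnj (b t)" "- \<tau>"])
      show "deriv (\<lambda>z. - F z) z \<noteq> 0" if "z \<in> ball 0 1" for z using F'[OF that] dF[OF that] by simp
      show "R.lands t (- cnj (b t)) \<and> - cnj (d (- cnj (- cnj (b t)))) = \<i> \<and> Re (- cnj (b t)) = - \<tau>" if "t \<in> TR" for t
        using T2[of t] sub(2) that by (auto simp: reflection(2))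
      show "eventually (\<lambda>r. Re (- cnj (f (of_real r * cis t))) < - \<tau>) (at_left 1)" if "t \<in> TR" for t
        using that by (simp add: TR_def)
    qed (use len sub inf in auto)
    then show ?thesis by (rule avoids_near_minus)
  qed
qed

end

section \<open>Choice of the rotation\<close>

context harmonic_ray_domain
begin

lemma deriv_rotated:
  assumes "z \<in> ball 0 1"
  shows "deriv (\<lambda>z. cnj e * h z + e * g z) z = cnj e * deriv h z + e * deriv g z"
proof -
  have "(h has_field_derivative deriv h z) (at z)" "(g has_field_derivative deriv g z) (at z)"
    using assms h g by (auto intro: holomorphic_derivI[OF _ open_ball])
  then show ?thesis by (intro DERIV_imp_deriv) (auto intro!: derivative_eq_intros)
qed

lemma deriv_rotated_nonzero:
  assumes "z \<in> ball 0 1" "cmod e = 1"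
  shows "deriv (\<lambda>z. cnj e * h z + e * g z) z \<noteq> 0"
proof
  assume "deriv (\<lambda>z. cnj e * h z + e * g z) z = 0"
  then have "cnj e * deriv h z = - (e * deriv g z)" unfolding deriv_rotated[OF assms(1)] by (simp add: eq_neg_iff_add_eq_0)
  then have "cmod (cnj e * deriv h z) = cmod (- (e * deriv g z))" by (rule arg_cong)
  then show False using sense[OF assms(1)] assms(2) by (simp add: norm_mult)
qed

text \<open>If infinitely many ray directions occur at landing points in the window, four of them
  lie within half a turn, and a rotation sends two to the left and two to the right. If only
  finitely many occur, one of them belongs to a set of angles that is not negligible; it is rotated
  to the vertical, and \<open>avoids_near_vertical\<close> decides by position.\<close>

theorem ray_avoidance_dense:
  assumes uv: "u < v" "v \<le> u + 2 * pi"
  obtains y e x \<kappa> where "u < y" "y < v" "cmod e = 1" "cmod x = 1" "cmod \<kappa> = 1"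
    "\<And>z s. \<lbrakk>z \<in> ball 0 1; 0 \<le> s\<rbrakk> \<Longrightarrow> (deriv h z + e * deriv g z) * (1 - cis (- y) * z) * (1 - x * z) \<noteq> of_real s * \<kappa>"
proof -
  note ob = that
  have fin: thesis if e: "cmod e = 1" and av: "harmonic_ray_complement.avoids_near (\<lambda>z. cnj e * h z + e * g z) u v" for e
  proof -
    have ee: "e * cnj e = 1" "e \<noteq> 0" using e by (auto simp: complex_norm_square[symmetric])
    obtain y x \<kappa> where a: "u < y" "y < v" "cmod x = 1" "cmod \<kappa> = 1"
      "\<forall>z\<in>ball 0 1. \<forall>s\<ge>0. deriv (\<lambda>z. cnj e * h z + e * g z) z * (1 - cis (- y) * z) * (1 - x * z) \<noteq> of_real s * \<kappa>"
      using av unfolding harmonic_ray_complement.avoids_near_def[OF rotation(1)[OF e]] by (elim exE conjE) (rule that)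
    show thesis
    \<comment> \<open>Multiplying by \<open>e\<close> turns \<open>cnj e * h' + e * g'\<close> into
      \<open>h' + e * e * g'\<close>, the form in which the normalization at 0 yields the value
      1.\<close>
    proof (rule ob[of y "e * e" x "e * \<kappa>"])
      fix z :: complex and s :: real assume z: "z \<in> ball 0 1" "0 \<le> s"
      have "e * ((cnj e * deriv h z + e * deriv g z) * (1 - cis (- y) * z) * (1 - x * z)) \<noteq> e * (of_real s * \<kappa>)"
        using a(5) z ee(2) by (auto simp: deriv_rotated)
      moreover have "e * (cnj e * deriv h z + e * deriv g z) = deriv h z + e * e * deriv g z"
        using ee(1) by (simp add: distrib_left mult.assoc[symmetric])
      ultimately show "(deriv h z + e * e * deriv g z) * (1 - cis (- y) * z) * (1 - x * z) \<noteq> of_real s * (e * \<kappa>)"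
        by (simp add: mult.assoc[symmetric] mult.commute[of e "of_real s"])
    qed (use a e in \<open>auto simp: norm_mult\<close>)
  qed
  define T where "T = {t \<in> {u<..<v}. \<exists>b. hits t b}"
  have T: "\<not> negligible T"
  proof
    assume "negligible T"
    then have "negligible (T \<union> {t. \<not> (\<exists>b. hits t b)})" using ae_hits by (rule negligible_Un)
    then have "negligible {u<..<v}" by (rule negligible_subset) (auto simp: T_def)
    moreover have "open {u<..<v}" "{u<..<v} \<noteq> {}" using uv by auto
    ultimately show False using open_not_negligible by blast
  qed
  define b where "b = (\<lambda>t. SOME b. hits t b)"
  have b: "hits t (b t)" if "t \<in> T" for t using that unfolding b_def T_def by (metis (mono_tags, lifting) mem_Collect_eq someI_ex)
  have bd: "cmod (d (b t)) = 1" if "t \<in> T" for t using b[OF that] dir(1) by (simp add: hits_def)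
  have rot: "e * (cnj e * w) = w" if "cmod e = 1" for e w :: complex
    using that by (simp add: mult.assoc[symmetric] complex_norm_square[symmetric])
  show thesis
  proof (cases "finite ((\<lambda>t. d (b t)) ` T)")
    case True
    obtain v0 where v0: "\<not> negligible {t \<in> T. d (b t) = v0}" by (rule nonnegligible_fiber[OF T True])
    define T1 where "T1 = {t \<in> T. d (b t) = v0}"
    have "T1 \<noteq> {}" using v0 unfolding T1_def[symmetric] by (metis negligible_empty)
    then have v1: "cmod v0 = 1" using bd by (auto simp: T1_def)
    \<comment> \<open>Rotation that takes the common direction \<open>v0\<close> to
      \<open>\<i>\<close>.\<close>
    define e where "e = - \<i> * v0"
    have e: "cmod e = 1" using v1 by (simp add: e_def norm_mult)
    have ev: "cnj e * v0 = \<i>" using v1 by (simp add: e_def mult.assoc complex_norm_square[symmetric] mult.commute[of "cnj v0"])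
    interpret R: harmonic_ray_complement "\<lambda>z. cnj e * f z" "\<lambda>b. cnj e * d (e * b)" "\<lambda>z. cnj e * h z + e * g z"
      by (rule rotation(1)[OF e])
    have "R.avoids_near u v"
    proof (rule R.avoids_near_vertical[OF deriv_rotated_nonzero[OF _ e] uv(2), of T1 "\<lambda>t. cnj e * b t"])
      show "R.lands t (cnj e * b t) \<and> cnj e * d (e * (cnj e * b t)) = \<i>" if "t \<in> T1" for t
        using that b ev unfolding rotation(2)[OF e] rot[OF e] by (auto simp: T1_def)
      show "negligible {t. R.lands t b'}" for b' unfolding rotation(2)[OF e] by (rule negligible_hits)
      show "T1 \<subseteq> {u<..<v}" by (auto simp: T1_def T_def)
      show "\<not> negligible T1" using v0 by (simp add: T1_def)
    qed
    then show thesis by (rule fin[OF e])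
  next
    case False
    define \<phi> where "\<phi> = (\<lambda>t. Arg (d (b t)))"
    have dcis: "d (b t) = cis (\<phi> t)" if "t \<in> T" for t
    proof -
      have "d (b t) \<noteq> 0" using bd[OF that] by auto
      then show ?thesis using cis_Arg[of "d (b t)"] bd[OF that] by (simp add: \<phi>_def sgn_eq)
    qed
    have inf: "infinite (\<phi> ` T)"
    proof
      assume "finite (\<phi> ` T)"
      then have "finite (cis ` \<phi> ` T)" by simp
      moreover have "cis ` \<phi> ` T = (\<lambda>t. d (b t)) ` T" using dcis by (auto simp: image_image)
      ultimately show False using False by simp
    qed
    have "\<phi> ` T = \<phi> ` ({t \<in> T. \<phi> t \<le> 0} \<union> {t \<in> T. \<phi> t > 0})" by (rule arg_cong[of _ _ "(`) \<phi>"]) auto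
    then have eq: "\<phi> ` T = \<phi> ` {t \<in> T. \<phi> t \<le> 0} \<union> \<phi> ` {t \<in> T. \<phi> t > 0}" unfolding image_Un .
    \<comment> \<open>\<open>Arg\<close> takes values in an interval of length \<open>2 * pi\<close>
      open on the left; cutting it at 0 gives four angles whose differences are strictly less than
      \<open>pi\<close>.\<close>
    have "infinite (\<phi> ` {t \<in> T. \<phi> t \<le> 0}) \<or> infinite (\<phi> ` {t \<in> T. \<phi> t > 0})" 
      using inf unfolding eq finite_Un by simp
    then obtain t1 t2 t3 t4 where t: "t1 \<in> T" "t2 \<in> T" "t3 \<in> T" "t4 \<in> T" "\<phi> t1 < \<phi> t2" "\<phi> t2 < \<phi> t3" "\<phi> t3 < \<phi> t4"
      and half: "\<phi> t4 < \<phi> t1 + pi"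
    proof (elim disjE)
      assume "infinite (\<phi> ` {t \<in> T. \<phi> t \<le> 0})"
      from four_increasing[OF this] obtain t1 t2 t3 t4 where
        "t1 \<in> {t \<in> T. \<phi> t \<le> 0}" "t2 \<in> {t \<in> T. \<phi> t \<le> 0}" "t3 \<in> {t \<in> T. \<phi> t \<le> 0}" "t4 \<in> {t \<in> T. \<phi> t \<le> 0}"
        "\<phi> t1 < \<phi> t2" "\<phi> t2 < \<phi> t3" "\<phi> t3 < \<phi> t4" .
      then have *: "t1 \<in> T" "t2 \<in> T" "t3 \<in> T" "t4 \<in> T" "\<phi> t1 < \<phi> t2" "\<phi> t2 < \<phi> t3" "\<phi> t3 < \<phi> t4" "\<phi> t4 \<le> 0"
        by simp_all
      have "- pi < \<phi> t1" unfolding \<phi>_def using Arg_bounded by blast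
      then have "\<phi> t4 < \<phi> t1 + pi" using *(8) by simp
      then show thesis by (rule that[OF *(1-7)])
    next
      assume "infinite (\<phi> ` {t \<in> T. \<phi> t > 0})"
      from four_increasing[OF this] obtain t1 t2 t3 t4 where
        "t1 \<in> {t \<in> T. \<phi> t > 0}" "t2 \<in> {t \<in> T. \<phi> t > 0}" "t3 \<in> {t \<in> T. \<phi> t > 0}" "t4 \<in> {t \<in> T. \<phi> t > 0}"
        "\<phi> t1 < \<phi> t2" "\<phi> t2 < \<phi> t3" "\<phi> t3 < \<phi> t4" .
      then have *: "t1 \<in> T" "t2 \<in> T" "t3 \<in> T" "t4 \<in> T" "\<phi> t1 < \<phi> t2" "\<phi> t2 < \<phi> t3" "\<phi> t3 < \<phi> t4" "\<phi> t1 > 0"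
        by simp_all
      have "\<phi> t4 \<le> pi" unfolding \<phi>_def using Arg_bounded by blast
      then have "\<phi> t4 < \<phi> t1 + pi" using *(8) by simp
      then show thesis by (rule that[OF *(1-7)])
    qed
    \<comment> \<open>\<open>m\<close> separates the second angle from the third. After the rotation
      by \<open>e\<close> a direction with angle \<open>\<phi>\<close> has real part
      \<open>sin (m - \<phi>)\<close>, so the first two rays go to the right and the last two to the
      left.\<close>
    define m where "m = (\<phi> t2 + \<phi> t3) / 2"
    define e where "e = cis (m - pi / 2)"
    have e: "cmod e = 1" by (simp add: e_def)
    have Re: "Re (cnj e * d (b t)) = sin (m - \<phi> t)" if "t \<in> T" for t
    proof -
      have "cnj e * d (b t) = cis (\<phi> t - m + pi / 2)" unfolding dcis[OF that] e_def cis_cnj cis_mult by (simp add: algebra_simps)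
      then have "Re (cnj e * d (b t)) = cos (\<phi> t - m + pi / 2)" by simp
      also have "\<dots> = - sin (\<phi> t - m)" by (simp add: cos_add)
      also have "\<dots> = sin (m - \<phi> t)" by (simp add: sin_minus[symmetric])
      finally show ?thesis .
    qed
    have m: "\<phi> t2 < m" "m < \<phi> t3" using t by (auto simp: m_def)
    have pos: "Re (cnj e * d (b t1)) > 0" "Re (cnj e * d (b t2)) > 0"
      using Re[OF t(1)] Re[OF t(2)] t m half by (auto intro!: sin_gt_zero)
    have "sin (\<phi> t3 - m) > 0" "sin (\<phi> t4 - m) > 0" using t m half by (auto intro!: sin_gt_zero)
    moreover have "sin (m - x) = - sin (x - m)" for x by (simp add: sin_minus[symmetric])
    ultimately have neg: "Re (cnj e * d (b t3)) < 0" "Re (cnj e * d (b t4)) < 0"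
      using Re[OF t(3)] Re[OF t(4)] by auto
    interpret R: harmonic_ray_complement "\<lambda>z. cnj e * f z" "\<lambda>b. cnj e * d (e * b)" "\<lambda>z. cnj e * h z + e * g z"
      by (rule rotation(1)[OF e])
    have L: "R.lands t (cnj e * b t)" if "t \<in> T" for t using b[OF that] unfolding rotation(2)[OF e] rot[OF e] .
    have ne: "cnj e * b s \<noteq> cnj e * b t" if "\<phi> s < \<phi> t" for s t
      using that e by (auto simp: \<phi>_def)
    have oL: "R.onL 0 t (cnj e * b s) \<longleftrightarrow> Re (cnj e * d (b s)) < 0" if "Re (cnj e * d (b s)) \<noteq> 0" for s t
    proof -
      have "cnj e * d (b s) \<noteq> \<i>" "cnj e * d (b s) \<noteq> - \<i>"
        using that by (metis imaginary_unit.sel(1), metis imaginary_unit.sel(1) uminus_complex.sel(1) minus_zero)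
      then show ?thesis unfolding R.onL_def rot[OF e] by simp
    qed
    have "R.avoids_near u v"
    proof (rule R.avoids_nearI[OF deriv_rotated_nonzero[OF _ e] uv(2), of t3 t4 t1 t2 "cnj e * b t3" "cnj e * b t4" "cnj e * b t1" "cnj e * b t2" 0])
      show "R.onL 0 t3 (cnj e * b t3)" "R.onL 0 t4 (cnj e * b t4)" "\<not> R.onL 0 t1 (cnj e * b t1)" "\<not> R.onL 0 t2 (cnj e * b t2)"
        using oL neg pos by (metis less_irrefl less_asym)+
    qed (use t L ne in \<open>auto simp: T_def\<close>)
    then show thesis by (rule fin[OF e])
  qed
qed

end

subsection \<open>Direction fields of the classes\<close>

definition direction_field :: "complex set \<Rightarrow> (complex \<Rightarrow> complex) \<Rightarrow> bool" where
  "direction_field \<Omega> d \<longleftrightarrow> (\<forall>b. b \<notin> \<Omega> \<longrightarrow> cmod (d b) = 1 \<and>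
    (\<forall>s\<ge>0. b + of_real s * d b \<notin> \<Omega> \<and> d (b + of_real s * d b) = d b))"

lemma half_line_sgn:
  assumes "v \<noteq> 0"
  shows "half_line a v = half_line a (sgn v)"
proof -
  have 1: "a + of_real t * v = a + of_real (t * cmod v) * sgn v" for t using assms by (simp add: sgn_eq)
  have 2: "a + of_real t * sgn v = a + of_real (t / cmod v) * v" for t by (simp add: sgn_eq)
  show ?thesis unfolding half_line_def
  proof (intro subset_antisym subsetI; clarify)
    fix t :: real assume "t \<ge> 0"
    then show "\<exists>t'. a + of_real t * v = a + of_real t' * sgn v \<and> t' \<ge> 0" using 1 by (intro exI[of _ "t * cmod v"]) simp
    show "\<exists>t'. a + of_real t * sgn v = a + of_real t' * v \<and> t' \<ge> 0" using 2 \<open>t \<ge> 0\<close> by (intro exI[of _ "t / cmod v"]) simp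
  qed
qed

lemma half_line_subset_direction:
  assumes sub: "half_line a v \<subseteq> half_line a' v'" and v: "cmod v = 1" "cmod v' = 1"
  shows "v = v'"
proof -
  have mem: "\<exists>z\<ge>0. a + of_real x * v = a' + of_real z * v'" if "x \<ge> 0" for x
    using sub that unfolding half_line_def by fastforce
  obtain z0 where z0: "z0 \<ge> 0" "a = a' + of_real z0 * v'" using mem[of 0] by auto
  obtain z where z: "z \<ge> 0" "a + of_real (z0 + 1) * v = a' + of_real z * v'" using mem[of "z0 + 1"] z0(1) by auto
  have eq: "of_real (z0 + 1) * v = of_real (z - z0) * v'"
    using z(2) unfolding z0(2) by (simp add: algebra_simps)
  then have "cmod (of_real (z0 + 1) * v) = cmod (of_real (z - z0) * v')" by (rule arg_cong)
  then have "\<bar>z0 + 1\<bar> = \<bar>z - z0\<bar>" by (simp only: norm_mult norm_of_real v mult_1_right)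
  then have "z - z0 = z0 + 1" using z0(1) z(1) by linarith
  then show ?thesis using eq z0(1) by (simp only: mult_cancel_left of_real_eq_0_iff) simp
qed

lemma half_line_tip_unique:
  assumes v: "v \<noteq> 0" and t: "t > 0"
  shows "half_line a v \<noteq> half_line (a + of_real t * v) w"
proof
  assume eq: "half_line a v = half_line (a + of_real t * v) w"
  have mem: "\<exists>y\<ge>0. a + of_real x * v = a + of_real t * v + of_real y * w" if "x \<ge> 0" for x
  proof -
    have "a + of_real x * v \<in> half_line a v" using that unfolding half_line_def by blast
    then have "a + of_real x * v \<in> half_line (a + of_real t * v) w" by (simp only: eq)
    then show ?thesis unfolding half_line_def by auto
  qed
  obtain y where y: "y \<ge> 0" "of_real t * v = - (of_real y * w)" using mem[of 0] by (auto simp: add_eq_0_iff)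
  obtain y2 where y2: "y2 \<ge> 0" "of_real (2 * t) * v = of_real t * v + of_real y2 * w" using mem[of "2 * t"] t by auto
  have "of_real t * v = of_real y2 * w" using y2(2) by (simp add: algebra_simps)
  then have "of_real y2 * w + of_real y * w = 0" unfolding eq_neg_iff_add_eq_0[symmetric] using y(2) by (rule trans[OF sym])
  then have "of_real (y + y2) * w = 0" by (simp add: distrib_right add.commute)
  then have "y + y2 = 0 \<or> w = 0" by (simp only: mult_eq_0_iff of_real_eq_0_iff)
  then have "y2 = 0 \<or> w = 0" using y(1) y2(1) by linarith
  then have "of_real t * v = 0" using \<open>of_real t * v = of_real y2 * w\<close> by auto
  then show False using t v by simp
qed

lemma close_to_convex_direction_field:
  assumes "close_to_convex_domain \<Omega>"
  shows "\<exists>d. direction_field \<Omega> d"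
proof -
  obtain \<F> where F: "\<forall>L\<in>\<F>. is_half_line L" "\<forall>L1\<in>\<F>. \<forall>L2\<in>\<F>. non_crossing L1 L2" "- \<Omega> = \<Union>\<F>"
    using assms unfolding close_to_convex_domain_def by blast
  \<comment> \<open>Prefer a half-line on which \<open>b\<close> is not the tip: its direction is then unique, and so the choice is
    constant along half-lines.\<close>
  define P where "P = (\<lambda>b v. cmod v = 1 \<and> (\<exists>a t. half_line a v \<in> \<F> \<and> t > 0 \<and> b = a + of_real t * v))"
  define Q where "Q = (\<lambda>b v. cmod v = 1 \<and> half_line b v \<in> \<F>)"
  define d where "d = (\<lambda>b. if \<exists>v. P b v then SOME v. P b v else SOME v. Q b v)"
  have PQ: "P b (d b) \<or> Q b (d b)" if b: "b \<notin> \<Omega>" for b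
  proof -
    obtain L where L: "L \<in> \<F>" "b \<in> L" using F(3) b by blast
    then obtain a w where w: "w \<noteq> 0" "L = half_line a w" using F(1) unfolding is_half_line_def by blast
    define v where "v = sgn w"
    have v: "cmod v = 1" "L = half_line a v" using w half_line_sgn by (auto simp: v_def norm_sgn)
    obtain t where t: "t \<ge> 0" "b = a + of_real t * v" using L(2) unfolding v(2) half_line_def by blast
    have "P b v \<or> Q b v"
    proof (cases "t = 0")
      case True then show ?thesis using t v L unfolding Q_def by simp
    next
      case False
      then have "t > 0" using t by simp
      then show ?thesis using t v L unfolding P_def by blast
    qed
    then show ?thesis unfolding d_def by (metis (mono_tags, lifting) someI_ex)
  qed
  \<comment> \<open>If \<open>b\<close> is the tip of neither half-line, not crossing at
    \<open>b\<close> means that one contains the other, and then their directions agree.\<close>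
  have uniq: "v = v'" if "P b v" "P b v'" for b v v'
  proof -
    obtain a t where a: "half_line a v \<in> \<F>" "t > 0" "b = a + of_real t * v" "cmod v = 1" using \<open>P b v\<close> unfolding P_def by blast
    obtain a' t' where a': "half_line a' v' \<in> \<F>" "t' > 0" "b = a' + of_real t' * v'" "cmod v' = 1" using \<open>P b v'\<close> unfolding P_def by blast
    have "v \<noteq> 0" "v' \<noteq> 0" using a(4) a'(4) by auto
    have "non_crossing (half_line a v) (half_line a' v')" using F(2) a(1) a'(1) by blast
    moreover have "b \<in> half_line a v" unfolding half_line_def a(3) using a(2) less_imp_le by blast
    moreover have "b \<in> half_line a' v'" unfolding half_line_def a'(3) using a'(2) less_imp_le by blast
    moreover have "half_line a v \<noteq> half_line b w" for w using half_line_tip_unique[OF \<open>v \<noteq> 0\<close> a(2)] a(3) by simp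
    moreover have "half_line a' v' \<noteq> half_line b w" for w using half_line_tip_unique[OF \<open>v' \<noteq> 0\<close> a'(2)] a'(3) by simp
    ultimately have "half_line a v \<subseteq> half_line a' v' \<or> half_line a' v' \<subseteq> half_line a v" unfolding non_crossing_def by (metis IntI)
    then show ?thesis using half_line_subset_direction a(4) a'(4) by metis
  qed
  have dP: "d b = v" if "P b v" for b v
    using uniq[of b _ v] that unfolding d_def by (metis (mono_tags, lifting) someI_ex)
  have "direction_field \<Omega> d" unfolding direction_field_def
  proof (intro allI impI conjI)
    fix b assume b: "b \<notin> \<Omega>"
    show "cmod (d b) = 1" using PQ[OF b] unfolding P_def Q_def by blast
    fix s :: real assume s: "0 \<le> s"
    obtain a t where a: "half_line a (d b) \<in> \<F>" "t \<ge> 0" "b = a + of_real t * d b"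
    proof -
      from PQ[OF b] show thesis
      proof
        assume "P b (d b)" then show thesis using that unfolding P_def by (auto intro: less_imp_le)
      next
        assume "Q b (d b)" then show thesis using that[of b 0] unfolding Q_def by simp
      qed
    qed
    have e: "b + of_real s * d b = a + of_real (t + s) * d b" using a(3) by (metis add.assoc distrib_right of_real_add)
    have "b + of_real s * d b \<in> half_line a (d b)" unfolding e half_line_def using a(2) s by (auto intro!: exI[of _ "t + s"])
    then show "b + of_real s * d b \<notin> \<Omega>" using a(1) F(3) by blast
    show "d (b + of_real s * d b) = d b"
    proof (cases "s = 0")
      case False
      then have "t + s > 0" using a(2) s by simp
      then have "P (b + of_real s * d b) (d b)" unfolding P_def e using a(1) \<open>cmod (d b) = 1\<close> by blast
      then show ?thesis by (rule dP)
    qed simp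
  qed
  then show ?thesis by blast
qed

text \<open>The ray continues the segment from 0 to \<open>b\<close>. A point of
  \<open>\<Omega>\<close> on it would bring the whole segment from 0, and with it \<open>b\<close>,
  into \<open>\<Omega>\<close>. Having 0 in \<open>\<Omega>\<close> makes \<open>sgn b\<close> a
  unit vector.\<close>

lemma starlike_direction_field:
  assumes st: "starlike_origin \<Omega>" and 0: "0 \<in> \<Omega>"
  shows "\<exists>d. direction_field \<Omega> d"
proof -
  have "direction_field \<Omega> sgn" unfolding direction_field_def
  proof (intro allI impI conjI)
    fix b assume b: "b \<notin> \<Omega>"
    then have b0: "b \<noteq> 0" using 0 by auto
    then show "cmod (sgn b) = 1" by (simp add: norm_sgn)
    fix s :: real assume s: "0 \<le> s"
    define c where "c = 1 + s / cmod b"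
    have c: "c \<ge> 1" using s by (simp add: c_def)
    have e: "b + of_real s * sgn b = of_real c * b" using b0 by (simp add: c_def sgn_eq algebra_simps)
    show "b + of_real s * sgn b \<notin> \<Omega>"
    proof
      assume "b + of_real s * sgn b \<in> \<Omega>"
      then have "closed_segment 0 (of_real c * b) \<subseteq> \<Omega>" using st unfolding e starlike_origin_def by blast
      moreover have "b \<in> closed_segment 0 (of_real c * b)"
        unfolding in_segment using c by (intro exI[of _ "1 / c"]) (simp add: scaleR_conv_of_real)
      ultimately show False using b by blast
    qed
    show "sgn (b + of_real s * sgn b) = sgn b" unfolding e using c by (simp add: sgn_mult sgn_of_real)
  qed
  then show ?thesis by blast
qed

text \<open>A line parallel to \<open>cis \<theta>\<close> meets \<open>\<Omega>\<close> in a
  connected set, so from a point outside at least one of its two rays stays outside. The forward ray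
  is preferred. If it is blocked at \<open>b\<close>, it is blocked from all points behind
  \<open>b\<close> as well, so in either case the choice is constant along the chosen ray.\<close>

lemma convex_in_direction_field:
  assumes "convex_in_direction \<theta> \<Omega>"
  shows "\<exists>d. direction_field \<Omega> d"
proof -
  define d where "d = (\<lambda>b. if \<forall>s\<ge>0. b + of_real s * cis \<theta> \<notin> \<Omega> then cis \<theta> else - cis \<theta>)"
  have "direction_field \<Omega> d" unfolding direction_field_def
  proof (intro allI impI conjI)
    fix b assume b: "b \<notin> \<Omega>"
    show "cmod (d b) = 1" by (simp add: d_def)
    fix s :: real assume s: "0 \<le> s"
    have "b + of_real s * d b \<notin> \<Omega> \<and> d (b + of_real s * d b) = d b"
    proof (cases "\<forall>s\<ge>0. b + of_real s * cis \<theta> \<notin> \<Omega>")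
      case True
      then have db: "d b = cis \<theta>" by (simp add: d_def)
      have "b + of_real s * cis \<theta> + of_real s' * cis \<theta> \<notin> \<Omega>" if "s' \<ge> 0" for s'
      proof -
        have "b + of_real s * cis \<theta> + of_real s' * cis \<theta> = b + of_real (s + s') * cis \<theta>" by (simp add: algebra_simps)
        moreover have "b + of_real (s + s') * cis \<theta> \<notin> \<Omega>" using True that s by (metis add_nonneg_nonneg)
        ultimately show ?thesis by metis
      qed
      then have "d (b + of_real s * cis \<theta>) = cis \<theta>" by (simp add: d_def)
      then show ?thesis using True s db by simp
    next
      case False
      then have db: "d b = - cis \<theta>" by (simp add: d_def)
      obtain s0 where s0: "s0 \<ge> 0" "b + of_real s0 * cis \<theta> \<in> \<Omega>" using False by blast
      have out: "b - of_real s * cis \<theta> \<notin> \<Omega>"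
      proof
        assume in\<Omega>: "b - of_real s * cis \<theta> \<in> \<Omega>"
        define X where "X = \<Omega> \<inter> {b + of_real t * cis \<theta> | t. True}"
        define \<phi> where "\<phi> = (\<lambda>w. Re ((w - b) * cis (- \<theta>)))"
        have \<phi>: "\<phi> (b + of_real t * cis \<theta>) = t" for t
        proof -
          have "(b + of_real t * cis \<theta> - b) * cis (- \<theta>) = of_real t * (cis \<theta> * cis (- \<theta>))" by (simp only: add_diff_cancel_left' mult.assoc)
          also have "\<dots> = of_real t" unfolding cis_mult by simp
          finally show ?thesis unfolding \<phi>_def by (simp only: Re_complex_of_real)
        qed
        have "connected (\<phi> ` X)"
          unfolding \<phi>_def
          by (intro connected_continuous_image continuous_intros)
             (use assms in \<open>simp add: X_def convex_in_direction_def\<close>)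
        moreover have "b + of_real s0 * cis \<theta> \<in> X" using s0 by (auto simp: X_def)
        then have "s0 \<in> \<phi> ` X" by (metis \<phi> imageI)
        moreover have "b + of_real (- s) * cis \<theta> \<in> X" using in\<Omega> unfolding X_def by (auto intro!: exI[of _ "- s"])
        then have "- s \<in> \<phi> ` X" by (metis \<phi> imageI)
        ultimately have "0 \<in> \<phi> ` X" using s s0(1) unfolding connected_iff_interval by fastforce
        then obtain t where "b + of_real t * cis \<theta> \<in> \<Omega>" "t = 0" using \<phi> by (auto simp: X_def)
        then show False using b by simp
      qed
      have "b - of_real s * cis \<theta> + of_real (s + s0) * cis \<theta> \<in> \<Omega>" using s0(2) by (simp add: algebra_simps)
      then have "\<not> (\<forall>s'\<ge>0. b - of_real s * cis \<theta> + of_real s' * cis \<theta> \<notin> \<Omega>)" using s s0(1) by (metis add_nonneg_nonneg)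
      then have "d (b - of_real s * cis \<theta>) = - cis \<theta>" unfolding d_def by (simp only: if_False)
      then show ?thesis using out db by simp
    qed
    then show "b + of_real s * d b \<notin> \<Omega>" "d (b + of_real s * d b) = d b" by blast+
  qed
  then show ?thesis by blast
qed

lemma harmonic_ray_domain_of_class:
  assumes K: "K \<ge> 1" and k: "k = (K - 1) / (K + 1)" and qc: "K_qc_harmonic K h g"
    and cls: "in_CH0 h g \<or> in_SHstar0 h g \<or> in_KH0 \<theta> h g"
  obtains d where "harmonic_ray_domain h g d K"
proof -
  have sh: "in_SH0 h g" using cls unfolding in_CH0_def in_SHstar0_def in_KH0_def by blast
  have hm: "harm h g = (\<lambda>z. h z + cnj (g z))" by (simp add: harm_def)
  have "harm h g 0 = 0" using sh by (simp add: in_SH0_def hm)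
  then have "0 \<in> harm h g ` unit_disk" by (metis centre_in_ball image_eqI zero_less_one)
  then obtain d where d: "direction_field (harm h g ` unit_disk) d"
    using cls close_to_convex_direction_field starlike_direction_field convex_in_direction_field
    unfolding in_CH0_def in_SHstar0_def in_KH0_def by blast
  have "harmonic_ray_domain h g d K"
  proof
    show "h holomorphic_on ball 0 1" "g holomorphic_on ball 0 1" using sh by (auto simp: in_SH0_def)
    show "inj_on (\<lambda>z. h z + cnj (g z)) (ball 0 1)" using sh by (simp add: in_SH0_def hm)
    show "\<exists>k. continuous_on ((\<lambda>z. h z + cnj (g z)) ` ball 0 1) k \<and> (\<forall>z\<in>ball 0 1. k (h z + cnj (g z)) = z)"
    proof -
      obtain k where "homeomorphism unit_disk (harm h g ` unit_disk) (harm h g) k" using qc unfolding K_qc_harmonic_def by blast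
      then show ?thesis unfolding homeomorphism_def hm by (intro exI[of _ k] conjI) simp_all
    qed
    show "cmod (deriv g z) < cmod (deriv h z)" if "z \<in> ball 0 1" for z using sh that by (simp add: in_SH0_def)
    show "(cmod (deriv h z) + cmod (deriv g z))\<^sup>2 \<le> K * \<bar>(cmod (deriv h z))\<^sup>2 - (cmod (deriv g z))\<^sup>2\<bar>" if z: "z \<in> ball 0 1" for z
    proof -
      define a b where "a = cmod (deriv h z)" and "b = cmod (deriv g z)"
      have ab: "0 \<le> b" "b < a" using sh z by (auto simp: in_SH0_def a_def b_def)
      \<comment> \<open>With \<open>k = (K - 1) / (K + 1)\<close>, the bound
        \<open>b \<le> k * a\<close> is the same as \<open>a + b \<le> K * (a - b)\<close>, which is
        then multiplied by \<open>a + b\<close>.\<close>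
      have "b / a \<le> (K - 1) / (K + 1)" using qc z unfolding K_qc_harmonic_def a_def b_def by (simp add: norm_divide)
      then have "(K + 1) * b \<le> (K - 1) * a" using ab K by (simp add: divide_simps mult.commute)
      then have "a + b \<le> K * (a - b)" by (simp add: algebra_simps)
      then have "(a + b) * (a + b) \<le> K * (a - b) * (a + b)" using ab by (intro mult_right_mono) auto
      also have "\<dots> = K * (a\<^sup>2 - b\<^sup>2)" by (simp add: power2_eq_square algebra_simps)
      also have "a\<^sup>2 - b\<^sup>2 = \<bar>a\<^sup>2 - b\<^sup>2\<bar>" using ab by (simp add: power_mono)
      finally show ?thesis unfolding a_def b_def by (simp add: power2_eq_square)
    qed
  qed (use d in \<open>auto simp: direction_field_def hm\<close>)
  then show thesis by (rule that)
qed

subsection \<open>Rearrangement of logarithms\<close>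

text \<open>Majorization tested on the functions \<open>max 0 (x - c)\<close>, the form in which
  subharmonicity delivers it. The exponential means needed at the end are superpositions of these
  functions over \<open>c\<close>, see \<open>majorized_exp\<close>. Continuity is included to make
  the integrals meaningful.\<close>

definition majorized :: "(real \<Rightarrow> real) \<Rightarrow> (real \<Rightarrow> real) \<Rightarrow> bool" where
  "majorized u U \<longleftrightarrow> continuous_on {0..2*pi} u \<and> continuous_on {0..2*pi} U \<and>
    (\<forall>c. integral {0..2*pi} (\<lambda>t. max 0 (u t - c)) \<le> integral {0..2*pi} (\<lambda>t. max 0 (U t - c)))"

definition symmetric_decreasing :: "(real \<Rightarrow> real) \<Rightarrow> bool" where
  "symmetric_decreasing U \<longleftrightarrow> (\<forall>t. U (2 * pi - t) = U t) \<and> (\<forall>s t. 0 \<le> s \<and> s \<le> t \<and> t \<le> pi \<longrightarrow> U t \<le> U s)"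

text \<open>Littlewood's subordination principle for the subharmonic functions \<open>max 0 (Re H - c)\<close>.\<close>
lemma majorized_subordination:
  assumes H: "H holomorphic_on ball 0 1" and s: "s holomorphic_on ball 0 1" "s 0 = 0"
    "\<And>z. cmod z < 1 \<Longrightarrow> cmod (s z) < 1" and r: "0 < r" "r < 1"
  shows "majorized (\<lambda>t. Re (H (s (of_real r * cis t)))) (\<lambda>t. Re (H (of_real r * cis t)))"
  unfolding majorized_def
proof (intro conjI allI)
  have circ: "of_real r * cis t \<in> ball 0 1" for t using r by (simp add: norm_mult)
  have sle: "cmod (s z) \<le> cmod z" if "cmod z < 1" for z by (rule Schwarz_Lemma(1)[OF s that])
  have cH: "continuous_on (ball 0 1) H" and cs: "continuous_on (ball 0 1) s"
    using H s by (auto intro: holomorphic_on_imp_continuous_on)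
  show c1: "continuous_on {0..2*pi} (\<lambda>t. Re (H (s (of_real r * cis t))))"
    by (intro continuous_on_Re continuous_on_compose2[OF cH] continuous_on_compose2[OF cs] continuous_intros)
       (use circ s(3) in auto)
  show c2: "continuous_on {0..2*pi} (\<lambda>t. Re (H (of_real r * cis t)))"
    by (intro continuous_on_Re continuous_on_compose2[OF cH] continuous_intros) (use circ in auto)
  fix c :: real
  have i1: "(\<lambda>t. max 0 (Re (H (s (of_real r * cis t))) - c)) integrable_on {0..2*pi}"
    by (intro integrable_continuous_interval continuous_intros c1)
  have i2: "(\<lambda>t. max 0 (Re (H (of_real r * cis t)) - c)) integrable_on {0..2*pi}"
    by (intro integrable_continuous_interval continuous_intros c2)
  show "integral {0..2*pi} (\<lambda>t. max 0 (Re (H (s (of_real r * cis t))) - c)) \<le> integral {0..2*pi} (\<lambda>t. max 0 (Re (H (of_real r * cis t)) - c))"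
  proof (rule field_le_epsilon)
    fix e' :: real assume e': "e' > 0"
    define e where "e = e' / (2 * (2 * pi))"
    have e: "e > 0" using e' by (simp add: e_def)
    have sb: "sphere 0 r \<subseteq> ball (0::complex) 1" "cball 0 r \<subseteq> ball (0::complex) 1" using r by auto
    have "continuous_on (sphere 0 r) (\<lambda>w. max 0 (Re (H w) - c))"
      by (intro continuous_intros continuous_on_subset[OF cH sb(1)])
    then obtain p where p: "\<And>w. w \<in> sphere 0 r \<Longrightarrow> \<bar>max 0 (Re (H w) - c) - Re (poly p w)\<bar> < e"
      using Re_poly_approx_on_circle[OF _ e] by blast
    \<comment> \<open>On the circle \<open>Re (poly p)\<close> is close to
      \<open>max 0 (Re H - c)\<close>. By the maximum principle for \<open>- p\<close> and for
      \<open>H - p\<close> it nearly dominates this function inside, where the Schwarz lemma puts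
      the values of \<open>s\<close>. The mean values of \<open>p\<close> and of the composition of
      \<open>p\<close> with \<open>s\<close> agree, since \<open>s 0 = 0\<close>.\<close>
    have inside: "max 0 (Re (H w) - c) \<le> Re (poly p w) + e" if w: "w \<in> cball 0 r" for w
    proof -
      have "Re (- poly p w) \<le> e"
      proof (rule maximum_real_frontier[of "\<lambda>w. - poly p w" "cball 0 r" e w])
        show "Re (- poly p z) \<le> e" if "z \<in> frontier (cball 0 r)" for z
          using p[of z] that by (simp add: frontier_cball)
      qed (use w in \<open>auto intro!: holomorphic_intros continuous_intros\<close>)
      moreover have "Re (H w - poly p w) \<le> c + e"
      proof (rule maximum_real_frontier[of "\<lambda>w. H w - poly p w" "cball 0 r" "c + e" w])
        show "Re (H z - poly p z) \<le> c + e" if "z \<in> frontier (cball 0 r)" for z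
          using p[of z] that by (simp add: frontier_cball)
        show "(\<lambda>w. H w - poly p w) holomorphic_on interior (cball 0 r)"
          by (intro holomorphic_intros holomorphic_on_subset[OF H]) (use sb(2) interior_subset in blast)
        show "continuous_on (closure (cball 0 r)) (\<lambda>w. H w - poly p w)"
          by (intro continuous_intros continuous_on_subset[OF cH]) (use sb(2) in simp)
      qed (use w in auto)
      ultimately show ?thesis by auto
    qed
    have hp: "poly p holomorphic_on A" for A by (intro holomorphic_intros)
    have mv1: "((\<lambda>t. Re (poly p (of_real r * cis t))) has_integral (2 * pi * Re (poly p 0))) {0..2*pi}"
      by (rule mean_value_circle_Re[OF hp r])
    have "(\<lambda>z. poly p (s z)) holomorphic_on ball 0 1"
      by (intro holomorphic_intros s(1))
    from mean_value_circle_Re[OF this r]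
    have mv2: "((\<lambda>t. Re (poly p (s (of_real r * cis t)))) has_integral (2 * pi * Re (poly p 0))) {0..2*pi}"
      by (simp add: s(2))
    have k: "((\<lambda>t. e) has_integral (2 * pi * e)) {0..2*pi}" using has_integral_const_real[of e 0 "2 * pi"] by simp
    have "integral {0..2*pi} (\<lambda>t. max 0 (Re (H (s (of_real r * cis t))) - c)) \<le> 2 * pi * Re (poly p 0) + 2 * pi * e"
    proof (rule has_integral_le[OF integrable_integral[OF i1] has_integral_add[OF mv2 k]])
      fix t
      have "cmod (s (of_real r * cis t)) \<le> r" using sle[of "of_real r * cis t"] r by (simp add: norm_mult)
      then show "max 0 (Re (H (s (of_real r * cis t))) - c) \<le> Re (poly p (s (of_real r * cis t))) + e"
        using inside[of "s (of_real r * cis t)"] by simp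
    qed
    moreover have "2 * pi * Re (poly p 0) \<le> integral {0..2*pi} (\<lambda>t. max 0 (Re (H (of_real r * cis t)) - c)) + 2 * pi * e"
    proof (rule has_integral_le[OF mv1 has_integral_add[OF integrable_integral[OF i2] k]])
      show "Re (poly p (of_real r * cis t)) \<le> max 0 (Re (H (of_real r * cis t)) - c) + e" for t
        using p[of "of_real r * cis t"] r by (simp add: norm_mult)
    qed
    moreover have "2 * pi * e + 2 * pi * e = e'" by (simp add: e_def)
    ultimately show "integral {0..2*pi} (\<lambda>t. max 0 (Re (H (s (of_real r * cis t))) - c)) \<le> integral {0..2*pi} (\<lambda>t. max 0 (Re (H (of_real r * cis t)) - c)) + e'"
      by linarith
  qed
qed

lemma symmetric_decreasing_fold:
  assumes "symmetric_decreasing U" "symmetric_decreasing U'" "t \<in> {0..2*pi}"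
  obtains t' where "t' \<in> {0..pi}" "U t = U t'" "U' t = U' t'"
proof (cases "t \<le> pi")
  case False
  then show ?thesis using assms that[of "2 * pi - t"] by (auto simp: symmetric_decreasing_def)
qed (use assms that in auto)

text \<open>\<open>U1\<close> and \<open>U2\<close> decrease together on \<open>[0, pi]\<close>, so
  levels read off at one angle are exceeded or not exceeded by both at once. The angle is one where
  \<open>U1 + U2\<close> equals \<open>c\<close>; for \<open>c\<close> outside the range of the sum
  the level of \<open>U2\<close> is taken at the end point 0 or \<open>pi\<close>, and the excess
  goes to the level of \<open>U1\<close>.\<close>

lemma common_level:
  assumes sd: "symmetric_decreasing U1" "symmetric_decreasing U2"
    and c: "continuous_on {0..2*pi} U1" "continuous_on {0..2*pi} U2"
  obtains c1 c2 where "c1 + c2 = c"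
    "\<And>t. t \<in> {0..2*pi} \<Longrightarrow> c1 \<le> U1 t \<and> c2 \<le> U2 t \<or> U1 t \<le> c1 \<and> U2 t \<le> c2"
proof -
  note ob = that
  have mono: "U1 t \<le> U1 s \<and> U2 t \<le> U2 s" if "0 \<le> s" "s \<le> t" "t \<le> pi" for s t
    using sd that unfolding symmetric_decreasing_def by blast
  have red: thesis if "c1 + c2 = c" and k: "\<And>t. t \<in> {0..pi} \<Longrightarrow> c1 \<le> U1 t \<and> c2 \<le> U2 t \<or> U1 t \<le> c1 \<and> U2 t \<le> c2" for c1 c2
  proof (rule ob[OF \<open>c1 + c2 = c\<close>])
    fix t :: real assume "t \<in> {0..2*pi}"
    from symmetric_decreasing_fold[OF sd this]
    obtain t' where "t' \<in> {0..pi}" "U1 t = U1 t'" "U2 t = U2 t'" by blast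
    then show "c1 \<le> U1 t \<and> c2 \<le> U2 t \<or> U1 t \<le> c1 \<and> U2 t \<le> c2" using k[of t'] by simp
  qed
  consider "c \<ge> U1 0 + U2 0" | "c \<le> U1 pi + U2 pi" | "U1 pi + U2 pi \<le> c" "c \<le> U1 0 + U2 0" by linarith
  then show thesis
  proof cases
    case 1
    show thesis by (rule red[of "c - U2 0" "U2 0"]) (use 1 mono[of 0] in force)+
  next
    case 2
    show thesis by (rule red[of "c - U2 pi" "U2 pi"]) (use 2 mono[of _ pi] in force)+
  next
    case 3
    have "continuous_on {0..pi} (\<lambda>t. U1 t + U2 t)"
      using c by (intro continuous_intros) (auto intro: continuous_on_subset)
    from IVT2'[OF 3 _ this] obtain t0 where t0: "0 \<le> t0" "t0 \<le> pi" "U1 t0 + U2 t0 = c" by auto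
    show thesis
    proof (rule red[OF t0(3)])
      fix t assume "t \<in> {0..pi}"
      then show "U1 t0 \<le> U1 t \<and> U2 t0 \<le> U2 t \<or> U1 t \<le> U1 t0 \<and> U2 t \<le> U2 t0"
        using mono[of t t0] mono[of t0 t] t0 by (cases "t \<le> t0") auto
    qed
  qed
qed

lemma majorized_add:
  assumes m: "majorized u1 U1" "majorized u2 U2" and sd: "symmetric_decreasing U1" "symmetric_decreasing U2"
  shows "majorized (\<lambda>t. u1 t + u2 t) (\<lambda>t. U1 t + U2 t)"
  unfolding majorized_def
proof (intro conjI allI)
  have cu: "continuous_on {0..2*pi} u1" "continuous_on {0..2*pi} u2" and cU: "continuous_on {0..2*pi} U1" "continuous_on {0..2*pi} U2"
    using m by (auto simp: majorized_def)
  show c1: "continuous_on {0..2*pi} (\<lambda>t. u1 t + u2 t)" and c2: "continuous_on {0..2*pi} (\<lambda>t. U1 t + U2 t)"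
    by (intro continuous_intros cu cU)+
  have int: "(\<lambda>t. max 0 (u t - c)) integrable_on {0..2*pi}" if "continuous_on {0..2*pi} u" for u :: "real \<Rightarrow> real" and c
    by (intro integrable_continuous_interval continuous_intros that)
  fix c
  \<comment> \<open>Splitting \<open>c\<close> at the angle where \<open>U1 + U2 = c\<close> makes \<open>max 0 (U1 + U2 - c)\<close> the sum of the two
    positive parts.\<close>
  obtain k1 k2 where k: "k1 + k2 = c"
    "\<And>t. t \<in> {0..2*pi} \<Longrightarrow> k1 \<le> U1 t \<and> k2 \<le> U2 t \<or> U1 t \<le> k1 \<and> U2 t \<le> k2"
    by (rule common_level[OF sd cU, where c = c]) blast
  have "integral {0..2*pi} (\<lambda>t. max 0 (u1 t + u2 t - c)) \<le> integral {0..2*pi} (\<lambda>t. max 0 (u1 t - k1) + max 0 (u2 t - k2))"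
    by (intro integral_le int c1 integrable_add cu) (use k(1) in auto)
  also have "\<dots> = integral {0..2*pi} (\<lambda>t. max 0 (u1 t - k1)) + integral {0..2*pi} (\<lambda>t. max 0 (u2 t - k2))"
    by (intro integral_add int cu)
  also have "\<dots> \<le> integral {0..2*pi} (\<lambda>t. max 0 (U1 t - k1)) + integral {0..2*pi} (\<lambda>t. max 0 (U2 t - k2))"
    using m by (intro add_mono) (auto simp: majorized_def)
  also have "\<dots> = integral {0..2*pi} (\<lambda>t. max 0 (U1 t - k1) + max 0 (U2 t - k2))"
    by (intro integral_add[symmetric] int cU)
  also have "\<dots> = integral {0..2*pi} (\<lambda>t. max 0 (U1 t + U2 t - c))"
  proof (rule integral_cong)
    fix t :: real assume "t \<in> {0..2*pi}"
    from k(2)[OF this] show "max 0 (U1 t - k1) + max 0 (U2 t - k2) = max 0 (U1 t + U2 t - c)" using k(1) by auto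
  qed
  finally show "integral {0..2*pi} (\<lambda>t. max 0 (u1 t + u2 t - c)) \<le> integral {0..2*pi} (\<lambda>t. max 0 (U1 t + U2 t - c))" .
qed

lemma symmetric_decreasing_add:
  "\<lbrakk>symmetric_decreasing U1; symmetric_decreasing U2\<rbrakk> \<Longrightarrow> symmetric_decreasing (\<lambda>t. U1 t + U2 t)"
  unfolding symmetric_decreasing_def by (auto intro: add_mono)

text \<open>Taylor's formula at \<open>m\<close> with integral remainder for
  \<open>exp (p * x)\<close>. Writing the factor as \<open>max 0 (x - c)\<close> allows an upper
  limit \<open>M\<close> that does not depend on \<open>x\<close>.\<close>

lemma exp_as_integral_of_positive_parts:
  fixes x m M p :: real
  assumes "m \<le> x" "x \<le> M"
  shows "((\<lambda>c. p\<^sup>2 * exp (p * c) * max 0 (x - c)) has_integral (exp (p * x) - exp (p * m) - p * exp (p * m) * (x - m))) {m..M}"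
proof -
  let ?F = "\<lambda>c. p * exp (p * c) * (x - c) + exp (p * c)"
  have "((\<lambda>c. p\<^sup>2 * exp (p * c) * (x - c)) has_integral (?F x - ?F m)) {m..x}"
  proof (rule fundamental_theorem_of_calculus[OF assms(1)])
    show "(?F has_vector_derivative p\<^sup>2 * exp (p * c) * (x - c)) (at c within {m..x})" for c
      unfolding has_real_derivative_iff_has_vector_derivative[symmetric]
      by (auto intro!: derivative_eq_intros simp: algebra_simps power2_eq_square)
  qed
  then have 1: "((\<lambda>c. p\<^sup>2 * exp (p * c) * max 0 (x - c)) has_integral (?F x - ?F m)) {m..x}"
    by (rule has_integral_eq[rotated]) auto
  have 2: "((\<lambda>c. p\<^sup>2 * exp (p * c) * max 0 (x - c)) has_integral 0) {x..M}"
    by (rule has_integral_eq[OF _ has_integral_0]) auto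
  have "((\<lambda>c. p\<^sup>2 * exp (p * c) * max 0 (x - c)) has_integral (?F x - ?F m + 0)) {m..M}"
    by (rule has_integral_combine[OF assms 1 2])
  then show ?thesis by (simp add: algebra_simps)
qed

text \<open>Integrating \<open>exp_as_integral_of_positive_parts\<close> over the angle and
  exchanging the integrals expresses the exponential mean by the quantities compared in
  \<open>majorized\<close>, with nonnegative weights. \<open>B\<close> bounds both functions, so
  both representations use the same interval of levels; the terms at the lower end are a constant
  and the positive part above \<open>- B\<close>.\<close>

lemma majorized_exp:
  assumes m: "majorized u U" and p: "p > 0"
  shows "integral {0..2*pi} (\<lambda>t. exp (p * u t)) \<le> integral {0..2*pi} (\<lambda>t. exp (p * U t))"
proof -
  have c: "continuous_on {0..2*pi} u" "continuous_on {0..2*pi} U" using m by (auto simp: majorized_def)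
  have "bounded (u ` {0..2*pi} \<union> U ` {0..2*pi})"
    using c by (auto intro!: compact_imp_bounded compact_continuous_image)
  then obtain B where B: "\<forall>x \<in> u ` {0..2*pi} \<union> U ` {0..2*pi}. \<bar>x\<bar> \<le> B" unfolding bounded_iff real_norm_def ..
  define K where "K = (\<lambda>(v::real \<Rightarrow> real) t c. p\<^sup>2 * exp (p * c) * max 0 (v t - c))"
  define I where "I = (\<lambda>(v::real \<Rightarrow> real) c. integral {0..2*pi} (\<lambda>t. max 0 (v t - c)))"
  have int: "(\<lambda>t. max 0 (v t - c)) integrable_on {0..2*pi}" if "continuous_on {0..2*pi} v" for v :: "real \<Rightarrow> real" and c
    by (intro integrable_continuous_interval continuous_intros that)
  have rep: "integral {0..2*pi} (\<lambda>t. exp (p * v t)) = 2 * pi * exp (- p * B) + p * exp (- p * B) * I v (- B) + integral {-B..B} (\<lambda>c. p\<^sup>2 * exp (p * c) * I v c)"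
    and repint: "(\<lambda>c. p\<^sup>2 * exp (p * c) * I v c) integrable_on {-B..B}"
    if cv: "continuous_on {0..2*pi} v" and bv: "\<And>t. t \<in> {0..2*pi} \<Longrightarrow> \<bar>v t\<bar> \<le> B" for v
  proof -
    have pr: "cbox (0, -B) (2*pi, B) = {0..2*pi} \<times> {-B..B}" by (simp add: cbox_Pair_eq)
    have cK: "continuous_on ({0..2*pi} \<times> {-B..B}) (\<lambda>(t, c). K v t c)"
      unfolding K_def split_def
      by (intro continuous_intros continuous_on_compose2[OF cv]) auto
    have eqK: "integral {0..2*pi} (\<lambda>t. K v t c) = p\<^sup>2 * exp (p * c) * I v c" for c
      unfolding K_def I_def by simp
    have swap: "integral {0..2*pi} (\<lambda>t. integral {-B..B} (K v t)) = integral {-B..B} (\<lambda>c. p\<^sup>2 * exp (p * c) * I v c)"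
      using integral_swap_continuous[of 0 "-B" "2*pi" B "K v"] cK pr unfolding cbox_interval eqK[symmetric] by simp
    have "continuous_on {-B..B} (\<lambda>c. integral (cbox 0 (2*pi)) (\<lambda>t. K v t c))"
    proof (rule integral_continuous_on_param)
      show "continuous_on ({-B..B} \<times> cbox 0 (2*pi)) (\<lambda>(c, t). K v t c)"
        unfolding K_def split_def cbox_interval
        by (intro continuous_intros continuous_on_compose2[OF cv]) auto
    qed
    then show "(\<lambda>c. p\<^sup>2 * exp (p * c) * I v c) integrable_on {-B..B}"
      unfolding cbox_interval eqK by (rule integrable_continuous_interval)
    have e: "exp (p * v t) = exp (- p * B) + p * exp (- p * B) * max 0 (v t - (-B)) + integral {-B..B} (K v t)" if t: "t \<in> {0..2*pi}" for t
    proof -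
      have b: "- B \<le> v t" "v t \<le> B" using bv[OF t] by auto
      have "integral {-B..B} (K v t) = exp (p * v t) - exp (p * (-B)) - p * exp (p * (-B)) * (v t - (-B))"
        unfolding K_def by (rule integral_unique[OF exp_as_integral_of_positive_parts[OF b]])
      then show ?thesis using b by (simp add: max_def)
    qed
    have iK: "(\<lambda>t. integral {-B..B} (K v t)) integrable_on {0..2*pi}"
      using integrable_continuous_interval[OF integral_continuous_on_param[of "{0..2*pi}" "-B" B "K v"]] cK
      unfolding cbox_interval by simp
    have "integral {0..2*pi} (\<lambda>t. exp (p * v t)) = integral {0..2*pi} (\<lambda>t. exp (- p * B) + p * exp (- p * B) * max 0 (v t - (-B)) + integral {-B..B} (K v t))"
      by (rule integral_cong) (rule e)
    also have "\<dots> = integral {0..2*pi} (\<lambda>t. exp (- p * B) + p * exp (- p * B) * max 0 (v t - (-B))) + integral {0..2*pi} (\<lambda>t. integral {-B..B} (K v t))"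
      by (rule integral_add[OF _ iK], intro integrable_continuous_interval continuous_intros cv)
    also have "integral {0..2*pi} (\<lambda>t. exp (- p * B) + p * exp (- p * B) * max 0 (v t - (-B))) = integral {0..2*pi} (\<lambda>t. exp (- p * B)) + integral {0..2*pi} (\<lambda>t. p * exp (- p * B) * max 0 (v t - (-B)))"
      by (rule integral_add; intro integrable_continuous_interval continuous_intros cv)
    finally show "integral {0..2*pi} (\<lambda>t. exp (p * v t)) = 2 * pi * exp (- p * B) + p * exp (- p * B) * I v (- B) + integral {-B..B} (\<lambda>c. p\<^sup>2 * exp (p * c) * I v c)"
      unfolding swap I_def by simp
  qed
  have b: "\<bar>u t\<bar> \<le> B" "\<bar>U t\<bar> \<le> B" if "t \<in> {0..2*pi}" for t using B that by blast+
  have le: "I u c \<le> I U c" for c using m by (simp add: majorized_def I_def)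
  have "integral {-B..B} (\<lambda>c. p\<^sup>2 * exp (p * c) * I u c) \<le> integral {-B..B} (\<lambda>c. p\<^sup>2 * exp (p * c) * I U c)"
    by (intro integral_le repint c mult_left_mono le) (use b in auto)
  moreover have "p * exp (- p * B) * I u (- B) \<le> p * exp (- p * B) * I U (- B)"
    using p by (intro mult_left_mono le) auto
  moreover note rep[OF c(1) b(1)] rep[OF c(2) b(2)]
  ultimately show ?thesis by linarith
qed

text \<open>The squared modulus is \<open>1 + 2 * s * a * cos t + a^2\<close>. For either sign,
  multiplying the logarithm by \<open>s\<close> makes it increase with \<open>cos t\<close>.\<close>

lemma symmetric_decreasing_log:
  assumes s: "s = 1 \<or> s = -1" and a: "0 \<le> a" "a < 1"
  shows "symmetric_decreasing (\<lambda>t. s * ln (cmod (1 + of_real (s * a) * cis t)))"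
proof -
  have sq: "(cmod (1 + of_real (s * a) * cis t))\<^sup>2 = 1 + 2 * (s * a) * cos t + a\<^sup>2" for t
  proof -
    have "(cmod (1 + of_real (s * a) * cis t))\<^sup>2 = (1 + s * a * cos t)\<^sup>2 + (s * a * sin t)\<^sup>2" by (simp add: cmod_power2)
    also have "(1 + x * c)\<^sup>2 + (x * y)\<^sup>2 = 1 + 2 * x * c + x\<^sup>2 * (c\<^sup>2 + y\<^sup>2)" for x c y :: real
      by (simp add: power2_eq_square algebra_simps)
    also have "(s * a)\<^sup>2 = a\<^sup>2" using s by auto
    finally show ?thesis by simp
  qed
  have pos: "cmod (1 + of_real (s * a) * cis t) > 0" for t
  proof -
    have "cmod (of_real (s * a) * cis t) < 1" using s a by (auto simp: norm_mult)
    then have "1 + of_real (s * a) * cis t \<noteq> 0" by (metis add_eq_0_iff norm_minus_cancel norm_one less_irrefl)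
    then show ?thesis by simp
  qed
  show ?thesis unfolding symmetric_decreasing_def
  proof (intro conjI allI impI)
    fix t
    have "(cmod (1 + of_real (s * a) * cis (2 * pi - t)))\<^sup>2 = (cmod (1 + of_real (s * a) * cis t))\<^sup>2" unfolding sq by simp
    then have "cmod (1 + of_real (s * a) * cis (2 * pi - t)) = cmod (1 + of_real (s * a) * cis t)" by (simp add: power2_eq_iff_nonneg)
    then show "s * ln (cmod (1 + of_real (s * a) * cis (2 * pi - t))) = s * ln (cmod (1 + of_real (s * a) * cis t))" by simp
  next
    fix x t assume xt: "0 \<le> x \<and> x \<le> t \<and> t \<le> pi"
    then have cs: "cos t \<le> cos x" by (intro cos_monotone_0_pi_le) auto
    have le: "ln (cmod (1 + of_real (s * a) * cis y)) \<le> ln (cmod (1 + of_real (s * a) * cis y'))"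
      if "(s * a) * cos y \<le> (s * a) * cos y'" for y y'
    proof -
      have "(cmod (1 + of_real (s * a) * cis y))\<^sup>2 \<le> (cmod (1 + of_real (s * a) * cis y'))\<^sup>2" unfolding sq using that by simp
      then have "cmod (1 + of_real (s * a) * cis y) \<le> cmod (1 + of_real (s * a) * cis y')" by (rule power2_le_imp_le) simp
      then show ?thesis using pos by simp
    qed
    from s show "s * ln (cmod (1 + of_real (s * a) * cis t)) \<le> s * ln (cmod (1 + of_real (s * a) * cis x))"
    proof
      assume "s = 1"
      then show ?thesis using le[of t x] mult_left_mono[OF cs a(1)] by simp
    next
      assume "s = -1"
      then show ?thesis using le[of x t] mult_left_mono[OF cs a(1)] by simp
    qed
  qed
qed

text \<open>The outer sign \<open>s\<close> tells whether the factor stands in the numerator or in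
  the denominator. \<open>majorized_subordination\<close> is applied to the Schwarz function
  \<open>s * w\<close> and to \<open>s * Ln (1 + s * c * z)\<close>; the inner sign puts the maximum
  of the majorant at \<open>t = 0\<close> in both cases, so that all majorants are ordered
  alike.\<close>

lemma majorized_log:
  assumes s: "s = 1 \<or> s = -1" and c: "0 \<le> c" "c \<le> 1" and r: "0 < r" "r < 1"
    and w: "w holomorphic_on ball 0 1" "w 0 = 0" "\<And>z. cmod z < 1 \<Longrightarrow> cmod (w z) < 1"
  shows "majorized (\<lambda>t. s * ln (cmod (1 + of_real c * w (of_real r * cis t)))) (\<lambda>t. s * ln (cmod (1 + of_real (s * (c * r)) * cis t)))"
    and "symmetric_decreasing (\<lambda>t. s * ln (cmod (1 + of_real (s * (c * r)) * cis t)))"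
proof -
  have ss: "s * s = 1" using s by auto
  have lt: "cmod (of_real (s * c) * z) < 1" if "cmod z < 1" for z
  proof -
    have "cmod (of_real (s * c) * z) = c * cmod z" using s c by (auto simp: norm_mult)
    also have "\<dots> \<le> 1 * cmod z" using c by (intro mult_right_mono) auto
    finally show ?thesis using that by simp
  qed
  have re: "Re (1 + of_real (s * c) * z) > 0" if "cmod z < 1" for z
  proof -
    have "\<bar>Re (of_real (s * c) * z)\<bar> < 1" using abs_Re_le_cmod[of "of_real (s * c) * z"] lt[OF that] by linarith
    then show ?thesis by (simp only: plus_complex.sel one_complex.sel)
  qed
  define H where "H = (\<lambda>z. of_real s * Ln (1 + of_real (s * c) * z))"
  have H: "H holomorphic_on ball 0 1" unfolding H_def
    by (intro holomorphic_intros) (use re in \<open>force simp: complex_nonpos_Reals_iff\<close>)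
  have ReH: "Re (H z) = s * ln (cmod (1 + of_real (s * c) * z))" if "cmod z < 1" for z
  proof -
    have "1 + of_real (s * c) * z \<noteq> 0" using re[OF that] by (metis less_irrefl zero_complex.sel(1))
    then show ?thesis by (simp add: H_def)
  qed
  have w': "(\<lambda>z. of_real s * w z) holomorphic_on ball 0 1" "of_real s * w 0 = 0" "\<And>z. cmod z < 1 \<Longrightarrow> cmod (of_real s * w z) < 1"
    using w s by (auto intro!: holomorphic_intros simp: norm_mult)
  have circ: "cmod (of_real r * cis t) < 1" for t using r by (simp add: norm_mult)
  have e1: "Re (H (of_real s * w (of_real r * cis t))) = s * ln (cmod (1 + of_real c * w (of_real r * cis t)))" for t
  proof -
    have "of_real (s * c) * (of_real s * x) = of_real (s * s) * (of_real c * x)" for x :: complex by (simp add: mult_ac)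
    then have "of_real (s * c) * (of_real s * x) = of_real c * x" for x :: complex by (simp add: ss)
    then show ?thesis using ReH[OF w'(3)[OF circ[of t]]] by (simp only:)
  qed
  have e2: "Re (H (of_real r * cis t)) = s * ln (cmod (1 + of_real (s * (c * r)) * cis t))" for t
    using ReH[OF circ] by (simp add: mult.assoc)
  show "majorized (\<lambda>t. s * ln (cmod (1 + of_real c * w (of_real r * cis t)))) (\<lambda>t. s * ln (cmod (1 + of_real (s * (c * r)) * cis t)))"
    using majorized_subordination[OF H w' r] unfolding e1 e2 .
  have "c * r < 1" using c r by (metis mult_le_one mult_less_cancel_right2 less_eq_real_def mult.commute not_less order_le_less_trans)
  then show "symmetric_decreasing (\<lambda>t. s * ln (cmod (1 + of_real (s * (c * r)) * cis t)))"
    using symmetric_decreasing_log[OF s, of "c * r"] c r by simp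
qed

text \<open>\<open>- \<Phi> / \<kappa>\<close> omits the negative real axis, so its principal square
  root \<open>Q\<close> lies in the right half-plane. The Cayley transform that takes
  \<open>Q 0\<close> to 0 gives \<open>w\<close>, and solving for \<open>Q\<close> gives
  \<open>Q = Q 0 * (1 + x * w) / (1 - w)\<close> with \<open>x = cnj (Q 0) / Q 0\<close>, where
  \<open>cmod (Q 0) = 1\<close>.\<close>

lemma square_root_representation:
  assumes \<Phi>: "\<Phi> holomorphic_on ball 0 1" "\<Phi> 0 = 1" and \<kappa>: "cmod \<kappa> = 1"
    and av: "\<And>z s. \<lbrakk>z \<in> ball 0 1; 0 \<le> s\<rbrakk> \<Longrightarrow> \<Phi> z \<noteq> of_real s * \<kappa>"
  obtains x w where "cmod x = 1" "w holomorphic_on ball 0 1" "w 0 = 0" "\<And>z. cmod z < 1 \<Longrightarrow> cmod (w z) < 1"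
    "\<And>z. cmod z < 1 \<Longrightarrow> cmod (\<Phi> z) = (cmod (1 + x * w z))\<^sup>2 / (cmod (1 - w z))\<^sup>2"
proof -
  have k0: "\<kappa> \<noteq> 0" using \<kappa> by auto
  define P where "P = (\<lambda>z. - \<Phi> z / \<kappa>)"
  have P: "P z \<notin> \<real>\<^sub>\<le>\<^sub>0" if "z \<in> ball 0 1" for z
  proof
    assume "P z \<in> \<real>\<^sub>\<le>\<^sub>0"
    then obtain s where s: "P z = of_real s" "s \<le> 0" by (auto simp: nonpos_Reals_def)
    then have "\<Phi> z = of_real (- s) * \<kappa>" using k0 by (simp add: P_def field_simps) (metis minus_minus)
    then show False using av[OF that, of "- s"] s by simp
  qed
  define Q where "Q = (\<lambda>z. csqrt (P z))"
  have Q: "Q holomorphic_on ball 0 1" unfolding Q_def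
    using P unfolding P_def by (intro holomorphic_intros \<Phi>) (use k0 in auto)
  have RQ: "Re (Q z) > 0" if "z \<in> ball 0 1" for z
  proof (rule ccontr)
    assume "\<not> Re (Q z) > 0"
    then have "Re (Q z) = 0" using csqrt_principal[of "P z"] by (auto simp: Q_def)
    then have "Re ((Q z)\<^sup>2) \<le> 0" "Im ((Q z)\<^sup>2) = 0" by (simp_all add: power2_eq_square)
    then have "P z \<in> \<real>\<^sub>\<le>\<^sub>0" unfolding complex_nonpos_Reals_iff by (simp add: Q_def)
    then show False using P[OF that] by simp
  qed
  have Q2: "(cmod (Q z))\<^sup>2 = cmod (\<Phi> z)" for z
    unfolding norm_power[symmetric] Q_def power2_csqrt P_def using \<kappa> by (simp add: norm_divide)
  have Q0: "cmod (Q 0) = 1" using Q2[of 0] \<Phi>(2) norm_ge_zero[of "Q 0"] by (auto simp: power2_eq_1_iff simp del: norm_ge_zero)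
  define w where "w = (\<lambda>z. (Q z - Q 0) / (Q z + cnj (Q 0)))"
  have den: "Q z + cnj (Q 0) \<noteq> 0" if "z \<in> ball 0 1" for z
    using RQ[OF that] RQ[of 0] by (auto simp: complex_eq_iff)
  have w1: "cmod (w z) < 1" if z: "cmod z < 1" for z
  proof -
    have "0 < Re (Q z) * Re (Q 0)" using RQ[of z] RQ[of 0] z by simp
    then have "(cmod (Q z - Q 0))\<^sup>2 < (cmod (Q z + cnj (Q 0)))\<^sup>2"
      by (simp add: cmod_power2) (simp add: power2_eq_square algebra_simps)
    then have "cmod (Q z - Q 0) < cmod (Q z + cnj (Q 0))" by (rule power_less_imp_less_base) simp
    then show ?thesis using den[of z] z by (simp add: w_def norm_divide)
  qed
  have wn: "1 - w z \<noteq> 0" if "cmod z < 1" for z using w1[OF that] by auto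
  define x where "x = cnj (Q 0) / Q 0"
  show thesis
  proof (rule that[of x w])
    show "cmod x = 1" using Q0 by (simp add: x_def norm_divide)
    show "w holomorphic_on ball 0 1" unfolding w_def by (intro holomorphic_intros Q) (use den in auto)
    show "w 0 = 0" by (simp add: w_def)
    show "cmod (w z) < 1" if "cmod z < 1" for z by (rule w1[OF that])
    fix z :: complex assume z: "cmod z < 1"
    have "w z * (Q z + cnj (Q 0)) = Q z - Q 0" using den[of z] z by (simp add: w_def)
    then have "Q z * (1 - w z) = Q 0 + cnj (Q 0) * w z" by (simp add: algebra_simps)
    also have "\<dots> = Q 0 * (1 + x * w z)" using Q0 by (auto simp: x_def field_simps)
    finally have "Q z = Q 0 * (1 + x * w z) / (1 - w z)" using wn[OF z] by (simp add: field_simps)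
    then have "cmod (Q z) = cmod (1 + x * w z) / cmod (1 - w z)" using Q0 by (simp add: norm_divide norm_mult)
    then show "cmod (\<Phi> z) = (cmod (1 + x * w z))\<^sup>2 / (cmod (1 - w z))\<^sup>2" unfolding Q2[symmetric] by (simp add: power_divide)
  qed
qed

subsection \<open>Integral means\<close>

text \<open>The dilatation divided by \<open>k\<close> is bounded by 1 and vanishes at 0; by the
  maximum principle the bound is strict.\<close>

lemma dilatation_Schwarz:
  assumes hol: "h holomorphic_on ball 0 1" "g holomorphic_on ball 0 1"
    and h': "\<And>z. z \<in> ball 0 1 \<Longrightarrow> deriv h z \<noteq> 0" and g0: "deriv g 0 = 0"
    and k: "0 \<le> k" "\<And>z. z \<in> ball 0 1 \<Longrightarrow> cmod (deriv g z / deriv h z) \<le> k"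
  obtains w where "w holomorphic_on ball 0 1" "w 0 = 0" "\<And>z. cmod z < 1 \<Longrightarrow> cmod (w z) < 1"
    "\<And>z. cmod z < 1 \<Longrightarrow> deriv g z = of_real k * w z * deriv h z"
proof -
  \<comment> \<open>For \<open>k = 0\<close> this is 0 by the convention for division, and the
    factorization holds because \<open>deriv g\<close> vanishes.\<close>
  define w where "w = (\<lambda>z. deriv g z / deriv h z / of_real k)"
  have hw: "w holomorphic_on ball 0 1" unfolding w_def divide_inverse[of _ "of_real k"]
    by (intro holomorphic_intros holomorphic_deriv hol open_ball h')
  have w0: "w 0 = 0" by (simp add: w_def g0)
  have le: "cmod (w z) \<le> 1" if "z \<in> ball 0 1" for z
  proof (cases "k = 0")
    case False
    then have "cmod (deriv g z / deriv h z) / k \<le> 1" using k(1) k(2)[OF that] by simp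
    then show ?thesis using k(1) by (simp add: w_def norm_divide norm_mult)
  qed (simp add: w_def)
  have eq: "deriv g z = of_real k * w z * deriv h z" if "cmod z < 1" for z
  proof (cases "k = 0")
    case True
    then have "deriv g z / deriv h z = 0" using k(2)[of z] that by simp
    then show ?thesis using True h'[of z] that by simp
  qed (use h'[of z] that in \<open>simp add: w_def\<close>)
  have lt: "cmod (w z) < 1" if z: "cmod z < 1" for z
  proof (rule ccontr)
    assume "\<not> cmod (w z) < 1"
    then have "cmod (w y) \<le> cmod (w z)" if "y \<in> ball 0 1" for y using le[OF that] by simp
    then have "w constant_on ball 0 1"
      using maximum_modulus_principle[OF hw open_ball connected_ball open_ball order_refl, of z] z by simp
    then have "w z = w 0" using z unfolding constant_on_def by (metis centre_in_ball mem_ball_0 zero_less_one)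
    then show False using w0 \<open>\<not> cmod (w z) < 1\<close> by simp
  qed
  show thesis by (rule that[OF hw w0 lt eq])
qed

lemma powr_as_exp: "x > 0 \<Longrightarrow> x powr p = exp (p * ln x)" for x :: real
  by (simp add: powr_def)

text \<open>The logarithm of \<open>cmod h' * cmod (1 - cis (- y) * z)\<close> is twice that of
  \<open>1 + x1 * v\<close>, minus twice that of \<open>1 - v\<close>, minus those of
  \<open>1 - x * z\<close> and of \<open>1 + k * e * w\<close>, in absolute values. Each term is
  majorized separately by \<open>majorized_log\<close>, and the sum of the majorants is the
  logarithm of \<open>cmod (Hk k z)\<close>.\<close>

lemma weighted_mean_le:
  assumes hol: "h holomorphic_on ball 0 1" "g holomorphic_on ball 0 1"
    and h': "\<And>z. z \<in> ball 0 1 \<Longrightarrow> deriv h z \<noteq> 0" and n: "deriv h 0 = 1" "deriv g 0 = 0"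
    and k: "0 \<le> k" "k < 1" "\<And>z. z \<in> ball 0 1 \<Longrightarrow> cmod (deriv g z / deriv h z) \<le> k"
    and e: "cmod e = 1" and x: "cmod x = 1" and \<kappa>: "cmod \<kappa> = 1"
    and av: "\<And>z s. \<lbrakk>z \<in> ball 0 1; 0 \<le> s\<rbrakk> \<Longrightarrow> (deriv h z + e * deriv g z) * (1 - cis (- y) * z) * (1 - x * z) \<noteq> of_real s * \<kappa>"
    and r: "0 < r" "r < 1" and p: "0 < p"
  shows "integral {0..2*pi} (\<lambda>t. (cmod (deriv h (of_real r * cis t)) * cmod (1 - cis (- y) * (of_real r * cis t))) powr p)
    \<le> integral {0..2*pi} (\<lambda>t. cmod (Hk k (of_real r * cis t)) powr p)"
proof -
  obtain w where w: "w holomorphic_on ball 0 1" "w 0 = 0" "\<And>z. cmod z < 1 \<Longrightarrow> cmod (w z) < 1"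
    "\<And>z. cmod z < 1 \<Longrightarrow> deriv g z = of_real k * w z * deriv h z"
    using dilatation_Schwarz[OF hol h' n(2) k(1,3)] by blast
  have "(\<lambda>z. (deriv h z + e * deriv g z) * (1 - cis (- y) * z) * (1 - x * z)) holomorphic_on ball 0 1"
    by (intro holomorphic_intros holomorphic_deriv hol open_ball)
  from square_root_representation[OF this _ \<kappa> av] n
  obtain x1 v where x1: "cmod x1 = 1" and v: "v holomorphic_on ball 0 1" "v 0 = 0" "\<And>z. cmod z < 1 \<Longrightarrow> cmod (v z) < 1"
    and rep: "\<And>z. cmod z < 1 \<Longrightarrow> cmod ((deriv h z + e * deriv g z) * (1 - cis (- y) * z) * (1 - x * z)) = (cmod (1 + x1 * v z))\<^sup>2 / (cmod (1 - v z))\<^sup>2"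
    by auto
  let ?z = "\<lambda>t. of_real r * cis t :: complex"
  have zr: "cmod (?z t) < 1" for t using r by (simp add: norm_mult)
  have nz: "1 + a \<noteq> 0" if "cmod a < 1" for a :: complex
    using that by (metis add_eq_0_iff norm_minus_cancel norm_one less_irrefl)
  have kl: "cmod (of_real k * a) < 1" if "cmod a < 1" for a
  proof -
    have "cmod (of_real k * a) = k * cmod a" using k(1) by (simp add: norm_mult)
    also have "\<dots> \<le> 1 * cmod a" using k by (intro mult_right_mono) auto
    finally show ?thesis using that by simp
  qed
  define u1 where "u1 = (\<lambda>t. 1 * ln (cmod (1 + of_real 1 * (x1 * v (?z t)))))"
  define u2 where "u2 = (\<lambda>t. -1 * ln (cmod (1 + of_real 1 * (- v (?z t)))))"
  define u3 where "u3 = (\<lambda>t. -1 * ln (cmod (1 + of_real 1 * (- (x * ?z t)))))"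
  define u4 where "u4 = (\<lambda>t. -1 * ln (cmod (1 + of_real k * (e * w (?z t)))))"
  define U1 where "U1 = (\<lambda>t. 1 * ln (cmod (1 + of_real (1 * (1 * r)) * cis t)))"
  define U2 where "U2 = (\<lambda>t. -1 * ln (cmod (1 + of_real (-1 * (1 * r)) * cis t)))"
  define U4 where "U4 = (\<lambda>t. -1 * ln (cmod (1 + of_real (-1 * (k * r)) * cis t)))"
  have m1: "majorized u1 U1" "symmetric_decreasing U1" unfolding u1_def U1_def
    by (rule majorized_log[OF _ _ _ r, of 1 1 "\<lambda>z. x1 * v z"]; use v x1 in \<open>auto intro!: holomorphic_intros simp: norm_mult\<close>)+
  have m2: "majorized u2 U2" "symmetric_decreasing U2" unfolding u2_def U2_def
    by (rule majorized_log[OF _ _ _ r, of "-1" 1 "\<lambda>z. - v z"]; use v in \<open>auto intro!: holomorphic_intros\<close>)+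
  have m3: "majorized u3 U2" unfolding u3_def U2_def
    by (rule majorized_log(1)[OF _ _ _ r, of "-1" 1 "\<lambda>z. - (x * z)"]; use x in \<open>auto intro!: holomorphic_intros simp: norm_mult\<close>)
  have m4: "majorized u4 U4" "symmetric_decreasing U4" unfolding u4_def U4_def
    by (rule majorized_log[OF _ _ _ r, of "-1" k "\<lambda>z. e * w z"]; use w e k in \<open>auto intro!: holomorphic_intros simp: norm_mult\<close>)+
  define u where "u = (\<lambda>t. u1 t + u1 t + (u2 t + u2 t) + u3 t + u4 t)"
  \<comment> \<open>\<open>u2\<close> and \<open>u3\<close> have the same majorant
    \<open>U2\<close>: the square from the omitted ray and the weight \<open>1 - x * z\<close>
    together produce the third power of \<open>1 - z\<close> in \<open>Hk\<close>.\<close>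
  define U where "U = (\<lambda>t. U1 t + U1 t + (U2 t + U2 t) + U2 t + U4 t)"
  have mu: "majorized u U" unfolding u_def U_def
    by (intro majorized_add symmetric_decreasing_add m1 m2 m3 m4)
  have eu: "(cmod (deriv h (?z t)) * cmod (1 - cis (- y) * ?z t)) powr p = exp (p * u t)" for t
  proof -
    have pos: "cmod (1 + x1 * v (?z t)) > 0" "cmod (1 - v (?z t)) > 0" "cmod (1 - x * ?z t) > 0" "cmod (1 + of_real k * (e * w (?z t))) > 0"
      using nz[of "x1 * v (?z t)"] nz[of "- v (?z t)"] nz[of "- (x * ?z t)"] nz[OF kl[of "e * w (?z t)"]] v(3)[OF zr] w(3)[OF zr] zr[of t] x1 x e
      by (auto simp: norm_mult)
    have hd: "deriv h (?z t) \<noteq> 0" "1 - cis (- y) * ?z t \<noteq> 0" using h'[of "?z t"] zr one_minus_cis_mult_nonzero by auto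
    have fac: "deriv h (?z t) + e * deriv g (?z t) = deriv h (?z t) * (1 + of_real k * (e * w (?z t)))"
      unfolding w(4)[OF zr] by (simp add: algebra_simps)
    define A where "A = cmod (deriv h (?z t)) * cmod (1 - cis (- y) * ?z t)"
    have A: "A > 0" using hd by (simp add: A_def)
    have "A * cmod (1 + of_real k * (e * w (?z t))) * cmod (1 - x * ?z t) = (cmod (1 + x1 * v (?z t)))\<^sup>2 / (cmod (1 - v (?z t)))\<^sup>2"
      using rep[OF zr[of t]] unfolding fac A_def norm_mult by (simp add: mult_ac)
    then have "ln (A * cmod (1 + of_real k * (e * w (?z t))) * cmod (1 - x * ?z t)) = ln ((cmod (1 + x1 * v (?z t)))\<^sup>2 / (cmod (1 - v (?z t)))\<^sup>2)"
      by (rule arg_cong)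
    then have "ln A + ln (cmod (1 + of_real k * (e * w (?z t)))) + ln (cmod (1 - x * ?z t)) = 2 * ln (cmod (1 + x1 * v (?z t))) - 2 * ln (cmod (1 - v (?z t)))"
      using A pos by (simp add: ln_mult ln_div ln_realpow)
    then have "ln A = u t" by (simp add: u_def u1_def u2_def u3_def u4_def)
    then show ?thesis using powr_as_exp[OF A, of p] unfolding A_def by simp
  qed
  have eU: "cmod (Hk k (?z t)) powr p = exp (p * U t)" for t
  proof -
    have pos: "cmod (1 + ?z t) > 0" "cmod (1 - ?z t) > 0" "cmod (1 - of_real k * ?z t) > 0"
      using nz[OF zr[of t]] nz[of "- ?z t"] nz[of "- (of_real k * ?z t)"] kl[OF zr[of t]] zr[of t] by auto
    have H: "cmod (Hk k (?z t)) = (cmod (1 + ?z t))\<^sup>2 / ((cmod (1 - ?z t)) ^ 3 * cmod (1 - of_real k * ?z t))"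
      by (simp add: Hk_def norm_divide norm_mult norm_power)
    then have "ln (cmod (Hk k (?z t))) = 2 * ln (cmod (1 + ?z t)) - (3 * ln (cmod (1 - ?z t)) + ln (cmod (1 - of_real k * ?z t)))"
      using pos by (simp add: ln_mult ln_div ln_realpow)
    then have "ln (cmod (Hk k (?z t))) = U t" by (simp add: U_def U1_def U2_def U4_def mult.assoc)
    moreover have "cmod (Hk k (?z t)) > 0" unfolding H using pos by simp
    ultimately show ?thesis using powr_as_exp by simp
  qed
  show ?thesis unfolding eu eU by (rule majorized_exp[OF mu p])
qed

text \<open>\<open>(1 - w * cnj z)^p\<close> is holomorphic in \<open>w\<close> on a disk larger
  than the unit disk and has the value 1 at 0, so its mean over the unit circle is 1. At
  \<open>w = cis y\<close> its modulus is the given integrand.\<close>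

lemma mean_of_factor_ge:
  assumes z: "cmod z < 1" and p: "0 < p"
  shows "2 * pi \<le> integral {0..2*pi} (\<lambda>y. cmod (1 - cis (- y) * z) powr p)"
proof -
  \<comment> \<open>Larger than 1, so that the unit circle is inside, but with
    \<open>R * cmod z < 1\<close>, so that the logarithm is defined; the formula also covers
    \<open>z = 0\<close>.\<close>
  define R where "R = 2 / (1 + cmod z)"
  have R: "R > 1" "R * cmod z < 1" using z by (auto simp: R_def field_simps add_pos_nonneg)
  define \<phi> where "\<phi> = (\<lambda>w. exp (of_real p * Ln (1 - w * cnj z)))"
  have re: "Re (1 - w * cnj z) > 0" if "cmod w < R" for w
  proof -
    have "cmod (w * cnj z) \<le> R * cmod z" using that by (simp add: norm_mult mult_right_mono)
    then have "\<bar>Re (w * cnj z)\<bar> < 1" using abs_Re_le_cmod[of "w * cnj z"] R by linarith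
    then show ?thesis by (simp only: minus_complex.sel one_complex.sel)
  qed
  have "\<phi> holomorphic_on ball 0 R" unfolding \<phi>_def
    by (intro holomorphic_intros) (use re in \<open>force simp: complex_nonpos_Reals_iff\<close>)
  from mean_value_circle[OF this, of 1] R have mv: "((\<lambda>t. \<phi> (cis t)) has_integral of_real (2 * pi)) {0..2*pi}"
    by (simp add: \<phi>_def)
  have n\<phi>: "cmod (\<phi> (cis t)) = cmod (1 - cis (- t) * z) powr p" for t
  proof -
    have "Re (1 - cis t * cnj z) > 0" using R by (intro re) simp
    then have "1 - cis t * cnj z \<noteq> 0" by (metis less_irrefl zero_complex.sel(1))
    moreover have "cmod (1 - cis t * cnj z) = cmod (cnj (1 - cis t * cnj z))" by (rule complex_mod_cnj[symmetric])
    then have "cmod (1 - cis t * cnj z) = cmod (1 - cis (- t) * z)"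
      by (simp only: complex_cnj_diff complex_cnj_mult complex_cnj_cnj complex_cnj_one cis_cnj)
    moreover have "1 - cis (- t) * z \<noteq> 0" by (rule one_minus_cis_mult_nonzero[OF z])
    ultimately show ?thesis by (simp add: \<phi>_def powr_def)
  qed
  have c: "continuous_on {0..2*pi} (\<lambda>y. cmod (1 - cis (- y) * z) powr p)"
    using one_minus_cis_mult_nonzero[OF z] by (intro continuous_intros) auto
  have "cmod (integral {0..2*pi} (\<lambda>t. \<phi> (cis t))) \<le> integral {0..2*pi} (\<lambda>y. cmod (1 - cis (- y) * z) powr p)"
    by (rule integral_norm_bound_integral) (use mv c n\<phi> in \<open>auto intro: integrable_continuous_interval\<close>)
  then show ?thesis using integral_unique[OF mv] by simp
qed

lemma integral_mean_le:
  assumes cls: "harmonic_ray_domain h g d K"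
    and n: "deriv h 0 = 1" "deriv g 0 = 0"
    and k: "0 \<le> k" "k < 1" "\<And>z. z \<in> ball 0 1 \<Longrightarrow> cmod (deriv g z / deriv h z) \<le> k"
    and r: "0 < r" "r < 1" and p: "0 < p"
  shows "integral {0..2*pi} (\<lambda>t. cmod (deriv h (of_real r * cis t)) powr p)
    \<le> integral {0..2*pi} (\<lambda>t. cmod (Hk k (of_real r * cis t)) powr p)"
proof -
  interpret harmonic_ray_domain h g d K by (rule cls)
  have h': "deriv h z \<noteq> 0" if "z \<in> ball 0 1" for z using sense[OF that] by auto
  let ?z = "\<lambda>t. of_real r * cis t :: complex"
  have zr: "cmod (?z t) < 1" for t using r by (simp add: norm_mult)
  define I where "I = integral {0..2*pi} (\<lambda>t. cmod (Hk k (?z t)) powr p)"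
  define J where "J = (\<lambda>y t. (cmod (deriv h (?z t)) * cmod (1 - cis (- y) * ?z t)) powr p)"
  have nz: "1 - cis a * ?z t \<noteq> 0" for a t by (rule one_minus_cis_mult_nonzero[OF zr])
  have hz: "deriv h (?z t) \<noteq> 0" for t using h' zr by simp
  have cdh: "continuous_on (ball 0 1) (deriv h)" by (intro holomorphic_on_imp_continuous_on holomorphic_deriv h open_ball)
  have cJ: "continuous_on (A \<times> B) (\<lambda>(y, t). J y t)" for A B :: "real set"
    unfolding J_def split_def
    by (intro continuous_intros continuous_on_compose2[OF cdh]) (use zr nz hz in auto)
  have cint: "continuous_on UNIV (\<lambda>y. integral {0..2*pi} (J y))"
    using integral_continuous_on_param[of UNIV 0 "2*pi" J] cJ unfolding cbox_interval by simp
  have le: "integral {0..2*pi} (J y) \<le> I" for y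
  proof (rule ccontr)
    assume "\<not> ?thesis"
    then have "y \<in> {y. integral {0..2*pi} (J y) > I}" by simp
    with open_Collect_less[OF continuous_on_const cint, of I]
    obtain \<delta> where \<delta>: "\<delta> > 0" "ball y \<delta> \<subseteq> {y. integral {0..2*pi} (J y) > I}" by (rule openE)
    \<comment> \<open>The bound by 1 keeps the window around \<open>y\<close> shorter than a full
      turn, as \<open>ray_avoidance_dense\<close> requires.\<close>
    define \<epsilon> where "\<epsilon> = min \<delta> 1"
    have \<epsilon>: "\<epsilon> > 0" "\<epsilon> \<le> \<delta>" "\<epsilon> \<le> 1" using \<delta>(1) by (auto simp: \<epsilon>_def)
    have uv: "y - \<epsilon> < y + \<epsilon>" "y + \<epsilon> \<le> y - \<epsilon> + 2 * pi" using \<epsilon> pi_gt3 by auto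
    obtain y' e x \<kappa> where y': "y - \<epsilon> < y'" "y' < y + \<epsilon>" and u: "cmod e = 1" "cmod x = 1" "cmod \<kappa> = 1"
      and av: "\<And>z s. \<lbrakk>z \<in> ball 0 1; 0 \<le> s\<rbrakk> \<Longrightarrow> (deriv h z + e * deriv g z) * (1 - cis (- y') * z) * (1 - x * z) \<noteq> of_real s * \<kappa>"
      by (rule ray_avoidance_dense[OF uv]) blast
    have "integral {0..2*pi} (J y') \<le> I"
      unfolding J_def I_def by (rule weighted_mean_le[OF h g h' n k(1,2,3) u av r p])
    moreover have "y' \<in> ball y \<delta>" using y' \<epsilon> by (auto simp: dist_real_def)
    ultimately show False using \<delta>(2) by auto
  qed
  have sw: "integral {0..2*pi} (\<lambda>y. integral {0..2*pi} (J y)) = integral {0..2*pi} (\<lambda>t. integral {0..2*pi} (\<lambda>y. J y t))"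
    using integral_swap_continuous[of 0 0 "2*pi" "2*pi" J] cJ[of "{0..2*pi}" "{0..2*pi}"] cbox_Pair_eq[of 0 0 "2*pi" "2*pi"]
    unfolding cbox_interval by simp
  have cth: "continuous_on {0..2*pi} (\<lambda>t. cmod (deriv h (?z t)) powr p)"
    by (intro continuous_intros continuous_on_compose2[OF cdh]) (use zr hz in auto)
  have ct: "continuous_on {0..2*pi} (\<lambda>t. integral {0..2*pi} (\<lambda>y. J y t))"
  proof -
    have "continuous_on ({0..2*pi} \<times> {0..2*pi}) (\<lambda>(t, y). J y t)"
      unfolding J_def split_def
      by (intro continuous_intros continuous_on_compose2[OF cdh]) (use zr nz hz in auto)
    then show ?thesis using integral_continuous_on_param[of "{0..2*pi}" 0 "2*pi" "\<lambda>t y. J y t"] unfolding cbox_interval by simp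
  qed
  have "2 * pi * integral {0..2*pi} (\<lambda>t. cmod (deriv h (?z t)) powr p) = integral {0..2*pi} (\<lambda>t. 2 * pi * cmod (deriv h (?z t)) powr p)"
    by simp
  also have "\<dots> \<le> integral {0..2*pi} (\<lambda>t. integral {0..2*pi} (\<lambda>y. J y t))"
  proof (intro integral_le integrable_continuous_interval ct continuous_on_mult_left cth)
    fix t
    have "integral {0..2*pi} (\<lambda>y. J y t) = cmod (deriv h (?z t)) powr p * integral {0..2*pi} (\<lambda>y. cmod (1 - cis (- y) * ?z t) powr p)"
      unfolding J_def by (simp add: powr_mult)
    then show "2 * pi * cmod (deriv h (?z t)) powr p \<le> integral {0..2*pi} (\<lambda>y. J y t)"
      using mult_left_mono[OF mean_of_factor_ge[OF zr p], of "cmod (deriv h (?z t)) powr p" t] by (simp add: mult_ac)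
  qed
  also have "\<dots> = integral {0..2*pi} (\<lambda>y. integral {0..2*pi} (J y))" by (rule sw[symmetric])
  also have "\<dots> \<le> integral {0..2*pi} (\<lambda>y. I)"
    by (intro integral_le integrable_continuous_interval continuous_on_subset[OF cint] le) auto
  also have "\<dots> = 2 * pi * I" by simp
  finally show ?thesis unfolding I_def by simp
qed

lemma Mp_mono_of_integral:
  assumes "integral {0..2*pi} (\<lambda>t. cmod (F (of_real r * cis t)) powr p) \<le> integral {0..2*pi} (\<lambda>t. cmod (G (of_real r * cis t)) powr p)"
    and "0 < p"
  shows "Mp p r F \<le> Mp p r G"
proof -
  have nn: "0 \<le> integral {0..2*pi} (\<lambda>t. cmod (F (of_real r * cis t)) powr p)"
  proof (cases "(\<lambda>t. cmod (F (of_real r * cis t)) powr p) integrable_on {0..2*pi}")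
    case True
    then show ?thesis by (rule integral_nonneg) simp
  qed (simp add: not_integrable_integral)
  show ?thesis unfolding Mp_def
    by (rule powr_mono2) (use assms nn in \<open>auto intro: mult_left_mono divide_right_mono\<close>)
qed

theorem theorem2:
  fixes K k p r \<theta> :: real and h g :: "complex \<Rightarrow> complex"
  assumes "K \<ge> 1" and "k = (K - 1) / (K + 1)" and "0 < p"
    and "K_qc_harmonic K h g"
    and "in_CH0 h g \<or> in_SHstar0 h g \<or> (0 \<le> \<theta> \<and> \<theta> < pi \<and> in_KH0 \<theta> h g)"
    and "0 < r" and "r < 1"
  shows "Mp p r (deriv h) \<le> Mp p r (Hk k) \<and> Mp p r (deriv g) \<le> Mp p r (Gk k)"
proof -
  have cls: "in_CH0 h g \<or> in_SHstar0 h g \<or> in_KH0 \<theta> h g" using assms(5) by blast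
  obtain d where d: "harmonic_ray_domain h g d K"
    by (rule harmonic_ray_domain_of_class[OF assms(1,2,4) cls])
  have sh: "in_SH0 h g" using cls unfolding in_CH0_def in_SHstar0_def in_KH0_def by blast
  have n: "deriv h 0 = 1" "deriv g 0 = 0" using sh by (auto simp: in_SH0_def)
  have hol: "h holomorphic_on ball 0 1" "g holomorphic_on ball 0 1" using sh by (auto simp: in_SH0_def)
  have h': "deriv h z \<noteq> 0" if "z \<in> ball 0 1" for z using sh that by (force simp: in_SH0_def)
  have k: "0 \<le> k" "k < 1" using assms(1) unfolding assms(2) by (auto simp: divide_less_eq)
  have qc: "cmod (deriv g z / deriv h z) \<le> k" if "z \<in> ball 0 1" for z
    using assms(2,4) that unfolding K_qc_harmonic_def by blast
  let ?z = "\<lambda>t. of_real r * cis t :: complex"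
  have zr: "cmod (?z t) < 1" "cmod (?z t) = r" for t using assms(6,7) by (simp_all add: norm_mult)
  have le: "integral {0..2*pi} (\<lambda>t. cmod (deriv h (?z t)) powr p) \<le> integral {0..2*pi} (\<lambda>t. cmod (Hk k (?z t)) powr p)"
    by (rule integral_mean_le[OF d n k qc assms(6,7,3)])
  obtain w where w: "w holomorphic_on ball 0 1" "w 0 = 0" "\<And>z. cmod z < 1 \<Longrightarrow> cmod (w z) < 1"
    "\<And>z. cmod z < 1 \<Longrightarrow> deriv g z = of_real k * w z * deriv h z"
    using dilatation_Schwarz[OF hol h' n(2) k(1) qc] by blast
  have cd: "continuous_on (ball 0 1) (deriv h)" "continuous_on (ball 0 1) (deriv g)"
    by (intro holomorphic_on_imp_continuous_on holomorphic_deriv hol open_ball)+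
  have i: "(\<lambda>t. cmod (F (?z t)) powr p) integrable_on {0..2*pi}" if "continuous_on (ball 0 1) F" for F :: "complex \<Rightarrow> complex"
    by (intro integrable_continuous_interval continuous_on_powr' continuous_intros continuous_on_compose2[OF that])
       (use zr assms(3) in auto)
  \<comment> \<open>By the Schwarz lemma the dilatation is at most \<open>k * r\<close> on the
    circle of radius \<open>r\<close>, where the modulus of \<open>Gk k\<close> is exactly
    \<open>k * r\<close> times that of \<open>Hk k\<close>. So the bound for \<open>deriv g\<close>
    follows from the one for \<open>deriv h\<close>.\<close>
  have gle: "cmod (deriv g (?z t)) powr p \<le> (k * r) powr p * cmod (deriv h (?z t)) powr p" for t
  proof -
    have "cmod (w (?z t)) \<le> r" using Schwarz_Lemma(1)[OF w(1,2,3) zr(1), of t] zr(2) by simp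
    then have "k * cmod (w (?z t)) * cmod (deriv h (?z t)) \<le> k * r * cmod (deriv h (?z t))"
      using k by (intro mult_right_mono mult_left_mono) auto
    then have "cmod (deriv g (?z t)) \<le> k * r * cmod (deriv h (?z t))"
      unfolding w(4)[OF zr(1)] using k by (simp add: norm_mult)
    then have "cmod (deriv g (?z t)) powr p \<le> (k * r * cmod (deriv h (?z t))) powr p"
      using assms(3) by (intro powr_mono2) auto
    also have "\<dots> = (k * r) powr p * cmod (deriv h (?z t)) powr p" by (rule powr_mult)
    finally show ?thesis .
  qed
  have GH: "cmod (Gk k (?z t)) powr p = (k * r) powr p * cmod (Hk k (?z t)) powr p" for t
  proof -
    have "Gk k (?z t) = of_real k * ?z t * Hk k (?z t)" by (simp add: Gk_def Hk_def)
    then have "cmod (Gk k (?z t)) = k * r * cmod (Hk k (?z t))" using k zr(2)[of t] by (simp add: norm_mult)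
    then show ?thesis using k assms(6) by (simp add: powr_mult)
  qed
  have "integral {0..2*pi} (\<lambda>t. cmod (deriv g (?z t)) powr p) \<le> integral {0..2*pi} (\<lambda>t. (k * r) powr p * cmod (deriv h (?z t)) powr p)"
  proof (rule integral_le[OF i[OF cd(2)] _ gle])
    show "(\<lambda>t. (k * r) powr p * cmod (deriv h (?z t)) powr p) integrable_on {0..2*pi}"
      using integrable_on_cmult_left[OF i[OF cd(1)], of "(k * r) powr p"] by simp
  qed
  also have "\<dots> = (k * r) powr p * integral {0..2*pi} (\<lambda>t. cmod (deriv h (?z t)) powr p)" by simp
  also have "\<dots> \<le> (k * r) powr p * integral {0..2*pi} (\<lambda>t. cmod (Hk k (?z t)) powr p)"
    by (intro mult_left_mono le) simp
  also have "\<dots> = integral {0..2*pi} (\<lambda>t. cmod (Gk k (?z t)) powr p)" unfolding GH by simp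
  finally show ?thesis using Mp_mono_of_integral le assms(3) by blast
qed

end
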